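(* Let $\mathcal A$ be a homogeneous constant-coefficient linear differential operator on $\mathbb R^d$ with constant rank. There is a constant $\varpi\ge1$, depending solely on the coefficients of the symbol $\mathbb A$ and on the dimension $d$, such that for every linear subspace $V\subset\mathbb V$ with $V\cap\Lambda_{\mathcal A}=\{0\}$ the Korn constant $$\omega(V)=\sup\Big\{\frac{\|u\|_{L^{1,\infty}}}{\|\operatorname{dist}(u,V)\|_{L^1}}: u\in C^\infty_c(\mathbb R^d;\mathbb V),\ \mathcal Au=0,\ u\not\equiv0\Big\}$$ is finite and satisfies $$\omega(V)\le\varpi\,d(V,\Lambda_{\mathcal A})^{-(\lfloor d/2\rfloor+2)}.$$
   Context: $\mathbb V,\mathbb W$ are finite-dimensional real inner product spaces, $d,k\ge 1$ are integers, and $\mathcal A=\sum_{|\gamma|=k}A_\gamma\partial^\gamma$ with $A_\gamma\in\mathrm{Hom}(\mathbb V,\mathbb W)$. Its symbol is $\mathbb A(\xi)=\sum_{|\gamma|=k}A_\gamma\xi^\gamma$. Constant rank: $\operatorname{rank}\mathbb A(\xi)$ is constant over $\xi\in\mathbb R^d\setminus\{0\}$. The wave cone is $\Lambda_{\mathcal A}=\bigcup_{|\xi|=1}\ker\mathbb A(\xi)\subset\mathbb V$. $S_{\mathbb V}$ is the unit sphere of $\mathbb V$ and $d(V,\Lambda_{\mathcal A})=\inf_{X\in V\cap S_{\mathbb V}}\operatorname{dist}(X,\Lambda_{\mathcal A})$, the infimum being taken in $[0,1]$. $\|u\|_{L^{1,\infty}}=\sup_{t>0}t\,\mathscr L^d(\{|u|>t\})$.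 The supremum defining $\omega(V)$ is taken in $[0,\infty]$. *)

theory Defs
  imports "HOL-Analysis.Analysis"
begin

subsection \<open>Partial derivatives and test functions\<close>

definition pderiv_dir :: "'d::finite \<Rightarrow> (real ^ 'd \<Rightarrow> 'v::real_normed_vector) \<Rightarrow> real ^ 'd \<Rightarrow> 'v" where
  "pderiv_dir i u x = frechet_derivative u (at x) (axis i 1)"

primrec pderivs :: "'d::finite list \<Rightarrow> (real ^ 'd \<Rightarrow> 'v::real_normed_vector) \<Rightarrow> real ^ 'd \<Rightarrow> 'v" where
  "pderivs [] u = u"
| "pderivs (i # is) u = pderiv_dir i (pderivs is u)"

text \<open>
  Since differentiable functions are continuous, requiring every iterated partial derivative to be
  Frechet differentiable is the same as requiring all of them to exist and to be continuous.
\<close>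

definition smooth :: "(real ^ 'd::finite \<Rightarrow> 'v::real_normed_vector) \<Rightarrow> bool" where
  "smooth u \<longleftrightarrow> (\<forall>is x. pderivs is u differentiable (at x))"

definition test_functions :: "(real ^ 'd::finite \<Rightarrow> 'v::real_normed_vector) set" where
  "test_functions = {u. smooth u \<and> compact (closure {x. u x \<noteq> 0})}"

text \<open>
  A multi-index is a function \<open>\<gamma> :: 'd \<Rightarrow> nat\<close>. The type \<open>'d\<close> carries no order, so the derivative
  is taken along some list of directions in which each \<open>i\<close> occurs \<open>\<gamma> i\<close> times; for smooth
  functions the order of differentiation is irrelevant. Such a list always exists, see
  \<open>ex_directions\<close>.
\<close>

definition mderiv :: "('d::finite \<Rightarrow> nat) \<Rightarrow> (real ^ 'd \<Rightarrow> 'v::real_normed_vector) \<Rightarrow> real ^ 'd \<Rightarrow> 'v" where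
  "mderiv \<gamma> = pderivs (SOME is. \<forall>i. count_list is i = \<gamma> i)"

lemma ex_directions:
  fixes \<gamma> :: "'d::finite \<Rightarrow> nat"
  shows "\<exists>is. \<forall>i. count_list is i = \<gamma> i"
proof -
  obtain ds :: "'d list" where ds: "set ds = UNIV" "distinct ds"
    using finite_distinct_list[OF finite_class.finite_UNIV] by blast
  have rep: "count_list (replicate n j) i = (if i = j then n else 0)" for n and i j :: 'd
    by (induction n) auto
  have "count_list (concat (map (\<lambda>j. replicate (\<gamma> j) j) xs)) i = (if i \<in> set xs then \<gamma> i else 0)"
    if "distinct xs" for xs i
    using that by (induction xs) (auto simp: rep)
  with ds show ?thesis
    by (metis UNIV_I)
qed

subsection \<open>Homogeneous constant-coefficient operators\<close>

definition multi_indices :: "nat \<Rightarrow> ('d::finite \<Rightarrow> nat) set" where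
  "multi_indices k = {\<gamma>. (\<Sum>i\<in>UNIV. \<gamma> i) = k}"

lemma finite_multi_indices: "finite (multi_indices k :: ('d::finite \<Rightarrow> nat) set)"
proof (rule finite_subset)
  show "multi_indices k \<subseteq> (UNIV :: 'd set) \<rightarrow>\<^sub>E {..k}"
    by (auto simp: multi_indices_def PiE_def intro: member_le_sum)
  show "finite ((UNIV :: 'd set) \<rightarrow>\<^sub>E {..k})"
    by (intro finite_PiE) auto
qed

text \<open>
  An operator of order \<open>k\<close> is given by its coefficients \<open>A \<gamma>\<close>; only the values at multi-indices of
  length \<open>k\<close> matter.
\<close>

definition diff_op ::
  "(('d::finite \<Rightarrow> nat) \<Rightarrow> 'v::euclidean_space \<Rightarrow>\<^sub>L 'w::euclidean_space) \<Rightarrow> nat \<Rightarrow>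
    (real ^ 'd \<Rightarrow> 'v) \<Rightarrow> real ^ 'd \<Rightarrow> 'w" where
  "diff_op A k u x = (\<Sum>\<gamma>\<in>multi_indices k. blinfun_apply (A \<gamma>) (mderiv \<gamma> u x))"

definition symbol ::
  "(('d::finite \<Rightarrow> nat) \<Rightarrow> 'v::euclidean_space \<Rightarrow>\<^sub>L 'w::euclidean_space) \<Rightarrow> nat \<Rightarrow>
    real ^ 'd \<Rightarrow> 'v \<Rightarrow>\<^sub>L 'w" where
  "symbol A k \<xi> = (\<Sum>\<gamma>\<in>multi_indices k. (\<Prod>i\<in>UNIV. (\<xi> $ i) ^ \<gamma> i) *\<^sub>R A \<gamma>)"

definition constant_rank ::
  "(('d::finite \<Rightarrow> nat) \<Rightarrow> 'v::euclidean_space \<Rightarrow>\<^sub>L 'w::euclidean_space) \<Rightarrow> nat \<Rightarrow> bool" where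
  "constant_rank A k \<longleftrightarrow> (\<exists>r. \<forall>\<xi>. \<xi> \<noteq> 0 \<longrightarrow> dim (range (blinfun_apply (symbol A k \<xi>))) = r)"

definition wave_cone ::
  "(('d::finite \<Rightarrow> nat) \<Rightarrow> 'v::euclidean_space \<Rightarrow>\<^sub>L 'w::euclidean_space) \<Rightarrow> nat \<Rightarrow> 'v set" where
  "wave_cone A k = (\<Union>\<xi>\<in>sphere 0 1. {v. blinfun_apply (symbol A k \<xi>) v = 0})"

text \<open>
  The infimum is taken in the lattice \<open>[0, 1]\<close>, so the empty infimum (for \<open>V = {0}\<close>) is \<open>1\<close>;
  inserting \<open>1\<close> does not change the other cases, because the wave cone contains \<open>0\<close>.
\<close>

definition cone_dist :: "'v::euclidean_space set \<Rightarrow> 'v set \<Rightarrow> real" where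
  "cone_dist V L = Inf (insert 1 ((\<lambda>X. infdist X L) ` (V \<inter> sphere 0 1)))"

subsection \<open>The Korn constant\<close>

definition weak_L1 :: "('a::euclidean_space \<Rightarrow> 'v::real_normed_vector) \<Rightarrow> ennreal" where
  "weak_L1 u = (SUP t\<in>{0<..}. ennreal t * emeasure lebesgue {x. t < norm (u x)})"

definition L1_dist :: "('a::euclidean_space \<Rightarrow> 'v::real_normed_vector) \<Rightarrow> 'v set \<Rightarrow> ennreal" where
  "L1_dist u V = (\<integral>\<^sup>+ x. ennreal (infdist (u x) V) \<partial>lebesgue)"

text \<open>
  The quotient is taken in \<open>[0, \<infinity>]\<close>: the numerator is positive for \<open>u \<noteq> 0\<close>, so a vanishing
  denominator gives \<open>\<infinity>\<close>.
\<close>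

definition korn_const ::
  "(('d::finite \<Rightarrow> nat) \<Rightarrow> 'v::euclidean_space \<Rightarrow>\<^sub>L 'w::euclidean_space) \<Rightarrow> nat \<Rightarrow> 'v set \<Rightarrow> ennreal" where
  "korn_const A k V =
    Sup {weak_L1 u / L1_dist u V | u.
      u \<in> test_functions \<and> (\<forall>x. diff_op A k u x = 0) \<and> (\<exists>x. u x \<noteq> 0)}"

end

theory Submission
  imports Defs
begin

text \<open>
  Write \<open>\<delta>\<close> for the distance between the unit sphere of \<open>V\<close> and the wave cone, and \<open>P\<close> for the orthogonal
  projection along \<open>V\<close>, so that \<open>\<bar>P u\<bar> = dist(u, V)\<close>. If \<open>u\<close> is annihilated by the operator, its Fourier
  transform at \<open>\<xi> \<noteq> 0\<close> lies in the kernel of the symbol at \<open>\<xi>\<close>. All these kernels lie in the wave cone, which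
  meets \<open>V\<close> only in \<open>0\<close>; hence \<open>P\<close> is injective on each of them, and \<open>u\<close> can be recovered from \<open>P u\<close>
  frequency by frequency: \<open>u = Q(D) P u\<close>, where \<open>Q(\<xi>)\<close> is the Moore--Penrose inverse of \<open>P \<pi>(\<xi>)\<close> and \<open>\<pi>(\<xi>)\<close> is
  the orthogonal projection onto the kernel of the symbol (\<open>oblique_perp\<close>). The theorem is therefore the weak
  \<open>(1,1)\<close> bound for the multiplier \<open>Q\<close>, which is homogeneous of degree \<open>0\<close>.

  The exponent comes from counting factors of \<open>1/\<delta>\<close>. First, \<open>\<bar>Q\<bar> \<le> 2/\<delta>\<close> (\<open>norm_oblique_le\<close>). Secondly, a derivative
  of a Moore--Penrose inverse \<open>Y\<close> of \<open>X\<close> contains \<open>Y\<close> twice where \<open>Y\<close> contained it once, while the products \<open>X Y\<close>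
  and \<open>Y X\<close> are projections and cost nothing; so each derivative of \<open>Q\<close> costs at most one more factor \<open>1/\<delta>\<close>
  (\<open>wsym_pinv\<close>, \<open>wsym_oblique\<close>). Constant rank is what makes \<open>\<pi>\<close> smooth on the sphere, with bounds that do not
  involve \<open>V\<close> (\<open>pinv_bounded_constant_rank\<close>). Thirdly, the Mikhlin--Hoermander theorem in its \<open>L\<^sup>2\<close> form works with
  any integer number \<open>s > d/2\<close> of derivatives, and \<open>s = \<lfloor>d/2\<rfloor> + 1\<close> is the least one. Altogether the
  constant is, up to a factor independent of \<open>V\<close>, \<open>\<delta>\<close> to the power \<open>-(1 + s) = -(\<lfloor>d/2\<rfloor> + 2)\<close>.

  The multiplier theorem (\<open>multiplier_weak_type\<close>) is proved on the finite group \<open>(\<int>/2\<^sup>q)\<^sup>d\<close>, with constants independent of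
  \<open>q\<close>. There the Fourier inversion is a finite sum, the dyadic cubes of the Calderon--Zygmund decomposition
  (\<open>calderon_zygmund\<close>) form a finite family, and no question of convergence arises. The multiplier is cut
  into dyadic annuli; Parseval for \<open>s\<close>-fold frequency differences bounds the weighted \<open>L\<^sup>2\<close> norms of the pieces
  of its kernel, Cauchy--Schwarz on dyadic shells turns these into \<open>L\<^sup>1\<close> bounds, and summing over the annuli
  gives the Hoermander condition (\<open>dyadic_hoermander\<close>).

  To pass from \<open>\<real>\<^sup>d\<close> to the finite group, \<open>u\<close> is approximated uniformly on a large cube by its convolution with
  a concentrated trigonometric polynomial (\<open>exists_trig_approximation\<close>). The Fourier coefficients of the
  approximation are multiples of values of the Fourier transform of \<open>u\<close>, so they still lie in the kernels of
  the symbol, and this survives restriction to a grid. The value at frequency \<open>0\<close> lies in the kernel of the symbol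
  at every frequency by homogeneity and continuity (\<open>mean_in_symbol_kernel\<close>). The estimate for the samples
  (\<open>discrete_korn\<close>) becomes the estimate for \<open>u\<close> by comparing sums with integrals over grid cells (\<open>korn_weak_type\<close>).
\<close>

section \<open>Fourier analysis on finite tori\<close>

definition cube :: "int set \<Rightarrow> (int ^ 'd::finite) set" where
  "cube S = {x. \<forall>i. x $ i \<in> S}"

lemma bij_betw_cube:
  "bij_betw vec_lambda (UNIV \<rightarrow>\<^sub>E S) (cube S :: (int ^ 'd::finite) set)"
proof (rule bij_betw_byWitness[where f' = vec_nth])
  show "vec_lambda ` (UNIV \<rightarrow>\<^sub>E S) \<subseteq> (cube S :: (int ^ 'd) set)"
    by (auto simp: cube_def PiE_def)
  show "vec_nth ` (cube S :: (int ^ 'd) set) \<subseteq> UNIV \<rightarrow>\<^sub>E S"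
    by (auto simp: cube_def PiE_def)
qed auto

lemma sum_prod_cube:
  fixes f :: "'d::finite \<Rightarrow> int \<Rightarrow> 'a::comm_semiring_1"
  assumes "finite S"
  shows "(\<Sum>x\<in>cube S. \<Prod>i\<in>UNIV. f i (x $ i)) = (\<Prod>i\<in>UNIV. \<Sum>t\<in>S. f i t)"
proof -
  have "(\<Sum>x\<in>cube S. \<Prod>i\<in>UNIV. f i (x $ i)) = (\<Sum>g\<in>UNIV \<rightarrow>\<^sub>E S. \<Prod>i\<in>UNIV. f i (g i))"
    by (subst sum.reindex_bij_betw[OF bij_betw_cube, symmetric]) simp
  also have "\<dots> = (\<Prod>i\<in>UNIV. \<Sum>t\<in>S. f i t)"
    using assms by (intro prod_sum_PiE[symmetric]) auto
  finally show ?thesis .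
qed

lemma finite_cube [simp]: "finite S \<Longrightarrow> finite (cube S :: (int ^ 'd::finite) set)"
  using bij_betw_finite[OF bij_betw_cube[of S]] by (auto intro!: finite_PiE)

lemma card_cube: "finite S \<Longrightarrow> card (cube S :: (int ^ 'd::finite) set) = card S ^ CARD('d)"
  using sum_prod_cube[of S "\<lambda>(_::'d) _. 1::nat"] by simp

abbreviation torus :: "nat \<Rightarrow> (int ^ 'd::finite) set" where
  "torus M \<equiv> cube {0..<int M}"

definition periodic :: "nat \<Rightarrow> (int ^ 'd::finite \<Rightarrow> 'a) \<Rightarrow> bool" where
  "periodic M F \<longleftrightarrow> (\<forall>x y. (\<forall>i. int M dvd x $ i - y $ i) \<longrightarrow> F x = F y)"

lemma periodicD: "periodic M F \<Longrightarrow> (\<And>i. int M dvd x $ i - y $ i) \<Longrightarrow> F x = F y"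
  by (auto simp: periodic_def)

text \<open>
  Representatives in \<open>{0..<M}\<close> may be shifted and reduced again; this is translation invariance of the
  counting measure on the group.
\<close>

lemma sum_torus_shift:
  fixes F :: "int ^ 'd::finite \<Rightarrow> 'a::comm_monoid_add"
  assumes "periodic M F" "M > 0"
  shows "(\<Sum>x\<in>torus M. F (x + y)) = (\<Sum>x\<in>torus M. F x)"
proof (rule sum.reindex_bij_witness[where j = "\<lambda>x. \<chi> i. (x $ i + y $ i) mod int M"
      and i = "\<lambda>x. \<chi> i. (x $ i - y $ i) mod int M"])
  fix x :: "int ^ 'd" assume "x \<in> torus M"
  then have x: "0 \<le> x $ i" "x $ i < int M" for i
    by (auto simp: cube_def)
  show "(\<chi> i. (((\<chi> i. (x $ i + y $ i) mod int M) :: int ^ 'd) $ i - y $ i) mod int M) = x"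
    using x by (simp add: vec_eq_iff mod_diff_left_eq)
  show "(\<chi> i. (((\<chi> i. (x $ i - y $ i) mod int M) :: int ^ 'd) $ i + y $ i) mod int M) = x"
    using x by (simp add: vec_eq_iff mod_add_left_eq)
  show "(\<chi> i. (x $ i + y $ i) mod int M) \<in> torus M" "(\<chi> i. (x $ i - y $ i) mod int M) \<in> torus M"
    using assms(2) by (auto simp: cube_def)
  show "F (\<chi> i. (x $ i + y $ i) mod int M) = F (x + y)"
    by (rule periodicD[OF assms(1)]) (simp add: mod_eq_dvd_iff[symmetric])
qed

text \<open>
  The characters of \<open>(\<int>/M)\<^sup>d\<close>, written on integer vectors so that no quotient type is needed.
\<close>

definition ch :: "nat \<Rightarrow> int ^ 'd::finite \<Rightarrow> int ^ 'd \<Rightarrow> complex" where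
  "ch M n x = cis (2 * pi / real M * (\<Sum>i\<in>UNIV. real_of_int (n $ i) * real_of_int (x $ i)))"

lemma ch_add: "ch M n (x + y) = ch M n x * ch M n y"
  by (simp add: ch_def cis_mult ring_distribs sum.distrib)

lemma ch_add_left: "ch M (n + m) x = ch M n x * ch M m x"
  by (simp add: ch_def cis_mult ring_distribs sum.distrib)

lemma ch_minus: "ch M n (- x) = cnj (ch M n x)" "ch M (- n) x = cnj (ch M n x)"
  by (simp_all add: ch_def cis_cnj sum_negf)

lemma norm_ch [simp]: "cmod (ch M n x) = 1"
  by (simp add: ch_def)

lemma ch_diff: "ch M n (x - y) = ch M n x * cnj (ch M n y)"
  using ch_add[of M n x "- y"] by (simp add: ch_minus)

lemma ch_diff_left: "ch M (n - m) x = ch M n x * cnj (ch M m x)"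
  using ch_add_left[of M n "- m" x] by (simp add: ch_minus)

lemma cis_dvd_eq_1:
  assumes "int M dvd k" "M > 0" shows "cis (2 * pi / real M * real_of_int k) = 1"
proof -
  from assms obtain l where l: "k = int M * l" by (auto simp: dvd_def)
  have "2 * pi / real M * real_of_int k = 2 * pi * real_of_int l"
    using assms(2) by (simp add: l)
  then show ?thesis
    using cis_multiple_2pi[of "real_of_int l"] by simp
qed

lemma cis_eq_1_dvd:
  assumes "cis (2 * pi / real M * real_of_int k) = 1" "M > 0" shows "int M dvd k"
proof -
  have "cos (2 * pi / real M * real_of_int k) = 1"
    using assms(1) by (metis cis.simps(1) one_complex.simps(1))
  then obtain l where "2 * pi / real M * real_of_int k = real_of_int l * 2 * pi"
    unfolding cos_one_2pi_int by blast
  then have "real_of_int k = real M * real_of_int l"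
    using assms(2) by (simp add: field_simps)
  also have "\<dots> = real_of_int (int M * l)" by simp
  finally have "k = int M * l" using of_int_eq_iff by blast
  then show ?thesis by simp
qed

lemma ch_one:
  assumes "M > 0" "\<forall>i. int M dvd x $ i" shows "ch M n x = 1"
proof -
  have "int M dvd (\<Sum>i\<in>UNIV. n $ i * x $ i)"
    using assms(2) by (intro dvd_sum) auto
  from cis_dvd_eq_1[OF this assms(1)] show ?thesis
    by (simp add: ch_def)
qed

lemma periodic_ch: "M > 0 \<Longrightarrow> periodic M (ch M (n :: int ^ 'd::finite))"
  unfolding periodic_def
proof (intro allI impI)
  fix x y :: "int ^ 'd" assume "M > 0" "\<forall>i. int M dvd x $ i - y $ i"
  then have "ch M n (x - y) = 1" by (intro ch_one) auto
  then show "ch M n x = ch M n y"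
    using ch_add[of M n "x - y" y] by simp
qed

lemma sum_ch:
  fixes n :: "int ^ 'd::finite"
  assumes "M > 0"
  shows "(\<Sum>x\<in>torus M. ch M n x) = (if \<forall>i. int M dvd n $ i then of_nat M ^ CARD('d) else 0)"
proof (cases "\<forall>i. int M dvd n $ i")
  case True
  then have "ch M n x = 1" for x
    using ch_one[OF assms, of n x] by (simp add: ch_def mult.commute)
  then show ?thesis using True by (simp add: card_cube)
next
  case False
  then obtain i where i: "\<not> int M dvd n $ i" by blast
  have c: "ch M n (axis i 1) \<noteq> 1"
  proof
    assume "ch M n (axis i 1) = 1"
    moreover have "(\<Sum>j\<in>UNIV. real_of_int (n $ j) * real_of_int (axis i 1 $ j)) = n $ i"
      by (simp add: axis_def if_distrib[of real_of_int] if_distrib[of "\<lambda>t. _ * t"] cong: if_cong)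
    ultimately have "cis (2 * pi / real M * n $ i) = 1" by (simp add: ch_def)
    with cis_eq_1_dvd assms i show False by blast
  qed
  have "(\<Sum>x\<in>torus M. ch M n x) = (\<Sum>x\<in>torus M. ch M n (x + axis i 1))"
    using sum_torus_shift[OF periodic_ch[OF assms] assms] by metis
  also have "\<dots> = (\<Sum>x\<in>torus M. ch M n x) * ch M n (axis i 1)"
    by (simp add: ch_add sum_distrib_right)
  finally have "(\<Sum>x\<in>torus M. ch M n x) = 0" using c by simp
  then show ?thesis unfolding if_not_P[OF False] .
qed

text \<open>
  Frequencies in such a set represent distinct characters, which makes the characters orthogonal.
\<close>

definition separated :: "nat \<Rightarrow> (int ^ 'd::finite) set \<Rightarrow> bool" where
  "separated M S \<longleftrightarrow> finite S \<and> (\<forall>n\<in>S. \<forall>m\<in>S. (\<forall>i. int M dvd n $ i - m $ i) \<longrightarrow> n = m)"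

lemma parseval:
  fixes c :: "int ^ 'd::finite \<Rightarrow> complex"
  assumes "M > 0" "separated M S"
  shows "(\<Sum>x\<in>torus M. (cmod (\<Sum>n\<in>S. c n * ch M n x))\<^sup>2) = real M ^ CARD('d) * (\<Sum>n\<in>S. (cmod (c n))\<^sup>2)"
proof -
  have fin: "finite S" using assms by (simp add: separated_def)
  have o: "(\<Sum>x\<in>torus M. ch M n x * cnj (ch M m x)) = (if m = n then of_nat M ^ CARD('d) else 0)"
    if "n \<in> S" "m \<in> S" for n m
    using that assms sum_ch[OF assms(1), of "n - m"] unfolding ch_diff_left separated_def by auto
  have "complex_of_real (\<Sum>x\<in>torus M. (cmod (\<Sum>n\<in>S. c n * ch M n x))\<^sup>2)
      = (\<Sum>x\<in>torus M. (\<Sum>n\<in>S. c n * ch M n x) * cnj (\<Sum>n\<in>S. c n * ch M n x))"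
    by (simp only: of_real_sum complex_norm_square)
  also have "\<dots> = (\<Sum>x\<in>torus M. \<Sum>n\<in>S. \<Sum>m\<in>S. c n * cnj (c m) * (ch M n x * cnj (ch M m x)))"
    by (simp add: sum_product mult_ac)
  also have "\<dots> = (\<Sum>n\<in>S. \<Sum>m\<in>S. \<Sum>x\<in>torus M. c n * cnj (c m) * (ch M n x * cnj (ch M m x)))"
    by (subst sum.swap, rule sum.cong[OF refl], subst sum.swap, rule refl)
  also have "\<dots> = (\<Sum>n\<in>S. \<Sum>m\<in>S. c n * cnj (c m) * (if m = n then of_nat M ^ CARD('d) else 0))"
    by (intro sum.cong refl) (simp add: o sum_distrib_left[symmetric])
  also have "\<dots> = (\<Sum>n\<in>S. c n * cnj (c n) * of_nat M ^ CARD('d))"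
    using fin by (simp add: if_distrib[of "\<lambda>t. _ * t"] cong: if_cong)
  also have "\<dots> = complex_of_real (real M ^ CARD('d) * (\<Sum>n\<in>S. (cmod (c n))\<^sup>2))"
    by (simp only: of_real_sum of_real_mult complex_norm_square) (simp add: sum_distrib_left mult_ac)
  finally show ?thesis unfolding of_real_eq_iff .
qed

lemma norm_sum_mult_le:
  fixes f g :: "'a \<Rightarrow> complex"
  shows "(cmod (\<Sum>x\<in>A. f x * g x))\<^sup>2 \<le> (\<Sum>x\<in>A. (cmod (f x))\<^sup>2) * (\<Sum>x\<in>A. (cmod (g x))\<^sup>2)"
proof -
  have "(cmod (\<Sum>x\<in>A. f x * g x))\<^sup>2 \<le> (\<Sum>x\<in>A. cmod (f x) * cmod (g x))\<^sup>2"
    by (intro power_mono order.trans[OF norm_sum] sum_mono) (auto simp: norm_mult)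
  also have "\<dots> \<le> (\<Sum>x\<in>A. (cmod (f x))\<^sup>2) * (\<Sum>x\<in>A. (cmod (g x))\<^sup>2)"
    by (rule Cauchy_Schwarz_ineq_sum)
  finally show ?thesis .
qed

text \<open>
  Duality: the left-hand side \<open>E\<close> is the pairing of \<open>g\<close> with the trigonometric polynomial whose coefficients
  are those of \<open>g\<close>, and \<open>parseval\<close> computes the norm of that polynomial as a multiple of \<open>E\<close>.
\<close>

lemma bessel:
  fixes g :: "int ^ 'd::finite \<Rightarrow> complex"
  assumes "M > 0" "separated M S"
  shows "(\<Sum>n\<in>S. (cmod (\<Sum>x\<in>torus M. g x * cnj (ch M n x)))\<^sup>2)
    \<le> real M ^ CARD('d) * (\<Sum>x\<in>torus M. (cmod (g x))\<^sup>2)"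
proof -
  define h where "h n = (\<Sum>x\<in>torus M. g x * cnj (ch M n x))" for n
  define E where "E = (\<Sum>n\<in>S. (cmod (h n))\<^sup>2)"
  have E0: "E \<ge> 0" unfolding E_def by (intro sum_nonneg) auto
  have "complex_of_real E = (\<Sum>n\<in>S. h n * cnj (h n))"
    by (simp only: E_def of_real_sum complex_norm_square)
  also have "\<dots> = (\<Sum>n\<in>S. \<Sum>x\<in>torus M. g x * (cnj (h n) * cnj (ch M n x)))"
    by (subst (1) h_def) (simp add: sum_distrib_left sum_distrib_right mult_ac)
  also have "\<dots> = (\<Sum>x\<in>torus M. g x * cnj (\<Sum>n\<in>S. h n * ch M n x))"
    by (subst sum.swap) (simp add: sum_distrib_left)
  finally have "E = cmod (\<Sum>x\<in>torus M. g x * cnj (\<Sum>n\<in>S. h n * ch M n x))"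
    using E0 by (metis abs_of_nonneg norm_of_real)
  then have "E\<^sup>2 \<le> (\<Sum>x\<in>torus M. (cmod (g x))\<^sup>2) * (\<Sum>x\<in>torus M. (cmod (cnj (\<Sum>n\<in>S. h n * ch M n x)))\<^sup>2)"
    by (simp only: norm_sum_mult_le)
  also have "\<dots> = (\<Sum>x\<in>torus M. (cmod (g x))\<^sup>2) * (real M ^ CARD('d) * E)"
    by (simp only: complex_mod_cnj parseval[OF assms] E_def)
  finally have "E * E \<le> (real M ^ CARD('d) * (\<Sum>x\<in>torus M. (cmod (g x))\<^sup>2)) * E"
    by (simp add: power2_eq_square mult_ac)
  then have "E = 0 \<or> E \<le> real M ^ CARD('d) * (\<Sum>x\<in>torus M. (cmod (g x))\<^sup>2)"
    using E0 mult_le_cancel_right[of E E] by auto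
  then show ?thesis
    unfolding E_def h_def using sum_nonneg[of "torus M" "\<lambda>x. (cmod (g x))\<^sup>2"] by fastforce
qed

text \<open>
  The convolution kernel on \<open>(\<int>/M)\<^sup>d\<close> of the Fourier multiplier \<open>c\<close> restricted to the frequencies in \<open>S\<close>.
\<close>

definition kernel :: "nat \<Rightarrow> (int ^ 'd::finite) set \<Rightarrow> (int ^ 'd \<Rightarrow> complex) \<Rightarrow> int ^ 'd \<Rightarrow> complex" where
  "kernel M S c z = (\<Sum>n\<in>S. c n * ch M n z) / of_nat M ^ CARD('d)"

definition conv :: "nat \<Rightarrow> (int ^ 'd::finite \<Rightarrow> complex) \<Rightarrow> (int ^ 'd \<Rightarrow> complex) \<Rightarrow> int ^ 'd \<Rightarrow> complex" where
  "conv M k g x = (\<Sum>y\<in>torus M. k (x - y) * g y)"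

lemma periodic_kernel: "M > 0 \<Longrightarrow> periodic M (kernel M S c)"
  using periodic_ch unfolding periodic_def kernel_def by (metis (no_types, lifting) sum.cong)

lemma conv_kernel:
  "conv M (kernel M S c) g x
    = (\<Sum>n\<in>S. (c n / of_nat M ^ CARD('d) * (\<Sum>y\<in>torus M. g y * cnj (ch M n y))) * ch M n x)"
  for x :: "int ^ 'd::finite"
  unfolding conv_def kernel_def
  by (simp add: ch_diff sum_distrib_left sum_distrib_right sum_divide_distrib, subst sum.swap)
     (simp add: mult_ac)

lemma L2_bound_kernel:
  fixes g :: "int ^ 'd::finite \<Rightarrow> complex"
  assumes "M > 0" "separated M S" "\<And>n. n \<in> S \<Longrightarrow> cmod (c n) \<le> B"
  shows "(\<Sum>x\<in>torus M. (cmod (conv M (kernel M S c) g x))\<^sup>2) \<le> B\<^sup>2 * (\<Sum>x\<in>torus M. (cmod (g x))\<^sup>2)"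
proof -
  define h where "h n = (\<Sum>y\<in>torus M. g y * cnj (ch M n y))" for n
  define D where "D = real M ^ CARD('d)"
  have D: "D > 0" using assms by (simp add: D_def)
  have "(\<Sum>x\<in>torus M. (cmod (conv M (kernel M S c) g x))\<^sup>2) = D * (\<Sum>n\<in>S. (cmod (c n / of_nat M ^ CARD('d) * h n))\<^sup>2)"
    unfolding conv_kernel parseval[OF assms(1,2)] h_def D_def ..
  also have "\<dots> = D * (\<Sum>n\<in>S. (cmod (c n))\<^sup>2 / D\<^sup>2 * (cmod (h n))\<^sup>2)"
    by (simp add: norm_mult norm_divide norm_power power_mult_distrib power_divide D_def)
  also have "\<dots> \<le> D * (\<Sum>n\<in>S. B\<^sup>2 / D\<^sup>2 * (cmod (h n))\<^sup>2)"
    using assms(3) D by (intro mult_left_mono sum_mono mult_right_mono divide_right_mono power_mono) auto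
  also have "\<dots> = B\<^sup>2 / D * (\<Sum>n\<in>S. (cmod (h n))\<^sup>2)"
    unfolding sum_distrib_left[symmetric] using D by (simp add: power2_eq_square)
  also have "\<dots> \<le> B\<^sup>2 / D * (D * (\<Sum>x\<in>torus M. (cmod (g x))\<^sup>2))"
    using bessel[OF assms(1,2), of g] D unfolding h_def D_def by (intro mult_left_mono) auto
  finally show ?thesis using D by simp
qed

lemma conv_kernel_ch:
  fixes x :: "int ^ 'd::finite"
  assumes "M > 0" "separated M S" "m \<in> S"
  shows "conv M (kernel M S c) (ch M m) x = c m * ch M m x"
proof -
  have fin: "finite S" using assms by (simp add: separated_def)
  have o: "(\<Sum>y\<in>torus M. ch M m y * cnj (ch M n y)) = (if n = m then of_nat M ^ CARD('d) else 0)"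
    if "n \<in> S" for n
    using that assms sum_ch[OF assms(1), of "m - n"] unfolding ch_diff_left separated_def by auto
  have "conv M (kernel M S c) (ch M m) x
     = (\<Sum>n\<in>S. if n = m then c n * ch M n x else 0)"
    unfolding conv_kernel using assms(1) by (intro sum.cong refl) (simp add: o)
  then show ?thesis using fin assms(3) by simp
qed

section \<open>Chordal distance\<close>

lemma norm_cis_minus_1: "cmod (cis a - 1) = 2 * \<bar>sin (a / 2)\<bar>"
proof -
  have "(cmod (cis a - 1))\<^sup>2 = (cos a - 1)\<^sup>2 + (sin a)\<^sup>2"
    by (simp add: cmod_power2)
  also have "\<dots> = 2 - 2 * cos a"
    using sin_cos_squared_add[of a] by (simp add: power2_diff)
  also have "\<dots> = (2 * \<bar>sin (a / 2)\<bar>)\<^sup>2"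
    using cos_double_sin[of "a / 2"] by (simp add: power_mult_distrib)
  finally show ?thesis
    by (metis abs_ge_zero norm_ge_zero power2_eq_iff_nonneg mult_nonneg_nonneg zero_le_numeral)
qed

text \<open>
  A concave function lies above its chord.
\<close>

lemma jordan_sin_ge: "2 / pi * x \<le> sin x" if "0 \<le> x" "x \<le> pi / 2"
proof -
  have "concave_on {0..pi/2} sin"
  proof (rule f''_le0_imp_concave)
    show "- sin x \<le> 0" if "x \<in> {0..pi/2}" for x :: real
      using that sin_ge_zero[of x] by auto
  qed (auto intro!: derivative_eq_intros)
  from concave_onD_Icc[OF this, of "x / (pi / 2)"] that show ?thesis
    by (simp add: field_simps)
qed

text \<open>
  Up to constants the distance of \<open>t\<close> from \<open>M \<int>\<close>. The chord is used instead of the arc because \<open>\<bar>cis - 1\<bar>\<close> is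
  exactly the factor by which a difference in frequency multiplies a kernel; weighted \<open>L\<^sup>2\<close> sums can then be
  evaluated by Parseval without loss.
\<close>

definition tdist :: "nat \<Rightarrow> int \<Rightarrow> real" where
  "tdist M t = real M / 4 * cmod (cis (2 * pi / real M * real_of_int t) - 1)"

lemma tdist_nonneg [simp]: "0 \<le> tdist M t"
  by (simp add: tdist_def)

lemma tdist_triangle: "tdist M (s + t) \<le> tdist M s + tdist M t"
proof -
  define a b where "a = cis (2 * pi / real M * real_of_int s)" "b = cis (2 * pi / real M * real_of_int t)"
  have "cis (2 * pi / real M * real_of_int (s + t)) - 1 = a * (b - 1) + (a - 1)"
    by (simp add: a_b_def cis_mult ring_distribs)
  moreover have "cmod a = 1" by (simp add: a_b_def)
  ultimately have "cmod (cis (2 * pi / real M * real_of_int (s + t)) - 1) \<le> cmod (b - 1) + cmod (a - 1)"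
    by (metis mult_1 norm_mult norm_triangle_ineq)
  then have "real M / 4 * cmod (cis (2 * pi / real M * real_of_int (s + t)) - 1)
      \<le> real M / 4 * (cmod (a - 1) + cmod (b - 1))"
    by (intro mult_left_mono) auto
  then show ?thesis
    by (simp add: tdist_def a_b_def ring_distribs)
qed

lemma tdist_le: "tdist M t \<le> 2 * \<bar>real_of_int t\<bar>"
proof (cases "M = 0")
  case False
  have "cmod (cis (2 * pi / real M * real_of_int t) - 1) \<le> 2 * (pi / real M * \<bar>real_of_int t\<bar>)"
    unfolding norm_cis_minus_1
    using abs_sin_x_le_abs_x[of "2 * pi / real M * real_of_int t / 2"] by (simp add: abs_mult)
  then have "tdist M t \<le> real M / 4 * (2 * (pi / real M * \<bar>real_of_int t\<bar>))"
    unfolding tdist_def by (intro mult_left_mono) auto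
  also have "\<dots> = pi / 2 * \<bar>real_of_int t\<bar>" using False by simp
  also have "\<dots> \<le> 2 * \<bar>real_of_int t\<bar>"
    using pi_less_4 by (intro mult_right_mono) auto
  finally show ?thesis .
qed (simp add: tdist_def)

lemma tdist_uminus: "tdist M (- t) = tdist M t"
  by (simp add: tdist_def norm_cis_minus_1)

lemma tdist_periodic: "int M dvd s - t \<Longrightarrow> tdist M s = tdist M t"
proof (cases "M = 0")
  case False
  assume "int M dvd s - t"
  then have "cis (2 * pi / real M * real_of_int (s - t)) = 1"
    using False by (intro cis_dvd_eq_1) auto
  then have "cis (2 * pi / real M * real_of_int ((s - t) + t)) = cis (2 * pi / real M * real_of_int t)"
    by (simp only: of_int_add ring_distribs cis_mult[symmetric] mult_1)
  then show ?thesis by (simp add: tdist_def)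
qed (simp add: tdist_def)

lemma tdist_ge:
  assumes "0 \<le> t" "t < int M"
  shows "min (real_of_int t) (real M - real_of_int t) \<le> tdist M t"
proof -
  have M: "real M > 0" using assms by linarith
  have *: "real_of_int u \<le> tdist M u" if "0 \<le> u" "2 * u \<le> int M" for u
  proof -
    have u: "2 * real_of_int u \<le> real M" using that(2) by linarith
    have "2 / pi * (pi / real M * real_of_int u) \<le> sin (pi / real M * real_of_int u)"
      using that M u by (intro jordan_sin_ge) (auto simp: field_simps)
    moreover have "0 \<le> 2 / pi * (pi / real M * real_of_int u)" using that M by simp
    ultimately have "2 * real_of_int u / real M \<le> \<bar>sin (pi / real M * real_of_int u)\<bar>"
      by simp
    then show ?thesis
      using M by (simp add: tdist_def norm_cis_minus_1 field_simps)
  qed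
  show ?thesis
  proof (cases "2 * t \<le> int M")
    case True then show ?thesis using *[of t] assms by linarith
  next
    case False
    have "tdist M (int M - t) = tdist M (- t)" by (rule tdist_periodic) simp
    then show ?thesis using *[of "int M - t"] assms False by (simp add: tdist_uminus)
  qed
qed

lemma card_tdist_less:
  assumes "1 \<le> R"
  shows "real (card {t \<in> {0..<int M}. tdist M t < R}) \<le> 4 * R"
proof -
  have "{t \<in> {0..<int M}. tdist M t < R} \<subseteq> {0..<\<lceil>R\<rceil>} \<union> {int M - \<lceil>R\<rceil>..<int M}"
  proof
    fix t assume "t \<in> {t \<in> {0..<int M}. tdist M t < R}"
    then have t: "0 \<le> t" "t < int M" "tdist M t < R" by auto
    then have "real_of_int t < R \<or> real M - real_of_int t < R"
      using tdist_ge[of t M] by linarith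
    then have "t < \<lceil>R\<rceil> \<or> int M - t < \<lceil>R\<rceil>"
      by (simp add: less_ceiling_iff)
    then show "t \<in> {0..<\<lceil>R\<rceil>} \<union> {int M - \<lceil>R\<rceil>..<int M}" using t by auto
  qed
  then have "card {t \<in> {0..<int M}. tdist M t < R} \<le> card ({0..<\<lceil>R\<rceil>} \<union> {int M - \<lceil>R\<rceil>..<int M})"
    by (intro card_mono) auto
  also have "\<dots> \<le> nat \<lceil>R\<rceil> + nat \<lceil>R\<rceil>"
    by (rule order.trans[OF card_Un_le]) simp
  finally have "real (card {t \<in> {0..<int M}. tdist M t < R}) \<le> 2 * real (nat \<lceil>R\<rceil>)"
    by linarith
  moreover have "real (nat \<lceil>R\<rceil>) \<le> R + 1" using assms by linarith
  ultimately show ?thesis using assms by linarith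
qed

text \<open>
  By translation invariance the centre may be taken to be \<open>0\<close>, where the set is a product of intervals.
\<close>

lemma card_torus_near:
  fixes c :: "int ^ 'd::finite"
  assumes "1 \<le> R" "M > 0"
  shows "real (card {x \<in> torus M. \<forall>i. tdist M (x $ i - c $ i) < R}) \<le> (4 * R) ^ CARD('d)"
proof -
  define F :: "int ^ 'd \<Rightarrow> nat" where "F x = (if \<forall>i. tdist M (x $ i) < R then 1 else 0)" for x
  have per: "periodic M F"
    unfolding periodic_def
  proof (intro allI impI)
    fix x y :: "int ^ 'd" assume "\<forall>i. int M dvd x $ i - y $ i"
    then have "tdist M (x $ i) = tdist M (y $ i)" for i by (simp add: tdist_periodic)
    then show "F x = F y" by (simp add: F_def)
  qed
  have "card {x \<in> torus M. \<forall>i. tdist M (x $ i - c $ i) < R} = (\<Sum>x\<in>torus M. F (x + - c))"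
    by (simp add: F_def sum.If_cases Int_def)
  also have "\<dots> = (\<Sum>x\<in>torus M. F x)" by (rule sum_torus_shift[OF per assms(2)])
  also have "\<dots> = card {x \<in> torus M :: (int ^ 'd) set. \<forall>i. tdist M (x $ i) < R}"
    by (simp add: F_def sum.If_cases Int_def)
  also have "\<dots> = card (cube {t \<in> {0..<int M}. tdist M t < R} :: (int ^ 'd) set)"
    by (rule arg_cong[where f = card]) (auto simp: cube_def)
  also have "\<dots> = card {t \<in> {0..<int M}. tdist M t < R} ^ CARD('d)"
    by (rule card_cube) (rule finite_subset[of _ "{0..<int M}"], auto)
  finally show ?thesis
    using power_mono[OF card_tdist_less[OF assms(1), of M], of "CARD('d)"] by simp
qed

definition far :: "nat \<Rightarrow> real \<Rightarrow> (int ^ 'd::finite) \<Rightarrow> bool" where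
  "far M R x \<longleftrightarrow> (\<exists>i. R \<le> tdist M (x $ i))"

lemma periodic_far: "periodic M (far M R :: int ^ 'd::finite \<Rightarrow> bool)"
  unfolding periodic_def
proof (intro allI impI)
  fix x y :: "int ^ 'd" assume "\<forall>i. int M dvd x $ i - y $ i"
  then have "tdist M (x $ i) = tdist M (y $ i)" for i by (simp add: tdist_periodic)
  then show "far M R x = far M R y" by (simp add: far_def)
qed

section \<open>The Calderon--Zygmund decomposition on the torus\<close>

text \<open>
  For \<open>M = 2\<^sup>q\<close> and \<open>l \<le> q\<close> these are the dyadic cubes of side \<open>2\<^sup>l\<close>.
\<close>

definition dyadic_cell :: "nat \<Rightarrow> nat \<Rightarrow> int ^ 'd::finite \<Rightarrow> (int ^ 'd) set" where
  "dyadic_cell M l x = {y \<in> torus M. \<forall>i. y $ i div 2 ^ l = x $ i div 2 ^ l}"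

lemma finite_dyadic_cell [simp]: "finite (dyadic_cell M l x)"
  by (simp add: dyadic_cell_def)

lemma div_pow2_mono:
  assumes "(a::int) div 2 ^ l = b div 2 ^ l" "l \<le> l'"
  shows "a div 2 ^ l' = b div 2 ^ l'"
proof -
  have "(2::int) ^ l' = 2 ^ l * 2 ^ (l' - l)"
    using assms(2) by (simp flip: power_add)
  then have "x div 2 ^ l' = (x div 2 ^ l) div 2 ^ (l' - l)" for x :: int
    by (simp only: zdiv_zmult2_eq zero_le_power zero_le_numeral)
  then show ?thesis using assms(1) by simp
qed

lemma dyadic_cell_eq: "y \<in> dyadic_cell M l x \<Longrightarrow> l \<le> l' \<Longrightarrow> dyadic_cell M l' y = dyadic_cell M l' x"
  unfolding dyadic_cell_def using div_pow2_mono[of "y $ i" l "x $ i" l' for i] by fastforce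

lemma dyadic_cell_mono: "l \<le> l' \<Longrightarrow> dyadic_cell M l x \<subseteq> dyadic_cell M l' x"
  unfolding dyadic_cell_def using div_pow2_mono by blast

text \<open>
  In each coordinate the cell is an interval of \<open>2\<^sup>l\<close> integers, which stays inside \<open>{0..<2\<^sup>q}\<close> because \<open>2\<^sup>l\<close>
  divides \<open>2\<^sup>q\<close>.
\<close>

lemma card_dyadic_cell:
  fixes x :: "int ^ 'd::finite"
  assumes "x \<in> torus (2 ^ q)" "l \<le> q"
  shows "card (dyadic_cell (2 ^ q) l x) = (2 ^ l) ^ CARD('d)"
proof -
  define f :: "'d \<Rightarrow> int \<Rightarrow> nat" where "f i t = (if t div 2 ^ l = x $ i div 2 ^ l then 1 else 0)" for i t
  have eq: "{t \<in> {0..<int (2 ^ q)}. t div 2 ^ l = x $ i div 2 ^ l}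
      = {2 ^ l * (x $ i div 2 ^ l)..<2 ^ l * (x $ i div 2 ^ l) + 2 ^ l}" (is "?A = ?B") for i
  proof
    show "?A \<subseteq> ?B"
    proof
      fix t assume "t \<in> ?A"
      then have t: "t div 2 ^ l = x $ i div 2 ^ l" by simp
      have "2 ^ l * (x $ i div 2 ^ l) = t - t mod 2 ^ l"
        unfolding t[symmetric] by (simp add: minus_mod_eq_mult_div)
      moreover have "0 \<le> t mod 2 ^ l" "t mod 2 ^ l < 2 ^ l" by auto
      ultimately show "t \<in> ?B" unfolding atLeastLessThan_iff by linarith
    qed
    show "?B \<subseteq> ?A"
    proof
      fix t assume t: "t \<in> ?B"
      define c where "c = x $ i div 2 ^ l"
      have x: "0 \<le> x $ i" "x $ i < 2 ^ q" using assms(1) by (auto simp: cube_def)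
      have c0: "0 \<le> c" unfolding c_def using x by (simp add: pos_imp_zdiv_nonneg_iff)
      have "(2::int) ^ q = 2 ^ l * 2 ^ (q - l)" using assms(2) by (simp flip: power_add)
      moreover have "2 ^ l * c \<le> x $ i"
        unfolding c_def by (simp add: minus_mod_eq_mult_div[symmetric])
      ultimately have "(2::int) ^ l * c < 2 ^ l * 2 ^ (q - l)" using x by linarith
      then have "c < 2 ^ (q - l)" by simp
      then have "2 ^ l * (c + 1) \<le> (2::int) ^ l * 2 ^ (q - l)" by (intro mult_left_mono) auto
      also have "\<dots> = 2 ^ q" using assms(2) by (simp flip: power_add)
      finally have c1: "2 ^ l * c + 2 ^ l \<le> (2::int) ^ q" by (simp add: ring_distribs)
      define r where "r = t - 2 ^ l * c"
      have r: "t = 2 ^ l * c + r" "0 \<le> r" "r < 2 ^ l" using t by (auto simp: r_def c_def)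
      have "t div 2 ^ l = c" using r by simp
      moreover have "0 \<le> t" "t < 2 ^ q" using r c0 c1 by auto
      ultimately show "t \<in> ?A" by (simp add: c_def)
    qed
  qed
  have "card (dyadic_cell (2 ^ q) l x) = (\<Sum>y\<in>torus (2 ^ q). if \<forall>i. y $ i div 2 ^ l = x $ i div 2 ^ l then 1 else 0)"
    by (simp add: sum.If_cases dyadic_cell_def Int_def)
  also have "\<dots> = (\<Sum>y\<in>torus (2 ^ q). \<Prod>i\<in>UNIV. f i (y $ i))"
    by (intro sum.cong refl) (auto simp: f_def)
  also have "\<dots> = (\<Prod>i\<in>UNIV. \<Sum>t\<in>{0..<int (2 ^ q)}. f i t)"
    by (rule sum_prod_cube) simp
  also have "\<dots> = (\<Prod>i\<in>(UNIV::'d set). 2 ^ l)"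
  proof (intro prod.cong refl)
    fix i
    have "(\<Sum>t\<in>{0..<int (2 ^ q)}. f i t) = card {t \<in> {0..<int (2 ^ q)}. t div 2 ^ l = x $ i div 2 ^ l}"
      by (simp add: f_def sum.If_cases Int_def)
    also have "\<dots> = nat (2 ^ l)" unfolding eq by simp
    finally show "(\<Sum>t\<in>{0..<int (2 ^ q)}. f i t) = 2 ^ l" by (simp add: nat_power_eq)
  qed
  finally show ?thesis by simp
qed

text \<open>
  The selection of maximal dyadic cubes on which the average of \<open>\<bar>f\<bar>\<close> exceeds \<open>\<alpha>\<close>. Since \<open>\<alpha>\<close> is at least the
  average over the whole torus, every selected cube has a dyadic parent, which is not selected.
\<close>

locale stopping_cubes =
  fixes q :: nat and f :: "int ^ 'd::finite \<Rightarrow> complex" and \<alpha> :: real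
  assumes \<alpha>: "\<alpha> > 0" and top_level: "(\<Sum>y\<in>torus (2 ^ q). cmod (f y)) \<le> \<alpha> * (2 ^ q) ^ CARD('d)"
begin

abbreviation cell :: "nat \<Rightarrow> int ^ 'd \<Rightarrow> (int ^ 'd) set" where
  "cell \<equiv> dyadic_cell (2 ^ q)"

abbreviation G :: "(int ^ 'd) set" where
  "G \<equiv> torus (2 ^ q)"

definition heavy :: "nat \<Rightarrow> int ^ 'd \<Rightarrow> bool" where
  "heavy l x \<longleftrightarrow> l \<le> q \<and> \<alpha> * (2 ^ l) ^ CARD('d) < (\<Sum>y\<in>cell l x. cmod (f y))"

definition bad :: "(int ^ 'd) set" where
  "bad = {x \<in> G. \<exists>l. heavy l x}"

text \<open>
  The level of the selected cube through \<open>x\<close>; meaningful only for \<open>x \<in> bad\<close>. Taking the largest level is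
  the choice of the maximal cube.
\<close>

definition level :: "int ^ 'd \<Rightarrow> nat" where
  "level x = Max {l. heavy l x}"

definition mean :: "int ^ 'd \<Rightarrow> complex" where
  "mean x = (\<Sum>y\<in>cell (level x) x. f y) / of_nat ((2 ^ level x) ^ CARD('d))"

definition bpart :: "int ^ 'd \<Rightarrow> complex" where
  "bpart x = (if x \<in> bad then f x - mean x else 0)"

definition gpart :: "int ^ 'd \<Rightarrow> complex" where
  "gpart x = (if x \<in> bad then mean x else f x)"

text \<open>
  The least point of the selected cube through \<open>x\<close>. Together with the level it identifies the cube, so
  pairs of level and corner index the selected cubes, and it serves as their centre.
\<close>

definition corner :: "int ^ 'd \<Rightarrow> int ^ 'd" where
  "corner x = (\<chi> i. 2 ^ level x * (x $ i div 2 ^ level x))"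

lemma finite_heavy: "finite {l. heavy l x}"
  by (rule finite_subset[of _ "{..q}"]) (auto simp: heavy_def)

lemma finite_bad [simp]: "finite bad"
  by (simp add: bad_def)

lemma bad_subset: "bad \<subseteq> G"
  by (auto simp: bad_def)

lemma heavy_level: "x \<in> bad \<Longrightarrow> heavy (level x) x"
  unfolding level_def using Max_in[OF finite_heavy, of x] by (auto simp: bad_def)

lemma not_heavy_above: "level x < l \<Longrightarrow> \<not> heavy l x"
  unfolding level_def using Max_ge[OF finite_heavy, of l x] by force

lemma heavy_cell: "y \<in> cell l x \<Longrightarrow> l \<le> l' \<Longrightarrow> heavy l' y \<longleftrightarrow> heavy l' x"
  by (simp add: heavy_def dyadic_cell_eq)

lemma cell_bad:
  assumes x: "x \<in> bad" and y: "y \<in> cell (level x) x"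
  shows "y \<in> bad" "level y = level x" "cell (level y) y = cell (level x) x" "mean y = mean x"
proof -
  have h: "heavy (level x) y" using heavy_level[OF x] heavy_cell[OF y] by simp
  show b: "y \<in> bad" using h y by (auto simp: bad_def dyadic_cell_def)
  have "level x \<le> level y"
    using not_heavy_above h by (metis not_le)
  moreover have "level y \<le> level x"
    using heavy_level[OF b] heavy_cell[OF y, of "level y"] not_heavy_above[of x "level y"]
    by (metis nat_le_linear not_le)
  ultimately show e: "level y = level x" by simp
  show c: "cell (level y) y = cell (level x) x" unfolding e using dyadic_cell_eq[OF y] by simp
  show "mean y = mean x" unfolding mean_def c unfolding e ..
qed

lemma level_less: "x \<in> bad \<Longrightarrow> level x < q"
proof (rule ccontr)
  assume x: "x \<in> bad" and "\<not> level x < q"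
  then have "level x = q" using heavy_level[OF x] by (auto simp: heavy_def)
  then have "heavy q x" using heavy_level[OF x] by simp
  then have "\<alpha> * (2 ^ q) ^ CARD('d) < (\<Sum>y\<in>cell q x. cmod (f y))" by (simp add: heavy_def)
  also have "\<dots> \<le> (\<Sum>y\<in>G. cmod (f y))" by (rule sum_mono2) (auto simp: dyadic_cell_def)
  finally show False using top_level by simp
qed

lemma card_cell_level: "x \<in> bad \<Longrightarrow> card (cell (level x) x) = (2 ^ level x) ^ CARD('d)"
  using level_less[of x] bad_subset by (intro card_dyadic_cell) auto

lemma corner_cell:
  assumes "x \<in> bad" "y \<in> cell (level x) x"
  shows "corner y = corner x"
proof -
  have "y $ i div 2 ^ level x = x $ i div 2 ^ level x" for i
    using assms(2) unfolding dyadic_cell_def by blast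
  then show ?thesis
    unfolding corner_def cell_bad(2)[OF assms] by (simp only:)
qed

lemma corner_eq_iff:
  assumes "x \<in> bad"
  shows "{y \<in> bad. (level y, corner y) = (level x, corner x)} = cell (level x) x"
proof -
  have "y \<in> cell (level x) x" if "y \<in> bad" "level y = level x" "corner y = corner x" for y
    using that bad_subset unfolding dyadic_cell_def corner_def vec_eq_iff by auto
  then show ?thesis using cell_bad(1,2)[OF assms] corner_cell[OF assms] by blast
qed

text \<open>
  The selected cubes partition \<open>bad\<close>, so estimates and cancellations can be checked cube by cube
  (\<open>corner_eq_iff\<close> identifies the inner index sets).
\<close>

lemma sum_bad_cells:
  fixes F :: "int ^ 'd \<Rightarrow> 'b::comm_monoid_add"
  shows "(\<Sum>y\<in>bad. F y) = (\<Sum>p\<in>(\<lambda>x. (level x, corner x)) ` bad. \<Sum>y\<in>{y \<in> bad. (level y, corner y) = p}. F y)"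
  by (rule sum.image_gen) simp

lemma sum_bad_mono:
  fixes F :: "int ^ 'd \<Rightarrow> real"
  assumes "\<And>x. x \<in> bad \<Longrightarrow> (\<Sum>y\<in>cell (level x) x. F y) \<le> (\<Sum>y\<in>cell (level x) x. H y)"
  shows "(\<Sum>y\<in>bad. F y) \<le> (\<Sum>y\<in>bad. H y)"
proof (subst (1 2) sum_bad_cells, rule sum_mono)
  fix p assume "p \<in> (\<lambda>x. (level x, corner x)) ` bad"
  then obtain x where x: "x \<in> bad" "p = (level x, corner x)" by auto
  show "(\<Sum>y\<in>{y \<in> bad. (level y, corner y) = p}. F y) \<le> (\<Sum>y\<in>{y \<in> bad. (level y, corner y) = p}. H y)"
    unfolding x(2) corner_eq_iff[OF x(1)] by (rule assms[OF x(1)])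
qed

lemma sum_bad_zero:
  fixes F :: "int ^ 'd \<Rightarrow> complex"
  assumes "\<And>x. x \<in> bad \<Longrightarrow> (\<Sum>y\<in>cell (level x) x. F y) = 0"
  shows "(\<Sum>y\<in>bad. F y) = 0"
proof (subst sum_bad_cells, rule sum.neutral, rule ballI)
  fix p assume "p \<in> (\<lambda>x. (level x, corner x)) ` bad"
  then obtain x where x: "x \<in> bad" "p = (level x, corner x)" by auto
  show "(\<Sum>y\<in>{y \<in> bad. (level y, corner y) = p}. F y) = 0"
    unfolding x(2) corner_eq_iff[OF x(1)] by (rule assms[OF x(1)])
qed

lemma sum_mean_le: "(\<Sum>y\<in>bad. cmod (mean y)) \<le> (\<Sum>y\<in>bad. cmod (f y))"
proof (rule sum_bad_mono)
  fix x assume x: "x \<in> bad"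
  have "(\<Sum>y\<in>cell (level x) x. cmod (mean y)) = (\<Sum>y\<in>cell (level x) x. cmod (mean x))"
    using cell_bad(4)[OF x] by (intro sum.cong) auto
  also have "\<dots> = cmod (\<Sum>y\<in>cell (level x) x. f y)"
    using card_cell_level[OF x] by (simp add: mean_def norm_divide norm_power)
  also have "\<dots> \<le> (\<Sum>y\<in>cell (level x) x. cmod (f y))" by (rule norm_sum)
  finally show "(\<Sum>y\<in>cell (level x) x. cmod (mean y)) \<le> (\<Sum>y\<in>cell (level x) x. cmod (f y))" .
qed

lemma card_bad: "\<alpha> * real (card bad) \<le> (\<Sum>y\<in>G. cmod (f y))"
proof -
  have "(\<Sum>y\<in>bad. \<alpha>) \<le> (\<Sum>y\<in>bad. cmod (f y))"
  proof (rule sum_bad_mono)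
    fix x assume x: "x \<in> bad"
    show "(\<Sum>y\<in>cell (level x) x. \<alpha>) \<le> (\<Sum>y\<in>cell (level x) x. cmod (f y))"
      using heavy_level[OF x] card_cell_level[OF x] by (simp add: heavy_def mult.commute)
  qed
  also have "\<dots> \<le> (\<Sum>y\<in>G. cmod (f y))" using bad_subset by (intro sum_mono2) auto
  finally show ?thesis by (simp add: mult.commute)
qed

lemma f_split: "f x = gpart x + bpart x"
  by (simp add: gpart_def bpart_def)

lemma sum_gpart_le: "(\<Sum>y\<in>G. cmod (gpart y)) \<le> (\<Sum>y\<in>G. cmod (f y))"
proof -
  have s: "(\<Sum>y\<in>G. h y) = (\<Sum>y\<in>G - bad. h y) + (\<Sum>y\<in>bad. h y)" for h :: "int ^ 'd \<Rightarrow> real"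
    using bad_subset by (intro sum.subset_diff) auto
  show ?thesis
    unfolding s[of "\<lambda>y. cmod (gpart y)"] s[of "\<lambda>y. cmod (f y)"]
    using sum_mean_le by (intro add_mono) (auto simp: gpart_def)
qed

lemma sum_bpart_le: "(\<Sum>y\<in>bad. cmod (bpart y)) \<le> 2 * (\<Sum>y\<in>G. cmod (f y))"
proof -
  have "(\<Sum>y\<in>bad. cmod (bpart y)) \<le> (\<Sum>y\<in>bad. cmod (f y) + cmod (mean y))"
    by (intro sum_mono) (auto simp: bpart_def norm_triangle_ineq4)
  also have "\<dots> \<le> (\<Sum>y\<in>bad. cmod (f y)) + (\<Sum>y\<in>bad. cmod (f y))"
    using sum_mean_le by (simp add: sum.distrib)
  finally have "(\<Sum>y\<in>bad. cmod (bpart y)) \<le> 2 * (\<Sum>y\<in>bad. cmod (f y))" by simp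
  moreover have "(\<Sum>y\<in>bad. cmod (f y)) \<le> (\<Sum>y\<in>G. cmod (f y))"
    using bad_subset by (intro sum_mono2) auto
  ultimately show ?thesis by linarith
qed

text \<open>
  On a selected cube the parent is not heavy, which bounds the average at the cost of the ratio \<open>2\<^sup>d\<close> of the
  volumes. Elsewhere not even the one-point cube is heavy.
\<close>

lemma gpart_bound:
  assumes "x \<in> G" shows "cmod (gpart x) \<le> 2 ^ CARD('d) * \<alpha>"
proof (cases "x \<in> bad")
  case True
  define l where "l = level x"
  have l: "l < q" using level_less[OF True] by (simp add: l_def)
  have "\<not> heavy (Suc l) x" using not_heavy_above[of x "Suc l"] by (simp add: l_def)
  then have "(\<Sum>y\<in>cell (Suc l) x. cmod (f y)) \<le> \<alpha> * (2 ^ Suc l) ^ CARD('d)"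
    using l unfolding heavy_def by linarith
  moreover have "cmod (\<Sum>y\<in>cell l x. f y) \<le> (\<Sum>y\<in>cell l x. cmod (f y))" by (rule norm_sum)
  moreover have "(\<Sum>y\<in>cell l x. cmod (f y)) \<le> (\<Sum>y\<in>cell (Suc l) x. cmod (f y))"
    using dyadic_cell_mono[of l "Suc l"] by (intro sum_mono2) auto
  ultimately have "cmod (\<Sum>y\<in>cell l x. f y) \<le> \<alpha> * (2 ^ Suc l) ^ CARD('d)" by linarith
  also have "\<dots> = 2 ^ CARD('d) * \<alpha> * (2 ^ l) ^ CARD('d)" by (simp add: power_mult_distrib)
  finally have "cmod (mean x) \<le> 2 ^ CARD('d) * \<alpha>"
    unfolding mean_def l_def[symmetric] by (simp add: norm_divide norm_power field_simps)
  then show ?thesis using True by (simp add: gpart_def)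
next
  case False
  then have "\<not> heavy 0 x" using assms by (auto simp: bad_def)
  moreover have "cell 0 x = {x}" using assms by (auto simp: dyadic_cell_def vec_eq_iff)
  ultimately have "cmod (f x) \<le> \<alpha>" by (simp add: heavy_def)
  also have "1 * \<alpha> \<le> 2 ^ CARD('d) * \<alpha>" using \<alpha> by (intro mult_right_mono) auto
  finally show ?thesis using False by (simp add: gpart_def)
qed

text \<open>
  The union of enlarged selected cubes, off which the Hoermander condition applies. A point of the cube differs from
  its corner by less than \<open>2\<^sup>l\<close> in each coordinate, \<open>l\<close> being the level, and the factor \<open>4\<close> is the one in the
  condition.
\<close>

definition nearbad :: "(int ^ 'd) set" where
  "nearbad = {x \<in> G. \<exists>y\<in>bad. \<not> far (2 ^ q) (4 * 2 ^ level y) (x - corner y)}"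

lemma card_nearbad: "real (card nearbad) \<le> 16 ^ CARD('d) * real (card bad)"
proof -
  define P where "P = (\<lambda>x. (level x, corner x)) ` bad"
  define N where "N = (\<lambda>(l::nat, c). {x \<in> G. \<forall>i. tdist (2 ^ q) (x $ i - c $ i) < 4 * 2 ^ l})"
  have fP: "finite P" by (simp add: P_def)
  have "nearbad \<subseteq> (\<Union>p\<in>P. N p)"
    unfolding nearbad_def P_def N_def far_def by (force simp: not_le)
  then have "card nearbad \<le> card (\<Union>p\<in>P. N p)"
    using fP by (intro card_mono finite_UN_I) (auto simp: N_def)
  also have "\<dots> \<le> (\<Sum>p\<in>P. card (N p))" by (rule card_UN_le[OF fP])
  finally have "real (card nearbad) \<le> (\<Sum>p\<in>P. real (card (N p)))"
    by (metis of_nat_le_iff of_nat_sum)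
  also have "\<dots> \<le> (\<Sum>p\<in>P. 16 ^ CARD('d) * real (card {y \<in> bad. (level y, corner y) = p}))"
  proof (rule sum_mono)
    fix p assume "p \<in> P"
    then obtain x where x: "x \<in> bad" "p = (level x, corner x)" by (auto simp: P_def)
    have e: "4 * (4 * 2 ^ level x) = 16 * (2::real) ^ level x" by simp
    have "real (card (N p)) \<le> (4 * (4 * 2 ^ level x)) ^ CARD('d)"
      unfolding x N_def prod.case by (rule card_torus_near) (use one_le_power[of "2::real" "level x"] in \<open>linarith | simp\<close>)+
    also have "\<dots> = 16 ^ CARD('d) * (2 ^ level x) ^ CARD('d)"
      unfolding e by (rule power_mult_distrib)
    finally show "real (card (N p)) \<le> 16 ^ CARD('d) * real (card {y \<in> bad. (level y, corner y) = p})"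
      unfolding x corner_eq_iff[OF x(1)] card_cell_level[OF x(1)] by simp
  qed
  also have "\<dots> = 16 ^ CARD('d) * real (card bad)"
    using sum_bad_cells[of "\<lambda>_. 1::real"] by (simp add: P_def sum_distrib_left[symmetric])
  finally show ?thesis .
qed

text \<open>
  The bad part has mean zero on each selected cube, so a value of the kernel that is constant on the cube may
  be subtracted.
\<close>

lemma conv_bpart:
  "conv (2 ^ q) k bpart x = (\<Sum>y\<in>bad. (k (x - y) - k (x - corner y)) * bpart y)"
proof -
  have "(\<Sum>y\<in>bad. k (x - corner y) * bpart y) = 0"
  proof (rule sum_bad_zero)
    fix z assume z: "z \<in> bad"
    have "(\<Sum>y\<in>cell (level z) z. k (x - corner y) * bpart y)
        = (\<Sum>y\<in>cell (level z) z. k (x - corner z) * (f y - mean z))"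
    proof (intro sum.cong refl)
      fix y assume y: "y \<in> cell (level z) z"
      then have "corner y = corner z"
        by (rule corner_cell[OF z])
      then show "k (x - corner y) * bpart y = k (x - corner z) * (f y - mean z)"
        using cell_bad[OF z y] by (simp add: bpart_def)
    qed
    also have "\<dots> = 0"
      using card_cell_level[OF z]
      by (simp add: sum_distrib_left[symmetric] sum_subtractf mean_def)
    finally show "(\<Sum>y\<in>cell (level z) z. k (x - corner y) * bpart y) = 0" .
  qed
  moreover have "conv (2 ^ q) k bpart x = (\<Sum>y\<in>bad. k (x - y) * bpart y)"
    unfolding conv_def using bad_subset
    by (intro sum.mono_neutral_right) (auto simp: bpart_def)
  ultimately show ?thesis by (simp add: left_diff_distrib sum_subtractf)
qed

lemma sum_conv_bpart_le:
  assumes per: "periodic (2 ^ q) k"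
    and hoer: "\<And>w \<rho>. 1 \<le> \<rho> \<Longrightarrow> (\<forall>i. 0 \<le> w $ i \<and> real_of_int (w $ i) < \<rho>)
        \<Longrightarrow> (\<Sum>x\<in>{x \<in> G. far (2 ^ q) (4 * \<rho>) x}. cmod (k (x - w) - k x)) \<le> B"
  shows "(\<Sum>x\<in>G - nearbad. cmod (conv (2 ^ q) k bpart x)) \<le> 2 * B * (\<Sum>y\<in>G. cmod (f y))"
proof -
  have B: "B \<ge> 0" using order.trans[OF sum_nonneg hoer[of 1 0]] by auto
  have "(\<Sum>x\<in>G - nearbad. cmod (conv (2 ^ q) k bpart x))
      \<le> (\<Sum>x\<in>G - nearbad. \<Sum>y\<in>bad. cmod (k (x - y) - k (x - corner y)) * cmod (bpart y))"
    unfolding conv_bpart by (intro sum_mono order.trans[OF norm_sum]) (simp add: norm_mult)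
  also have "\<dots> = (\<Sum>y\<in>bad. (\<Sum>x\<in>G - nearbad. cmod (k (x - y) - k (x - corner y))) * cmod (bpart y))"
    by (subst sum.swap) (simp add: sum_distrib_right)
  also have "\<dots> \<le> (\<Sum>y\<in>bad. B * cmod (bpart y))"
  proof (intro sum_mono mult_right_mono)
    fix y assume y: "y \<in> bad"
    define w where "w = y - corner y"
    define \<rho> where "\<rho> = (2::real) ^ level y"
    define H where "H x = (if far (2 ^ q) (4 * \<rho>) x then cmod (k (x - w) - k x) else 0)" for x
    have wi: "w $ i = y $ i mod 2 ^ level y" for i
      by (simp add: w_def corner_def minus_mult_div_eq_mod)
    have w: "0 \<le> w $ i" "real_of_int (w $ i) < \<rho>" for i
    proof -
      show "0 \<le> w $ i" by (simp add: wi)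
      have "w $ i < 2 ^ level y" by (simp add: wi)
      then show "real_of_int (w $ i) < \<rho>"
        unfolding \<rho>_def by (metis of_int_less_iff of_int_numeral of_int_power)
    qed
    have perH: "periodic (2 ^ q) H"
      unfolding periodic_def
    proof (intro allI impI)
      fix a b :: "int ^ 'd" assume ab: "\<forall>i. int (2 ^ q) dvd a $ i - b $ i"
      have "far (2 ^ q) (4 * \<rho>) a = far (2 ^ q) (4 * \<rho>) b"
        using ab by (intro periodicD[OF periodic_far]) auto
      moreover have "k a = k b" "k (a - w) = k (b - w)"
        using ab by (auto intro!: periodicD[OF per])
      ultimately show "H a = H b" by (simp add: H_def)
    qed
    have "(\<Sum>x\<in>G - nearbad. cmod (k (x - y) - k (x - corner y))) = (\<Sum>x\<in>G - nearbad. H (x + - corner y))"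
    proof (intro sum.cong refl)
      fix x assume "x \<in> G - nearbad"
      then have "far (2 ^ q) (4 * \<rho>) (x + - corner y)"
        using y by (auto simp: nearbad_def \<rho>_def)
      then show "cmod (k (x - y) - k (x - corner y)) = H (x + - corner y)"
        by (simp add: H_def w_def)
    qed
    also have "\<dots> \<le> (\<Sum>x\<in>G. H (x + - corner y))"
      by (intro sum_mono2) (auto simp: H_def)
    also have "\<dots> = (\<Sum>x\<in>G. H x)" by (rule sum_torus_shift[OF perH]) simp
    also have "\<dots> = (\<Sum>x\<in>{x \<in> G. far (2 ^ q) (4 * \<rho>) x}. cmod (k (x - w) - k x))"
      by (simp add: H_def sum.If_cases Int_def)
    also have "\<dots> \<le> B" using w by (intro hoer) (auto simp: \<rho>_def)
    finally show "(\<Sum>x\<in>G - nearbad. cmod (k (x - y) - k (x - corner y))) \<le> B" .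
  qed simp
  also have "\<dots> \<le> B * (2 * (\<Sum>y\<in>G. cmod (f y)))"
    unfolding sum_distrib_left[symmetric] using sum_bpart_le B by (intro mult_left_mono) auto
  finally show ?thesis by simp
qed

end

text \<open>
  Markov's inequality for counting measure.
\<close>

lemma card_markov:
  fixes F :: "'a \<Rightarrow> real"
  assumes "finite A" "\<And>x. x \<in> A \<Longrightarrow> 0 \<le> F x" "s > 0"
  shows "s * real (card {x \<in> A. s < F x}) \<le> (\<Sum>x\<in>A. F x)"
proof -
  have "s * real (card {x \<in> A. s < F x}) = (\<Sum>x\<in>{x \<in> A. s < F x}. s)" by simp
  also have "\<dots> \<le> (\<Sum>x\<in>{x \<in> A. s < F x}. F x)" by (intro sum_mono) auto
  also have "\<dots> \<le> (\<Sum>x\<in>A. F x)" using assms by (intro sum_mono2) auto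
  finally show ?thesis .
qed

text \<open>
  The three summands of the constant come from the good part (\<open>L\<^sup>2\<close> bound and Markov), from the enlarged cubes,
  which are few, and from the bad part off these cubes (Hoermander condition and Markov).
\<close>

theorem calderon_zygmund:
  fixes k f :: "int ^ 'd::finite \<Rightarrow> complex"
  assumes per: "periodic (2 ^ q) k" and B: "B > 0" and t: "t > 0"
    and L2: "\<And>g. (\<Sum>x\<in>torus (2 ^ q). (cmod (conv (2 ^ q) k g x))\<^sup>2) \<le> B\<^sup>2 * (\<Sum>x\<in>torus (2 ^ q). (cmod (g x))\<^sup>2)"
    and hoer: "\<And>w \<rho>. 1 \<le> \<rho> \<Longrightarrow> (\<forall>i. 0 \<le> w $ i \<and> real_of_int (w $ i) < \<rho>)
        \<Longrightarrow> (\<Sum>x\<in>{x \<in> torus (2 ^ q). far (2 ^ q) (4 * \<rho>) x}. cmod (k (x - w) - k x)) \<le> B"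
  shows "t * real (card {x \<in> torus (2 ^ q). t < cmod (conv (2 ^ q) k f x)})
      \<le> (4 * 2 ^ CARD('d) + 16 ^ CARD('d) + 4) * B * (\<Sum>y\<in>torus (2 ^ q). cmod (f y))"
proof -
  define S where "S = (\<Sum>y\<in>torus (2 ^ q). cmod (f y))"
  define \<alpha> where "\<alpha> = t / B"
  have S0: "S \<ge> 0" unfolding S_def by (intro sum_nonneg) auto
  have \<alpha>0: "\<alpha> > 0" using t B by (simp add: \<alpha>_def)
  show ?thesis
  proof (cases "S \<le> \<alpha> * (2 ^ q) ^ CARD('d)")
    case False
    \<comment> \<open>When the average of \<open>f\<close> over the torus exceeds the threshold, counting all points suffices.\<close>
    have "card {x \<in> torus (2 ^ q) :: (int ^ 'd) set. t < cmod (conv (2 ^ q) k f x)} \<le> card (torus (2 ^ q) :: (int ^ 'd) set)"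
      by (intro card_mono) auto
    also have "\<dots> = (2 ^ q) ^ CARD('d)" by (simp add: card_cube nat_power_eq)
    finally have "real (card {x \<in> torus (2 ^ q). t < cmod (conv (2 ^ q) k f x)}) \<le> real ((2 ^ q) ^ CARD('d))"
      by (simp only: of_nat_le_iff)
    then have "t * real (card {x \<in> torus (2 ^ q). t < cmod (conv (2 ^ q) k f x)}) \<le> t * (2 ^ q) ^ CARD('d)"
      using t by (intro mult_left_mono) auto
    also have "\<dots> \<le> 1 * B * S" using False B by (simp add: \<alpha>_def field_simps)
    also have "\<dots> \<le> (4 * 2 ^ CARD('d) + 16 ^ CARD('d) + 4) * B * S"
      using B S0 by (intro mult_right_mono) (auto simp: add_nonneg_nonneg intro: add_increasing)
    finally show ?thesis by (simp add: S_def)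
  next
    case True
    interpret stopping_cubes q f \<alpha>
      using \<alpha>0 True by unfold_locales (auto simp: S_def)
    define X1 where "X1 = {x \<in> G. (t / 2)\<^sup>2 < (cmod (conv (2 ^ q) k gpart x))\<^sup>2}"
    define X3 where "X3 = {x \<in> G - nearbad. t / 2 < cmod (conv (2 ^ q) k bpart x)}"
    have "{x \<in> G. t < cmod (conv (2 ^ q) k f x)} \<subseteq> X1 \<union> nearbad \<union> X3"
    proof
      fix x assume "x \<in> {x \<in> G. t < cmod (conv (2 ^ q) k f x)}"
      then have x: "x \<in> G" "t < cmod (conv (2 ^ q) k f x)" by auto
      have "conv (2 ^ q) k f x = conv (2 ^ q) k gpart x + conv (2 ^ q) k bpart x"
        unfolding conv_def by (subst f_split) (simp add: ring_distribs sum.distrib)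
      then have "t / 2 < cmod (conv (2 ^ q) k gpart x) \<or> t / 2 < cmod (conv (2 ^ q) k bpart x)"
        using x(2) norm_triangle_ineq[of "conv (2 ^ q) k gpart x" "conv (2 ^ q) k bpart x"] by fastforce
      then show "x \<in> X1 \<union> nearbad \<union> X3"
        using x(1) t by (auto simp: X1_def X3_def intro: power_strict_mono)
    qed
    then have "card {x \<in> G. t < cmod (conv (2 ^ q) k f x)} \<le> card (X1 \<union> nearbad \<union> X3)"
      by (intro card_mono) (auto simp: X1_def X3_def nearbad_def)
    also have "\<dots> \<le> card X1 + card nearbad + card X3"
      using card_Un_le[of "X1 \<union> nearbad" X3] card_Un_le[of X1 nearbad] by linarith
    finally have "real (card {x \<in> G. t < cmod (conv (2 ^ q) k f x)}) \<le> real (card X1) + real (card nearbad) + real (card X3)"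
      by linarith
    then have main: "t * real (card {x \<in> G. t < cmod (conv (2 ^ q) k f x)})
        \<le> t * real (card X1) + t * real (card nearbad) + t * real (card X3)"
      using t by (simp add: ring_distribs(1)[symmetric])
    have "(t / 2)\<^sup>2 * real (card X1) \<le> (\<Sum>x\<in>G. (cmod (conv (2 ^ q) k gpart x))\<^sup>2)"
      unfolding X1_def using t by (intro card_markov) auto
    also have "\<dots> \<le> B\<^sup>2 * (\<Sum>x\<in>G. (cmod (gpart x))\<^sup>2)" by (rule L2)
    also have "\<dots> \<le> B\<^sup>2 * (\<Sum>x\<in>G. 2 ^ CARD('d) * \<alpha> * cmod (gpart x))"
      using gpart_bound by (intro mult_left_mono sum_mono) (auto simp: power2_eq_square intro!: mult_right_mono)
    also have "\<dots> \<le> B\<^sup>2 * (2 ^ CARD('d) * \<alpha> * S)"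
      unfolding sum_distrib_left[symmetric] using sum_gpart_le \<alpha>0
      by (intro mult_left_mono) (auto simp: S_def)
    also have "\<dots> = t / 4 * (4 * 2 ^ CARD('d) * B * S)"
      using B by (simp add: \<alpha>_def power2_eq_square)
    finally have "t / 4 * (t * real (card X1)) \<le> t / 4 * (4 * 2 ^ CARD('d) * B * S)"
      by (simp add: power2_eq_square)
    then have 1: "t * real (card X1) \<le> 4 * 2 ^ CARD('d) * B * S"
      using t by (simp only: mult_le_cancel_left_pos divide_pos_pos zero_less_numeral)
    have "t * real (card nearbad) \<le> t * (16 ^ CARD('d) * real (card bad))"
      using card_nearbad t by (intro mult_left_mono) auto
    also have "\<dots> = 16 ^ CARD('d) * B * (\<alpha> * real (card bad))" using B by (simp add: \<alpha>_def)
    also have "\<dots> \<le> 16 ^ CARD('d) * B * S"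
      using card_bad B by (intro mult_left_mono) (auto simp: S_def)
    finally have 2: "t * real (card nearbad) \<le> 16 ^ CARD('d) * B * S" .
    have "t / 2 * real (card X3) \<le> (\<Sum>x\<in>G - nearbad. cmod (conv (2 ^ q) k bpart x))"
      unfolding X3_def using t by (intro card_markov) auto
    also have "\<dots> \<le> 2 * B * S" unfolding S_def by (rule sum_conv_bpart_le[OF per hoer])
    finally have 3: "t * real (card X3) \<le> 4 * B * S" by simp
    show ?thesis
      using main 1 2 3 unfolding S_def[symmetric] by (simp add: ring_distribs)
  qed
qed

section \<open>Symbol classes\<close>

text \<open>
  The partial derivative as a relation between a point and a value, which can be used for functions with values
  in any normed space and on open sets without junk values.
\<close>

definition pder :: "'d::finite \<Rightarrow> (real ^ 'd \<Rightarrow> 'e::real_normed_vector) \<Rightarrow> real ^ 'd \<Rightarrow> 'e \<Rightarrow> bool" where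
  "pder i F \<xi> D \<longleftrightarrow> ((\<lambda>t. F (\<xi> + t *\<^sub>R axis i 1)) has_vector_derivative D) (at 0)"

text \<open>
  A family of functions \<open>F p\<close>, with a weight \<open>K p\<close> for each member, belongs to the class if it has \<open>n\<close>
  successive partial derivatives on \<open>U\<close> and those of order \<open>j\<close> are bounded by a constant times \<open>K p ^ (a + j)\<close>,
  uniformly in \<open>p\<close>. The weight records how many factors of the reciprocal distance to the wave cone a
  derivative costs; with weight \<open>1\<close> these are uniform \<open>C\<^sup>n\<close> bounds.
\<close>

primrec wsym :: "'p set \<Rightarrow> ('p \<Rightarrow> real) \<Rightarrow> (real ^ 'd::finite) set \<Rightarrow> nat \<Rightarrow> nat
    \<Rightarrow> ('p \<Rightarrow> real ^ 'd \<Rightarrow> 'e::real_normed_vector) \<Rightarrow> bool" where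
  "wsym I K U 0 a F \<longleftrightarrow> (\<exists>C. \<forall>p\<in>I. \<forall>\<xi>\<in>U. norm (F p \<xi>) \<le> C * K p ^ a)"
| "wsym I K U (Suc n) a F \<longleftrightarrow> (\<exists>C. \<forall>p\<in>I. \<forall>\<xi>\<in>U. norm (F p \<xi>) \<le> C * K p ^ a) \<and>
    (\<forall>i. \<exists>G. (\<forall>p\<in>I. \<forall>\<xi>\<in>U. pder i (F p) \<xi> (G p \<xi>)) \<and> wsym I K U n (Suc a) G)"

lemma wsym_bound: "wsym I K U n a F \<Longrightarrow> \<exists>C. \<forall>p\<in>I. \<forall>\<xi>\<in>U. norm (F p \<xi>) \<le> C * K p ^ a"
  by (cases n) auto

lemma wsym_deriv:
  "wsym I K U (Suc n) a F \<Longrightarrow> \<exists>G. (\<forall>p\<in>I. \<forall>\<xi>\<in>U. pder i (F p) \<xi> (G p \<xi>)) \<and> wsym I K U n (Suc a) G"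
  by auto

lemma wsym_SucI:
  assumes "\<exists>C. \<forall>p\<in>I. \<forall>\<xi>\<in>U. norm (F p \<xi>) \<le> C * K p ^ a"
    and "\<And>i. \<exists>G. (\<forall>p\<in>I. \<forall>\<xi>\<in>U. pder i (F p) \<xi> (G p \<xi>)) \<and> wsym I K U n (Suc a) G"
  shows "wsym I K U (Suc n) a F"
  using assms by auto

lemma wsym_Suc_D: "wsym I K U (Suc n) a F \<Longrightarrow> wsym I K U n a F"
proof (induction n arbitrary: a F)
  case (Suc n)
  show ?case
  proof (rule wsym_SucI)
    fix i
    from wsym_deriv[OF Suc.prems, of i] obtain G
      where "\<forall>p\<in>I. \<forall>\<xi>\<in>U. pder i (F p) \<xi> (G p \<xi>)" "wsym I K U (Suc n) (Suc a) G" by blast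
    with Suc.IH show "\<exists>G. (\<forall>p\<in>I. \<forall>\<xi>\<in>U. pder i (F p) \<xi> (G p \<xi>)) \<and> wsym I K U n (Suc a) G" by blast
  qed (rule wsym_bound[OF Suc.prems])
qed auto

lemma wsym_reindex:
  fixes F :: "'p \<Rightarrow> real ^ 'd::finite \<Rightarrow> 'e::real_normed_vector"
  assumes "wsym I K U n a F" "\<And>p. p \<in> J \<Longrightarrow> h p \<in> I" "V \<subseteq> U"
  shows "wsym J (\<lambda>p. K (h p)) V n a (\<lambda>p. F (h p))"
  using assms(1)
proof (induction n arbitrary: a F)
  case 0
  then show ?case using assms(2,3) by (auto simp: subset_iff) blast
next
  case (Suc n)
  show ?case
  proof (rule wsym_SucI)
    show "\<exists>C. \<forall>p\<in>J. \<forall>\<xi>\<in>V. norm (F (h p) \<xi>) \<le> C * K (h p) ^ a"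
      using wsym_bound[OF Suc.prems] assms(2,3) by blast
    fix i
    from wsym_deriv[OF Suc.prems, of i] obtain G
      where "\<forall>p\<in>I. \<forall>\<xi>\<in>U. pder i (F p) \<xi> (G p \<xi>)" "wsym I K U n (Suc a) G" by blast
    with Suc.IH[of "Suc a" G] show "\<exists>G. (\<forall>p\<in>J. \<forall>\<xi>\<in>V. pder i (F (h p)) \<xi> (G p \<xi>)) \<and> wsym J (\<lambda>p. K (h p)) V n (Suc a) G"
      using assms(2,3) by (intro exI[of _ "\<lambda>p. G (h p)"]) blast
  qed
qed

lemma pder_cong:
  assumes "open U" "\<xi> \<in> U" "\<And>\<eta>. \<eta> \<in> U \<Longrightarrow> F \<eta> = G \<eta>"
  shows "pder i F \<xi> D \<longleftrightarrow> pder i G \<xi> D"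
proof -
  have c: "continuous (at 0) (\<lambda>t::real. \<xi> + t *\<^sub>R axis i 1)" by (intro continuous_intros)
  have "\<forall>\<^sub>F t in at (0::real). \<xi> + t *\<^sub>R axis i 1 \<in> U"
    using c assms(1,2) unfolding continuous_at by (auto dest!: topological_tendstoD)
  then have ev: "\<forall>\<^sub>F t in at (0::real). F (\<xi> + t *\<^sub>R axis i 1) = G (\<xi> + t *\<^sub>R axis i 1)"
    by eventually_elim (use assms in auto)
  have z: "F (\<xi> + 0 *\<^sub>R axis i 1) = G (\<xi> + 0 *\<^sub>R axis i 1)" using assms by simp
  from ev z have "\<forall>\<^sub>F t in nhds (0::real). F (\<xi> + t *\<^sub>R axis i 1) = G (\<xi> + t *\<^sub>R axis i 1)"
    unfolding eventually_nhds_conv_at by blast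
  then show ?thesis unfolding pder_def
    using z by (intro has_vector_derivative_cong_ev) (auto elim: eventually_mono)
qed

lemma wsym_cong:
  fixes F :: "'p \<Rightarrow> real ^ 'd::finite \<Rightarrow> 'e::real_normed_vector"
  assumes "open U" "wsym I K U n a F" "\<And>p \<xi>. p \<in> I \<Longrightarrow> \<xi> \<in> U \<Longrightarrow> F p \<xi> = F' p \<xi>"
  shows "wsym I K U n a F'"
proof (cases n)
  case 0
  then show ?thesis using assms(2,3) by auto
next
  case (Suc m)
  show ?thesis
    unfolding Suc
  proof (rule wsym_SucI)
    show "\<exists>C. \<forall>p\<in>I. \<forall>\<xi>\<in>U. norm (F' p \<xi>) \<le> C * K p ^ a"
      using wsym_bound[OF assms(2)] assms(3) by auto
    show "\<exists>G. (\<forall>p\<in>I. \<forall>\<xi>\<in>U. pder i (F' p) \<xi> (G p \<xi>)) \<and> wsym I K U m (Suc a) G" for i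
    proof -
      from wsym_deriv[OF assms(2)[unfolded Suc], of i] obtain G
        where G: "\<forall>p\<in>I. \<forall>\<xi>\<in>U. pder i (F p) \<xi> (G p \<xi>)" "wsym I K U m (Suc a) G" by blast
      have "pder i (F' p) \<xi> (G p \<xi>)" if "p \<in> I" "\<xi> \<in> U" for p \<xi>
        using G(1) that pder_cong[OF assms(1) that(2), of "F p" "F' p" i "G p \<xi>"] assms(3) by blast
      then show ?thesis using G(2) by blast
    qed
  qed
qed

lemma wsym_weight_mono:
  fixes F :: "'p \<Rightarrow> real ^ 'd::finite \<Rightarrow> 'e::real_normed_vector"
  assumes "wsym I K U n a F" "a \<le> b" "\<And>p. p \<in> I \<Longrightarrow> 1 \<le> K p"
  shows "wsym I K U n b F"
  using assms(1,2)
proof (induction n arbitrary: a b F)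
  have *: "\<exists>C. \<forall>p\<in>I. \<forall>\<xi>\<in>U. norm (F p \<xi>) \<le> C * K p ^ b"
    if "wsym I K U n a F" "a \<le> b" for n a b and F :: "'p \<Rightarrow> real ^ 'd \<Rightarrow> 'e"
  proof -
    from wsym_bound[OF that(1)] obtain C where C: "\<forall>p\<in>I. \<forall>\<xi>\<in>U. norm (F p \<xi>) \<le> C * K p ^ a" by blast
    have "norm (F p \<xi>) \<le> \<bar>C\<bar> * K p ^ b" if p: "p \<in> I" "\<xi> \<in> U" for p \<xi>
    proof -
      have "norm (F p \<xi>) \<le> C * K p ^ a" using C p by blast
      also have "\<dots> \<le> \<bar>C\<bar> * K p ^ a" using assms(3)[OF p(1)] by (intro mult_right_mono) auto
      also have "\<dots> \<le> \<bar>C\<bar> * K p ^ b"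
        using assms(3)[OF p(1)] \<open>a \<le> b\<close> by (intro mult_left_mono power_increasing) auto
      finally show ?thesis .
    qed
    then show ?thesis by blast
  qed
  {
    case 0
    then show ?case using *[of 0] by simp
  next
    case (Suc n)
    show ?case
    proof (rule wsym_SucI)
      fix i
      from wsym_deriv[OF Suc.prems(1), of i] obtain G
        where "\<forall>p\<in>I. \<forall>\<xi>\<in>U. pder i (F p) \<xi> (G p \<xi>)" "wsym I K U n (Suc a) G" by blast
      with Suc.IH Suc.prems(2)
      show "\<exists>G. (\<forall>p\<in>I. \<forall>\<xi>\<in>U. pder i (F p) \<xi> (G p \<xi>)) \<and> wsym I K U n (Suc b) G"
        using Suc_le_mono by blast
    qed (rule *[OF Suc.prems])
  }
qed

text \<open>
  Since \<open>K p \<ge> 1\<close>, uniform bounds only get weaker when powers of the weight are attached to them.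
\<close>

lemma wsym_unweighted:
  fixes F :: "'p \<Rightarrow> real ^ 'd::finite \<Rightarrow> 'e::real_normed_vector"
  assumes "wsym I (\<lambda>_. 1) U n a F" "\<And>p. p \<in> I \<Longrightarrow> 1 \<le> K p"
  shows "wsym I K U n b F"
  using assms(1)
proof (induction n arbitrary: a b F)
  have *: "\<exists>C. \<forall>p\<in>I. \<forall>\<xi>\<in>U. norm (F p \<xi>) \<le> C * K p ^ b"
    if F: "wsym I (\<lambda>_. 1) U n a F" for n a b and F :: "'p \<Rightarrow> real ^ 'd \<Rightarrow> 'e"
  proof -
    from wsym_bound[OF F] obtain C where C: "\<forall>p\<in>I. \<forall>\<xi>\<in>U. norm (F p \<xi>) \<le> C" by auto
    have "norm (F p \<xi>) \<le> \<bar>C\<bar> * K p ^ b" if p: "p \<in> I" "\<xi> \<in> U" for p \<xi>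
    proof -
      have "norm (F p \<xi>) \<le> \<bar>C\<bar> * 1" using C p by fastforce
      also have "\<dots> \<le> \<bar>C\<bar> * K p ^ b" using assms(2)[OF p(1)] by (intro mult_left_mono) auto
      finally show ?thesis .
    qed
    then show ?thesis by blast
  qed
  {
    case 0
    then show ?case using *[of 0] by simp
  next
    case (Suc n)
    show ?case
    proof (rule wsym_SucI)
      fix i
      from wsym_deriv[OF Suc.prems(1), of i] obtain G
        where "\<forall>p\<in>I. \<forall>\<xi>\<in>U. pder i (F p) \<xi> (G p \<xi>)" "wsym I (\<lambda>_. 1) U n (Suc a) G" by blast
      with Suc.IH
      show "\<exists>G. (\<forall>p\<in>I. \<forall>\<xi>\<in>U. pder i (F p) \<xi> (G p \<xi>)) \<and> wsym I K U n (Suc b) G" by blast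
    qed (rule *[OF Suc.prems])
  }
qed

lemma wsym_const:
  assumes "\<And>p. p \<in> I \<Longrightarrow> norm (c p) \<le> C * K p ^ a"
  shows "wsym I K U n a (\<lambda>p _. c p)"
proof -
  have z: "wsym I K U n a (\<lambda>_ _. 0)" for n a
  proof (induction n arbitrary: a)
    case (Suc n)
    show ?case
      by (rule wsym_SucI) (auto intro!: exI[of _ 0] exI[of _ "\<lambda>_ _. 0"] Suc simp: pder_def)
  qed (auto intro!: exI[of _ 0])
  show ?thesis
  proof (cases n)
    case 0
    then show ?thesis using assms by auto
  next
    case (Suc m)
    show ?thesis unfolding Suc
      using assms z by (intro wsym_SucI) (auto intro!: exI[of _ "\<lambda>_ _. 0"] simp: pder_def simp del: wsym.simps)
  qed
qed

lemma wsym_add: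
  fixes F H :: "'p \<Rightarrow> real ^ 'd::finite \<Rightarrow> 'e::real_normed_vector"
  assumes "wsym I K U n a F" "wsym I K U n a H"
  shows "wsym I K U n a (\<lambda>p \<xi>. F p \<xi> + H p \<xi>)"
  using assms
proof (induction n arbitrary: a F H)
  have *: "\<exists>C. \<forall>p\<in>I. \<forall>\<xi>\<in>U. norm (F p \<xi> + H p \<xi>) \<le> C * K p ^ a"
    if "wsym I K U n a F" "wsym I K U n a H" for n a and F H :: "'p \<Rightarrow> real ^ 'd \<Rightarrow> 'e"
  proof -
    from wsym_bound[OF that(1)] wsym_bound[OF that(2)] obtain C1 C2
      where "\<forall>p\<in>I. \<forall>\<xi>\<in>U. norm (F p \<xi>) \<le> C1 * K p ^ a" "\<forall>p\<in>I. \<forall>\<xi>\<in>U. norm (H p \<xi>) \<le> C2 * K p ^ a" by blast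
    then show ?thesis
      by (intro exI[of _ "C1 + C2"]) (auto simp: ring_distribs intro: norm_triangle_mono)
  qed
  {
    case 0
    then show ?case using *[of 0] by simp
  next
    case (Suc n)
    show ?case
    proof (rule wsym_SucI)
      fix i
      from wsym_deriv[OF Suc.prems(1), of i] wsym_deriv[OF Suc.prems(2), of i] obtain G1 G2
        where "\<forall>p\<in>I. \<forall>\<xi>\<in>U. pder i (F p) \<xi> (G1 p \<xi>)" "wsym I K U n (Suc a) G1"
          "\<forall>p\<in>I. \<forall>\<xi>\<in>U. pder i (H p) \<xi> (G2 p \<xi>)" "wsym I K U n (Suc a) G2" by blast
      with Suc.IH
      show "\<exists>G. (\<forall>p\<in>I. \<forall>\<xi>\<in>U. pder i (\<lambda>\<xi>. F p \<xi> + H p \<xi>) \<xi> (G p \<xi>)) \<and> wsym I K U n (Suc a) G"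
        by (intro exI[of _ "\<lambda>p \<xi>. G1 p \<xi> + G2 p \<xi>"])
           (auto simp: pder_def intro: has_vector_derivative_add)
    qed (rule *[OF Suc.prems])
  }
qed

text \<open>
  Leibniz' rule: in each term the exponents of the weight add up to \<open>a + b\<close> plus the number of derivatives.
\<close>

lemma wsym_bilinear:
  fixes F :: "'p \<Rightarrow> real ^ 'd::finite \<Rightarrow> 'e::real_normed_vector"
    and H :: "'p \<Rightarrow> real ^ 'd \<Rightarrow> 'f::real_normed_vector"
    and B :: "'e \<Rightarrow> 'f \<Rightarrow> 'g::real_normed_vector"
  assumes B: "bounded_bilinear B" and "wsym I K U n a F" "wsym I K U n b H"
    and K: "\<And>p. p \<in> I \<Longrightarrow> 0 \<le> K p"
  shows "wsym I K U n (a + b) (\<lambda>p \<xi>. B (F p \<xi>) (H p \<xi>))"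
  using assms(2,3)
proof (induction n arbitrary: a b F H)
  have *: "\<exists>C. \<forall>p\<in>I. \<forall>\<xi>\<in>U. norm (B (F p \<xi>) (H p \<xi>)) \<le> C * K p ^ (a + b)"
    if "wsym I K U n a F" "wsym I K U n b H" for n a b and F :: "'p \<Rightarrow> real ^ 'd \<Rightarrow> 'e" and H :: "'p \<Rightarrow> real ^ 'd \<Rightarrow> 'f"
  proof -
    from wsym_bound[OF that(1)] wsym_bound[OF that(2)] obtain C1 C2
      where C: "\<forall>p\<in>I. \<forall>\<xi>\<in>U. norm (F p \<xi>) \<le> C1 * K p ^ a" "\<forall>p\<in>I. \<forall>\<xi>\<in>U. norm (H p \<xi>) \<le> C2 * K p ^ b" by blast
    from bounded_bilinear.pos_bounded[OF B] obtain C0 where C0: "C0 > 0" "\<And>x y. norm (B x y) \<le> norm x * norm y * C0" by blast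
    have "norm (B (F p \<xi>) (H p \<xi>)) \<le> (C1 * C2 * C0) * K p ^ (a + b)" if p: "p \<in> I" "\<xi> \<in> U" for p \<xi>
    proof -
      have "norm (B (F p \<xi>) (H p \<xi>)) \<le> norm (F p \<xi>) * norm (H p \<xi>) * C0" by (rule C0)
      also have "\<dots> \<le> (C1 * K p ^ a) * (C2 * K p ^ b) * C0"
      proof (intro mult_right_mono mult_mono)
        show "0 \<le> C1 * K p ^ a" using C(1) p norm_ge_zero[of "F p \<xi>"] order.trans by blast
      qed (use C p C0 in auto)
      finally show ?thesis by (simp add: power_add mult_ac)
    qed
    then show ?thesis by blast
  qed
  {
    case 0
    then show ?case using *[of 0] by simp
  next
    case (Suc n)
    show ?case
    proof (rule wsym_SucI)
      fix i
      from wsym_deriv[OF Suc.prems(1), of i] wsym_deriv[OF Suc.prems(2), of i] obtain G1 G2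
        where G: "\<forall>p\<in>I. \<forall>\<xi>\<in>U. pder i (F p) \<xi> (G1 p \<xi>)" "wsym I K U n (Suc a) G1"
          "\<forall>p\<in>I. \<forall>\<xi>\<in>U. pder i (H p) \<xi> (G2 p \<xi>)" "wsym I K U n (Suc b) G2" by blast
      have "pder i (\<lambda>\<xi>. B (F p \<xi>) (H p \<xi>)) \<xi> (B (F p \<xi>) (G2 p \<xi>) + B (G1 p \<xi>) (H p \<xi>))"
        if "p \<in> I" "\<xi> \<in> U" for p \<xi>
        using bounded_bilinear.has_vector_derivative[OF B] G(1,3) that unfolding pder_def by fastforce
      moreover have "wsym I K U n (Suc (a + b)) (\<lambda>p \<xi>. B (F p \<xi>) (G2 p \<xi>) + B (G1 p \<xi>) (H p \<xi>))"
        using Suc.IH[OF wsym_Suc_D[OF Suc.prems(1)] G(4)] Suc.IH[OF G(2) wsym_Suc_D[OF Suc.prems(2)]]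
        by (intro wsym_add) auto
      ultimately show "\<exists>G. (\<forall>p\<in>I. \<forall>\<xi>\<in>U. pder i (\<lambda>\<xi>. B (F p \<xi>) (H p \<xi>)) \<xi> (G p \<xi>)) \<and> wsym I K U n (Suc (a + b)) G"
        by (intro exI[of _ "\<lambda>p \<xi>. B (F p \<xi>) (G2 p \<xi>) + B (G1 p \<xi>) (H p \<xi>)"]) simp
    qed (rule *[OF Suc.prems])
  }
qed

lemma wsym_linear:
  assumes f: "bounded_linear f" and F: "wsym I K U n a F" and K: "\<And>p. p \<in> I \<Longrightarrow> 0 \<le> K p"
  shows "wsym I K U n a (\<lambda>p \<xi>. f (F p \<xi>))"
proof -
  have "bounded_bilinear (\<lambda>(r::real) x. r *\<^sub>R f x)"
    by (rule bounded_bilinear.comp[OF bounded_bilinear_scaleR bounded_linear_ident f])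
  from wsym_bilinear[OF this wsym_const[of I "\<lambda>_. 1" 1 K 0 U n] F K]
  show ?thesis by simp
qed

lemma wsym_minus:
  "wsym I K U n a F \<Longrightarrow> (\<And>p. p \<in> I \<Longrightarrow> 0 \<le> K p) \<Longrightarrow> wsym I K U n a (\<lambda>p \<xi>. - F p \<xi>)"
  by (rule wsym_linear[OF bounded_linear_minus[OF bounded_linear_ident]])

lemma wsym_diff:
  assumes "wsym I K U n a F" "wsym I K U n a H" "\<And>p. p \<in> I \<Longrightarrow> 0 \<le> K p"
  shows "wsym I K U n a (\<lambda>p \<xi>. F p \<xi> - H p \<xi>)"
  using wsym_add[OF assms(1) wsym_minus[OF assms(2,3)]] by simp

lemma wsym_sum:
  assumes "finite A" "\<And>x. x \<in> A \<Longrightarrow> wsym I K U n a (F x)"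
  shows "wsym I K U n a (\<lambda>p \<xi>. \<Sum>x\<in>A. F x p \<xi>)"
  using assms
proof (induction rule: finite_induct)
  case empty
  show ?case using wsym_const[of I "\<lambda>_. 0" 0 K a U n] by simp
next
  case (insert x A)
  then show ?case using wsym_add[of I K U n a "F x"] by simp
qed

text \<open>
  The top derivatives carry the weight \<open>K p ^ (a + n)\<close>; dividing by this power gives bounds that no longer
  depend on \<open>p\<close>. This is where the final exponent of the distance to the cone is fixed.
\<close>

lemma wsym_normalize:
  fixes F :: "'p \<Rightarrow> real ^ 'd::finite \<Rightarrow> 'e::real_normed_vector"
  assumes "wsym I K U n a F" "\<And>p. p \<in> I \<Longrightarrow> 1 \<le> K p" "a + n \<le> m"
  shows "wsym I (\<lambda>_. 1) U n b (\<lambda>p \<xi>. F p \<xi> /\<^sub>R K p ^ m)"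
  using assms(1,3)
proof (induction n arbitrary: a b F)
  have *: "\<exists>C. \<forall>p\<in>I. \<forall>\<xi>\<in>U. norm (F p \<xi> /\<^sub>R K p ^ m) \<le> C * 1 ^ b"
    if F: "wsym I K U n a F" "a + n \<le> m" for n a b and F :: "'p \<Rightarrow> real ^ 'd \<Rightarrow> 'e"
  proof -
    from wsym_bound[OF F(1)] obtain C where C: "\<forall>p\<in>I. \<forall>\<xi>\<in>U. norm (F p \<xi>) \<le> C * K p ^ a" by auto
    have "norm (F p \<xi> /\<^sub>R K p ^ m) \<le> \<bar>C\<bar>" if p: "p \<in> I" "\<xi> \<in> U" for p \<xi>
    proof -
      have K: "1 \<le> K p" using assms(2) p by blast
      have "norm (F p \<xi>) \<le> C * K p ^ a" using C p by blast
      also have "\<dots> \<le> \<bar>C\<bar> * K p ^ a" using K by (intro mult_right_mono) auto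
      also have "\<dots> \<le> \<bar>C\<bar> * K p ^ m" using K F(2) by (intro mult_left_mono power_increasing) auto
      finally show ?thesis using K by (simp add: field_simps)
    qed
    then show ?thesis by auto
  qed
  {
    case 0
    then show ?case using *[of 0] by simp
  next
    case (Suc n)
    show ?case
    proof (rule wsym_SucI)
      fix i
      from wsym_deriv[OF Suc.prems(1), of i] obtain G
        where G: "\<forall>p\<in>I. \<forall>\<xi>\<in>U. pder i (F p) \<xi> (G p \<xi>)" "wsym I K U n (Suc a) G" by blast
      have "pder i (\<lambda>\<xi>. F p \<xi> /\<^sub>R K p ^ m) \<xi> (G p \<xi> /\<^sub>R K p ^ m)" if "p \<in> I" "\<xi> \<in> U" for p \<xi>
        using G(1) that bounded_linear.has_vector_derivative[OF bounded_linear_scaleR_right] unfolding pder_def by blast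
      then show "\<exists>G. (\<forall>p\<in>I. \<forall>\<xi>\<in>U. pder i (\<lambda>\<xi>. F p \<xi> /\<^sub>R K p ^ m) \<xi> (G p \<xi>)) \<and> wsym I (\<lambda>_. 1) U n (Suc b) G"
        using Suc.IH[OF G(2)] Suc.prems(2) by (intro exI[of _ "\<lambda>p \<xi>. G p \<xi> /\<^sub>R K p ^ m"]) auto
    qed (rule *[OF Suc.prems])
  }
qed

lemma pder_unique: "pder i F \<xi> D \<Longrightarrow> pder i F \<xi> D' \<Longrightarrow> D = D'"
  unfolding pder_def by (rule vector_derivative_unique_at)

lemma pder_zero: "open U \<Longrightarrow> \<xi> \<in> U \<Longrightarrow> (\<And>\<eta>. \<eta> \<in> U \<Longrightarrow> F \<eta> = 0) \<Longrightarrow> pder i F \<xi> 0"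
  using pder_cong[of U \<xi> F "\<lambda>_. 0" i 0] by (simp add: pder_def)

text \<open>
  All derivatives vanish on \<open>U - S\<close> too, and the two open sets \<open>U\<close> and \<open>- S\<close> cover the space.
\<close>

lemma wsym_zero_extension:
  fixes F :: "'p \<Rightarrow> real ^ 'd::finite \<Rightarrow> 'e::real_normed_vector"
  assumes "wsym I K U n a F" "open U" "closed S" "S \<subseteq> U"
    "\<And>p \<xi>. p \<in> I \<Longrightarrow> \<xi> \<in> U - S \<Longrightarrow> F p \<xi> = 0" and K: "\<And>p. p \<in> I \<Longrightarrow> 1 \<le> K p"
  shows "wsym I K UNIV n a (\<lambda>p \<xi>. if \<xi> \<in> U then F p \<xi> else 0)"
  using assms(1,5)
proof (induction n arbitrary: a F)
  have *: "\<exists>C. \<forall>p\<in>I. \<forall>\<xi>\<in>UNIV. norm (if \<xi> \<in> U then F p \<xi> else 0) \<le> C * K p ^ a"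
    if F: "wsym I K U n a F" for n a and F :: "'p \<Rightarrow> real ^ 'd \<Rightarrow> 'e"
  proof -
    from wsym_bound[OF wsym_weight_mono[OF F order_refl K]] obtain C where C: "\<forall>p\<in>I. \<forall>\<xi>\<in>U. norm (F p \<xi>) \<le> C * K p ^ a" by blast
    have "norm (F p \<xi>) \<le> \<bar>C\<bar> * K p ^ a" if "p \<in> I" "\<xi> \<in> U" for p \<xi>
    proof -
      have "norm (F p \<xi>) \<le> C * K p ^ a" using C that by blast
      also have "\<dots> \<le> \<bar>C\<bar> * K p ^ a" using K[OF that(1)] by (intro mult_right_mono) auto
      finally show ?thesis .
    qed
    moreover have "0 \<le> \<bar>C\<bar> * K p ^ a" if "p \<in> I" for p using K[OF that] by auto
    ultimately show ?thesis by (intro exI[of _ "\<bar>C\<bar>"]) auto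
  qed
  {
    case 0
    then show ?case using *[of 0] by simp
  next
    case (Suc n)
    show ?case
    proof (rule wsym_SucI)
      fix i
      from wsym_deriv[OF Suc.prems(1), of i] obtain G
        where G: "\<forall>p\<in>I. \<forall>\<xi>\<in>U. pder i (F p) \<xi> (G p \<xi>)" "wsym I K U n (Suc a) G" by blast
      have op: "open (U - S)" using assms(2,3) by (rule open_Diff)
      have G0: "G p \<xi> = 0" if "p \<in> I" "\<xi> \<in> U - S" for p \<xi>
        using pder_unique[OF _ pder_zero[OF op that(2), of "F p" i]] G(1) Suc.prems(2)[OF that(1)] that by blast
      have "pder i (\<lambda>\<xi>. if \<xi> \<in> U then F p \<xi> else 0) \<xi> (if \<xi> \<in> U then G p \<xi> else 0)" if p: "p \<in> I" for p \<xi>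
      proof (cases "\<xi> \<in> U")
        case True
        then show ?thesis
          using G(1) p pder_cong[OF assms(2) True, of "\<lambda>\<xi>. if \<xi> \<in> U then F p \<xi> else 0" "F p"] by auto
      next
        case False
        then have "\<xi> \<in> - S" using assms(4) by auto
        moreover have "open (- S)" using assms(3) by auto
        ultimately have "pder i (\<lambda>\<xi>. if \<xi> \<in> U then F p \<xi> else 0) \<xi> 0"
          using Suc.prems(2)[OF p] by (intro pder_zero) auto
        then show ?thesis using False by simp
      qed
      then show "\<exists>G. (\<forall>p\<in>I. \<forall>\<xi>\<in>UNIV. pder i (\<lambda>\<xi>. if \<xi> \<in> U then F p \<xi> else 0) \<xi> (G p \<xi>)) \<and> wsym I K UNIV n (Suc a) G"
        using Suc.IH[OF G(2) G0] by (intro exI[of _ "\<lambda>p \<xi>. if \<xi> \<in> U then G p \<xi> else 0"]) auto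
    qed (rule *[OF Suc.prems(1)])
  }
qed

lemma wsym_mult:
  fixes F H :: "'p \<Rightarrow> real ^ 'd::finite \<Rightarrow> 'e::real_normed_algebra"
  assumes "wsym I (\<lambda>_. 1) U n 0 F" "wsym I (\<lambda>_. 1) U n 0 H"
  shows "wsym I (\<lambda>_. 1) U n 0 (\<lambda>p \<xi>. F p \<xi> * H p \<xi>)"
  using wsym_bilinear[OF bounded_bilinear_mult assms] by simp

lemma wsym_power:
  fixes F :: "'p \<Rightarrow> real ^ 'd::finite \<Rightarrow> 'e::real_normed_algebra_1"
  assumes "wsym I (\<lambda>_. 1) U n 0 F"
  shows "wsym I (\<lambda>_. 1) U n 0 (\<lambda>p \<xi>. F p \<xi> ^ m)"
proof (induction m)
  case 0
  show ?case by (simp, rule wsym_const[of I "\<lambda>_. 1" 1]) simp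
qed (use wsym_mult[OF assms] in auto)

lemma wsym_prod:
  fixes F :: "'x \<Rightarrow> 'p \<Rightarrow> real ^ 'd::finite \<Rightarrow> 'e::{real_normed_algebra_1,comm_monoid_mult}"
  assumes "finite A" "\<And>x. x \<in> A \<Longrightarrow> wsym I (\<lambda>_. 1) U n 0 (F x)"
  shows "wsym I (\<lambda>_. 1) U n 0 (\<lambda>p \<xi>. \<Prod>x\<in>A. F x p \<xi>)"
  using assms
proof (induction rule: finite_induct)
  case empty
  show ?case by (simp, rule wsym_const[of I "\<lambda>_. 1" 1]) simp
next
  case (insert x A)
  then show ?case using wsym_mult[of I U n "F x"] by simp
qed

lemma wsym_coordinate:
  fixes U :: "(real ^ 'd::finite) set" and i :: 'd
  assumes "bounded U"
  shows "wsym I (\<lambda>_. 1) U n 0 (\<lambda>p \<xi>. \<xi> $ i :: real)"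
proof -
  from assms obtain R where R: "\<And>x. x \<in> U \<Longrightarrow> norm x \<le> R" unfolding bounded_iff by blast
  have b: "\<exists>C. \<forall>p\<in>I. \<forall>\<xi>\<in>U. norm (\<xi> $ i) \<le> C * 1 ^ 0"
    using R component_le_norm_cart order.trans by (intro exI[of _ R]) fastforce
  show ?thesis
  proof (cases n)
    case (Suc m)
    show ?thesis unfolding Suc
    proof (rule wsym_SucI[OF b])
      fix j
      have "pder j (\<lambda>\<xi>. \<xi> $ i) \<xi> (axis j 1 $ i)" for \<xi> :: "real ^ 'd"
        unfolding pder_def by (auto intro!: derivative_eq_intros simp: has_real_derivative_iff_has_vector_derivative[symmetric])
      moreover have "wsym I (\<lambda>_. 1) U m (Suc 0) (\<lambda>_ _. axis j 1 $ i :: real)"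
        by (rule wsym_const) auto
      ultimately show "\<exists>G. (\<forall>p\<in>I. \<forall>\<xi>\<in>U. pder j (\<lambda>\<xi>. \<xi> $ i) \<xi> (G p \<xi>)) \<and> wsym I (\<lambda>_. 1) U m (Suc 0) G"
        by (intro exI[of _ "\<lambda>_ _. axis j 1 $ i"]) blast
    qed
  qed (use b in simp)
qed

section \<open>A dyadic partition of unity\<close>

text \<open>
  Powers of the positive part are the source of cut-off functions with as many derivatives as required.
\<close>

lemma has_derivative_posmax_power:
  "((\<lambda>x::real. max 0 x ^ Suc (Suc n)) has_real_derivative real (Suc (Suc n)) * max 0 x ^ Suc n) (at x)"
proof -
  consider "x < 0" | "x > 0" | "x = 0" by linarith
  then show ?thesis
  proof cases
    case 1
    have "((\<lambda>x::real. 0) has_real_derivative 0) (at x)" by simp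
    then have "((\<lambda>x::real. max 0 x ^ Suc (Suc n)) has_real_derivative 0) (at x)"
      by (rule has_field_derivative_transform_within_open[of _ _ _ "{..<0}"]) (use 1 in auto)
    then show ?thesis using 1 by simp
  next
    case 2
    have "((\<lambda>x::real. x ^ Suc (Suc n)) has_real_derivative real (Suc (Suc n)) * x ^ Suc n) (at x)"
      using DERIV_pow[of "Suc (Suc n)" x UNIV] by simp
    then have "((\<lambda>x::real. max 0 x ^ Suc (Suc n)) has_real_derivative real (Suc (Suc n)) * x ^ Suc n) (at x)"
      by (rule has_field_derivative_transform_within_open[of _ _ _ "{0<..}"]) (use 2 in auto)
    then show ?thesis using 2 by simp
  next
    case 3
    have "((\<lambda>y::real. max 0 y ^ Suc (Suc n) / y) \<longlongrightarrow> 0) (at 0)"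
    proof (rule Lim_null_comparison)
      show "\<forall>\<^sub>F y in at 0. norm (max 0 y ^ Suc (Suc n) / y) \<le> \<bar>y\<bar> ^ Suc n"
        by (rule eventuallyI) (auto simp: max_def abs_mult power_abs mult_nonpos_nonneg)
      show "((\<lambda>y::real. \<bar>y\<bar> ^ Suc n) \<longlongrightarrow> 0) (at 0)"
        by (auto intro!: tendsto_eq_intros)
    qed
    then show ?thesis using 3 by (simp add: has_field_derivative_iff)
  qed
qed

lemma pder_chain:
  assumes "pder i F \<xi> D" "(f has_real_derivative E) (at (F \<xi>))"
  shows "pder i (\<lambda>\<xi>. f (F \<xi>)) \<xi> (E * D)"
  using DERIV_chain2[of f E "\<lambda>t. F (\<xi> + t *\<^sub>R axis i 1)" 0 D UNIV] assms
  by (simp add: pder_def has_real_derivative_iff_has_vector_derivative[symmetric])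

lemma wsym_posmax_power:
  fixes F :: "'p \<Rightarrow> real ^ 'd::finite \<Rightarrow> real"
  assumes "wsym I (\<lambda>_. 1) U n 0 F"
  shows "wsym I (\<lambda>_. 1) U n 0 (\<lambda>p \<xi>. max 0 (F p \<xi>) ^ Suc n)"
  using assms
proof (induction n)
  have *: "\<exists>C. \<forall>p\<in>I. \<forall>\<xi>\<in>U. norm (max 0 (F p \<xi>) ^ Suc n) \<le> C * 1 ^ 0"
    if "wsym I (\<lambda>_. 1) U n 0 F" for n
  proof -
    from wsym_bound[OF that] obtain C where C: "\<forall>p\<in>I. \<forall>\<xi>\<in>U. \<bar>F p \<xi>\<bar> \<le> C" by auto
    then have "\<bar>max 0 (F p \<xi>) ^ Suc n\<bar> \<le> \<bar>C\<bar> ^ Suc n" if "p \<in> I" "\<xi> \<in> U" for p \<xi>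
      unfolding power_abs using that by (intro power_mono) fastforce+
    then show ?thesis by auto
  qed
  {
    case 0
    then show ?case using *[of 0] by simp
  next
    case (Suc n)
    show ?case
    proof (rule wsym_SucI)
      fix i
      from wsym_deriv[OF Suc.prems, of i] obtain G
        where G: "\<forall>p\<in>I. \<forall>\<xi>\<in>U. pder i (F p) \<xi> (G p \<xi>)" "wsym I (\<lambda>_. 1) U n (Suc 0) G" by blast
      define H where "H p \<xi> = real (Suc (Suc n)) * max 0 (F p \<xi>) ^ Suc n * G p \<xi>" for p \<xi>
      have "pder i (\<lambda>\<xi>. max 0 (F p \<xi>) ^ Suc (Suc n)) \<xi> (H p \<xi>)" if "p \<in> I" "\<xi> \<in> U" for p \<xi>
        unfolding H_def using G(1) that by (intro pder_chain[OF _ has_derivative_posmax_power]) auto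
      moreover have "wsym I (\<lambda>_. 1) U n (0 + (0 + Suc 0)) H"
        unfolding H_def mult.assoc
        using Suc.IH[OF wsym_Suc_D[OF Suc.prems]] G(2)
        by (intro wsym_bilinear[OF bounded_bilinear_mult] wsym_const[of _ _ "real (Suc (Suc n))"]) auto
      ultimately show "\<exists>G. (\<forall>p\<in>I. \<forall>\<xi>\<in>U. pder i (\<lambda>\<xi>. max 0 (F p \<xi>) ^ Suc (Suc n)) \<xi> (G p \<xi>)) \<and> wsym I (\<lambda>_. 1) U n (Suc 0) G"
        by auto
    qed (rule *[OF Suc.prems])
  }
qed

lemma wsym_inverse:
  fixes F :: "'p \<Rightarrow> real ^ 'd::finite \<Rightarrow> real"
  assumes "wsym I (\<lambda>_. 1) U n 0 F" and c: "c > 0" "\<And>p \<xi>. p \<in> I \<Longrightarrow> \<xi> \<in> U \<Longrightarrow> c \<le> F p \<xi>"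
  shows "wsym I (\<lambda>_. 1) U n 0 (\<lambda>p \<xi>. inverse (F p \<xi>))"
  using assms(1)
proof (induction n)
  have "norm (inverse (F p \<xi>)) \<le> inverse c" if "p \<in> I" "\<xi> \<in> U" for p \<xi>
    using c(1) c(2)[OF that] by (auto intro!: le_imp_inverse_le)
  then have *: "\<exists>C. \<forall>p\<in>I. \<forall>\<xi>\<in>U. norm (inverse (F p \<xi>)) \<le> C * 1 ^ 0" by auto
  {
    case 0
    then show ?case using * by simp
  next
    case (Suc n)
    show ?case
    proof (rule wsym_SucI)
      fix i
      from wsym_deriv[OF Suc.prems, of i] obtain G
        where G: "\<forall>p\<in>I. \<forall>\<xi>\<in>U. pder i (F p) \<xi> (G p \<xi>)" "wsym I (\<lambda>_. 1) U n (Suc 0) G" by blast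
      define H where "H p \<xi> = - (inverse (F p \<xi>) * inverse (F p \<xi>) * G p \<xi>)" for p \<xi>
      have "pder i (\<lambda>\<xi>. inverse (F p \<xi>)) \<xi> (H p \<xi>)" if "p \<in> I" "\<xi> \<in> U" for p \<xi>
      proof -
        have "(inverse has_real_derivative - (inverse (F p \<xi>) * inverse (F p \<xi>))) (at (F p \<xi>))"
          using DERIV_inverse[of "F p \<xi>"] c(1) c(2)[OF that] by (simp add: power2_eq_square)
        from pder_chain[where F = "F p" and \<xi> = \<xi>, OF _ this] show ?thesis using G(1) that by (simp add: H_def)
      qed
      moreover have "wsym I (\<lambda>_. 1) U n (0 + 0 + Suc 0) H"
        unfolding H_def
        using Suc.IH[OF wsym_Suc_D[OF Suc.prems]] G(2)
        by (intro wsym_minus wsym_bilinear[OF bounded_bilinear_mult]) auto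
      ultimately show "\<exists>G. (\<forall>p\<in>I. \<forall>\<xi>\<in>U. pder i (\<lambda>\<xi>. inverse (F p \<xi>)) \<xi> (G p \<xi>)) \<and> wsym I (\<lambda>_. 1) U n (Suc 0) G"
        by auto
    qed (rule *)
  }
qed

text \<open>
  A cut-off that is \<open>1\<close> for \<open>r \<le> 1\<close> and \<open>0\<close> for \<open>r \<ge> 4\<close>, meant to be applied to a squared norm. The denominator
  never vanishes, and \<open>m\<close> is one more than the number of derivatives needed.
\<close>

definition step :: "nat \<Rightarrow> real \<Rightarrow> real" where
  "step m r = max 0 (4 - r) ^ m * inverse (max 0 (4 - r) ^ m + max 0 (r - 1) ^ m)"

lemma step_eq_1: "r \<le> 1 \<Longrightarrow> 0 < m \<Longrightarrow> step m r = 1"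
  by (simp add: step_def zero_power)

lemma step_eq_0: "4 \<le> r \<Longrightarrow> 0 < m \<Longrightarrow> step m r = 0"
  by (simp add: step_def zero_power)

lemma wsym_step:
  fixes U :: "(real ^ 'd::finite) set"
  assumes "bounded U"
  shows "wsym I (\<lambda>_. 1) U n 0 (\<lambda>p \<xi>. step (Suc n) (c * (norm \<xi>)\<^sup>2))"
proof -
  have q: "wsym I (\<lambda>_. 1) U n 0 (\<lambda>p \<xi>. c * (\<Sum>i\<in>UNIV. (\<xi> $ i)\<^sup>2))"
    by (intro wsym_mult wsym_sum wsym_power wsym_coordinate[OF assms]
        wsym_const[of _ "\<lambda>_. c" "\<bar>c\<bar>"]) auto
  have sq: "c * (norm \<xi>)\<^sup>2 = c * (\<Sum>i\<in>UNIV. (\<xi> $ i)\<^sup>2)" for \<xi> :: "real ^ 'd"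
    unfolding power2_norm_eq_inner by (simp add: inner_vec_def power2_eq_square)
  have k: "wsym I (\<lambda>_. 1) U n 0 (\<lambda>p \<xi>. a)" for a :: real
    by (rule wsym_const[of _ "\<lambda>_. a" "\<bar>a\<bar>"]) auto
  have c1: "1 \<le> max 0 (4 - r) ^ Suc n + max 0 (r - 1) ^ Suc n" for r :: real
  proof (cases "r \<le> 2")
    case True
    then have "1 \<le> max 0 (4 - r) ^ Suc n" by (intro one_le_power) auto
    moreover have "0 \<le> max 0 (r - 1) ^ Suc n" by (intro zero_le_power) auto
    ultimately show ?thesis by linarith
  next
    case False
    then have "1 \<le> max 0 (r - 1) ^ Suc n" by (intro one_le_power) auto
    moreover have "0 \<le> max 0 (4 - r) ^ Suc n" by (intro zero_le_power) auto
    ultimately show ?thesis by linarith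
  qed
  show ?thesis
    unfolding step_def sq
    by (intro wsym_mult wsym_posmax_power wsym_diff k q wsym_inverse[of _ _ _ _ 1] wsym_add)
       (use c1 in auto)
qed

text \<open>
  Differences of consecutive dilates of one cut-off, so that sums over dyadic scales telescope. The factor
  \<open>1\<close> in the first term gives both terms the same form.
\<close>

definition annular_bump :: "nat \<Rightarrow> real ^ 'd::finite \<Rightarrow> real" where
  "annular_bump m \<xi> = step m (1 * (norm \<xi>)\<^sup>2) - step m (4 * (norm \<xi>)\<^sup>2)"

lemma wsym_annular_bump:
  "bounded U \<Longrightarrow> wsym I (\<lambda>_. 1) U n 0 (\<lambda>p. annular_bump (Suc n))"
  unfolding annular_bump_def[abs_def] by (intro wsym_diff wsym_step) auto

lemma annular_bump_eq_0:
  assumes "0 < m" "norm \<xi> \<le> 1 / 2 \<or> 2 \<le> norm \<xi>" shows "annular_bump m \<xi> = 0"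
proof (cases "2 \<le> norm \<xi>")
  case True
  then have "2\<^sup>2 \<le> (norm \<xi>)\<^sup>2" by (intro power_mono) auto
  then show ?thesis using assms(1) by (simp add: annular_bump_def step_eq_0)
next
  case False
  then have "(norm \<xi>)\<^sup>2 \<le> (1/2)\<^sup>2" using assms(2) by (intro power_mono) auto
  then have "(norm \<xi>)\<^sup>2 \<le> 1/4" by (simp add: power2_eq_square)
  then show ?thesis using assms(1) by (simp add: annular_bump_def step_eq_1)
qed

lemma sum_annular_bump_telescope:
  "(\<Sum>j\<le>J. annular_bump m ((1 / 2 ^ j) *\<^sub>R \<xi>)) = step m ((norm \<xi>)\<^sup>2 / 4 ^ J) - step m (4 * (norm \<xi>)\<^sup>2)"
proof -
  have "(norm ((1 / 2 ^ j) *\<^sub>R \<xi>))\<^sup>2 = (norm \<xi>)\<^sup>2 / 4 ^ j" for j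
  proof -
    have "((2::real) ^ j)\<^sup>2 = 4 ^ j" by (simp add: power2_eq_square flip: power_mult_distrib)
    then show ?thesis by (simp add: power_divide)
  qed
  then have e: "annular_bump m ((1 / 2 ^ j) *\<^sub>R \<xi>) = step m ((norm \<xi>)\<^sup>2 / 4 ^ j) - step m (4 * (norm \<xi>)\<^sup>2 / 4 ^ j)" for j
    by (simp add: annular_bump_def)
  show ?thesis unfolding e by (induction J) auto
qed

lemma sum_annular_bump:
  assumes "0 < m" "1 \<le> norm \<xi>" "norm \<xi> \<le> 2 ^ J"
  shows "(\<Sum>j\<le>J. annular_bump m ((1 / 2 ^ j) *\<^sub>R \<xi>)) = 1"
proof -
  define r where "r = (norm \<xi>)\<^sup>2"
  have "r \<le> (2 ^ J)\<^sup>2" unfolding r_def using assms by (intro power_mono) auto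
  also have "\<dots> = 4 ^ J" by (simp add: power2_eq_square power_mult_distrib[symmetric])
  finally have "r / 4 ^ J \<le> 1" by simp
  moreover have "1\<^sup>2 \<le> r" unfolding r_def using assms by (intro power_mono) auto
  ultimately show ?thesis unfolding sum_annular_bump_telescope r_def[symmetric] using assms(1) by (simp add: step_eq_0 step_eq_1)
qed

(* Composition has to bind tighter than addition in the formulas for derivatives of inverses. *)
no_notation blinfun_compose (infixl "o\<^sub>L" 55)
notation blinfun_compose (infixl "o\<^sub>L" 72)

section \<open>Adjoints\<close>

definition adj :: "('a::euclidean_space \<Rightarrow>\<^sub>L 'b::euclidean_space) \<Rightarrow> ('b \<Rightarrow>\<^sub>L 'a)" where
  "adj F = Blinfun (adjoint (blinfun_apply F))"

lemma linear_blinfun_apply: "linear (blinfun_apply F)"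
  by (simp add: blinfun.bounded_linear_right bounded_linear.linear)

lemma adj_apply: "blinfun_apply (adj F) = adjoint (blinfun_apply F)"
  for F :: "'a::euclidean_space \<Rightarrow>\<^sub>L 'b::euclidean_space"
  unfolding adj_def
  by (intro bounded_linear_Blinfun_apply) (simp add: adjoint_linear linear_blinfun_apply linear_conv_bounded_linear[symmetric])

lemma adj_inner: "x \<bullet> adj F y = F x \<bullet> y" "adj F y \<bullet> x = y \<bullet> F x"
  for F :: "'a::euclidean_space \<Rightarrow>\<^sub>L 'b::euclidean_space"
  using adjoint_works[OF linear_blinfun_apply, of x F y] by (auto simp: adj_apply inner_commute)

lemma adjI:
  fixes F :: "'a::euclidean_space \<Rightarrow>\<^sub>L 'b::euclidean_space"
  assumes "\<And>x y. F x \<bullet> y = x \<bullet> blinfun_apply G y" shows "adj F = G"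
proof (rule blinfun_eqI)
  fix y
  have "x \<bullet> adj F y = x \<bullet> G y" for x using assms by (simp add: adj_inner)
  then show "adj F y = G y" using vector_eq_ldot by blast
qed

lemma adj_compose: "adj (F o\<^sub>L G) = adj G o\<^sub>L adj F"
  for F :: "'b::euclidean_space \<Rightarrow>\<^sub>L 'c::euclidean_space" and G :: "'a::euclidean_space \<Rightarrow>\<^sub>L 'b"
  by (rule adjI) (simp add: adj_inner)

lemma norm_adj_le: "norm (adj F) \<le> norm F"
  for F :: "'a::euclidean_space \<Rightarrow>\<^sub>L 'b::euclidean_space"
proof (rule norm_blinfun_bound)
  fix y
  have "norm (adj F y) * norm (adj F y) = F (adj F y) \<bullet> y"
    by (simp add: power2_norm_eq_inner[symmetric] adj_inner(1)[symmetric] flip: power2_eq_square)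
  also have "\<dots> \<le> norm (F (adj F y)) * norm y" by (rule norm_cauchy_schwarz)
  also have "\<dots> \<le> norm F * norm (adj F y) * norm y"
    by (intro mult_right_mono norm_blinfun) auto
  finally have "norm (adj F y) * norm (adj F y) \<le> (norm F * norm y) * norm (adj F y)" by (simp add: mult_ac)
  then show "norm (adj F y) \<le> norm F * norm y"
    by (cases "norm (adj F y) = 0") (auto simp: mult_le_cancel_right)
qed simp

lemma bounded_linear_adj: "bounded_linear (adj :: ('a::euclidean_space \<Rightarrow>\<^sub>L 'b::euclidean_space) \<Rightarrow> _)"
proof (rule bounded_linear_intro[of _ 1])
  show "adj (F + G) = adj F + adj G" for F G :: "'a \<Rightarrow>\<^sub>L 'b"
    by (rule adjI) (simp add: blinfun.add_left inner_add_left inner_add_right adj_inner)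
  show "adj (r *\<^sub>R F) = r *\<^sub>R adj F" for r and F :: "'a \<Rightarrow>\<^sub>L 'b"
    by (rule adjI) (simp add: blinfun.scaleR_left adj_inner)
qed (use norm_adj_le in auto)

lemmas linear_adj = bounded_linear.linear[OF bounded_linear_adj]

section \<open>The Moore--Penrose inverse\<close>

definition penrose :: "('a::euclidean_space \<Rightarrow>\<^sub>L 'b::euclidean_space) \<Rightarrow> ('b \<Rightarrow>\<^sub>L 'a) \<Rightarrow> bool" where
  "penrose X Y \<longleftrightarrow> X o\<^sub>L Y o\<^sub>L X = X \<and> Y o\<^sub>L X o\<^sub>L Y = Y \<and> adj (X o\<^sub>L Y) = X o\<^sub>L Y \<and> adj (Y o\<^sub>L X) = Y o\<^sub>L X"

lemma penroseD:
  assumes "penrose X Y"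
  shows "X (Y (X v)) = X v" "Y (X (Y y)) = Y y" "adj Y (adj X y) = X (Y y)" "adj X (adj Y v) = Y (X v)"
    "adj X (adj Y (adj X y)) = adj X y" "adj X (X (Y y)) = adj X y"
proof -
  have a: "X o\<^sub>L Y o\<^sub>L X = X" "Y o\<^sub>L X o\<^sub>L Y = Y" "adj Y o\<^sub>L adj X = X o\<^sub>L Y" "adj X o\<^sub>L adj Y = Y o\<^sub>L X"
    using assms by (simp_all add: penrose_def adj_compose)
  show b: "X (Y (X v)) = X v" "Y (X (Y y)) = Y y" "adj Y (adj X y) = X (Y y)" "adj X (adj Y v) = Y (X v)" for v y
    using a by (metis blinfun_apply_blinfun_compose)+
  have "adj (X o\<^sub>L Y o\<^sub>L X) = adj X" by (simp add: a)
  then have "adj X o\<^sub>L (adj Y o\<^sub>L adj X) = adj X" by (simp add: adj_compose)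
  then show c: "adj X (adj Y (adj X y)) = adj X y" by (metis blinfun_apply_blinfun_compose)
  then show "adj X (X (Y y)) = adj X y" using b(3) by metis
qed

text \<open>
  The derivative of the Moore--Penrose inverse is read off from this exact formula (Wedin's identity). It
  follows from \<open>Y = Y (X Y)\<close> and \<open>Y0 = (Y0 X0) Y0\<close>, where the symmetric projections \<open>X Y\<close> and \<open>Y0 X0\<close> are
  replaced by their adjoints.
\<close>

lemma penrose_difference:
  assumes XY: "penrose X Y" and 0: "penrose X0 Y0"
  shows "Y - Y0 = - (Y o\<^sub>L (X - X0) o\<^sub>L Y0) + Y o\<^sub>L adj Y o\<^sub>L adj (X - X0) o\<^sub>L (id_blinfun - X0 o\<^sub>L Y0)
     + (id_blinfun - Y o\<^sub>L X) o\<^sub>L adj (X - X0) o\<^sub>L adj Y0 o\<^sub>L Y0"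
proof (rule blinfun_eqI)
  fix y
  have d: "adj (X - X0) = adj X - adj X0" by (rule linear_diff[OF linear_adj])
  define w where "w = adj Y0 (Y0 y)"
  have 1: "Y (X (adj X w)) = adj X w"
    using penroseD(4)[OF XY, of "adj X w"] penroseD(5)[OF XY, of w] by simp
  have 2: "adj X0 w = Y0 y" unfolding w_def
    using penroseD(4)[OF 0, of "Y0 y"] penroseD(2)[OF 0, of y] by simp
  have 3: "adj X0 (X0 (Y0 y)) = adj X0 y" by (rule penroseD(6)[OF 0])
  have 4: "Y (adj Y (adj X z)) = Y z" for z
    using penroseD(3)[OF XY, of z] penroseD(2)[OF XY, of z] by simp
  show "(Y - Y0) y = (- (Y o\<^sub>L (X - X0) o\<^sub>L Y0) + Y o\<^sub>L adj Y o\<^sub>L adj (X - X0) o\<^sub>L (id_blinfun - X0 o\<^sub>L Y0)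
     + (id_blinfun - Y o\<^sub>L X) o\<^sub>L adj (X - X0) o\<^sub>L adj Y0 o\<^sub>L Y0) y"
    by (simp add: d blinfun.bilinear_simps w_def[symmetric] 1 2 3 4)
qed

lemma penrose_unique: "penrose X Y \<Longrightarrow> penrose X Y' \<Longrightarrow> Y = Y'"
  using penrose_difference[of X Y X Y']
  by (simp add: linear_0[OF linear_adj])

text \<open>
  The inverse maps \<open>y\<close> to the vector orthogonal to the kernel of \<open>X\<close> whose image is the orthogonal projection
  of \<open>y\<close> onto the range. The predicate \<open>P\<close> in the proof characterises this vector.
\<close>

lemma penrose_exists:
  fixes X :: "'a::euclidean_space \<Rightarrow>\<^sub>L 'b::euclidean_space"
  shows "\<exists>Y. penrose X Y"
proof -
  define P where "P y x \<longleftrightarrow> (\<forall>n. X n = 0 \<longrightarrow> x \<bullet> n = 0) \<and> (\<forall>w. (y - X x) \<bullet> X w = 0)" for y x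
  have lin: "linear (blinfun_apply X)" by (rule linear_blinfun_apply)
  have subN: "subspace {n. X n = 0}" using linear_subspace_kernel[OF lin] .
  have subR: "subspace (range X)" by (rule linear_subspace_image[OF lin]) simp
  have ex: "\<exists>x. P y x" for y
  proof -
    obtain r z where r: "r \<in> span (range X)" "\<And>w. w \<in> span (range X) \<Longrightarrow> orthogonal z w" "y = r + z"
      using orthogonal_subspace_decomp_exists by blast
    have sr: "span (range X) = range X" using subR by (simp add: span_eq_iff)
    obtain v where v: "r = X v" using r(1) unfolding sr by blast
    obtain n x where x: "n \<in> span {n. X n = 0}" "\<And>w. w \<in> span {n. X n = 0} \<Longrightarrow> orthogonal x w" "v = n + x"
      using orthogonal_subspace_decomp_exists by blast
    have sn: "span {n. X n = 0} = {n. X n = 0}" using subN by (simp add: span_eq_iff)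
    have "X x = r" using x v sn by (simp add: blinfun.add_right)
    then have "P y x" using x(2) r(2,3) unfolding sn sr P_def orthogonal_def by auto
    then show ?thesis by blast
  qed
  have uniq: "x = x'" if "P y x" "P y x'" for y x x'
  proof -
    have "X (x - x') \<bullet> X w = 0" for w
    proof -
      have "X (x - x') \<bullet> X w = (y - X x') \<bullet> X w - (y - X x) \<bullet> X w"
        by (simp add: blinfun.diff_right inner_diff_left)
      then show ?thesis using that by (simp add: P_def)
    qed
    from this[of "x - x'"] have "X (x - x') = 0" by simp
    then have "x \<bullet> (x - x') = 0" "x' \<bullet> (x - x') = 0" using that by (auto simp: P_def)
    then have "(x - x') \<bullet> (x - x') = 0" by (simp add: inner_diff_left)
    then show ?thesis by simp
  qed
  define g where "g y = (SOME x. P y x)" for y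
  have g: "P y (g y)" for y unfolding g_def using ex by (rule someI_ex)
  have gu: "P y x \<Longrightarrow> g y = x" for y x using g uniq by blast
  have "linear g"
  proof (rule linearI)
    fix y y' r
    have "P (y + y') (g y + g y')"
      using g[of y] g[of y'] unfolding P_def
      by (auto simp: inner_add_left blinfun.add_right inner_diff_left algebra_simps)
    then show "g (y + y') = g y + g y'" by (rule gu)
    have e: "r *\<^sub>R y - X (r *\<^sub>R g y) = r *\<^sub>R (y - X (g y))" by (simp add: blinfun.scaleR_right algebra_simps)
    have "P (r *\<^sub>R y) (r *\<^sub>R g y)"
      using g[of y] unfolding P_def e by simp
    then show "g (r *\<^sub>R y) = r *\<^sub>R g y" by (rule gu)
  qed
  then have bg: "bounded_linear g" by (simp add: linear_conv_bounded_linear)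
  define Y where "Y = Blinfun g"
  have Y: "blinfun_apply Y = g" unfolding Y_def by (rule bounded_linear_Blinfun_apply[OF bg])
  have XYX: "X (g (X v)) = X v" for v
  proof -
    have "(X v - X (g (X v))) \<bullet> X (v - g (X v)) = 0" using g[of "X v"] by (simp add: P_def)
    then have "X (v - g (X v)) = 0" by (simp add: blinfun.diff_right)
    then show ?thesis by (simp add: blinfun.diff_right)
  qed
  have YXY: "g (X (g y)) = g y" for y
    by (rule gu) (use g[of y] in \<open>auto simp: P_def\<close>)
  have 1: "X (g y) \<bullet> y' = X (g y) \<bullet> X (g y')" for y y'
    using g[of y'] unfolding P_def by (metis eq_iff_diff_eq_0 inner_commute inner_diff_left)
  have 2: "g (X v) \<bullet> v' = g (X v) \<bullet> g (X v')" for v v'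
  proof -
    have "X (v' - g (X v')) = 0" by (simp add: blinfun.diff_right XYX)
    then have "g (X v) \<bullet> (v' - g (X v')) = 0" using g[of "X v"] by (simp add: P_def)
    then show ?thesis by (simp add: inner_diff_right)
  qed
  have "adj (X o\<^sub>L Y) = X o\<^sub>L Y"
    by (rule adjI) (metis 1 Y blinfun_apply_blinfun_compose inner_commute)
  moreover have "adj (Y o\<^sub>L X) = Y o\<^sub>L X"
    by (rule adjI) (metis 2 Y blinfun_apply_blinfun_compose inner_commute)
  moreover have "X o\<^sub>L Y o\<^sub>L X = X" "Y o\<^sub>L X o\<^sub>L Y = Y"
    by (auto intro!: blinfun_eqI simp: Y XYX YXY)
  ultimately show ?thesis unfolding penrose_def by blast
qed

definition pinv :: "('a::euclidean_space \<Rightarrow>\<^sub>L 'b::euclidean_space) \<Rightarrow> ('b \<Rightarrow>\<^sub>L 'a)" where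
  "pinv X = (SOME Y. penrose X Y)"

lemma penrose_pinv: "penrose X (pinv X)"
  unfolding pinv_def using penrose_exists by (rule someI_ex)

lemmas pinv_simps = penroseD[OF penrose_pinv]

lemma pinv_eqI: "penrose X Y \<Longrightarrow> pinv X = Y"
  using penrose_unique penrose_pinv by blast

lemma pinv_scaleR:
  assumes "r \<noteq> 0" shows "pinv (r *\<^sub>R X) = inverse r *\<^sub>R pinv X"
proof (rule pinv_eqI)
  have a: "adj (c *\<^sub>R F) = c *\<^sub>R adj F" for c and F :: "'c::euclidean_space \<Rightarrow>\<^sub>L 'd::euclidean_space"
    by (rule linear_cmul[OF linear_adj])
  show "penrose (r *\<^sub>R X) (inverse r *\<^sub>R pinv X)"
    using penrose_pinv[of X] assms unfolding penrose_def
    by (simp add: bounded_bilinear.scaleR_left[OF bounded_bilinear_blinfun_compose]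
        bounded_bilinear.scaleR_right[OF bounded_bilinear_blinfun_compose] a)
qed

lemma pinv_orthogonal_kernel:
  fixes X :: "'a::euclidean_space \<Rightarrow>\<^sub>L 'b::euclidean_space"
  shows "X n = 0 \<Longrightarrow> pinv X y \<bullet> n = 0"
proof -
  assume n: "X n = 0"
  have "pinv X y \<bullet> n = pinv X (X (pinv X y)) \<bullet> n" by (simp add: pinv_simps)
  also have "\<dots> = adj X (adj (pinv X) (pinv X y)) \<bullet> n" by (simp only: pinv_simps(4))
  also have "\<dots> = 0" by (simp add: adj_inner n blinfun.zero_right)
  finally show ?thesis .
qed

lemma pinv_left_inverse:
  fixes X :: "'a::euclidean_space \<Rightarrow>\<^sub>L 'b::euclidean_space"
  assumes "\<And>n. X n = 0 \<Longrightarrow> v \<bullet> n = 0" shows "pinv X (X v) = v"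
proof -
  define d where "d = v - pinv X (X v)"
  have Xd: "X d = 0" by (simp add: d_def blinfun.diff_right pinv_simps)
  have "d \<bullet> d = v \<bullet> d - pinv X (X v) \<bullet> d" by (simp add: d_def inner_diff_left)
  then have "d \<bullet> d = 0" using assms[OF Xd] pinv_orthogonal_kernel[OF Xd] by simp
  then show ?thesis by (simp add: d_def)
qed

lemma norm_compose_pinv_le:
  fixes X :: "'a::euclidean_space \<Rightarrow>\<^sub>L 'b::euclidean_space"
  shows "norm (X (pinv X y)) \<le> norm y"
proof -
  have "norm (X (pinv X y)) * norm (X (pinv X y)) = X (pinv X y) \<bullet> adj (pinv X) (adj X y)"
    by (simp add: pinv_simps power2_norm_eq_inner flip: power2_eq_square)
  also have "\<dots> = pinv X (X (pinv X y)) \<bullet> adj X y" by (simp only: adj_inner)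
  also have "\<dots> = X (pinv X y) \<bullet> y" by (simp only: pinv_simps(2) adj_inner)
  also have "\<dots> \<le> norm (X (pinv X y)) * norm y" by (rule norm_cauchy_schwarz)
  finally show ?thesis by (cases "norm (X (pinv X y)) = 0") (auto simp: mult_le_cancel_left)
qed

lemma norm_pinv_le:
  fixes X :: "'a::euclidean_space \<Rightarrow>\<^sub>L 'b::euclidean_space"
  assumes "c > 0" "\<And>v. (\<And>n. X n = 0 \<Longrightarrow> v \<bullet> n = 0) \<Longrightarrow> c * norm v \<le> norm (X v)"
  shows "norm (pinv X) \<le> 1 / c"
proof (rule norm_blinfun_bound)
  fix y
  have "c * norm (pinv X y) \<le> norm (X (pinv X y))" by (rule assms(2)) (rule pinv_orthogonal_kernel)
  also have "\<dots> \<le> norm y" by (rule norm_compose_pinv_le)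
  finally show "norm (pinv X y) \<le> 1 / c * norm y" using assms(1) by (simp add: field_simps)
qed (use assms in auto)

section \<open>Differentiability of the Moore--Penrose inverse\<close>

lemma pder_iff_tendsto:
  "pder i F \<xi> D \<longleftrightarrow> ((\<lambda>t. (1 / t) *\<^sub>R (F (\<xi> + t *\<^sub>R axis i 1) - F \<xi>)) \<longlongrightarrow> D) (at (0::real))"
proof -
  have e: "norm (F (\<xi> + t *\<^sub>R axis i 1) - F \<xi> - t *\<^sub>R D) / norm t
      = norm ((1 / t) *\<^sub>R (F (\<xi> + t *\<^sub>R axis i 1) - F \<xi>) - D)" if "t \<noteq> 0" for t :: real
  proof -
    have "F (\<xi> + t *\<^sub>R axis i 1) - F \<xi> - t *\<^sub>R D = t *\<^sub>R ((1 / t) *\<^sub>R (F (\<xi> + t *\<^sub>R axis i 1) - F \<xi>) - D)"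
      using that by (simp add: scaleR_diff_right)
    then show ?thesis using that by simp
  qed
  have "pder i F \<xi> D \<longleftrightarrow> ((\<lambda>t. norm (F (\<xi> + t *\<^sub>R axis i 1) - F \<xi> - t *\<^sub>R D) / norm t) \<longlongrightarrow> 0) (at (0::real))"
    unfolding pder_def has_vector_derivative_def has_derivative_at by (simp add: bounded_linear_scaleR_left)
  also have "\<dots> \<longleftrightarrow> ((\<lambda>t. norm ((1 / t) *\<^sub>R (F (\<xi> + t *\<^sub>R axis i 1) - F \<xi>) - D)) \<longlongrightarrow> 0) (at (0::real))"
    by (rule tendsto_cong) (unfold eventually_at_filter, rule always_eventually, use e in blast)
  also have "\<dots> \<longleftrightarrow> ((\<lambda>t. (1 / t) *\<^sub>R (F (\<xi> + t *\<^sub>R axis i 1) - F \<xi>)) \<longlongrightarrow> D) (at (0::real))"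
    by (simp add: tendsto_norm_zero_iff LIM_zero_iff)
  finally show ?thesis .
qed

lemmas tendsto_blinfun_compose = bounded_bilinear.tendsto[OF bounded_bilinear_blinfun_compose]
lemmas tendsto_adj = bounded_linear.tendsto[OF bounded_linear_adj]

lemma norm_compose_id_minus:
  fixes X :: "'a::euclidean_space \<Rightarrow>\<^sub>L 'b::euclidean_space"
  shows "norm (id_blinfun - Y o\<^sub>L X) \<le> 1 + norm Y * norm X"
proof -
  have "norm (id_blinfun :: 'a \<Rightarrow>\<^sub>L 'a) \<le> 1"
    by (rule norm_blinfun_bound) auto
  then show ?thesis
    using norm_blinfun_compose[of Y X]
    by (intro order.trans[OF norm_triangle_ineq4] add_mono)
qed

text \<open>
  A uniform bound on the inverses makes them continuous through \<open>penrose_difference\<close>; dividing that identity by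
  the increment then gives the derivative.
\<close>

lemma pder_pinv:
  fixes X :: "real ^ 'd::finite \<Rightarrow> 'a::euclidean_space \<Rightarrow>\<^sub>L 'b::euclidean_space"
  assumes U: "open U" "\<xi> \<in> U" and X: "pder i X \<xi> D" and Y: "\<And>\<eta>. \<eta> \<in> U \<Longrightarrow> norm (pinv (X \<eta>)) \<le> C"
  defines "Z \<equiv> pinv (X \<xi>)"
  shows "pder i (\<lambda>\<eta>. pinv (X \<eta>)) \<xi> (- (Z o\<^sub>L D o\<^sub>L Z) + Z o\<^sub>L adj Z o\<^sub>L adj D o\<^sub>L (id_blinfun - X \<xi> o\<^sub>L Z)
     + (id_blinfun - Z o\<^sub>L X \<xi>) o\<^sub>L adj D o\<^sub>L adj Z o\<^sub>L Z)"
proof -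
  define x where "x t = X (\<xi> + t *\<^sub>R axis i 1)" for t :: real
  define y where "y t = pinv (x t)" for t :: real
  define e where "e t = x t - x 0" for t :: real
  have y0: "y 0 = Z" "x 0 = X \<xi>" by (auto simp: y_def x_def Z_def)
  have diff: "y t - Z = - (y t o\<^sub>L e t o\<^sub>L Z) + y t o\<^sub>L adj (y t) o\<^sub>L adj (e t) o\<^sub>L (id_blinfun - x 0 o\<^sub>L Z)
     + (id_blinfun - y t o\<^sub>L x t) o\<^sub>L adj (e t) o\<^sub>L adj Z o\<^sub>L Z" for t
    unfolding e_def y_def Z_def y0(2)[symmetric]
    using penrose_difference[OF penrose_pinv[of "x t"] penrose_pinv[of "x 0"]] by (simp add: y0)
  have q: "((\<lambda>t. (1 / t) *\<^sub>R e t) \<longlongrightarrow> D) (at 0)"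
    using X unfolding pder_iff_tendsto by (simp add: e_def x_def)
  have e0: "(e \<longlongrightarrow> 0) (at 0)"
  proof -
    have "((\<lambda>t. t *\<^sub>R ((1 / t) *\<^sub>R e t)) \<longlongrightarrow> 0 *\<^sub>R D) (at 0)"
      by (intro tendsto_scaleR q tendsto_ident_at)
    then have "((\<lambda>t. t *\<^sub>R ((1 / t) *\<^sub>R e t)) \<longlongrightarrow> 0) (at 0)" by simp
    moreover have "\<forall>\<^sub>F t in at 0. t *\<^sub>R ((1 / t) *\<^sub>R e t) = e t"
      by (auto simp: eventually_at_filter)
    ultimately show ?thesis using tendsto_cong by fast
  qed
  have xlim: "(x \<longlongrightarrow> x 0) (at 0)"
    using tendsto_add[OF e0 tendsto_const[of "x 0"]] by (simp add: e_def)
  have c: "continuous (at 0) (\<lambda>t::real. \<xi> + t *\<^sub>R axis i 1)" by (intro continuous_intros)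
  have "\<forall>\<^sub>F t in at (0::real). \<xi> + t *\<^sub>R axis i 1 \<in> U"
    using c U unfolding continuous_at by (auto dest!: topological_tendstoD)
  then have yb: "\<forall>\<^sub>F t in at (0::real). norm (y t) \<le> C"
    by eventually_elim (use Y in \<open>auto simp: y_def x_def\<close>)
  have C: "0 \<le> C" using Y[OF U(2)] norm_ge_zero order.trans by blast
  have ylim: "(y \<longlongrightarrow> Z) (at 0)"
  proof -
    define b where "b t = C * norm (e t) * norm Z + C * C * norm (e t) * norm (id_blinfun - x 0 o\<^sub>L Z)
        + (1 + C * norm (x t)) * norm (e t) * norm Z * norm Z" for t
    have "(b \<longlongrightarrow> C * 0 * norm Z + C * C * 0 * norm (id_blinfun - x 0 o\<^sub>L Z)
        + (1 + C * norm (x 0)) * 0 * norm Z * norm Z) (at 0)"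
      unfolding b_def
      by (intro tendsto_add tendsto_mult tendsto_const tendsto_norm_zero[OF e0] tendsto_norm[OF xlim])
    then have b0: "(b \<longlongrightarrow> 0) (at 0)" by simp
    have "\<forall>\<^sub>F t in at 0. norm (y t - Z) \<le> b t"
      using yb
    proof eventually_elim
      case (elim t)
      have comp: "norm (F o\<^sub>L G) \<le> f * g" if "norm F \<le> f" "norm G \<le> g" "0 \<le> f"
        for F :: "'e::real_normed_vector \<Rightarrow>\<^sub>L 'f::real_normed_vector" and G :: "'g::real_normed_vector \<Rightarrow>\<^sub>L 'e" and f g
        by (rule order.trans[OF norm_blinfun_compose mult_mono[OF that(1,2,3) norm_ge_zero]])
      have 1: "norm (y t o\<^sub>L e t o\<^sub>L Z) \<le> C * norm (e t) * norm Z"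
        using C elim by (intro comp) auto
      have 2: "norm (y t o\<^sub>L adj (y t) o\<^sub>L adj (e t) o\<^sub>L (id_blinfun - x 0 o\<^sub>L Z)) \<le> C * C * norm (e t) * norm (id_blinfun - x 0 o\<^sub>L Z)"
        using C elim by (intro comp norm_adj_le order.trans[OF norm_adj_le elim]) auto
      have "norm (id_blinfun - y t o\<^sub>L x t) \<le> 1 + norm (y t) * norm (x t)"
        unfolding y_def by (rule norm_compose_id_minus)
      also have "\<dots> \<le> 1 + C * norm (x t)" using elim by (intro add_left_mono mult_right_mono) auto
      finally have "norm ((id_blinfun - y t o\<^sub>L x t) o\<^sub>L adj (e t) o\<^sub>L adj Z o\<^sub>L Z) \<le> (1 + C * norm (x t)) * norm (e t) * norm Z * norm Z"
        using C by (intro comp norm_adj_le) auto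
      then show ?case unfolding diff b_def using 1 2
        by (intro order.trans[OF norm_triangle_ineq] add_mono) auto
    qed
    then have "((\<lambda>t. y t - Z) \<longlongrightarrow> 0) (at 0)" using b0 by (rule Lim_null_comparison)
    then show ?thesis by (simp add: LIM_zero_iff)
  qed
  define w where "w t = (1 / t) *\<^sub>R e t" for t
  have sc: "c *\<^sub>R (F o\<^sub>L G) = F o\<^sub>L (c *\<^sub>R G)" "c *\<^sub>R (F o\<^sub>L G) = (c *\<^sub>R F) o\<^sub>L G" "c *\<^sub>R adj H = adj (c *\<^sub>R H)"
    for c and F :: "'e::real_normed_vector \<Rightarrow>\<^sub>L 'f::real_normed_vector" and G :: "'g::real_normed_vector \<Rightarrow>\<^sub>L 'e"
      and H :: "'h::euclidean_space \<Rightarrow>\<^sub>L 'i::euclidean_space"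
    by (simp_all add: bounded_bilinear.scaleR_left[OF bounded_bilinear_blinfun_compose]
        bounded_bilinear.scaleR_right[OF bounded_bilinear_blinfun_compose] linear_cmul[OF linear_adj])
  have "(1 / t) *\<^sub>R (y t - Z) = - (y t o\<^sub>L w t o\<^sub>L Z) + y t o\<^sub>L adj (y t) o\<^sub>L adj (w t) o\<^sub>L (id_blinfun - x 0 o\<^sub>L Z)
     + (id_blinfun - y t o\<^sub>L x t) o\<^sub>L adj (w t) o\<^sub>L adj Z o\<^sub>L Z" for t
    unfolding diff w_def by (simp add: scaleR_add_right scaleR_diff_right bounded_bilinear.scaleR_left[OF bounded_bilinear_blinfun_compose]
        bounded_bilinear.scaleR_right[OF bounded_bilinear_blinfun_compose] linear_cmul[OF linear_adj])
  moreover have "((\<lambda>t. - (y t o\<^sub>L w t o\<^sub>L Z) + y t o\<^sub>L adj (y t) o\<^sub>L adj (w t) o\<^sub>L (id_blinfun - x 0 o\<^sub>L Z)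
     + (id_blinfun - y t o\<^sub>L x t) o\<^sub>L adj (w t) o\<^sub>L adj Z o\<^sub>L Z) \<longlongrightarrow>
     - (Z o\<^sub>L D o\<^sub>L Z) + Z o\<^sub>L adj Z o\<^sub>L adj D o\<^sub>L (id_blinfun - x 0 o\<^sub>L Z)
     + (id_blinfun - Z o\<^sub>L x 0) o\<^sub>L adj D o\<^sub>L adj Z o\<^sub>L Z) (at 0)"
    using q[folded w_def] ylim xlim
    by (intro tendsto_add tendsto_minus tendsto_blinfun_compose tendsto_adj tendsto_diff tendsto_const)
  ultimately show ?thesis
    unfolding pder_iff_tendsto y0(2)[symmetric] by (simp add: y_def[symmetric] x_def[symmetric] y0(1))
qed

lemma penrose_sym: "penrose X Y \<Longrightarrow> penrose Y X"
  by (simp add: penrose_def)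

lemma norm_pinv_compose_le: "norm (pinv X (X v)) \<le> norm v"
  for X :: "'a::euclidean_space \<Rightarrow>\<^sub>L 'b::euclidean_space"
  using norm_compose_pinv_le[of "pinv X" v] pinv_eqI[OF penrose_sym[OF penrose_pinv[of X]]] by simp

text \<open>
  Leibniz' rule alone would leave terms with two inverses. But \<open>X\<close> annihilates \<open>1 - Z X\<close>, is
  annihilated by \<open>1 - X Z\<close>, and absorbs a factor \<open>Z\<close> next to the adjoint of \<open>Z\<close>, so a single inverse is left in each term.
\<close>

lemma
  fixes X :: "real ^ 'd::finite \<Rightarrow> 'a::euclidean_space \<Rightarrow>\<^sub>L 'b::euclidean_space"
  assumes X: "pder i X \<xi> D" and Y: "pder i (\<lambda>\<eta>. pinv (X \<eta>)) \<xi> (- (Z o\<^sub>L D o\<^sub>L Z) + Z o\<^sub>L adj Z o\<^sub>L adj D o\<^sub>L (id_blinfun - X \<xi> o\<^sub>L Z)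
     + (id_blinfun - Z o\<^sub>L X \<xi>) o\<^sub>L adj D o\<^sub>L adj Z o\<^sub>L Z)" and Z: "Z = pinv (X \<xi>)"
  shows pder_compose_pinv: "pder i (\<lambda>\<eta>. X \<eta> o\<^sub>L pinv (X \<eta>)) \<xi>
      ((id_blinfun - X \<xi> o\<^sub>L Z) o\<^sub>L D o\<^sub>L Z + adj Z o\<^sub>L adj D o\<^sub>L (id_blinfun - X \<xi> o\<^sub>L Z))"
    and pder_pinv_compose: "pder i (\<lambda>\<eta>. pinv (X \<eta>) o\<^sub>L X \<eta>) \<xi>
      (Z o\<^sub>L D o\<^sub>L (id_blinfun - Z o\<^sub>L X \<xi>) + (id_blinfun - Z o\<^sub>L X \<xi>) o\<^sub>L adj D o\<^sub>L adj Z)"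
proof -
  define DY where "DY = - (Z o\<^sub>L D o\<^sub>L Z) + Z o\<^sub>L adj Z o\<^sub>L adj D o\<^sub>L (id_blinfun - X \<xi> o\<^sub>L Z)
     + (id_blinfun - Z o\<^sub>L X \<xi>) o\<^sub>L adj D o\<^sub>L adj Z o\<^sub>L Z"
  have pen: "penrose (X \<xi>) Z" by (simp add: Z penrose_pinv)
  note P = penroseD[OF pen]
  note Q = penroseD[OF penrose_sym[OF pen]]
  have 1: "X \<xi> (Z (adj Z u)) = adj Z u" for u
    using Q(4)[of "adj Z u"] Q(5)[of u] by simp
  have 2: "adj Z (Z (X \<xi> v)) = adj Z v" for v
    by (rule Q(6))
  have "pder i (\<lambda>\<eta>. X \<eta> o\<^sub>L pinv (X \<eta>)) \<xi> (X \<xi> o\<^sub>L DY + D o\<^sub>L Z)"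
    using bounded_bilinear.has_vector_derivative[OF bounded_bilinear_blinfun_compose X[unfolded pder_def] Y[unfolded pder_def]]
    by (simp add: pder_def DY_def Z)
  also have "X \<xi> o\<^sub>L DY + D o\<^sub>L Z = (id_blinfun - X \<xi> o\<^sub>L Z) o\<^sub>L D o\<^sub>L Z + adj Z o\<^sub>L adj D o\<^sub>L (id_blinfun - X \<xi> o\<^sub>L Z)"
    by (rule blinfun_eqI) (simp add: DY_def blinfun.bilinear_simps P 1)
  finally show "pder i (\<lambda>\<eta>. X \<eta> o\<^sub>L pinv (X \<eta>)) \<xi>
      ((id_blinfun - X \<xi> o\<^sub>L Z) o\<^sub>L D o\<^sub>L Z + adj Z o\<^sub>L adj D o\<^sub>L (id_blinfun - X \<xi> o\<^sub>L Z))" .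
  have "pder i (\<lambda>\<eta>. pinv (X \<eta>) o\<^sub>L X \<eta>) \<xi> (Z o\<^sub>L D + DY o\<^sub>L X \<xi>)"
    using bounded_bilinear.has_vector_derivative[OF bounded_bilinear_blinfun_compose Y[unfolded pder_def] X[unfolded pder_def]]
    by (simp add: pder_def DY_def Z)
  also have "Z o\<^sub>L D + DY o\<^sub>L X \<xi> = Z o\<^sub>L D o\<^sub>L (id_blinfun - Z o\<^sub>L X \<xi>) + (id_blinfun - Z o\<^sub>L X \<xi>) o\<^sub>L adj D o\<^sub>L adj Z"
    by (rule blinfun_eqI) (simp add: DY_def blinfun.bilinear_simps P(1) 2)
  finally show "pder i (\<lambda>\<eta>. pinv (X \<eta>) o\<^sub>L X \<eta>) \<xi>
      (Z o\<^sub>L D o\<^sub>L (id_blinfun - Z o\<^sub>L X \<xi>) + (id_blinfun - Z o\<^sub>L X \<xi>) o\<^sub>L adj D o\<^sub>L adj Z)" .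
qed

text \<open>
  The three classes have to be treated together: the derivative of the inverse is a polynomial in the
  derivative of \<open>X\<close>, the inverse (twice) and the projections \<open>X Y\<close>, \<open>Y X\<close>, whose derivatives in turn contain the
  inverse once. A direct application of Leibniz' rule to \<open>X Y\<close> would give weight \<open>1\<close> instead of \<open>0\<close> and hence too
  many weights after several derivatives.
\<close>

lemma wsym_pinv:
  fixes X :: "'p \<Rightarrow> real ^ 'd::finite \<Rightarrow> 'a::euclidean_space \<Rightarrow>\<^sub>L 'b::euclidean_space"
  assumes U: "open U" and X: "wsym I (\<lambda>_. 1) U n 0 X" and K: "\<And>p. p \<in> I \<Longrightarrow> 1 \<le> K p"
    and bnd: "\<And>p \<xi>. p \<in> I \<Longrightarrow> \<xi> \<in> U \<Longrightarrow> norm (pinv (X p \<xi>)) \<le> C * K p"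
  shows "wsym I K U n 1 (\<lambda>p \<xi>. pinv (X p \<xi>)) \<and> wsym I K U n 0 (\<lambda>p \<xi>. X p \<xi> o\<^sub>L pinv (X p \<xi>))
    \<and> wsym I K U n 0 (\<lambda>p \<xi>. pinv (X p \<xi>) o\<^sub>L X p \<xi>)"
  using X
proof (induction n)
  define Y where "Y p \<xi> = pinv (X p \<xi>)" for p \<xi>
  define R where "R p \<xi> = X p \<xi> o\<^sub>L pinv (X p \<xi>)" for p \<xi>
  define L where "L p \<xi> = pinv (X p \<xi>) o\<^sub>L X p \<xi>" for p \<xi>
  have b1: "\<exists>C. \<forall>p\<in>I. \<forall>\<xi>\<in>U. norm (Y p \<xi>) \<le> C * K p ^ 1" using bnd by (auto intro!: exI[of _ C] simp: Y_def)
  have "norm (R p \<xi>) \<le> 1" "norm (L p \<xi>) \<le> 1" for p \<xi>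
    by (auto intro!: norm_blinfun_bound simp: R_def L_def norm_compose_pinv_le norm_pinv_compose_le)
  then have b2: "\<exists>C. \<forall>p\<in>I. \<forall>\<xi>\<in>U. norm (R p \<xi>) \<le> C * K p ^ 0"
    and b3: "\<exists>C. \<forall>p\<in>I. \<forall>\<xi>\<in>U. norm (L p \<xi>) \<le> C * K p ^ 0" by (auto intro!: exI[of _ 1])
  {
    case 0
    then show ?case using b1 b2 b3 by (simp add: Y_def R_def L_def)
  next
    case (Suc n)
    note X = Suc.prems
    have K0: "\<And>p. p \<in> I \<Longrightarrow> 0 \<le> K p" using K order.trans[OF zero_le_one] by blast
    have wY: "wsym I K U n 1 Y" and wR: "wsym I K U n 0 R" and wL: "wsym I K U n 0 L"
      using Suc.IH[OF wsym_Suc_D[OF X]] by (simp_all add: Y_def[abs_def] R_def[abs_def] L_def[abs_def])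
    have id: "wsym I K U n 0 (\<lambda>_ _. id_blinfun :: 'c::euclidean_space \<Rightarrow>\<^sub>L 'c)"
      by (rule wsym_const[where C = 1]) (auto intro!: norm_blinfun_bound)
    note c = wsym_bilinear[OF bounded_bilinear_blinfun_compose _ _ K0]
    note a = wsym_linear[OF bounded_linear_adj _ K0]
    have R': "wsym I K U n 0 (\<lambda>p \<xi>. id_blinfun - R p \<xi>)" by (rule wsym_diff[OF id wR K0])
    have L': "wsym I K U n 0 (\<lambda>p \<xi>. id_blinfun - L p \<xi>)" by (rule wsym_diff[OF id wL K0])
    have "\<exists>D. (\<forall>p\<in>I. \<forall>\<xi>\<in>U. pder i (X p) \<xi> (D p \<xi>)) \<and> wsym I K U n 0 D" for i
    proof -
      from wsym_deriv[OF X, of i] obtain D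
        where D: "\<forall>p\<in>I. \<forall>\<xi>\<in>U. pder i (X p) \<xi> (D p \<xi>)" "wsym I (\<lambda>_. 1) U n (Suc 0) D" by blast
      show ?thesis by (rule exI[of _ D], rule conjI[OF D(1) wsym_unweighted[OF D(2) K]])
    qed
    then have ex: "\<forall>i. \<exists>D. (\<forall>p\<in>I. \<forall>\<xi>\<in>U. pder i (X p) \<xi> (D p \<xi>)) \<and> wsym I K U n 0 D" ..
    obtain D where "\<forall>i. (\<forall>p\<in>I. \<forall>\<xi>\<in>U. pder i (X p) \<xi> (D i p \<xi>)) \<and> wsym I K U n 0 (D i)"
      using choice[OF ex] by (elim exE)
    then have D: "\<And>i p \<xi>. p \<in> I \<Longrightarrow> \<xi> \<in> U \<Longrightarrow> pder i (X p) \<xi> (D i p \<xi>)"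
      and wD: "\<And>i. wsym I K U n 0 (D i)" by simp_all
    have pY: "pder i (Y p) \<xi> (- (Y p \<xi> o\<^sub>L D i p \<xi> o\<^sub>L Y p \<xi>) + Y p \<xi> o\<^sub>L adj (Y p \<xi>) o\<^sub>L adj (D i p \<xi>) o\<^sub>L (id_blinfun - R p \<xi>)
     + (id_blinfun - L p \<xi>) o\<^sub>L adj (D i p \<xi>) o\<^sub>L adj (Y p \<xi>) o\<^sub>L Y p \<xi>)" if "p \<in> I" "\<xi> \<in> U" for i p \<xi>
      using pder_pinv[OF U that(2) D[OF that] bnd[OF that(1)]] by (simp add: Y_def[abs_def] R_def L_def)
    have pR: "pder i (R p) \<xi> ((id_blinfun - R p \<xi>) o\<^sub>L D i p \<xi> o\<^sub>L Y p \<xi> + adj (Y p \<xi>) o\<^sub>L adj (D i p \<xi>) o\<^sub>L (id_blinfun - R p \<xi>))"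
      if "p \<in> I" "\<xi> \<in> U" for i p \<xi>
      using pder_compose_pinv[OF D[OF that] pder_pinv[OF U that(2) D[OF that] bnd[OF that(1)]] refl]
      by (simp add: Y_def R_def[abs_def])
    have pL: "pder i (L p) \<xi> (Y p \<xi> o\<^sub>L D i p \<xi> o\<^sub>L (id_blinfun - L p \<xi>) + (id_blinfun - L p \<xi>) o\<^sub>L adj (D i p \<xi>) o\<^sub>L adj (Y p \<xi>))"
      if "p \<in> I" "\<xi> \<in> U" for i p \<xi>
      using pder_pinv_compose[OF D[OF that] pder_pinv[OF U that(2) D[OF that] bnd[OF that(1)]] refl]
      by (simp add: Y_def L_def[abs_def])
    have wYD: "wsym I K U n 2 (\<lambda>p \<xi>. - (Y p \<xi> o\<^sub>L D i p \<xi> o\<^sub>L Y p \<xi>) + Y p \<xi> o\<^sub>L adj (Y p \<xi>) o\<^sub>L adj (D i p \<xi>) o\<^sub>L (id_blinfun - R p \<xi>)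
     + (id_blinfun - L p \<xi>) o\<^sub>L adj (D i p \<xi>) o\<^sub>L adj (Y p \<xi>) o\<^sub>L Y p \<xi>)" for i
    proof (intro wsym_add wsym_minus K0)
      show "wsym I K U n 2 (\<lambda>p \<xi>. Y p \<xi> o\<^sub>L D i p \<xi> o\<^sub>L Y p \<xi>)"
        using c[OF c[OF wY wD] wY] by (simp add: numeral_2_eq_2)
      show "wsym I K U n 2 (\<lambda>p \<xi>. Y p \<xi> o\<^sub>L adj (Y p \<xi>) o\<^sub>L adj (D i p \<xi>) o\<^sub>L (id_blinfun - R p \<xi>))"
        using c[OF c[OF c[OF wY a[OF wY]] a[OF wD]] R'] by (simp add: numeral_2_eq_2)
      show "wsym I K U n 2 (\<lambda>p \<xi>. (id_blinfun - L p \<xi>) o\<^sub>L adj (D i p \<xi>) o\<^sub>L adj (Y p \<xi>) o\<^sub>L Y p \<xi>)"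
        using c[OF c[OF c[OF L' a[OF wD]] a[OF wY]] wY] by (simp add: numeral_2_eq_2)
    qed
    have wRD: "wsym I K U n 1 (\<lambda>p \<xi>. (id_blinfun - R p \<xi>) o\<^sub>L D i p \<xi> o\<^sub>L Y p \<xi> + adj (Y p \<xi>) o\<^sub>L adj (D i p \<xi>) o\<^sub>L (id_blinfun - R p \<xi>))" for i
    proof (intro wsym_add)
      show "wsym I K U n 1 (\<lambda>p \<xi>. (id_blinfun - R p \<xi>) o\<^sub>L D i p \<xi> o\<^sub>L Y p \<xi>)"
        using c[OF c[OF R' wD] wY] by simp
      show "wsym I K U n 1 (\<lambda>p \<xi>. adj (Y p \<xi>) o\<^sub>L adj (D i p \<xi>) o\<^sub>L (id_blinfun - R p \<xi>))"
        using c[OF c[OF a[OF wY] a[OF wD]] R'] by simp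
    qed
    have wLD: "wsym I K U n 1 (\<lambda>p \<xi>. Y p \<xi> o\<^sub>L D i p \<xi> o\<^sub>L (id_blinfun - L p \<xi>) + (id_blinfun - L p \<xi>) o\<^sub>L adj (D i p \<xi>) o\<^sub>L adj (Y p \<xi>))" for i
    proof (intro wsym_add)
      show "wsym I K U n 1 (\<lambda>p \<xi>. Y p \<xi> o\<^sub>L D i p \<xi> o\<^sub>L (id_blinfun - L p \<xi>))"
        using c[OF c[OF wY wD] L'] by simp
      show "wsym I K U n 1 (\<lambda>p \<xi>. (id_blinfun - L p \<xi>) o\<^sub>L adj (D i p \<xi>) o\<^sub>L adj (Y p \<xi>))"
        using c[OF c[OF L' a[OF wD]] a[OF wY]] by simp
    qed
    have "wsym I K U (Suc n) 1 Y"
    proof (rule wsym_SucI[OF b1])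
      show "\<exists>G. (\<forall>p\<in>I. \<forall>\<xi>\<in>U. pder i (Y p) \<xi> (G p \<xi>)) \<and> wsym I K U n (Suc 1) G" for i
        by (rule exI, rule conjI[OF _ wYD[of i, unfolded Suc_1[symmetric]]]) (use pY in blast)
    qed
    moreover have "wsym I K U (Suc n) 0 R"
    proof (rule wsym_SucI[OF b2])
      show "\<exists>G. (\<forall>p\<in>I. \<forall>\<xi>\<in>U. pder i (R p) \<xi> (G p \<xi>)) \<and> wsym I K U n (Suc 0) G" for i
        by (rule exI, rule conjI[OF _ wRD[of i, unfolded One_nat_def]]) (use pR in blast)
    qed
    moreover have "wsym I K U (Suc n) 0 L"
    proof (rule wsym_SucI[OF b3])
      show "\<exists>G. (\<forall>p\<in>I. \<forall>\<xi>\<in>U. pder i (L p) \<xi> (G p \<xi>)) \<and> wsym I K U n (Suc 0) G" for i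
        by (rule exI, rule conjI[OF _ wLD[of i, unfolded One_nat_def]]) (use pL in blast)
    qed
    ultimately show ?case by (simp add: Y_def[abs_def] R_def[abs_def] L_def[abs_def])
  }
qed

section \<open>Bounds from constant rank\<close>

text \<open>
  On the complement of the kernel of \<open>X0\<close> a small perturbation remains bounded below. Since the ranks agree,
  the perturbed operator attains its whole range on this complement, and vectors orthogonal to its own kernel are
  the shortest preimages.
\<close>

lemma pinv_bound_near:
  fixes X X0 :: "'a::euclidean_space \<Rightarrow>\<^sub>L 'b::euclidean_space"
  assumes rank: "dim (range (blinfun_apply X)) = dim (range (blinfun_apply X0))"
    and near: "norm (X - X0) \<le> 1 / (2 * (norm (pinv X0) + 1))"
  shows "norm (pinv X) \<le> 2 * (norm (pinv X0) + 1)"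
proof -
  define K where "K = norm (pinv X0) + 1"
  have K: "K > 0" by (simp add: K_def add_nonneg_pos)
  define Z where "Z = {v. \<forall>n. X0 n = 0 \<longrightarrow> v \<bullet> n = 0}"
  have subZ: "subspace Z"
    unfolding Z_def subspace_def by (auto simp: inner_add_left)
  have lower: "norm v \<le> 2 * K * norm (X v)" if "v \<in> Z" for v
  proof -
    have "pinv X0 (X0 v) = v" using that by (intro pinv_left_inverse) (auto simp: Z_def)
    then have "norm v \<le> norm (pinv X0) * norm (X0 v)" using norm_blinfun[of "pinv X0" "X0 v"] by simp
    also have "\<dots> \<le> K * norm (X0 v)" by (intro mult_right_mono) (auto simp: K_def)
    finally have 1: "norm v \<le> K * norm (X0 v)" .
    have "X0 v = X v - (X - X0) v" by (simp add: blinfun.diff_left)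
    then have "norm (X0 v) \<le> norm (X v) + norm ((X - X0) v)" by (metis norm_triangle_ineq4)
    also have "norm ((X - X0) v) \<le> norm (X - X0) * norm v" by (rule norm_blinfun)
    also have "\<dots> \<le> 1 / (2 * K) * norm v" using near by (intro mult_right_mono) (auto simp: K_def)
    finally have "K * norm (X0 v) \<le> K * (norm (X v) + 1 / (2 * K) * norm v)" using K by (intro mult_left_mono) auto
    also have "\<dots> = K * norm (X v) + norm v / 2" using K by (simp add: field_simps)
    finally show ?thesis using 1 by simp
  qed
  have inj: "inj_on (blinfun_apply X) Z"
  proof (rule inj_onI)
    fix u v assume uv: "u \<in> Z" "v \<in> Z" "X u = X v"
    then have "u - v \<in> Z" using subZ by (simp add: subspace_diff)
    from lower[OF this] uv(3) show "u = v" by (simp add: blinfun.diff_right)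
  qed
  have inj0: "inj_on (blinfun_apply X0) Z"
  proof (rule inj_onI)
    fix u v assume uv: "u \<in> Z" "v \<in> Z" "X0 u = X0 v"
    have "pinv X0 (X0 u) = u" by (rule pinv_left_inverse) (use uv(1) in \<open>simp add: Z_def\<close>)
    moreover have "pinv X0 (X0 v) = v" by (rule pinv_left_inverse) (use uv(2) in \<open>simp add: Z_def\<close>)
    ultimately show "u = v" using uv(3) by metis
  qed
  have spanZ: "span Z = Z" using subZ by (simp add: span_eq_iff)
  have "range (blinfun_apply X0) = X0 ` Z"
  proof
    show "range (blinfun_apply X0) \<subseteq> X0 ` Z"
    proof
      fix y assume "y \<in> range (blinfun_apply X0)"
      then obtain v where v: "y = X0 v" by auto
      have "pinv X0 (X0 v) \<in> Z" by (simp add: Z_def pinv_orthogonal_kernel)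
      then show "y \<in> X0 ` Z" using v pinv_simps(1)[of X0 v] by (metis image_eqI)
    qed
  qed auto
  then have "dim (range (blinfun_apply X0)) = dim Z"
    using dim_image_eq[OF linear_blinfun_apply, of X0 Z] inj0 by (simp add: spanZ)
  moreover have "dim (X ` Z) = dim Z"
    using dim_image_eq[OF linear_blinfun_apply, of X Z] inj by (simp add: spanZ)
  ultimately have d: "dim (X ` Z) = dim (range (blinfun_apply X))" using rank by simp
  have range: "X ` Z = range (blinfun_apply X)"
  proof (rule subspace_dim_equal)
    show "subspace (X ` Z)" "subspace (range (blinfun_apply X))"
      using subZ by (auto intro: linear_subspace_image[OF linear_blinfun_apply])
  qed (use d in auto)
  have "norm (pinv X) \<le> 1 / (1 / (2 * K))"
  proof (rule norm_pinv_le)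
    fix v assume v: "\<And>n. X n = 0 \<Longrightarrow> v \<bullet> n = 0"
    have "X v \<in> X ` Z" unfolding range by (rule rangeI)
    then obtain w where w: "w \<in> Z" "X w = X v" by (metis (no_types, lifting) imageE)
    have "v \<bullet> (w - v) = 0" using w(2) by (intro v) (simp add: blinfun.diff_right)
    then have "v \<bullet> v = v \<bullet> w" by (simp add: inner_diff_right)
    then have "norm v * norm v \<le> norm v * norm w"
      using norm_cauchy_schwarz[of v w] by (simp add: power2_norm_eq_inner flip: power2_eq_square)
    then have "norm v \<le> norm w" by (cases "v = 0") auto
    also have "\<dots> \<le> 2 * K * norm (X v)" using lower[OF w(1)] w(2) by simp
    finally show "1 / (2 * K) * norm v \<le> norm (X v)" using K by (simp add: field_simps)
  qed (use K in auto)
  then show ?thesis by (simp add: K_def)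
qed

lemma pinv_bounded_constant_rank:
  fixes X :: "'p::metric_space \<Rightarrow> 'a::euclidean_space \<Rightarrow>\<^sub>L 'b::euclidean_space"
  assumes "compact S" "continuous_on S X" "\<And>x. x \<in> S \<Longrightarrow> dim (range (blinfun_apply (X x))) = r"
  shows "\<exists>C. \<forall>x\<in>S. norm (pinv (X x)) \<le> C"
proof -
  define K where "K x = norm (pinv (X x)) + 1" for x
  have K: "K x > 0" for x by (simp add: K_def add_nonneg_pos)
  have "\<exists>d>0. \<forall>y\<in>S. dist y x < d \<longrightarrow> dist (X y) (X x) < 1 / (2 * K x)" if "x \<in> S" for x
    using assms(2) that K[of x] unfolding continuous_on_iff by (auto dest!: bspec[of S _ x])
  then obtain d where d: "\<And>x. x \<in> S \<Longrightarrow> d x > 0"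
    "\<And>x y. x \<in> S \<Longrightarrow> y \<in> S \<Longrightarrow> dist y x < d x \<Longrightarrow> dist (X y) (X x) < 1 / (2 * K x)" by metis
  obtain T where T: "T \<subseteq> S" "finite T" "S \<subseteq> (\<Union>x\<in>T. ball x (d x))"
    by (rule compactE_image[OF assms(1), of S "\<lambda>x. ball x (d x)"]) (use d(1) in force)+
  have "norm (pinv (X y)) \<le> (\<Sum>x\<in>T. 2 * K x)" if y: "y \<in> S" for y
  proof -
    from T(3) y obtain x where x: "x \<in> T" "dist y x < d x" by (auto simp: dist_commute)
    then have xS: "x \<in> S" using T(1) by auto
    have "norm (X y - X x) \<le> 1 / (2 * (norm (pinv (X x)) + 1))"
      using d(2)[OF xS y x(2)] by (simp add: dist_norm K_def)
    then have "norm (pinv (X y)) \<le> 2 * K x"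
      unfolding K_def by (intro pinv_bound_near) (use assms(3) xS y in auto)
    also have "\<dots> \<le> (\<Sum>x\<in>T. 2 * K x)"
      using x(1) T(2) K by (intro member_le_sum) (auto simp: less_imp_le)
    finally show ?thesis .
  qed
  then show ?thesis by blast
qed

section \<open>Orthogonal projections\<close>

lemma perp_exists:
  fixes V :: "'a::euclidean_space set"
  assumes "subspace V"
  shows "\<exists>P :: 'a \<Rightarrow>\<^sub>L 'a. \<forall>x. x - P x \<in> V \<and> (\<forall>v\<in>V. P x \<bullet> v = 0)"
proof -
  define R where "R x z \<longleftrightarrow> x - z \<in> V \<and> (\<forall>v\<in>V. z \<bullet> v = 0)" for x z
  have ex: "\<exists>z. R x z" for x
  proof -
    obtain y z where "y \<in> span V" "\<And>w. w \<in> span V \<Longrightarrow> orthogonal z w" "x = y + z"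
      using orthogonal_subspace_decomp_exists by blast
    moreover have "span V = V" using assms by (simp add: span_eq_iff)
    ultimately have "R x z" by (auto simp: R_def orthogonal_def)
    then show ?thesis ..
  qed
  have uniq: "z = z'" if "R x z" "R x z'" for x z z'
  proof -
    have "(x - z') - (x - z) \<in> V" by (rule subspace_diff[OF assms]) (use that in \<open>simp_all add: R_def\<close>)
    then have "z - z' \<in> V" by simp
    then have "(z - z') \<bullet> (z - z') = 0" using that by (simp add: R_def inner_diff_left)
    then show ?thesis by simp
  qed
  define g where "g x = (SOME z. R x z)" for x
  have g: "R x (g x)" for x unfolding g_def using ex by (rule someI_ex)
  have gu: "R x z \<Longrightarrow> g x = z" for x z using g uniq by blast
  have "linear g"
  proof (rule linearI)
    fix x y r
    have "(x - g x) + (y - g y) \<in> V" "r *\<^sub>R (x - g x) \<in> V"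
      using g[of x] g[of y] assms by (auto simp: R_def intro: subspace_add subspace_scale)
    then have "R (x + y) (g x + g y)" "R (r *\<^sub>R x) (r *\<^sub>R g x)"
      using g[of x] g[of y] by (auto simp: R_def inner_add_left algebra_simps)
    then show "g (x + y) = g x + g y" "g (r *\<^sub>R x) = r *\<^sub>R g x" by (auto intro: gu)
  qed
  then have "bounded_linear g" by (simp add: linear_conv_bounded_linear)
  then have "blinfun_apply (Blinfun g) = g" by (rule bounded_linear_Blinfun_apply)
  then show ?thesis using g unfolding R_def by (intro exI[of _ "Blinfun g"]) simp
qed

definition perp :: "'a::euclidean_space set \<Rightarrow> 'a \<Rightarrow>\<^sub>L 'a" where
  "perp V = (SOME P. \<forall>x. x - blinfun_apply P x \<in> V \<and> (\<forall>v\<in>V. P x \<bullet> v = 0))"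

lemma perp:
  assumes "subspace V"
  shows "x - perp V x \<in> V" "v \<in> V \<Longrightarrow> perp V x \<bullet> v = 0"
  using someI_ex[OF perp_exists[OF assms]] unfolding perp_def by blast+

text \<open>
  By Cauchy--Schwarz, as \<open>perp V x\<close> is orthogonal to \<open>V\<close> and differs from \<open>x - v\<close> by an element of \<open>V\<close>.
\<close>

lemma infdist_eq_norm_perp:
  assumes "subspace V" shows "infdist x V = norm (perp V x)"
proof (rule antisym)
  have "infdist x V \<le> dist x (x - perp V x)" by (rule infdist_le[OF perp(1)[OF assms]])
  then show "infdist x V \<le> norm (perp V x)" by (simp add: dist_norm)
  have "V \<noteq> {}" using subspace_0[OF assms] by auto
  then show "norm (perp V x) \<le> infdist x V"
    unfolding infdist_notempty[OF \<open>V \<noteq> {}\<close>]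
  proof (rule cINF_greatest)
    fix v assume v: "v \<in> V"
    have "(x - perp V x) - v \<in> V" by (rule subspace_diff[OF assms perp(1)[OF assms] v])
    then have "perp V x \<bullet> ((x - perp V x) - v) = 0" by (rule perp(2)[OF assms])
    then have "norm (perp V x) * norm (perp V x) = perp V x \<bullet> (x - v)"
      by (simp add: power2_norm_eq_inner inner_diff_right flip: power2_eq_square)
    also have "\<dots> \<le> norm (perp V x) * norm (x - v)" by (rule norm_cauchy_schwarz)
    finally show "norm (perp V x) \<le> dist x v"
      by (cases "norm (perp V x) = 0") (auto simp: dist_norm mult_le_cancel_left)
  qed
qed

lemma norm_perp_le: "subspace V \<Longrightarrow> norm (perp V) \<le> 1"
proof (rule norm_blinfun_bound)
  fix x assume V: "subspace V"
  have "norm (perp V x) \<le> dist x 0"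
    unfolding infdist_eq_norm_perp[OF V, symmetric] by (rule infdist_le[OF subspace_0[OF V]])
  then show "norm (perp V x) \<le> 1 * norm x" by simp
qed simp

section \<open>The symbol and the wave cone\<close>

lemma symbol_scaleR: "symbol A k (c *\<^sub>R \<xi>) = c ^ k *\<^sub>R symbol A k \<xi>"
proof -
  have "(\<Prod>i\<in>UNIV. (c * \<xi> $ i) ^ \<gamma> i) = c ^ k * (\<Prod>i\<in>UNIV. (\<xi> $ i) ^ \<gamma> i)" if "\<gamma> \<in> multi_indices k" for \<gamma>
  proof -
    have "(\<Prod>i\<in>UNIV. (c * \<xi> $ i) ^ \<gamma> i) = (\<Prod>i\<in>UNIV. c ^ \<gamma> i) * (\<Prod>i\<in>UNIV. (\<xi> $ i) ^ \<gamma> i)"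
      by (simp add: power_mult_distrib prod.distrib)
    also have "(\<Prod>i\<in>UNIV. c ^ \<gamma> i) = c ^ k"
      using that by (simp add: multi_indices_def flip: power_sum)
    finally show ?thesis .
  qed
  then show ?thesis by (simp add: symbol_def scaleR_sum_right)
qed

lemma continuous_on_symbol: "continuous_on S (symbol A k)"
  unfolding symbol_def[abs_def] by (intro continuous_intros)

lemma wsym_symbol:
  fixes A :: "('d::finite \<Rightarrow> nat) \<Rightarrow> 'v::euclidean_space \<Rightarrow>\<^sub>L 'w::euclidean_space"
  assumes "bounded U"
  shows "wsym I (\<lambda>_. 1) U n 0 (\<lambda>p. symbol A k)"
proof -
  have "wsym I (\<lambda>_. 1) U n (0 + 0) (\<lambda>p \<xi>. (\<Prod>i\<in>UNIV. (\<xi> $ i) ^ \<gamma> i) *\<^sub>R A \<gamma>)" for \<gamma>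
    by (intro wsym_bilinear[OF bounded_bilinear_scaleR] wsym_prod wsym_power wsym_coordinate[OF assms]
        wsym_const[of _ _ "norm (A \<gamma>)"]) auto
  then show ?thesis
    unfolding symbol_def[abs_def] by (intro wsym_sum finite_multi_indices) auto
qed

lemma wave_coneI:
  assumes "\<xi> \<noteq> 0" "symbol A k \<xi> v = 0" shows "v \<in> wave_cone A k"
proof -
  have "symbol A k (sgn \<xi>) v = 0" using assms(2)
    by (simp add: sgn_div_norm symbol_scaleR blinfun.scaleR_left)
  moreover have "sgn \<xi> \<in> sphere 0 1" using assms(1) by (simp add: norm_sgn)
  ultimately show ?thesis unfolding wave_cone_def by blast
qed

lemma wave_cone_scaleR: "v \<in> wave_cone A k \<Longrightarrow> c *\<^sub>R v \<in> wave_cone A k"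
  by (auto simp: wave_cone_def blinfun.scaleR_right)

lemma cone_dist_le: "cone_dist V L \<le> 1" "X \<in> V \<Longrightarrow> norm X = 1 \<Longrightarrow> cone_dist V L \<le> infdist X L"
proof -
  have b: "bdd_below (insert 1 ((\<lambda>X. infdist X L) ` (V \<inter> sphere 0 1)))"
    by (rule bdd_belowI[of _ 0]) (auto simp: infdist_nonneg)
  show "cone_dist V L \<le> 1" unfolding cone_dist_def by (rule cInf_lower[OF _ b]) simp
  show "X \<in> V \<Longrightarrow> norm X = 1 \<Longrightarrow> cone_dist V L \<le> infdist X L"
    unfolding cone_dist_def by (rule cInf_lower[OF _ b]) auto
qed

text \<open>
  On the compact set of pairs of unit vectors \<open>\<xi>\<close> and \<open>X \<in> V\<close> the symbol does not vanish, so \<open>\<bar>A(\<xi>) X\<bar>\<close> is bounded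
  below; replacing \<open>X\<close> by \<open>X - Y\<close> with \<open>Y\<close> in the kernel converts this into a lower bound for the distance.
\<close>

lemma cone_dist_pos:
  fixes A :: "('d::finite \<Rightarrow> nat) \<Rightarrow> 'v::euclidean_space \<Rightarrow>\<^sub>L 'w::euclidean_space"
  assumes V: "subspace V" and disj: "V \<inter> wave_cone A k = {0}"
  shows "0 < cone_dist V (wave_cone A k)"
proof -
  define S where "S = (sphere 0 1 :: (real ^ 'd) set) \<times> (V \<inter> sphere 0 1)"
  define f where "f = (\<lambda>(\<xi>, X). norm (blinfun_apply (symbol A k \<xi>) X))"
  have cS: "compact S" unfolding S_def
    by (rule compact_Times[OF compact_sphere closed_Int_compact[OF closed_subspace[OF V] compact_sphere]])
  have cf: "continuous_on S f" unfolding f_def case_prod_beta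
    by (intro continuous_intros continuous_on_compose2[OF continuous_on_symbol[of UNIV]]) auto
  have pos: "0 < f z" if "z \<in> S" for z
  proof -
    obtain \<xi> X where z: "z = (\<xi>, X)" by (cases z)
    have z': "norm \<xi> = 1" "X \<in> V" "norm X = 1" using that by (auto simp: z S_def)
    have "symbol A k \<xi> X \<noteq> 0"
    proof
      assume "symbol A k \<xi> X = 0"
      then have "X \<in> wave_cone A k" using z'(1) by (intro wave_coneI[of \<xi>]) auto
      then have "X = 0" using disj z'(2) by blast
      then show False using z'(3) by simp
    qed
    then show ?thesis by (simp add: f_def z)
  qed
  obtain c where c: "c > 0" "\<And>z. z \<in> S \<Longrightarrow> c \<le> f z"
  proof (cases "S = {}")
    case False
    from continuous_attains_inf[OF cS False cf] pos show ?thesis using that by blast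
  qed (use that[of 1] in auto)
  have "bounded (symbol A k ` sphere 0 1)"
    by (intro compact_imp_bounded compact_continuous_image continuous_on_symbol compact_sphere)
  then obtain a where a: "a > 0" "\<And>\<xi>. norm \<xi> = 1 \<Longrightarrow> norm (symbol A k \<xi>) \<le> a"
    unfolding bounded_pos by auto
  have "min 1 (c / a) \<le> cone_dist V (wave_cone A k)"
    unfolding cone_dist_def
  proof (rule cInf_greatest)
    fix r assume "r \<in> insert 1 ((\<lambda>X. infdist X (wave_cone A k)) ` (V \<inter> sphere 0 1))"
    then consider "r = 1" | X where "X \<in> V" "norm X = 1" "r = infdist X (wave_cone A k)" by auto
    then show "min 1 (c / a) \<le> r"
    proof cases
      case 2
      have ne: "wave_cone A k \<noteq> {}" using disj by auto
      have "c / a \<le> infdist X (wave_cone A k)"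
        unfolding infdist_notempty[OF ne]
      proof (rule cINF_greatest[OF ne])
        fix Y assume "Y \<in> wave_cone A k"
        then obtain \<xi> where \<xi>: "norm \<xi> = 1" "symbol A k \<xi> Y = 0" by (auto simp: wave_cone_def)
        have "c \<le> f (\<xi>, X)" using \<xi> 2 by (intro c(2)) (auto simp: S_def)
        also have "\<dots> = norm (symbol A k \<xi> (X - Y))" by (simp add: f_def blinfun.diff_right \<xi>(2))
        also have "\<dots> \<le> norm (symbol A k \<xi>) * norm (X - Y)" by (rule norm_blinfun)
        also have "\<dots> \<le> a * dist X Y" using a(2)[OF \<xi>(1)] by (simp add: dist_norm mult_right_mono)
        finally show "c / a \<le> dist X Y" using a(1) by (simp add: field_simps)
      qed
      then show ?thesis using 2 by simp
    qed simp
  qed simp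
  moreover have "0 < min 1 (c / a)" using a c by simp
  ultimately show ?thesis by linarith
qed

text \<open>
  Compare a cone vector \<open>v\<close> with its projection \<open>w\<close> onto \<open>V\<close>: after normalising \<open>w\<close>, the cone contains the point
  \<open>v / \<bar>w\<bar>\<close> at distance \<open>\<bar>P v\<bar> / \<bar>w\<bar>\<close>. The factor \<open>2\<close> covers the case of vectors whose projection is short.
\<close>

lemma cone_dist_norm_le:
  assumes V: "subspace V" and v: "v \<in> wave_cone A k"
  shows "cone_dist V (wave_cone A k) * norm v \<le> 2 * norm (perp V v)"
proof (cases "norm v \<le> 2 * norm (perp V v)")
  case True
  have "cone_dist V (wave_cone A k) * norm v \<le> 1 * norm v"
    by (intro mult_right_mono cone_dist_le) auto
  with True show ?thesis by simp
next
  case False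
  define w where "w = v - perp V v"
  have w: "w \<in> V" unfolding w_def by (rule perp(1)[OF V])
  have nw: "norm v / 2 \<le> norm w" "0 < norm w"
    using norm_triangle_ineq2[of v "perp V v"] False by (auto simp: w_def)
  have 1: "norm ((1 / norm w) *\<^sub>R w) = 1" using nw by simp
  have "cone_dist V (wave_cone A k) \<le> infdist ((1 / norm w) *\<^sub>R w) (wave_cone A k)"
    using w V 1 by (intro cone_dist_le(2) subspace_scale) auto
  also have "\<dots> \<le> dist ((1 / norm w) *\<^sub>R w) ((1 / norm w) *\<^sub>R v)"
    by (intro infdist_le wave_cone_scaleR v)
  also have "\<dots> = norm (perp V v) / norm w"
    by (simp add: dist_norm scaleR_diff_right[symmetric] w_def del: scaleR_diff_right) 
  finally have "cone_dist V (wave_cone A k) * norm w \<le> norm (perp V v)" using nw by (simp add: field_simps)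
  moreover have "0 \<le> cone_dist V (wave_cone A k)"
    unfolding cone_dist_def by (rule cInf_greatest) (auto simp: infdist_nonneg)
  then have "cone_dist V (wave_cone A k) * (norm v / 2) \<le> cone_dist V (wave_cone A k) * norm w"
    using nw by (intro mult_left_mono) auto
  ultimately show ?thesis by simp
qed

section \<open>Recovering a kernel vector from its part orthogonal to V\<close>

text \<open>
  The orthogonal projection onto the kernel of the symbol.
\<close>

definition kernel_proj :: "(('d::finite \<Rightarrow> nat) \<Rightarrow> 'v::euclidean_space \<Rightarrow>\<^sub>L 'w::euclidean_space) \<Rightarrow> nat \<Rightarrow> real ^ 'd \<Rightarrow> 'v \<Rightarrow>\<^sub>L 'v" where
  "kernel_proj A k \<xi> = id_blinfun - pinv (symbol A k \<xi>) o\<^sub>L symbol A k \<xi>"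

text \<open>
  On the image of the kernel of the symbol under the projection along \<open>V\<close>, this operator inverts that projection;
  a Moore--Penrose inverse extends it canonically, which gives differentiability in \<open>\<xi>\<close> for free.
\<close>

definition oblique :: "(('d::finite \<Rightarrow> nat) \<Rightarrow> 'v::euclidean_space \<Rightarrow>\<^sub>L 'w::euclidean_space) \<Rightarrow> nat \<Rightarrow> 'v set \<Rightarrow> real ^ 'd \<Rightarrow> 'v \<Rightarrow>\<^sub>L 'v" where
  "oblique A k V \<xi> = pinv (perp V o\<^sub>L kernel_proj A k \<xi>)"

lemma kernel_proj:
  fixes A :: "('d::finite \<Rightarrow> nat) \<Rightarrow> 'v::euclidean_space \<Rightarrow>\<^sub>L 'w::euclidean_space"
  shows "symbol A k \<xi> (kernel_proj A k \<xi> v) = 0"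
    and "symbol A k \<xi> v = 0 \<Longrightarrow> kernel_proj A k \<xi> v = v"
  by (simp_all add: kernel_proj_def blinfun.bilinear_simps pinv_simps)

lemma oblique_scaleR:
  assumes "c \<noteq> 0" shows "oblique A k V (c *\<^sub>R \<xi>) = oblique A k V \<xi>"
  using assms
  by (simp add: oblique_def kernel_proj_def symbol_scaleR pinv_scaleR
      bounded_bilinear.scaleR_left[OF bounded_bilinear_blinfun_compose]
      bounded_bilinear.scaleR_right[OF bounded_bilinear_blinfun_compose])

text \<open>
  The kernel of \<open>P \<pi>\<close> contains that of the orthogonal projection \<open>\<pi>\<close>, so its complement is contained in the range
  of \<open>\<pi>\<close>.
\<close>

lemma orthogonal_kernel_in_symbol_kernel:
  fixes A :: "('d::finite \<Rightarrow> nat) \<Rightarrow> 'v::euclidean_space \<Rightarrow>\<^sub>L 'w::euclidean_space"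
  assumes v: "\<And>n. (perp V o\<^sub>L kernel_proj A k \<xi>) n = 0 \<Longrightarrow> v \<bullet> n = 0"
  shows "kernel_proj A k \<xi> v = v"
proof -
  define n where "n = v - kernel_proj A k \<xi> v"
  have "kernel_proj A k \<xi> n = 0"
    using kernel_proj(2)[OF kernel_proj(1)[of A k \<xi> v]] by (simp add: n_def blinfun.diff_right)
  then have 1: "v \<bullet> n = 0" by (intro v) (simp add: blinfun.zero_right)
  have e: "n = pinv (symbol A k \<xi>) (symbol A k \<xi> v)"
    by (simp add: n_def kernel_proj_def blinfun.diff_left)
  have "n \<bullet> kernel_proj A k \<xi> v = 0"
    unfolding e by (rule pinv_orthogonal_kernel) (rule kernel_proj(1))
  then have "n \<bullet> n = 0" using 1 by (simp add: n_def inner_diff_left inner_diff_right inner_commute)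
  then show ?thesis by (simp add: n_def)
qed

context
  fixes A :: "('d::finite \<Rightarrow> nat) \<Rightarrow> 'v::euclidean_space \<Rightarrow>\<^sub>L 'w::euclidean_space" and k :: nat and V
  assumes V: "subspace V" and disj: "V \<inter> wave_cone A k = {0}"
begin

lemma perp_lower_bound:
  assumes "\<xi> \<noteq> 0" "\<And>n. (perp V o\<^sub>L kernel_proj A k \<xi>) n = 0 \<Longrightarrow> v \<bullet> n = 0"
  shows "cone_dist V (wave_cone A k) / 2 * norm v \<le> norm ((perp V o\<^sub>L kernel_proj A k \<xi>) v)"
proof -
  have e: "kernel_proj A k \<xi> v = v" by (rule orthogonal_kernel_in_symbol_kernel[OF assms(2)])
  have "v \<in> wave_cone A k"
    using kernel_proj(1)[of A k \<xi> v] assms(1) unfolding e by (intro wave_coneI)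
  from cone_dist_norm_le[OF V this] show ?thesis by (simp add: e)
qed

lemma norm_oblique_le:
  assumes "\<xi> \<noteq> 0" shows "norm (oblique A k V \<xi>) \<le> 2 * (1 / cone_dist V (wave_cone A k))"
proof -
  have "norm (oblique A k V \<xi>) \<le> 1 / (cone_dist V (wave_cone A k) / 2)"
    unfolding oblique_def using cone_dist_pos[OF V disj]
    by (intro norm_pinv_le perp_lower_bound[OF assms]) auto
  then show ?thesis by simp
qed

lemma oblique_perp:
  assumes "\<xi> \<noteq> 0" "symbol A k \<xi> v = 0" shows "oblique A k V \<xi> (perp V v) = v"
proof -
  have "oblique A k V \<xi> ((perp V o\<^sub>L kernel_proj A k \<xi>) v) = v"
    unfolding oblique_def
  proof (rule pinv_left_inverse)
    fix n assume n: "(perp V o\<^sub>L kernel_proj A k \<xi>) n = 0"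
    have "kernel_proj A k \<xi> n \<in> wave_cone A k" by (rule wave_coneI[OF assms(1) kernel_proj(1)])
    moreover have "kernel_proj A k \<xi> n \<in> V" using perp(1)[OF V, of "kernel_proj A k \<xi> n"] n by simp
    ultimately have "kernel_proj A k \<xi> n = 0" using disj by blast
    then have e: "n = pinv (symbol A k \<xi>) (symbol A k \<xi> n)"
      by (simp add: kernel_proj_def blinfun.diff_left)
    have "pinv (symbol A k \<xi>) (symbol A k \<xi> n) \<bullet> v = 0" by (rule pinv_orthogonal_kernel[OF assms(2)])
    then have "n \<bullet> v = 0" by (simp only: e[symmetric])
    then show "v \<bullet> n = 0" by (simp add: inner_commute)
  qed
  then show ?thesis using kernel_proj(2)[OF assms(2)] by simp
qed

end

text \<open>
  Dilation by powers of \<open>2\<close> moves every nonzero frequency into the annulus, and the operator does not change. Its closure is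
  compact and avoids \<open>0\<close>, which is what the uniform bound from constant rank requires.
\<close>

theorem wsym_oblique:
  fixes A :: "('d::finite \<Rightarrow> nat) \<Rightarrow> 'v::euclidean_space \<Rightarrow>\<^sub>L 'w::euclidean_space"
  assumes "constant_rank A k"
  shows "wsym {V. subspace V \<and> V \<inter> wave_cone A k = {0}} (\<lambda>V. 1 / cone_dist V (wave_cone A k))
    {\<xi>. 1 / 4 < norm \<xi> \<and> norm \<xi> < 4} n 1 (oblique A k)"
proof -
  define I where "I = {V. subspace V \<and> V \<inter> wave_cone A k = {0}}"
  define U where "U = {\<xi> :: real ^ 'd. 1 / 4 < norm \<xi> \<and> norm \<xi> < 4}"
  define U' where "U' = {\<xi> :: real ^ 'd. 1 / 4 \<le> norm \<xi> \<and> norm \<xi> \<le> 4}"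
  have bU: "bounded U" unfolding U_def bounded_iff by (rule exI[of _ 4]) auto
  have oU: "open U" unfolding U_def
    by (intro open_Collect_conj open_Collect_less continuous_intros)
  have "bounded U'" unfolding U'_def bounded_iff by (rule exI[of _ 4]) auto
  moreover have "closed U'" unfolding U'_def
    by (intro closed_Collect_conj closed_Collect_le continuous_intros)
  ultimately have cU': "compact U'" by (simp add: compact_eq_bounded_closed)
  from assms obtain r where r: "\<And>\<xi>. \<xi> \<noteq> 0 \<Longrightarrow> dim (range (blinfun_apply (symbol A k \<xi>))) = r"
    unfolding constant_rank_def by blast
  have "\<xi> \<noteq> 0" if "\<xi> \<in> U'" for \<xi> using that by (auto simp: U'_def)
  then have "\<exists>C. \<forall>\<xi>\<in>U'. norm (pinv (symbol A k \<xi>)) \<le> C"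
    using r by (intro pinv_bounded_constant_rank[OF cU' continuous_on_symbol]) auto
  then obtain C where C: "\<And>\<xi>. \<xi> \<in> U' \<Longrightarrow> norm (pinv (symbol A k \<xi>)) \<le> C" by blast
  have "wsym I (\<lambda>_. 1) U n 0 (\<lambda>p \<xi>. pinv (symbol A k \<xi>) o\<^sub>L symbol A k \<xi>)"
    using wsym_pinv[OF oU wsym_symbol[OF bU], of I "\<lambda>_. 1" A k C n] C
    by (auto simp: U_def U'_def)
  moreover have "wsym I (\<lambda>_. 1) U n 0 (\<lambda>_ _. id_blinfun :: 'v \<Rightarrow>\<^sub>L 'v)"
    by (rule wsym_const[where C = 1]) (auto intro!: norm_blinfun_bound)
  ultimately have "wsym I (\<lambda>_. 1) U n 0 (\<lambda>p. kernel_proj A k)"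
    unfolding kernel_proj_def[abs_def] by (intro wsym_diff) auto
  moreover have "wsym I (\<lambda>_. 1) U n 0 (\<lambda>V _. perp V)"
    by (rule wsym_const[where C = 1]) (use norm_perp_le in \<open>auto simp: I_def\<close>)
  ultimately have X: "wsym I (\<lambda>_. 1) U n 0 (\<lambda>V \<xi>. perp V o\<^sub>L kernel_proj A k \<xi>)"
    using wsym_bilinear[OF bounded_bilinear_blinfun_compose, of I "\<lambda>_. 1" U n 0 "\<lambda>V _. perp V" 0 "\<lambda>p. kernel_proj A k"] by simp
  have K: "1 \<le> 1 / cone_dist V (wave_cone A k)" if "V \<in> I" for V
    using cone_dist_pos[of V A k] cone_dist_le(1)[of V "wave_cone A k"] that by (simp add: I_def)
  have "norm (pinv (perp V o\<^sub>L kernel_proj A k \<xi>)) \<le> 2 * (1 / cone_dist V (wave_cone A k))"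
    if "V \<in> I" "\<xi> \<in> U" for V \<xi>
  proof -
    have V: "subspace V" "V \<inter> wave_cone A k = {0}" using that(1) by (simp_all add: I_def)
    have "\<xi> \<noteq> 0" using that(2) by (auto simp: U_def)
    from norm_oblique_le[OF V this] show ?thesis by (simp only: oblique_def)
  qed
  from wsym_pinv[OF oU X K this] show ?thesis
    unfolding I_def U_def oblique_def[abs_def] by blast
qed

section \<open>Finite differences\<close>

definition fdiff :: "'d::finite \<Rightarrow> real \<Rightarrow> (real ^ 'd \<Rightarrow> 'e::real_normed_vector) \<Rightarrow> real ^ 'd \<Rightarrow> 'e" where
  "fdiff i h F \<xi> = F (\<xi> + h *\<^sub>R axis i 1) - F \<xi>"

lemma pder_shift: "pder i F (\<xi> + v) D \<Longrightarrow> pder i (\<lambda>\<xi>. F (\<xi> + v)) \<xi> D"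
  by (simp add: pder_def add_ac)

lemma pder_fdiff:
  "(\<And>\<xi>. pder i F \<xi> (G \<xi>)) \<Longrightarrow> pder i (fdiff i h F) \<xi> (fdiff i h G \<xi>)"
  unfolding fdiff_def[abs_def]
  using pder_shift[of i F _ "h *\<^sub>R axis i 1"] unfolding pder_def
  by (intro has_vector_derivative_diff) auto

lemma pder_fdiff_funpow:
  "(\<And>\<xi>. pder i F \<xi> (G \<xi>)) \<Longrightarrow> pder i ((fdiff i h ^^ n) F) \<xi> ((fdiff i h ^^ n) G \<xi>)"
proof (induction n arbitrary: \<xi>)
  case (Suc n)
  then show ?case using pder_fdiff[of i "(fdiff i h ^^ n) F" "(fdiff i h ^^ n) G" h] by simp
qed simp

lemma norm_fdiff_le:
  fixes F :: "real ^ 'd::finite \<Rightarrow> 'e::real_normed_vector"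
  assumes "\<And>\<xi>. pder i F \<xi> (G \<xi>)" "\<And>\<xi>. norm (G \<xi>) \<le> C"
  shows "norm (fdiff i h F \<xi>) \<le> C * \<bar>h\<bar>"
proof -
  define g where "g t = F (\<xi> + t *\<^sub>R axis i 1)" for t :: real
  have "(g has_vector_derivative G (\<xi> + t *\<^sub>R axis i 1)) (at t)" for t
  proof -
    have "pder i F (\<xi> + t *\<^sub>R axis i 1) (G (\<xi> + t *\<^sub>R axis i 1))" by (rule assms)
    then have 1: "((\<lambda>s. F (\<xi> + t *\<^sub>R axis i 1 + s *\<^sub>R axis i 1)) has_vector_derivative G (\<xi> + t *\<^sub>R axis i 1)) (at (t - t))"
      by (simp add: pder_def)
    have 2: "((\<lambda>s. s - t) has_vector_derivative 1) (at t)"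
      by (auto intro!: derivative_eq_intros)
    have "(\<lambda>s. F (\<xi> + t *\<^sub>R axis i 1 + s *\<^sub>R axis i 1)) \<circ> (\<lambda>s. s - t) = g"
      by (auto simp: g_def fun_eq_iff scaleR_diff_left)
    then show ?thesis using vector_diff_chain_at[OF 2 1] by simp
  qed
  then have "norm (g h - g 0) \<le> C * norm (h - 0)"
    using assms(2)
    by (intro differentiable_bound[where S = UNIV and f' = "\<lambda>t s. s *\<^sub>R G (\<xi> + t *\<^sub>R axis i 1)"])
       (auto simp: has_vector_derivative_def intro!: onorm_le, simp add: mult.commute[of C] mult_left_mono)
  then show ?thesis by (simp add: g_def fdiff_def)
qed

text \<open>
  One derivative is traded for one factor of the step at a time, by the mean value inequality.
\<close>

lemma norm_fdiff_funpow_le: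
  assumes "wsym I (\<lambda>_. 1) UNIV n a F"
  shows "\<exists>C. \<forall>p\<in>I. \<forall>h \<xi>. norm ((fdiff i h ^^ n) (F p) \<xi>) \<le> C * \<bar>h\<bar> ^ n"
  using assms
proof (induction n arbitrary: a F)
  case 0
  then show ?case by auto
next
  case (Suc n)
  from wsym_deriv[OF Suc.prems, of i] obtain G
    where G: "\<forall>p\<in>I. \<forall>\<xi>\<in>UNIV. pder i (F p) \<xi> (G p \<xi>)" "wsym I (\<lambda>_. 1) UNIV n (Suc a) G" by blast
  from Suc.IH[OF G(2)] obtain C where C: "\<forall>p\<in>I. \<forall>h \<xi>. norm ((fdiff i h ^^ n) (G p) \<xi>) \<le> C * \<bar>h\<bar> ^ n" by blast
  have "norm ((fdiff i h ^^ Suc n) (F p) \<xi>) \<le> C * \<bar>h\<bar> ^ Suc n" if "p \<in> I" for p h \<xi>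
  proof -
    have "pder i ((fdiff i h ^^ n) (F p)) \<eta> ((fdiff i h ^^ n) (G p) \<eta>)" for \<eta>
      using G(1) that by (intro pder_fdiff_funpow) auto
    then have "norm (fdiff i h ((fdiff i h ^^ n) (F p)) \<xi>) \<le> C * \<bar>h\<bar> ^ n * \<bar>h\<bar>"
      by (rule norm_fdiff_le) (use C that in auto)
    then show ?thesis by (simp add: mult_ac)
  qed
  then show ?case by blast
qed

section \<open>Weighted estimates for dyadic kernels\<close>

definition bdiff :: "'d::finite \<Rightarrow> (int ^ 'd \<Rightarrow> complex) \<Rightarrow> int ^ 'd \<Rightarrow> complex" where
  "bdiff i c n = c (n - axis i 1) - c n"

lemma cube_mono: "N \<le> N' \<Longrightarrow> cube {-N..N} \<subseteq> cube {-N'..N'}"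
proof -
  assume "N \<le> N'"
  then have "{-N..N} \<subseteq> {-N'..N'}" by auto
  then show ?thesis unfolding cube_def by blast
qed

text \<open>
  The support is tracked separately from the cube of frequencies over which a kernel is summed, because every
  difference enlarges it by one.
\<close>

definition supp_in :: "int \<Rightarrow> (int ^ 'd::finite \<Rightarrow> complex) \<Rightarrow> bool" where
  "supp_in N c \<longleftrightarrow> (\<forall>n. c n \<noteq> 0 \<longrightarrow> n \<in> cube {-N..N})"

lemma supp_in_bdiff: "supp_in N c \<Longrightarrow> supp_in (N + 1) (bdiff i c)"
proof -
  assume c: "supp_in N c"
  have "n \<in> cube {-(N + 1)..N + 1}" if n: "bdiff i c n \<noteq> 0" for n
  proof -
    consider "c n \<noteq> 0" | "c (n - axis i 1) \<noteq> 0" using n by (force simp: bdiff_def)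
    then show ?thesis
    proof cases
      case 1
      then have "n \<in> cube {-N..N}" using c by (auto simp: supp_in_def)
      then show ?thesis using cube_mono[of N "N + 1"] by auto
    next
      case 2
      then have "n - axis i 1 \<in> cube {-N..N}" using c by (auto simp: supp_in_def)
      then have h: "-N \<le> n $ j - axis i 1 $ j" "n $ j - axis i 1 $ j \<le> N" for j
        by (auto simp: cube_def)
      have "0 \<le> (axis i 1 $ j :: int)" "(axis i 1 $ j :: int) \<le> 1" for j by (auto simp: axis_def)
      with h have "-(N + 1) \<le> n $ j \<and> n $ j \<le> N + 1" for j
        by (smt (verit))
      then show ?thesis by (auto simp: cube_def)
    qed
  qed
  then show ?thesis by (auto simp: supp_in_def)
qed

lemma supp_in_funpow_bdiff: "supp_in N c \<Longrightarrow> supp_in (N + int r) ((bdiff i ^^ r) c)"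
proof (induction r)
  case (Suc r)
  then show ?case using supp_in_bdiff[of "N + int r" "(bdiff i ^^ r) c" i] by (simp add: add_ac)
qed simp

text \<open>
  Summation by parts. The frequency cube is larger than the support of the multiplier, so no
  boundary terms occur.
\<close>

lemma kernel_bdiff:
  fixes z :: "int ^ 'd::finite"
  assumes "supp_in N c" "N < N'"
  shows "kernel M (cube {-N'..N'}) (bdiff i c) z = (ch M (axis i 1) z - 1) * kernel M (cube {-N'..N'}) c z"
proof -
  define S where "S = (cube {-N'..N'} :: (int ^ 'd) set)"
  have fin: "finite S" by (simp add: S_def)
  have "(\<Sum>n\<in>S. c (n - axis i 1) * ch M n z) = (\<Sum>n\<in>(\<lambda>n. n - axis i 1) ` S. c n * ch M (n + axis i 1) z)"
    by (subst sum.reindex) (auto simp: inj_on_def)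
  also have "\<dots> = (\<Sum>n\<in>{n. c n \<noteq> 0}. c n * ch M (n + axis i 1) z)"
  proof (rule sum.mono_neutral_right)
    show "{n. c n \<noteq> 0} \<subseteq> (\<lambda>n. n - axis i 1) ` S"
    proof
      fix n assume "n \<in> {n. c n \<noteq> 0}"
      then have "n \<in> cube {-N..N}" using assms(1) by (auto simp: supp_in_def)
      then have h: "-N \<le> n $ j" "n $ j \<le> N" for j by (auto simp: cube_def)
      have "0 \<le> (axis i 1 $ j :: int)" "(axis i 1 $ j :: int) \<le> 1" for j by (auto simp: axis_def)
      with h assms(2) have "-N' \<le> n $ j + axis i 1 $ j \<and> n $ j + axis i 1 $ j \<le> N'" for j
        by (smt (verit))
      then have "n + axis i 1 \<in> S" by (auto simp: S_def cube_def)
      then show "n \<in> (\<lambda>n. n - axis i 1) ` S" by (intro image_eqI[of _ _ "n + axis i 1"]) auto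
    qed
  qed (use fin in auto)
  also have "\<dots> = (\<Sum>n\<in>S. c n * ch M (n + axis i 1) z)"
  proof (rule sum.mono_neutral_left)
    show "{n. c n \<noteq> 0} \<subseteq> S"
    proof
      fix n assume "n \<in> {n. c n \<noteq> 0}"
      then have "n \<in> cube {-N..N}" using assms(1) by (auto simp: supp_in_def)
      then show "n \<in> S" using assms(2) cube_mono[of N N'] by (auto simp: S_def)
    qed
  qed (use fin in auto)
  also have "\<dots> = (\<Sum>n\<in>S. c n * ch M n z) * ch M (axis i 1) z"
    by (simp add: ch_add_left sum_distrib_right mult.assoc)
  finally have "(\<Sum>n\<in>S. bdiff i c n * ch M n z) = (\<Sum>n\<in>S. c n * ch M n z) * ch M (axis i 1) z - (\<Sum>n\<in>S. c n * ch M n z)"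
    by (simp only: bdiff_def left_diff_distrib sum_subtractf)
  also have "\<dots> = (ch M (axis i 1) z - 1) * (\<Sum>n\<in>S. c n * ch M n z)"
    by algebra
  finally have "(\<Sum>n\<in>S. bdiff i c n * ch M n z) = (ch M (axis i 1) z - 1) * (\<Sum>n\<in>S. c n * ch M n z)" .
  then show ?thesis unfolding kernel_def S_def by simp
qed

lemma kernel_funpow_bdiff:
  fixes z :: "int ^ 'd::finite"
  assumes "supp_in N c" "N + int r \<le> N'"
  shows "kernel M (cube {-N'..N'}) ((bdiff i ^^ r) c) z = (ch M (axis i 1) z - 1) ^ r * kernel M (cube {-N'..N'}) c z"
  using assms(2)
proof (induction r)
  case (Suc r)
  have "kernel M (cube {-N'..N'}) (bdiff i ((bdiff i ^^ r) c)) z = (ch M (axis i 1) z - 1) * kernel M (cube {-N'..N'}) ((bdiff i ^^ r) c) z"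
    using supp_in_funpow_bdiff[OF assms(1), of r i] Suc.prems by (intro kernel_bdiff) auto
  then show ?case using Suc by simp
qed simp

lemma separated_cube:
  assumes "2 * N < int M" shows "separated M (cube {-N..N} :: (int ^ 'd::finite) set)"
  unfolding separated_def
proof (intro conjI ballI impI)
  fix n m :: "int ^ 'd" assume nm: "n \<in> cube {-N..N}" "m \<in> cube {-N..N}" "\<forall>i. int M dvd n $ i - m $ i"
  have "n $ i = m $ i" for i
  proof (rule ccontr)
    assume ne: "n $ i \<noteq> m $ i"
    have "int M dvd n $ i - m $ i" using nm by blast
    then have "int M \<le> \<bar>n $ i - m $ i\<bar>" using ne dvd_imp_le_int[of "n $ i - m $ i" "int M"] by simp
    moreover have "-N \<le> n $ i" "n $ i \<le> N" "-N \<le> m $ i" "m $ i \<le> N" using nm(1,2) by (auto simp: cube_def)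
    ultimately show False using assms by linarith
  qed
  then show "n = m" by (simp add: vec_eq_iff)
qed simp

lemma sum_kernel_sq_le:
  fixes c :: "int ^ 'd::finite \<Rightarrow> complex"
  assumes "2 * N' < int M" "supp_in N c" "0 \<le> N" "N \<le> N'" "\<And>n. cmod (c n) \<le> B"
  shows "(\<Sum>z\<in>torus M. (cmod (kernel M (cube {-N'..N'}) c z))\<^sup>2) \<le> B\<^sup>2 * (2 * real_of_int N + 1) ^ CARD('d) / real M ^ CARD('d)"
proof -
  define D where "D = real M ^ CARD('d)"
  have M: "M > 0" using assms by (cases M) auto
  then have D: "D > 0" by (simp add: D_def)
  have sub: "cube {-N..N} \<subseteq> (cube {-N'..N'} :: (int ^ 'd) set)" by (rule cube_mono[OF assms(4)])
  have "(\<Sum>z\<in>torus M. (cmod (kernel M (cube {-N'..N'}) c z))\<^sup>2)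
      = (\<Sum>z\<in>torus M. (cmod (\<Sum>n\<in>cube {-N'..N'}. c n * ch M n z))\<^sup>2) / D\<^sup>2"
    by (simp add: kernel_def norm_divide norm_power power_divide D_def flip: sum_divide_distrib)
  also have "\<dots> = (\<Sum>n\<in>cube {-N'..N'}. (cmod (c n))\<^sup>2) / D"
    using D unfolding parseval[OF M separated_cube[OF assms(1)]] D_def[symmetric] by (simp add: power2_eq_square)
  also have "(\<Sum>n\<in>cube {-N'..N'}. (cmod (c n))\<^sup>2) = (\<Sum>n\<in>cube {-N..N}. (cmod (c n))\<^sup>2)"
    using sub assms(2) by (intro sum.mono_neutral_right) (auto simp: supp_in_def)
  also have "\<dots> \<le> (\<Sum>n\<in>(cube {-N..N} :: (int ^ 'd) set). B\<^sup>2)"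
    using assms(5) by (intro sum_mono power_mono) auto
  also have "\<dots> = B\<^sup>2 * (2 * real_of_int N + 1) ^ CARD('d)"
    using assms(3) by (simp add: card_cube mult.commute)
  finally show ?thesis using D by (simp add: divide_right_mono D_def)
qed

definition rvec :: "int ^ 'd::finite \<Rightarrow> real ^ 'd" where
  "rvec n = (\<chi> i. real_of_int (n $ i))"

lemma bdiff_sample:
  "bdiff i (\<lambda>n. \<Phi> (h *\<^sub>R rvec n)) = (\<lambda>n. fdiff i (- h) \<Phi> (h *\<^sub>R rvec n))"
proof -
  have "h *\<^sub>R rvec (n - axis i 1) = h *\<^sub>R rvec n + (- h) *\<^sub>R axis i 1" for n
    by (simp add: vec_eq_iff rvec_def axis_def algebra_simps)
  then show ?thesis by (simp add: bdiff_def fdiff_def fun_eq_iff)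
qed

lemma bdiff_funpow_sample:
  "(bdiff i ^^ r) (\<lambda>n. \<Phi> (h *\<^sub>R rvec n)) = (\<lambda>n. (fdiff i (- h) ^^ r) \<Phi> (h *\<^sub>R rvec n))"
proof (induction r)
  case (Suc r)
  then show ?case using bdiff_sample[of i "(fdiff i (- h) ^^ r) \<Phi>" h] by simp
qed simp

lemma supp_in_sample:
  fixes \<Phi> :: "real ^ 'd::finite \<Rightarrow> complex"
  assumes "\<And>\<xi>. 2 \<le> norm \<xi> \<Longrightarrow> \<Phi> \<xi> = 0"
  shows "supp_in (2 ^ (j + 1)) (\<lambda>n. \<Phi> ((1 / 2 ^ j) *\<^sub>R rvec n))"
  unfolding supp_in_def
proof (intro allI impI)
  fix n :: "int ^ 'd" assume "\<Phi> ((1 / 2 ^ j) *\<^sub>R rvec n) \<noteq> 0"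
  then have "norm ((1 / 2 ^ j) *\<^sub>R rvec n) < 2" using assms not_le by blast
  then have b: "norm (rvec n) < 2 * 2 ^ j" by (simp add: field_simps)
  have "\<bar>n $ i\<bar> \<le> 2 ^ (j + 1)" for i
  proof -
    have "\<bar>real_of_int (n $ i)\<bar> \<le> norm (rvec n)"
      using component_le_norm_cart[of "rvec n" i] by (simp add: rvec_def)
    then have "real_of_int \<bar>n $ i\<bar> < real_of_int (2 ^ (j + 1))" using b by simp
    then show ?thesis by linarith
  qed
  then show "n \<in> cube {- (2 ^ (j + 1))..2 ^ (j + 1)}" by (auto simp: cube_def abs_le_iff minus_le_iff)
qed

text \<open>
  Parseval for the kernel of a multiplier living at frequencies of size \<open>2\<^sup>j\<close>, and for its \<open>s\<close>-fold differences in one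
  frequency variable. A difference step is \<open>1/2\<^sup>j\<close> in the rescaled variable and multiplies the kernel by a
  factor of modulus \<open>4/M\<close> times the chordal distance; the natural length is therefore \<open>M/2\<^sup>j\<close>.
\<close>

lemma kernel_L2_bounds:
  fixes F :: "'p \<Rightarrow> real ^ 'd::finite \<Rightarrow> complex"
  assumes F: "wsym I (\<lambda>_. 1) UNIV s 0 F" and supp: "\<And>p \<xi>. p \<in> I \<Longrightarrow> 2 \<le> norm \<xi> \<Longrightarrow> F p \<xi> = 0"
  shows "\<exists>C\<ge>0. \<forall>p\<in>I. \<forall>M j N. 2 ^ (j + 1) + int s \<le> N \<longrightarrow> 2 * N < int M \<longrightarrow>
    (\<Sum>z\<in>torus M. (cmod (kernel M (cube {-N..N}) (\<lambda>n. F p ((1 / 2 ^ j) *\<^sub>R rvec n)) z))\<^sup>2)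
        \<le> C / (real M / 2 ^ j) ^ CARD('d) \<and>
    (\<forall>i. (\<Sum>z\<in>torus M. tdist M (z $ i) ^ (2 * s) * (cmod (kernel M (cube {-N..N}) (\<lambda>n. F p ((1 / 2 ^ j) *\<^sub>R rvec n)) z))\<^sup>2)
        \<le> C * (real M / 2 ^ j) ^ (2 * s) / (real M / 2 ^ j) ^ CARD('d))"
proof -
  from wsym_bound[OF F] obtain C0 where C0: "\<And>p \<xi>. p \<in> I \<Longrightarrow> cmod (F p \<xi>) \<le> C0" by auto
  have "\<exists>C. \<forall>p\<in>I. \<forall>h \<xi>. norm ((fdiff i h ^^ s) (F p) \<xi>) \<le> C * \<bar>h\<bar> ^ s" for i
    by (rule norm_fdiff_funpow_le[OF F])
  then obtain Ci where Ci: "\<And>i p h \<xi>. p \<in> I \<Longrightarrow> norm ((fdiff i h ^^ s) (F p) \<xi>) \<le> Ci i * \<bar>h\<bar> ^ s" by metis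
  define C1 where "C1 = (\<Sum>i\<in>UNIV. \<bar>Ci i\<bar>)"
  have C1: "norm ((fdiff i h ^^ s) (F p) \<xi>) \<le> C1 * \<bar>h\<bar> ^ s" if "p \<in> I" for i p h \<xi>
  proof -
    have "\<bar>Ci i\<bar> \<le> C1" unfolding C1_def by (rule member_le_sum) auto
    then have "Ci i * \<bar>h\<bar> ^ s \<le> C1 * \<bar>h\<bar> ^ s" by (intro mult_right_mono) auto
    then show ?thesis using Ci[OF that, of i h \<xi>] by linarith
  qed
  define C where "C = C0\<^sup>2 * 5 ^ CARD('d) + C1\<^sup>2 * (5 + 2 * real s) ^ CARD('d)"
  have "C \<ge> 0" by (simp add: C_def)
  moreover have "(\<Sum>z\<in>torus M. (cmod (kernel M (cube {-N..N}) (\<lambda>n. F p ((1 / 2 ^ j) *\<^sub>R rvec n)) z))\<^sup>2)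
        \<le> C / (real M / 2 ^ j) ^ CARD('d)" (is ?A)
    "(\<Sum>z\<in>torus M. tdist M (z $ i) ^ (2 * s) * (cmod (kernel M (cube {-N..N}) (\<lambda>n. F p ((1 / 2 ^ j) *\<^sub>R rvec n)) z))\<^sup>2)
        \<le> C * (real M / 2 ^ j) ^ (2 * s) / (real M / 2 ^ j) ^ CARD('d)" (is ?B)
    if p: "p \<in> I" and N: "2 ^ (j + 1) + int s \<le> N" "2 * N < int M" for p M j N i
  proof -
    define c where "c n = F p ((1 / 2 ^ j) *\<^sub>R rvec n)" for n
    define \<kappa> where "\<kappa> = kernel M (cube {-N..N}) c"
    have c: "supp_in (2 ^ (j + 1)) c" unfolding c_def using supp[OF p] by (rule supp_in_sample)
    have "(0::int) < 2 ^ (j + 1)" by simp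
    then have M: "M > 0" using N by linarith
    define P where "P = (2::real) ^ j"
    have P: "P \<ge> 1" by (simp add: P_def)
    have "(\<Sum>z\<in>torus M. (cmod (\<kappa> z))\<^sup>2) \<le> C0\<^sup>2 * (2 * real_of_int (2 ^ (j + 1)) + 1) ^ CARD('d) / real M ^ CARD('d)"
      unfolding \<kappa>_def using N c C0[OF p] by (intro sum_kernel_sq_le) (auto simp: c_def)
    \<comment> \<open>the cube of frequencies has \<open>2 * 2 ^ (j + 1) + 1 \<le> 5 * 2 ^ j\<close> points in each direction\<close>
    also have "\<dots> \<le> C0\<^sup>2 * (5 * P) ^ CARD('d) / real M ^ CARD('d)"
      using P by (intro divide_right_mono mult_left_mono power_mono) (auto simp: P_def)
    also have "\<dots> = C0\<^sup>2 * 5 ^ CARD('d) / (real M / P) ^ CARD('d)"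
      by (simp add: power_mult_distrib power_divide)
    also have "\<dots> \<le> C / (real M / P) ^ CARD('d)"
      using P by (intro divide_right_mono) (auto simp: C_def)
    finally show ?A by (simp add: \<kappa>_def P_def c_def[abs_def])
    have eq: "tdist M (z $ i) ^ (2 * s) * (cmod (\<kappa> z))\<^sup>2
        = (real M / 4) ^ (2 * s) * (cmod (kernel M (cube {-N..N}) ((bdiff i ^^ s) c) z))\<^sup>2" for z
    proof -
      have "(\<Sum>j\<in>UNIV. real_of_int (axis i 1 $ j) * real_of_int (z $ j)) = z $ i"
        by (simp add: axis_def if_distrib[of real_of_int] if_distrib[of "\<lambda>t. t * _"] cong: if_cong)
      then have t: "tdist M (z $ i) = real M / 4 * cmod (ch M (axis i 1) z - 1)"
        by (simp add: tdist_def ch_def)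
      have "(cmod (kernel M (cube {-N..N}) ((bdiff i ^^ s) c) z))\<^sup>2 = cmod (ch M (axis i 1) z - 1) ^ (2 * s) * (cmod (\<kappa> z))\<^sup>2"
        using kernel_funpow_bdiff[OF c N(1), of M i z]
        by (simp add: \<kappa>_def norm_mult norm_power power_mult_distrib power_mult[symmetric] mult.commute[of s])
      then show ?thesis unfolding t power_mult_distrib by (simp only: mult.assoc)
    qed
    have "(\<Sum>z\<in>torus M. (cmod (kernel M (cube {-N..N}) ((bdiff i ^^ s) c) z))\<^sup>2)
        \<le> (C1 * \<bar>- (1 / 2 ^ j)\<bar> ^ s)\<^sup>2 * (2 * real_of_int (2 ^ (j + 1) + int s) + 1) ^ CARD('d) / real M ^ CARD('d)"
      using N supp_in_funpow_bdiff[OF c, of s i]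
    proof (intro sum_kernel_sq_le)
      show "cmod ((bdiff i ^^ s) c n) \<le> C1 * \<bar>- (1 / 2 ^ j)\<bar> ^ s" for n
        unfolding c_def[abs_def] bdiff_funpow_sample by (rule C1[OF p])
    qed auto
    also have "\<dots> = C1\<^sup>2 / P ^ (2 * s) * (2 * real_of_int (2 ^ (j + 1) + int s) + 1) ^ CARD('d) / real M ^ CARD('d)"
      by (simp add: P_def power_mult_distrib power_divide power_mult[symmetric] mult.commute[of s])
    also have "\<dots> \<le> C1\<^sup>2 / P ^ (2 * s) * ((5 + 2 * real s) * P) ^ CARD('d) / real M ^ CARD('d)"
    proof (intro divide_right_mono mult_left_mono power_mono)
      have e: "real_of_int (2 ^ (j + 1) + int s) = 2 * P + real s" by (simp add: P_def)
      have "2 * real s * 1 \<le> 2 * real s * P" using P by (intro mult_left_mono) auto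
      then show "2 * real_of_int (2 ^ (j + 1) + int s) + 1 \<le> (5 + 2 * real s) * P"
        unfolding e using P by (simp add: ring_distribs)
    qed (use P in auto)
    finally have "(\<Sum>z\<in>torus M. tdist M (z $ i) ^ (2 * s) * (cmod (\<kappa> z))\<^sup>2)
      \<le> (real M / 4) ^ (2 * s) * (C1\<^sup>2 / P ^ (2 * s) * ((5 + 2 * real s) * P) ^ CARD('d) / real M ^ CARD('d))"
      unfolding eq sum_distrib_left[symmetric] by (intro mult_left_mono) auto
    also have "\<dots> \<le> real M ^ (2 * s) * (C1\<^sup>2 / P ^ (2 * s) * ((5 + 2 * real s) * P) ^ CARD('d) / real M ^ CARD('d))"
      using P by (intro mult_right_mono power_mono) auto
    also have "\<dots> = C1\<^sup>2 * (5 + 2 * real s) ^ CARD('d) * (real M / P) ^ (2 * s) / (real M / P) ^ CARD('d)"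
      by (simp add: power_mult_distrib power_divide)
    also have "\<dots> \<le> C * (real M / P) ^ (2 * s) / (real M / P) ^ CARD('d)"
      using P by (intro divide_right_mono mult_right_mono) (auto simp: C_def)
    finally show ?B by (simp add: \<kappa>_def P_def c_def[abs_def])
  qed
  ultimately show ?thesis by blast
qed

lemma far_mono: "far M R x \<Longrightarrow> R' \<le> R \<Longrightarrow> far M R' x"
  unfolding far_def using order.trans by blast

text \<open>
  Cauchy--Schwarz on the shell between \<open>\<rho>\<close> and \<open>2 \<rho>\<close>: the number of points is of order \<open>\<rho>\<^sup>d\<close>, and the sum of
  squares is of order \<open>lam / \<rho> ^ (d + 1)\<close> because \<open>2 s \<ge> d + 1\<close>. This leaves \<open>sqrt (lam / \<rho>)\<close>, which is
  summable over dyadic \<open>\<rho>\<close>. Here the condition \<open>s > d/2\<close> enters.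
\<close>

lemma L1_from_weighted_L2:
  fixes \<kappa> :: "int ^ 'd::finite \<Rightarrow> complex" and lam C :: real
  assumes lam: "1 \<le> lam" and s: "CARD('d) + 1 \<le> 2 * s" and C: "C \<ge> 0" and M: "M > 0"
    and 1: "(\<Sum>z\<in>torus M. (cmod (\<kappa> z))\<^sup>2) \<le> C / lam ^ CARD('d)"
    and 2: "\<And>i. (\<Sum>z\<in>torus M. tdist M (z $ i) ^ (2 * s) * (cmod (\<kappa> z))\<^sup>2) \<le> C * lam ^ (2 * s) / lam ^ CARD('d)"
  defines "D \<equiv> sqrt (8 ^ CARD('d) * CARD('d) * C)"
  shows "\<And>\<rho>. lam \<le> \<rho> \<Longrightarrow> (\<Sum>z\<in>{z \<in> torus M. far M \<rho> z}. cmod (\<kappa> z)) \<le> 4 * D * sqrt (lam / \<rho>)"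
    and "(\<Sum>z\<in>torus M. cmod (\<kappa> z)) \<le> 5 * D"
proof -
  have D0: "D \<ge> 0" using C by (simp add: D_def)
  have cs: "(\<Sum>z\<in>A. cmod (\<kappa> z)) \<le> sqrt (real (card A) * (\<Sum>z\<in>A. (cmod (\<kappa> z))\<^sup>2))" for A :: "(int ^ 'd) set"
    using Cauchy_Schwarz_ineq_sum[of "\<lambda>_. 1" "\<lambda>z. cmod (\<kappa> z)" A]
    by (intro real_le_rsqrt) simp
  have near: "real (card {z \<in> torus M :: (int ^ 'd) set. \<not> far M R z}) \<le> (4 * R) ^ CARD('d)" if "1 \<le> R" for R
    using card_torus_near[OF that M, of 0] by (simp add: far_def not_le)
  have tail: "(\<Sum>z\<in>{z \<in> torus M. far M \<rho> z}. (cmod (\<kappa> z))\<^sup>2) \<le> CARD('d) * C * lam / \<rho> ^ (CARD('d) + 1)"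
    if \<rho>: "lam \<le> \<rho>" for \<rho>
  proof -
    have r0: "\<rho> > 0" using lam \<rho> by simp
    have "\<rho> ^ (2 * s) * (\<Sum>z\<in>{z \<in> torus M. far M \<rho> z}. (cmod (\<kappa> z))\<^sup>2)
       = (\<Sum>z\<in>{z \<in> torus M. far M \<rho> z}. \<rho> ^ (2 * s) * (cmod (\<kappa> z))\<^sup>2)" by (simp add: sum_distrib_left)
    also have "\<dots> \<le> (\<Sum>z\<in>{z \<in> torus M. far M \<rho> z}. \<Sum>i\<in>UNIV. tdist M (z $ i) ^ (2 * s) * (cmod (\<kappa> z))\<^sup>2)"
    proof (rule sum_mono)
      fix z :: "int ^ 'd" assume "z \<in> {z \<in> torus M. far M \<rho> z}"
      then obtain i where i: "\<rho> \<le> tdist M (z $ i)" by (auto simp: far_def)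
      have "\<rho> ^ (2 * s) * (cmod (\<kappa> z))\<^sup>2 \<le> tdist M (z $ i) ^ (2 * s) * (cmod (\<kappa> z))\<^sup>2"
        using i r0 by (intro mult_right_mono power_mono) auto
      also have "\<dots> \<le> (\<Sum>i\<in>UNIV. tdist M (z $ i) ^ (2 * s) * (cmod (\<kappa> z))\<^sup>2)"
        by (rule member_le_sum) auto
      finally show "\<rho> ^ (2 * s) * (cmod (\<kappa> z))\<^sup>2 \<le> (\<Sum>i\<in>UNIV. tdist M (z $ i) ^ (2 * s) * (cmod (\<kappa> z))\<^sup>2)" .
    qed
    also have "\<dots> \<le> (\<Sum>z\<in>torus M. \<Sum>i\<in>UNIV. tdist M (z $ i) ^ (2 * s) * (cmod (\<kappa> z))\<^sup>2)"
      by (intro sum_mono2) (auto intro!: sum_nonneg)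
    also have "\<dots> = (\<Sum>i\<in>UNIV. \<Sum>z\<in>torus M. tdist M (z $ i) ^ (2 * s) * (cmod (\<kappa> z))\<^sup>2)"
      by (rule sum.swap)
    also have "\<dots> \<le> (\<Sum>i\<in>(UNIV :: 'd set). C * lam ^ (2 * s) / lam ^ CARD('d))" by (intro sum_mono 2)
    also have "\<dots> = CARD('d) * C * (lam ^ (2 * s) / lam ^ CARD('d))" by simp
    finally have "(\<Sum>z\<in>{z \<in> torus M. far M \<rho> z}. (cmod (\<kappa> z))\<^sup>2)
        \<le> CARD('d) * C * (lam ^ (2 * s) / lam ^ CARD('d)) / \<rho> ^ (2 * s)"
      by (simp only: pos_le_divide_eq[OF zero_less_power[OF r0]] mult.commute)
    also have "\<dots> = CARD('d) * C * (lam / \<rho>) ^ (2 * s) / lam ^ CARD('d)"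
      by (simp add: power_divide)
    also have "\<dots> \<le> CARD('d) * C * (lam / \<rho>) ^ (CARD('d) + 1) / lam ^ CARD('d)"
      using s C lam \<rho> r0 by (intro divide_right_mono mult_left_mono power_decreasing) auto
    also have "\<dots> = CARD('d) * C * lam / \<rho> ^ (CARD('d) + 1)"
      using lam by (simp add: power_divide)
    finally show ?thesis .
  qed
  have shell: "(\<Sum>z\<in>{z \<in> torus M. far M \<rho> z \<and> \<not> far M (2 * \<rho>) z}. cmod (\<kappa> z)) \<le> D * sqrt (lam / \<rho>)"
    if \<rho>: "lam \<le> \<rho>" for \<rho>
  proof -
    define A where "A = {z \<in> torus M :: (int ^ 'd) set. far M \<rho> z \<and> \<not> far M (2 * \<rho>) z}"
    have r0: "\<rho> \<ge> 1" using lam \<rho> by simp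
    have "card A \<le> card {z \<in> torus M :: (int ^ 'd) set. \<not> far M (2 * \<rho>) z}"
      by (rule card_mono) (auto simp: A_def)
    then have a: "real (card A) \<le> (4 * (2 * \<rho>)) ^ CARD('d)" using near[of "2 * \<rho>"] r0 by linarith
    have "(\<Sum>z\<in>A. (cmod (\<kappa> z))\<^sup>2) \<le> (\<Sum>z\<in>{z \<in> torus M. far M \<rho> z}. (cmod (\<kappa> z))\<^sup>2)"
      by (intro sum_mono2) (auto simp: A_def)
    with tail[OF \<rho>] have b: "(\<Sum>z\<in>A. (cmod (\<kappa> z))\<^sup>2) \<le> CARD('d) * C * lam / \<rho> ^ (CARD('d) + 1)" by linarith
    have "real (card A) * (\<Sum>z\<in>A. (cmod (\<kappa> z))\<^sup>2) \<le> (4 * (2 * \<rho>)) ^ CARD('d) * (CARD('d) * C * lam / \<rho> ^ (CARD('d) + 1))"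
      using r0 by (intro mult_mono a b sum_nonneg) auto
    also have "\<dots> = 8 ^ CARD('d) * CARD('d) * C * (lam / \<rho>)"
      using r0 by (simp add: power_mult_distrib[of 8 \<rho>])
    finally have "sqrt (real (card A) * (\<Sum>z\<in>A. (cmod (\<kappa> z))\<^sup>2)) \<le> D * sqrt (lam / \<rho>)"
      unfolding D_def real_sqrt_mult[symmetric] by (rule real_sqrt_le_mono)
    then show ?thesis using cs[of A] unfolding A_def by linarith
  qed
  show *: "(\<Sum>z\<in>{z \<in> torus M. far M \<rho> z}. cmod (\<kappa> z)) \<le> 4 * D * sqrt (lam / \<rho>)" if \<rho>: "lam \<le> \<rho>" for \<rho>
  proof -
    \<comment> \<open>Downward induction on the radius: beyond \<open>M/2\<close> there are no points. The shells form a geometric series with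
        ratio \<open>sqrt (1/2) \<le> 3/4\<close>, whose sum is at most \<open>4\<close> times the first term.\<close>
    have main: "lam \<le> \<rho> \<Longrightarrow> real M / 2 < 2 ^ L * \<rho> \<Longrightarrow>
      (\<Sum>z\<in>{z \<in> torus M. far M \<rho> z}. cmod (\<kappa> z)) \<le> 4 * D * sqrt (lam / \<rho>)" for L
    proof (induction L arbitrary: \<rho>)
      case 0
      have "tdist M t \<le> real M / 2" for t
        using norm_triangle_ineq4[of "cis (2 * pi / real M * real_of_int t)" 1]
          mult_left_mono[of _ 2 "real M"] by (simp add: tdist_def)
      then have "tdist M t < \<rho>" for t
        using 0(2) by (metis le_less_trans mult_1 power_0)
      then have "\<not> far M \<rho> z" for z :: "int ^ 'd" by (simp add: far_def not_le)
      then show ?case using D0 lam 0 by simp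
    next
      case (Suc L)
      have r0: "\<rho> \<ge> 1" using lam Suc.prems by simp
      have sub: "{z \<in> torus M :: (int ^ 'd) set. far M \<rho> z}
          = {z \<in> torus M. far M \<rho> z \<and> \<not> far M (2 * \<rho>) z} \<union> {z \<in> torus M. far M (2 * \<rho>) z}"
        using r0 far_mono[of M "2 * \<rho>" _ \<rho>] by auto
      have "(\<Sum>z\<in>{z \<in> torus M. far M \<rho> z}. cmod (\<kappa> z))
        = (\<Sum>z\<in>{z \<in> torus M. far M \<rho> z \<and> \<not> far M (2 * \<rho>) z}. cmod (\<kappa> z)) + (\<Sum>z\<in>{z \<in> torus M. far M (2 * \<rho>) z}. cmod (\<kappa> z))"
        unfolding sub by (rule sum.union_disjoint) auto
      also have "\<dots> \<le> D * sqrt (lam / \<rho>) + 4 * D * sqrt (lam / (2 * \<rho>))"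
        using Suc.prems r0 by (intro add_mono shell Suc.IH) (auto simp: mult_ac)
      also have "sqrt (lam / (2 * \<rho>)) \<le> 3 / 4 * sqrt (lam / \<rho>)"
      proof -
        have "sqrt (lam / (2 * \<rho>)) \<le> sqrt ((3 / 4)\<^sup>2 * (lam / \<rho>))"
          using lam r0 by (intro real_sqrt_le_mono) (simp add: field_simps power2_eq_square)
        then show ?thesis unfolding real_sqrt_mult real_sqrt_abs by simp
      qed
      finally show ?case using D0 by (simp add: mult_left_mono)
    qed
    obtain L :: nat where "real M / 2 / \<rho> < 2 ^ L" using real_arch_pow[of 2 "real M / 2 / \<rho>"] by auto
    then have "real M / 2 < 2 ^ L * \<rho>" using lam \<rho> by (simp add: field_simps)
    then show ?thesis using main \<rho> by blast
  qed
  define A where "A = {z \<in> torus M :: (int ^ 'd) set. \<not> far M lam z}"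
  have "(\<Sum>z\<in>A. (cmod (\<kappa> z))\<^sup>2) \<le> C / lam ^ CARD('d)"
    by (rule order.trans[OF sum_mono2 1]) (auto simp: A_def)
  then have "real (card A) * (\<Sum>z\<in>A. (cmod (\<kappa> z))\<^sup>2) \<le> (4 * lam) ^ CARD('d) * (C / lam ^ CARD('d))"
    using near[OF lam] lam unfolding A_def[symmetric] by (intro mult_mono sum_nonneg) auto
  also have "\<dots> = 4 ^ CARD('d) * 1 * C" using lam by (simp add: power_mult_distrib)
  also have "\<dots> \<le> 8 ^ CARD('d) * CARD('d) * C"
  proof (rule mult_right_mono[OF _ C])
    have "(4::real) ^ CARD('d) * 1 \<le> 8 ^ CARD('d) * real CARD('d)"
      by (intro mult_mono power_mono) (auto simp: Suc_leI)
    then show "(4::real) ^ CARD('d) * 1 \<le> real (8 ^ CARD('d) * CARD('d))" by simp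
  qed
  finally have "sqrt (real (card A) * (\<Sum>z\<in>A. (cmod (\<kappa> z))\<^sup>2)) \<le> D"
    unfolding D_def by (rule real_sqrt_le_mono)
  then have "(\<Sum>z\<in>A. cmod (\<kappa> z)) \<le> D" using cs[of A] by linarith
  moreover have "(\<Sum>z\<in>torus M. cmod (\<kappa> z)) = (\<Sum>z\<in>A. cmod (\<kappa> z)) + (\<Sum>z\<in>{z \<in> torus M. far M lam z}. cmod (\<kappa> z))"
  proof -
    have "torus M = A \<union> {z \<in> torus M :: (int ^ 'd) set. far M lam z}" by (auto simp: A_def)
    then show ?thesis
      by (metis (no_types, lifting) A_def disjoint_iff finite_Un finite_atLeastLessThan_int finite_cube mem_Collect_eq sum.union_disjoint)
  qed
  ultimately show "(\<Sum>z\<in>torus M. cmod (\<kappa> z)) \<le> 5 * D"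
    using *[of lam] lam by simp
qed

abbreviation dyadic_kernel :: "nat \<Rightarrow> int \<Rightarrow> nat \<Rightarrow> (real ^ 'd::finite \<Rightarrow> complex) \<Rightarrow> int ^ 'd \<Rightarrow> complex" where
  "dyadic_kernel M N j \<Phi> \<equiv> kernel M (cube {-N..N}) (\<lambda>n. \<Phi> ((1 / 2 ^ j) *\<^sub>R rvec n))"

lemma kernel_L1_bounds:
  fixes F :: "'p \<Rightarrow> real ^ 'd::finite \<Rightarrow> complex"
  assumes F: "wsym I (\<lambda>_. 1) UNIV s 0 F" and s: "CARD('d) + 1 \<le> 2 * s"
    and supp: "\<And>p \<xi>. p \<in> I \<Longrightarrow> 2 \<le> norm \<xi> \<Longrightarrow> F p \<xi> = 0"
  shows "\<exists>C\<ge>0. \<forall>p\<in>I. \<forall>M j N. 2 ^ (j + 1) + int s \<le> N \<longrightarrow> 2 * N < int M \<longrightarrow>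
    (\<Sum>z\<in>torus M. cmod (dyadic_kernel M N j (F p) z)) \<le> C \<and>
    (\<forall>\<rho>. real M / 2 ^ j \<le> \<rho> \<longrightarrow>
      (\<Sum>z\<in>{z \<in> torus M. far M \<rho> z}. cmod (dyadic_kernel M N j (F p) z)) \<le> C * sqrt (real M / 2 ^ j / \<rho>))"
proof -
  from kernel_L2_bounds[OF F supp] obtain C where C: "C \<ge> 0" and
    b: "\<And>p M j N. p \<in> I \<Longrightarrow> 2 ^ (j + 1) + int s \<le> N \<Longrightarrow> 2 * N < int M \<Longrightarrow>
    (\<Sum>z\<in>torus M. (cmod (dyadic_kernel M N j (F p) z))\<^sup>2) \<le> C / (real M / 2 ^ j) ^ CARD('d) \<and>
    (\<forall>i. (\<Sum>z\<in>torus M. tdist M (z $ i) ^ (2 * s) * (cmod (dyadic_kernel M N j (F p) z))\<^sup>2)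
        \<le> C * (real M / 2 ^ j) ^ (2 * s) / (real M / 2 ^ j) ^ CARD('d))" by blast
  define D where "D = sqrt (8 ^ CARD('d) * CARD('d) * C)"
  have D0: "D \<ge> 0" using C by (simp add: D_def)
  have "(\<Sum>z\<in>torus M. cmod (dyadic_kernel M N j (F p) z)) \<le> 5 * D"
    "real M / 2 ^ j \<le> \<rho> \<Longrightarrow>
      (\<Sum>z\<in>{z \<in> torus M. far M \<rho> z}. cmod (dyadic_kernel M N j (F p) z)) \<le> 5 * D * sqrt (real M / 2 ^ j / \<rho>)"
    if p: "p \<in> I" and N: "2 ^ (j + 1) + int s \<le> N" "2 * N < int M" for p M j N \<rho>
  proof -
    have "2 * 2 ^ (j + 1) < int M" using N by linarith
    then have "real_of_int (2 * 2 ^ (j + 1)) < real_of_int (int M)" by (simp only: of_int_less_iff)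
    then have M: "4 * 2 ^ j < real M" by simp
    have M0: "M > 0" using M by (cases M) (auto simp: not_less)
    have lam: "1 \<le> real M / 2 ^ j"
      using M zero_less_power[of "2::real" j] by (simp only: le_divide_eq_1_pos)
    note L = L1_from_weighted_L2[OF lam s C M0, of "dyadic_kernel M N j (F p)", folded D_def]
    show "(\<Sum>z\<in>torus M. cmod (dyadic_kernel M N j (F p) z)) \<le> 5 * D"
      by (rule L(2)) (use b[OF p N] in auto)
    assume \<rho>: "real M / 2 ^ j \<le> \<rho>"
    have "(\<Sum>z\<in>{z \<in> torus M. far M \<rho> z}. cmod (dyadic_kernel M N j (F p) z)) \<le> 4 * D * sqrt (real M / 2 ^ j / \<rho>)"
      by (rule L(1)) (use b[OF p N] \<rho> in auto)
    also have "\<dots> \<le> 5 * D * sqrt (real M / 2 ^ j / \<rho>)"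
      using D0 order.trans[OF lam \<rho>] by (intro mult_right_mono) auto
    finally show "(\<Sum>z\<in>{z \<in> torus M. far M \<rho> z}. cmod (dyadic_kernel M N j (F p) z)) \<le> 5 * D * sqrt (real M / 2 ^ j / \<rho>)" .
  qed
  then show ?thesis using D0 by (intro exI[of _ "5 * D"]) auto
qed

section \<open>The Hoermander condition\<close>

lemma pder_cis:
  fixes \<xi> :: "real ^ 'd::finite"
  shows "pder j (\<lambda>\<xi>. cis (a * \<xi> $ i)) \<xi> ((if j = i then \<i> * of_real a else 0) * cis (a * \<xi> $ i))"
proof (cases "j = i")
  case True
  have "((\<lambda>t. cis (a * (\<xi> $ i + t))) has_vector_derivative \<i> * of_real a * cis (a * (\<xi> $ i))) (at 0)"
  proof -
    have "((\<lambda>z. exp (\<i> * (of_real a * (of_real (\<xi> $ i) + z)))) has_field_derivative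
        \<i> * of_real a * exp (\<i> * (of_real a * of_real (\<xi> $ i)))) (at (of_real 0))"
      by (auto intro!: derivative_eq_intros)
    from has_vector_derivative_real_field[OF this, of UNIV] show ?thesis by (simp add: cis_conv_exp)
  qed
  then show ?thesis by (simp add: pder_def True)
next
  case False
  then show ?thesis by (simp add: pder_def axis_def)
qed

lemma wsym_cis:
  assumes "\<And>p. p \<in> I \<Longrightarrow> \<bar>c p\<bar> \<le> B"
  shows "wsym I (\<lambda>_. 1) U n a (\<lambda>p \<xi>. cis (c p * \<xi> $ d p))"
proof (induction n arbitrary: a)
  case 0
  show ?case by (auto intro!: exI[of _ 1])
next
  case (Suc n)
  show ?case
  proof (rule wsym_SucI)
    fix j
    have "wsym I (\<lambda>_. 1) U n (0 + Suc a) (\<lambda>p \<xi>. (if j = d p then \<i> * of_real (c p) else 0) * cis (c p * \<xi> $ d p))"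
    proof (rule wsym_bilinear[OF bounded_bilinear_mult wsym_const[of _ _ B] Suc])
      fix p assume "p \<in> I"
      then show "cmod (if j = d p then \<i> * of_real (c p) else 0) \<le> B * 1 ^ 0"
        using assms[of p] by (auto simp: norm_mult)
    qed auto
    then show "\<exists>G. (\<forall>p\<in>I. \<forall>\<xi>\<in>U. pder j (\<lambda>\<xi>. cis (c p * \<xi> $ d p)) \<xi> (G p \<xi>)) \<and> wsym I (\<lambda>_. 1) U n (Suc a) G"
      by (intro exI[of _ "\<lambda>p \<xi>. (if j = d p then \<i> * of_real (c p) else 0) * cis (c p * \<xi> $ d p)"]
          conjI ballI pder_cis) simp
  qed (auto intro!: exI[of _ 1])
qed

text \<open>
  The multiplier of a translation by \<open>h\<close>, minus the identity and divided by \<open>h\<close>, converges with all its derivatives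
  as \<open>h\<close> tends to \<open>0\<close>; hence the bounds are uniform in \<open>h\<close>.
\<close>

lemma wsym_cis_quotient:
  assumes "bounded U"
  shows "wsym (UNIV \<times> {0<..1}) (\<lambda>_. 1) U n 0 (\<lambda>(i, h) (\<xi> :: real ^ 'd::finite). (cis (- 2 * pi * h * \<xi> $ i) - 1) / of_real h)"
proof -
  let ?I = "(UNIV :: 'd set) \<times> {0<..1::real}"
  from assms obtain R where R: "\<And>x. x \<in> U \<Longrightarrow> norm x \<le> R" unfolding bounded_iff by blast
  have "cmod ((cis (- 2 * pi * h * \<xi> $ i) - 1) / of_real h) \<le> 2 * pi * R" if "\<xi> \<in> U" "0 < h" for i h and \<xi> :: "real ^ 'd"
  proof -
    have "cmod (cis (- 2 * pi * h * \<xi> $ i) - 1) \<le> 2 * \<bar>(- 2 * pi * h * \<xi> $ i) / 2\<bar>"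
      unfolding norm_cis_minus_1 by (intro mult_left_mono abs_sin_x_le_abs_x) auto
    also have "\<dots> = 2 * pi * h * \<bar>\<xi> $ i\<bar>" using that by (simp add: abs_mult)
    also have "\<dots> \<le> 2 * pi * h * R"
      using that component_le_norm_cart[of \<xi> i] R[OF that(1)] by (intro mult_left_mono) auto
    finally show ?thesis using that(2) by (simp add: norm_divide field_simps)
  qed
  then have b: "\<exists>C. \<forall>p\<in>?I. \<forall>\<xi>\<in>U. norm ((\<lambda>(i, h) (\<xi> :: real ^ 'd). (cis (- 2 * pi * h * \<xi> $ i) - 1) / of_real h) p \<xi>) \<le> C * 1 ^ 0"
    by (intro exI[of _ "2 * pi * R"]) auto
  show ?thesis
  proof (cases n)
    case 0
    then show ?thesis using b by auto
  next
    case (Suc m)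
    show ?thesis unfolding Suc
    proof (rule wsym_SucI[OF b])
      fix j :: 'd
      define G where "G p \<xi> = (if j = fst p then - (2 * pi * \<i>) else 0) * cis ((- 2 * pi * snd p) * \<xi> $ fst p)"
        for p :: "'d \<times> real" and \<xi> :: "real ^ 'd"
      have "wsym ?I (\<lambda>_. 1) U m (0 + Suc 0) G"
        unfolding G_def
        by (rule wsym_bilinear[OF bounded_bilinear_mult wsym_const[of _ _ "2 * pi"] wsym_cis[of _ _ "2 * pi"]])
           (auto simp: norm_mult abs_mult)
      moreover have "pder j ((\<lambda>(i, h) (\<xi> :: real ^ 'd). (cis (- 2 * pi * h * \<xi> $ i) - 1) / of_real h) p) \<xi> (G p \<xi>)"
        if "p \<in> ?I" for p \<xi>
      proof -
        have h: "snd p > 0" using that by auto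
        have "((\<lambda>t. (cis ((- 2 * pi * snd p) * (\<xi> + t *\<^sub>R axis j 1) $ fst p) - 1) / of_real (snd p)) has_vector_derivative
          ((if j = fst p then \<i> * of_real (- 2 * pi * snd p) else 0) * cis ((- 2 * pi * snd p) * \<xi> $ fst p) - 0) / of_real (snd p)) (at 0)"
          using pder_cis[of j "- 2 * pi * snd p" "fst p" \<xi>] unfolding pder_def
          by (intro has_vector_derivative_divide has_vector_derivative_diff has_vector_derivative_const)
        moreover have "((if j = fst p then \<i> * of_real (- 2 * pi * snd p) else 0) * cis ((- 2 * pi * snd p) * \<xi> $ fst p) - 0) / of_real (snd p) = G p \<xi>"
          using h by (simp add: G_def)
        ultimately show ?thesis by (simp add: pder_def case_prod_beta)
      qed
      ultimately show "\<exists>G. (\<forall>p\<in>?I. \<forall>\<xi>\<in>U. pder j ((\<lambda>(i, h) (\<xi> :: real ^ 'd). (cis (- 2 * pi * h * \<xi> $ i) - 1) / of_real h) p) \<xi> (G p \<xi>)) \<and> wsym ?I (\<lambda>_. 1) U m (Suc 0) G"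
        by (intro exI[of _ G]) auto
    qed
  qed
qed

text \<open>
  Translating the kernel by one grid point multiplies the multiplier by a character, which on the rescaled frequency
  variable is a translation by \<open>h = 2\<^sup>j/M\<close>. The difference is \<open>h\<close> times the kernel of a multiplier in a bounded
  class, to which \<open>kernel_L1_bounds\<close> applies.
\<close>

lemma dyadic_kernel_unit_step:
  fixes F :: "'p \<Rightarrow> real ^ 'd::finite \<Rightarrow> complex"
  assumes F: "wsym I (\<lambda>_. 1) UNIV s 0 F" and s: "CARD('d) + 1 \<le> 2 * s"
    and supp: "\<And>p \<xi>. p \<in> I \<Longrightarrow> 2 \<le> norm \<xi> \<Longrightarrow> F p \<xi> = 0"
  shows "\<exists>C\<ge>0. \<forall>p\<in>I. \<forall>M j N i. 2 ^ (j + 1) + int s \<le> N \<longrightarrow> 2 * N < int M \<longrightarrow>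
    (\<Sum>z\<in>torus M. cmod (dyadic_kernel M N j (F p) (z - axis i 1) - dyadic_kernel M N j (F p) z)) \<le> C * (2 ^ j / real M)"
proof -
  define E where "E = (\<lambda>(i :: 'd, h) (\<xi> :: real ^ 'd). (cis (- 2 * pi * h * \<xi> $ i) - 1) / of_real h)"
  define F' where "F' q \<xi> = F (fst q) \<xi> * E (snd q) \<xi>" for q \<xi>
  define I' where "I' = I \<times> (UNIV \<times> {0<..1::real} :: ('d \<times> real) set)"
  define B where "B = ball (0::real ^ 'd) 4"
  have 1: "wsym I' (\<lambda>_. 1) B s 0 (\<lambda>q. F (fst q))"
    by (rule wsym_reindex[OF F]) (auto simp: I'_def)
  have "wsym (UNIV \<times> {0<..1}) (\<lambda>_. 1) B s 0 E"
    unfolding E_def by (rule wsym_cis_quotient) (simp add: B_def)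
  then have 2: "wsym I' (\<lambda>_. 1) B s 0 (\<lambda>q. E (snd q))"
    by (rule wsym_reindex) (auto simp: I'_def)
  have "wsym I' (\<lambda>_. 1) B s 0 F'"
    unfolding F'_def by (rule wsym_mult[OF 1 2])
  then have "wsym I' (\<lambda>_. 1) UNIV s 0 (\<lambda>q \<xi>. if \<xi> \<in> B then F' q \<xi> else 0)"
  proof (rule wsym_zero_extension)
    show "F' q \<xi> = 0" if "q \<in> I'" "\<xi> \<in> B - cball 0 2" for q \<xi>
      using supp that by (auto simp: F'_def I'_def)
  qed (auto simp: B_def)
  then have F': "wsym I' (\<lambda>_. 1) UNIV s 0 F'"
    by (rule wsym_cong[rotated]) (use supp in \<open>auto simp: F'_def I'_def B_def\<close>)
  have "F' q \<xi> = 0" if "q \<in> I'" "2 \<le> norm \<xi>" for q \<xi>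
    using supp that by (auto simp: F'_def I'_def)
  from kernel_L1_bounds[OF F' s this] obtain C where C: "C \<ge> 0"
    "\<And>q M j N. q \<in> I' \<Longrightarrow> 2 ^ (j + 1) + int s \<le> N \<Longrightarrow> 2 * N < int M \<Longrightarrow>
      (\<Sum>z\<in>torus M. cmod (dyadic_kernel M N j (F' q) z)) \<le> C" by blast
  have "(\<Sum>z\<in>torus M. cmod (dyadic_kernel M N j (F p) (z - axis i 1) - dyadic_kernel M N j (F p) z)) \<le> C * (2 ^ j / real M)"
    if p: "p \<in> I" and N: "2 ^ (j + 1) + int s \<le> N" "2 * N < int M" for p M j N i
  proof -
    define h where "h = 2 ^ j / real M"
    have "2 * 2 ^ (j + 1) < int M" using N by linarith
    then have "real_of_int (2 * 2 ^ (j + 1)) < real_of_int (int M)" by (simp only: of_int_less_iff)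
    then have M: "4 * 2 ^ j < real M" by simp
    have M0: "real M > 0" using M zero_less_power[of "2::real" j] by linarith
    have "2 ^ j \<le> real M" using M zero_less_power[of "2::real" j] by linarith
    then have h: "0 < h" "h \<le> 1" using M0 unfolding h_def by (simp_all only: divide_le_eq_1_pos divide_pos_pos zero_less_power zero_less_numeral)
    have ch: "cnj (ch M n (axis i 1)) = cis (- 2 * pi * h * ((1 / 2 ^ j) *\<^sub>R rvec n) $ i)" for n
    proof -
      have "(\<Sum>j\<in>UNIV. real_of_int (n $ j) * real_of_int (axis i 1 $ j)) = n $ i"
        by (simp add: axis_def if_distrib[of real_of_int] if_distrib[of "\<lambda>t. _ * t"] cong: if_cong)
      then show ?thesis by (simp add: ch_def cis_cnj h_def rvec_def mult.assoc)
    qed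
    have "dyadic_kernel M N j (F p) (z - axis i 1) - dyadic_kernel M N j (F p) z
        = of_real h * dyadic_kernel M N j (F' (p, i, h)) z" for z
    proof -
      have "F p ((1 / 2 ^ j) *\<^sub>R rvec n) * ch M n (z - axis i 1) - F p ((1 / 2 ^ j) *\<^sub>R rvec n) * ch M n z
        = of_real h * (F' (p, i, h) ((1 / 2 ^ j) *\<^sub>R rvec n) * ch M n z)" for n
      proof -
        have "cis (- 2 * pi * h * ((1 / 2 ^ j) *\<^sub>R rvec n) $ i) = 1 + of_real h * E (i, h) ((1 / 2 ^ j) *\<^sub>R rvec n)"
          using h(1) by (simp add: E_def)
        then show ?thesis unfolding F'_def ch_diff ch by (simp add: algebra_simps)
      qed
      then show ?thesis
        by (simp add: kernel_def diff_divide_distrib[symmetric] sum_subtractf[symmetric] sum_distrib_left)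
    qed
    then have "(\<Sum>z\<in>torus M. cmod (dyadic_kernel M N j (F p) (z - axis i 1) - dyadic_kernel M N j (F p) z))
        = h * (\<Sum>z\<in>torus M. cmod (dyadic_kernel M N j (F' (p, i, h)) z))"
      using h(1) by (simp add: norm_mult sum_distrib_left)
    also have "\<dots> \<le> h * C"
      using h p N by (intro mult_left_mono C(2)) (auto simp: I'_def)
    finally show ?thesis by (simp add: h_def mult.commute)
  qed
  then show ?thesis using C(1) by blast
qed

text \<open>
  A translation is a chain of unit steps.
\<close>

lemma sum_translate_diff_le:
  fixes k :: "int ^ 'd::finite \<Rightarrow> complex"
  assumes per: "periodic M k" and M: "M > 0"
    and step: "\<And>i. (\<Sum>z\<in>torus M. cmod (k (z - axis i 1) - k z)) \<le> c"
    and w: "\<And>i. 0 \<le> w $ i"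
  shows "(\<Sum>z\<in>torus M. cmod (k (z - w) - k z)) \<le> c * real_of_int (\<Sum>i\<in>UNIV. w $ i)"
  using w
proof (induction "nat (\<Sum>i\<in>UNIV. w $ i)" arbitrary: w)
  case 0
  have nn: "\<And>i. i \<in> UNIV \<Longrightarrow> 0 \<le> w $ i" using 0 by auto
  have "(\<Sum>i\<in>UNIV. w $ i) = 0" using 0 sum_nonneg[of UNIV "\<lambda>i. w $ i"] by simp
  then have "\<forall>i\<in>UNIV. w $ i = 0" using sum_nonneg_eq_0_iff[of UNIV "\<lambda>i. w $ i"] nn by simp
  then have "w = 0" by (simp add: vec_eq_iff)
  then show ?case by simp
next
  case (Suc m)
  have "\<exists>i. 0 < w $ i"
  proof (rule ccontr)
    assume "\<nexists>i. 0 < w $ i"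
    then have "(\<Sum>i\<in>UNIV. w $ i) \<le> 0" by (intro sum_nonpos) (auto simp: not_less)
    then show False using Suc(2) by simp
  qed
  then obtain i where i: "0 < w $ i" by blast
  define v where "v = w - axis i 1"
  have w: "w = v + axis i 1" by (simp add: v_def)
  have s: "(\<Sum>i\<in>UNIV. w $ i) = (\<Sum>i\<in>UNIV. v $ i) + 1"
    by (simp add: w sum.distrib axis_def)
  have v: "0 \<le> v $ j" for j using Suc.prems[of j] i by (auto simp: v_def axis_def)
  have IH: "(\<Sum>z\<in>torus M. cmod (k (z - v) - k z)) \<le> c * real_of_int (\<Sum>i\<in>UNIV. v $ i)"
    by (rule Suc.hyps(1)) (use Suc.hyps(2) s v in auto)
  have per': "periodic M (\<lambda>z. cmod (k (z - axis i 1) - k z))"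
    unfolding periodic_def
  proof (intro allI impI)
    fix a b :: "int ^ 'd" assume ab: "\<forall>i. int M dvd a $ i - b $ i"
    have "k a = k b" "k (a - axis i 1) = k (b - axis i 1)"
      using ab by (auto intro!: periodicD[OF per])
    then show "cmod (k (a - axis i 1) - k a) = cmod (k (b - axis i 1) - k b)" by simp
  qed
  have "(\<Sum>z\<in>torus M. cmod (k (z - w) - k z))
      \<le> (\<Sum>z\<in>torus M. cmod (k ((z + - v) - axis i 1) - k (z + - v)) + cmod (k (z - v) - k z))"
  proof (rule sum_mono)
    fix z
    have "k (z - w) - k z = (k ((z + - v) - axis i 1) - k (z + - v)) + (k (z - v) - k z)"
      by (simp add: w algebra_simps)
    then show "cmod (k (z - w) - k z) \<le> cmod (k ((z + - v) - axis i 1) - k (z + - v)) + cmod (k (z - v) - k z)"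
      using norm_triangle_ineq by metis
  qed
  also have "\<dots> = (\<Sum>z\<in>torus M. cmod (k (z - axis i 1) - k z)) + (\<Sum>z\<in>torus M. cmod (k (z - v) - k z))"
    unfolding sum.distrib sum_torus_shift[OF per' M] ..
  also have "\<dots> \<le> c + c * real_of_int (\<Sum>i\<in>UNIV. v $ i)" by (intro add_mono step IH)
  also have "\<dots> = c * real_of_int (\<Sum>i\<in>UNIV. w $ i)" unfolding s by (simp add: algebra_simps)
  finally show ?case .
qed

text \<open>
  A geometric series with ratio \<open>2\<close> up to the scale \<open>1/a\<close>, and one with ratio \<open>sqrt (1/2) \<le> 3/4\<close> beyond it; the
  bound in the induction is chosen to telescope.
\<close>

lemma sum_dyadic_min_le:
  fixes a :: real
  assumes "a > 0"
  shows "(\<Sum>j\<le>J. if 2 ^ j * a \<le> 1 then 2 ^ j * a else sqrt (1 / (2 ^ j * a))) \<le> 6"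
proof -
  define g where "g r = (if r \<le> 1 then r else sqrt (1 / r))" for r :: real
  have "(\<Sum>j<n. g (2 ^ j * a)) \<le> (if 2 ^ n * a \<le> 1 then 2 ^ n * a else 6 - 4 * sqrt (1 / (2 ^ n * a)))" for n
  proof (induction n)
    case 0
    have "4 * sqrt (1 / a) \<le> 5" if "a > 1"
    proof -
      have "sqrt (1 / a) \<le> 1" using that by simp
      then show ?thesis by linarith
    qed
    then show ?case using assms by auto
  next
    case (Suc n)
    define r where "r = 2 ^ n * a"
    have r0: "r > 0" using assms by (simp add: r_def)
    have e: "2 ^ Suc n * a = 2 * r" by (simp add: r_def)
    have IH: "(\<Sum>j<n. g (2 ^ j * a)) \<le> (if r \<le> 1 then r else 6 - 4 * sqrt (1 / r))"
      using Suc by (simp only: r_def)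
    have "(if r \<le> 1 then r else 6 - 4 * sqrt (1 / r)) + g r \<le> (if 2 * r \<le> 1 then 2 * r else 6 - 4 * sqrt (1 / (2 * r)))"
    proof -
      consider "2 * r \<le> 1" | "2 * r > 1" "r \<le> 1" | "r > 1" by linarith
      then show ?thesis
      proof cases
        case 2
        then have "sqrt (1 / (2 * r)) \<le> 1" by simp
        moreover have "g r = r" "(if r \<le> 1 then r else 6 - 4 * sqrt (1 / r)) = r"
          "(if 2 * r \<le> 1 then 2 * r else 6 - 4 * sqrt (1 / (2 * r))) = 6 - 4 * sqrt (1 / (2 * r))"
          using 2 by (auto simp: g_def)
        ultimately show ?thesis using 2 by linarith
      next
        case 3
        have "sqrt (1 / (2 * r)) \<le> sqrt ((3 / 4)\<^sup>2 * (1 / r))"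
          using r0 by (intro real_sqrt_le_mono) (simp add: field_simps power2_eq_square)
        then have "sqrt (1 / (2 * r)) \<le> 3 / 4 * sqrt (1 / r)" unfolding real_sqrt_mult real_sqrt_abs by simp
        then show ?thesis using 3 by (simp add: g_def)
      qed (simp add: g_def r0)
    qed
    then show ?case using IH unfolding e by (simp add: r_def)
  qed
  from this[of "Suc J"] have "(\<Sum>j\<le>J. g (2 ^ j * a)) \<le> (if 2 ^ Suc J * a \<le> 1 then 2 ^ Suc J * a else 6 - 4 * sqrt (1 / (2 ^ Suc J * a)))"
    by (simp only: lessThan_Suc_atMost)
  also have "\<dots> \<le> 6"
  proof (cases "2 ^ Suc J * a \<le> 1")
    case True
    then show ?thesis unfolding if_P[OF True] by linarith
  next
    case False
    have "0 \<le> sqrt (1 / (2 ^ Suc J * a))" using assms by simp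
    then show ?thesis unfolding if_not_P[OF False] by linarith
  qed
  finally show ?thesis by (simp add: g_def)
qed

text \<open>
  For translations shorter than the natural length \<open>M/2\<^sup>j\<close> of the kernel the smoothness bound is used, for longer
  ones the decay of the tail at both points. The sum over \<open>j\<close> converges on both sides of the transition.
\<close>

lemma dyadic_hoermander:
  fixes F :: "'p \<Rightarrow> real ^ 'd::finite \<Rightarrow> complex"
  assumes F: "wsym I (\<lambda>_. 1) UNIV s 0 F" and s: "CARD('d) + 1 \<le> 2 * s"
    and supp: "\<And>p \<xi>. p \<in> I \<Longrightarrow> 2 \<le> norm \<xi> \<Longrightarrow> F p \<xi> = 0"
  shows "\<exists>C\<ge>0. \<forall>p\<in>I. \<forall>M J N w \<rho>. 2 ^ (J + 1) + int s \<le> N \<longrightarrow> 2 * N < int M \<longrightarrow> 1 \<le> \<rho> \<longrightarrow>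
     (\<forall>i. 0 \<le> w $ i \<and> real_of_int (w $ i) < \<rho>) \<longrightarrow>
    (\<Sum>j\<le>J. \<Sum>x\<in>{x \<in> torus M. far M (4 * \<rho>) x}. cmod (dyadic_kernel M N j (F p) (x - w) - dyadic_kernel M N j (F p) x)) \<le> C"
proof -
  obtain C1 where C1: "C1 \<ge> 0"
    "\<And>p M j N \<rho>. p \<in> I \<Longrightarrow> 2 ^ (j + 1) + int s \<le> N \<Longrightarrow> 2 * N < int M \<Longrightarrow> real M / 2 ^ j \<le> \<rho> \<Longrightarrow>
      (\<Sum>z\<in>{z \<in> torus M. far M \<rho> z}. cmod (dyadic_kernel M N j (F p) z)) \<le> C1 * sqrt (real M / 2 ^ j / \<rho>)"
    using kernel_L1_bounds[OF F s supp] by blast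
  obtain C2 where C2: "C2 \<ge> 0"
    "\<And>p M j N i. p \<in> I \<Longrightarrow> 2 ^ (j + 1) + int s \<le> N \<Longrightarrow> 2 * N < int M \<Longrightarrow>
    (\<Sum>z\<in>torus M. cmod (dyadic_kernel M N j (F p) (z - axis i 1) - dyadic_kernel M N j (F p) z)) \<le> C2 * (2 ^ j / real M)"
    using dyadic_kernel_unit_step[OF F s supp] by blast
  define C where "C = 2 * C1 + C2 * CARD('d)"
  have C0: "C \<ge> 0" using C1 C2 by (simp add: C_def)
  have "(\<Sum>j\<le>J. \<Sum>x\<in>{x \<in> torus M. far M (4 * \<rho>) x}. cmod (dyadic_kernel M N j (F p) (x - w) - dyadic_kernel M N j (F p) x)) \<le> C * 6"
    if p: "p \<in> I" and N: "2 ^ (J + 1) + int s \<le> N" "2 * N < int M" and \<rho>: "1 \<le> \<rho>"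
      and w: "\<forall>i. 0 \<le> w $ i \<and> real_of_int (w $ i) < \<rho>" for p M J N w \<rho>
  proof -
    have "(0::int) < 2 ^ (J + 1)" by simp
    then have M: "M > 0" using N by linarith
    define a where "a = \<rho> / real M"
    have a: "a > 0" using \<rho> M by (simp add: a_def)
    have "(\<Sum>x\<in>{x \<in> torus M. far M (4 * \<rho>) x}. cmod (dyadic_kernel M N j (F p) (x - w) - dyadic_kernel M N j (F p) x))
      \<le> C * (if 2 ^ j * a \<le> 1 then 2 ^ j * a else sqrt (1 / (2 ^ j * a)))" if j: "j \<le> J" for j
    proof -
      define k where "k = dyadic_kernel M N j (F p)"
      have per: "periodic M k" unfolding k_def by (rule periodic_kernel[OF M])
      have "(2::int) ^ (j + 1) \<le> 2 ^ (J + 1)" using j by (intro power_increasing) auto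
      then have Nj: "2 ^ (j + 1) + int s \<le> N" using N by linarith
      show ?thesis
      proof (cases "2 ^ j * a \<le> 1")
        case True
        have "(\<Sum>x\<in>{x \<in> torus M. far M (4 * \<rho>) x}. cmod (k (x - w) - k x)) \<le> (\<Sum>x\<in>torus M. cmod (k (x - w) - k x))"
          by (intro sum_mono2) auto
        also have "\<dots> \<le> C2 * (2 ^ j / real M) * real_of_int (\<Sum>i\<in>UNIV. w $ i)"
          by (rule sum_translate_diff_le[OF per M]) (use C2(2)[OF p Nj N(2)] w in \<open>auto simp: k_def\<close>)
        also have "\<dots> \<le> C2 * (2 ^ j / real M) * (CARD('d) * \<rho>)"
        proof (intro mult_left_mono)
          have "(\<Sum>i\<in>UNIV. real_of_int (w $ i)) \<le> (\<Sum>i\<in>(UNIV::'d set). \<rho>)"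
            using w by (intro sum_mono) (auto intro: less_imp_le)
          then show "real_of_int (\<Sum>i\<in>UNIV. w $ i) \<le> CARD('d) * \<rho>" by simp
        qed (use C2 in auto)
        also have "\<dots> = C2 * CARD('d) * (2 ^ j * a)" by (simp add: a_def)
        also have "\<dots> \<le> C * (2 ^ j * a)" using a C1(1) by (intro mult_right_mono) (auto simp: C_def)
        finally show ?thesis using True by (simp add: k_def)
      next
        case False
        then have lam: "real M / 2 ^ j \<le> \<rho>" using M by (simp add: a_def field_simps)
        define H where "H x = (if far M \<rho> x then cmod (k x) else 0)" for x
        have perH: "periodic M H"
          unfolding periodic_def
        proof (intro allI impI)
          fix a b :: "int ^ 'd" assume ab: "\<forall>i. int M dvd a $ i - b $ i"
          have "far M \<rho> a = far M \<rho> b" using ab by (intro periodicD[OF periodic_far]) auto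
          moreover have "k a = k b" using ab by (auto intro!: periodicD[OF per])
          ultimately show "H a = H b" by (simp add: H_def)
        qed
        have f1: "far M \<rho> x" if "far M (4 * \<rho>) x" for x :: "int ^ 'd"
          using far_mono[OF that, of \<rho>] \<rho> by simp
        have f2: "far M \<rho> (x - w)" if far: "far M (4 * \<rho>) x" for x :: "int ^ 'd"
        proof -
          from far obtain i where i: "4 * \<rho> \<le> tdist M (x $ i)" by (auto simp: far_def)
          have "tdist M (x $ i) \<le> tdist M ((x - w) $ i) + tdist M (w $ i)"
            using tdist_triangle[of M "(x - w) $ i" "w $ i"] by simp
          moreover have "tdist M (w $ i) \<le> 2 * \<bar>real_of_int (w $ i)\<bar>" by (rule tdist_le)
          moreover have "\<bar>real_of_int (w $ i)\<bar> < \<rho>" using w by auto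
          ultimately have "\<rho> \<le> tdist M ((x - w) $ i)" using i \<rho> by linarith
          then show ?thesis by (auto simp: far_def)
        qed
        have S: "(\<Sum>x\<in>torus M. H x) = (\<Sum>x\<in>{x \<in> torus M. far M \<rho> x}. cmod (k x))"
          by (simp add: H_def sum.If_cases Int_def)
        have "(\<Sum>x\<in>{x \<in> torus M. far M (4 * \<rho>) x}. cmod (k (x - w) - k x))
            \<le> (\<Sum>x\<in>{x \<in> torus M. far M (4 * \<rho>) x}. H (x + - w) + H x)"
          using f1 f2 by (intro sum_mono) (auto simp: H_def norm_triangle_ineq4)
        also have "\<dots> \<le> (\<Sum>x\<in>torus M. H (x + - w) + H x)"
          by (intro sum_mono2) (auto simp: H_def)
        also have "\<dots> = 2 * (\<Sum>x\<in>{x \<in> torus M. far M \<rho> x}. cmod (k x))"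
          unfolding sum.distrib sum_torus_shift[OF perH M] S by simp
        also have "\<dots> \<le> 2 * (C1 * sqrt (real M / 2 ^ j / \<rho>))"
          unfolding k_def by (intro mult_left_mono C1(2)[OF p Nj N(2) lam]) auto
        also have "real M / 2 ^ j / \<rho> = 1 / (2 ^ j * a)" by (simp add: a_def field_simps)
        also have "2 * (C1 * sqrt (1 / (2 ^ j * a))) \<le> C * sqrt (1 / (2 ^ j * a))"
          unfolding mult.assoc[symmetric] using a C2(1) by (intro mult_right_mono) (auto simp: C_def)
        finally show ?thesis using False by (simp add: k_def)
      qed
    qed
    then have "(\<Sum>j\<le>J. \<Sum>x\<in>{x \<in> torus M. far M (4 * \<rho>) x}. cmod (dyadic_kernel M N j (F p) (x - w) - dyadic_kernel M N j (F p) x))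
      \<le> (\<Sum>j\<le>J. C * (if 2 ^ j * a \<le> 1 then 2 ^ j * a else sqrt (1 / (2 ^ j * a))))"
      by (intro sum_mono) auto
    also have "\<dots> \<le> C * 6"
      unfolding sum_distrib_left[symmetric] using C0 sum_dyadic_min_le[OF a] by (intro mult_left_mono) auto
    finally show ?thesis .
  qed
  then show ?thesis using C0 by (intro exI[of _ "C * 6"]) auto
qed

section \<open>The weak-type multiplier theorem\<close>

lemma step_bounds: "0 \<le> step m r" "step m r \<le> 1"
proof -
  have a: "0 \<le> max 0 (4 - r) ^ m" "0 \<le> max 0 (r - 1) ^ m" by (auto intro!: zero_le_power)
  show "0 \<le> step m r" unfolding step_def using a by (intro mult_nonneg_nonneg) auto
  have "x * inverse (x + y) \<le> 1" if "0 \<le> x" "0 \<le> y" for x y :: real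
    using that by (cases "x + y = 0") (simp_all add: divide_inverse[symmetric])
  then show "step m r \<le> 1" unfolding step_def using a by blast
qed

lemma abs_sum_annular_bump_le:
  "\<bar>\<Sum>j\<le>J. annular_bump m ((1 / 2 ^ j) *\<^sub>R \<xi>)\<bar> \<le> 1"
  unfolding sum_annular_bump_telescope
  using step_bounds[of m "(norm \<xi>)\<^sup>2 / 4 ^ J"] step_bounds[of m "4 * (norm \<xi>)\<^sup>2"] by linarith

lemma norm_rvec_ge_1:
  assumes "n \<noteq> 0" shows "1 \<le> norm (rvec n)"
proof -
  from assms obtain i where i: "n $ i \<noteq> 0" by (auto simp: vec_eq_iff)
  then have "1 \<le> \<bar>real_of_int (n $ i)\<bar>" by linarith
  also have "\<dots> \<le> norm (rvec n)" using component_le_norm_cart[of "rvec n" i] by (simp add: rvec_def)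
  finally show ?thesis .
qed

text \<open>
  The multiplier is cut off smoothly at frequencies of size \<open>2\<^sup>J\<close> by the dyadic partition of unity. By invariance
  under dilation by \<open>1/2\<close> all dyadic pieces are rescalings of the single function \<open>F p\<close>. The bump
  functions vanish at \<open>0\<close>, so frequency \<open>0\<close> is added by hand; its kernel is constant and drops out of the
  Hoermander condition.
\<close>

theorem multiplier_weak_type:
  fixes m :: "'p \<Rightarrow> real ^ 'd::finite \<Rightarrow> complex"
  assumes m: "wsym I (\<lambda>_. 1) {\<xi>. 1 / 4 < norm \<xi> \<and> norm \<xi> < 4} s 0 m" and s: "CARD('d) + 1 \<le> 2 * s"
    and hom: "\<And>p \<xi>. p \<in> I \<Longrightarrow> \<xi> \<noteq> 0 \<Longrightarrow> m p ((1 / 2) *\<^sub>R \<xi>) = m p \<xi>"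
    and bnd: "\<And>p \<xi>. p \<in> I \<Longrightarrow> cmod (m p \<xi>) \<le> B"
  shows "\<exists>C>0. \<forall>p\<in>I. \<forall>J q. 2 * (2 ^ (J + 1) + int s) < 2 ^ q \<longrightarrow>
    (\<exists>k. (\<forall>n x. norm (rvec n) \<le> 2 ^ J \<longrightarrow> conv (2 ^ q) k (ch (2 ^ q) n) x = m p (rvec n) * ch (2 ^ q) n x) \<and>
      (\<forall>f t. 0 < t \<longrightarrow> t * real (card {x \<in> torus (2 ^ q). t < cmod (conv (2 ^ q) k f x)})
        \<le> C * (\<Sum>y\<in>torus (2 ^ q). cmod (f y))))"
proof -
  define U where "U = {\<xi> :: real ^ 'd. 1 / 4 < norm \<xi> \<and> norm \<xi> < 4}"
  define S where "S = {\<xi> :: real ^ 'd. 1 / 2 \<le> norm \<xi> \<and> norm \<xi> \<le> 2}"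
  from s obtain s' where s': "s = Suc s'" by (cases s) auto
  define F where "F p \<xi> = of_real (annular_bump (Suc s) \<xi>) * m p \<xi>" for p \<xi>
  have bU: "bounded U" unfolding U_def bounded_iff by (rule exI[of _ 4]) auto
  have oU: "open U" unfolding U_def
    by (intro open_Collect_conj open_Collect_less continuous_intros)
  have cS: "closed S" unfolding S_def
    by (intro closed_Collect_conj closed_Collect_le continuous_intros)
  have SU: "S \<subseteq> U" by (auto simp: S_def U_def)
  have F0: "F p \<xi> = 0" if "\<xi> \<notin> S" for p \<xi>
    using that by (auto simp: F_def S_def intro!: annular_bump_eq_0)
  have "wsym I (\<lambda>_. 1) U s 0 (\<lambda>p \<xi>. complex_of_real (annular_bump (Suc s) \<xi>))"
    by (rule wsym_linear[OF bounded_linear_of_real wsym_annular_bump[OF bU]]) simp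
  then have "wsym I (\<lambda>_. 1) U s 0 F"
    unfolding F_def using m unfolding U_def by (intro wsym_mult)
  then have "wsym I (\<lambda>_. 1) UNIV s 0 (\<lambda>p \<xi>. if \<xi> \<in> U then F p \<xi> else 0)"
    by (rule wsym_zero_extension[OF _ oU cS SU]) (use F0 in auto)
  then have wF: "wsym I (\<lambda>_. 1) UNIV s 0 F"
    by (rule wsym_cong[rotated]) (use F0 SU in auto)
  have supp: "F p \<xi> = 0" if "2 \<le> norm \<xi>" for p \<xi>
    using that by (simp add: F_def annular_bump_eq_0)
  from dyadic_hoermander[OF wF s supp] obtain C where C: "C \<ge> 0"
    "\<And>p M J N w \<rho>. p \<in> I \<Longrightarrow> 2 ^ (J + 1) + int s \<le> N \<Longrightarrow> 2 * N < int M \<Longrightarrow> 1 \<le> \<rho> \<Longrightarrow>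
     (\<forall>i. 0 \<le> w $ i \<and> real_of_int (w $ i) < \<rho>) \<Longrightarrow>
    (\<Sum>j\<le>J. \<Sum>x\<in>{x \<in> torus M. far M (4 * \<rho>) x}. cmod (dyadic_kernel M N j (F p) (x - w) - dyadic_kernel M N j (F p) x)) \<le> C"
    by blast
  define H where "H = C + \<bar>B\<bar> + 1"
  have H: "H > 0" "C \<le> H" "\<bar>B\<bar> \<le> H" using C(1) by (auto simp: H_def)
  have homj: "m p ((1 / 2 ^ j) *\<^sub>R \<xi>) = m p \<xi>" if "p \<in> I" "\<xi> \<noteq> 0" for p j \<xi>
  proof (induction j)
    case (Suc j)
    have "(1 / 2 ^ Suc j) *\<^sub>R \<xi> = (1 / 2) *\<^sub>R ((1 / 2 ^ j) *\<^sub>R \<xi>)" by simp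
    then show ?case using hom[OF that(1), of "(1 / 2 ^ j) *\<^sub>R \<xi>"] that(2) Suc by simp
  qed simp
  have main: "\<exists>k. (\<forall>n x. norm (rvec n) \<le> 2 ^ J \<longrightarrow> conv (2 ^ q) k (ch (2 ^ q) n) x = m p (rvec n) * ch (2 ^ q) n x) \<and>
      (\<forall>f t. 0 < t \<longrightarrow> t * real (card {x \<in> torus (2 ^ q). t < cmod (conv (2 ^ q) k f x)})
        \<le> (4 * 2 ^ CARD('d) + 16 ^ CARD('d) + 4) * H * (\<Sum>y\<in>torus (2 ^ q). cmod (f y)))"
    if p: "p \<in> I" and q: "2 * (2 ^ (J + 1) + int s) < 2 ^ q" for p J q
  proof -
    define N where "N = 2 ^ (J + 1) + int s"
    define M where "M = (2::nat) ^ q"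
    define c where "c n = (\<Sum>j\<le>J. F p ((1 / 2 ^ j) *\<^sub>R rvec n)) + (if n = 0 then m p 0 else 0)" for n
    define k where "k = kernel M (cube {-N..N}) c"
    have M: "M > 0" by (simp add: M_def)
    have N: "2 ^ (J + 1) + int s \<le> N" "2 * N < int M" using q by (auto simp: N_def M_def)
    have sep: "separated M (cube {-N..N} :: (int ^ 'd) set)" by (rule separated_cube[OF N(2)])
    have rvec0: "rvec 0 = (0 :: real ^ 'd)" by (simp add: rvec_def vec_eq_iff)
    have c0: "c 0 = m p 0"
      using F0[of 0] by (simp add: c_def rvec0 S_def)
    have cn: "c n = of_real (\<Sum>j\<le>J. annular_bump (Suc s) ((1 / 2 ^ j) *\<^sub>R rvec n)) * m p (rvec n)" if "n \<noteq> 0" for n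
    proof -
      have "rvec n \<noteq> 0" using norm_rvec_ge_1[OF that] by auto
      then have "F p ((1 / 2 ^ j) *\<^sub>R rvec n) = of_real (annular_bump (Suc s) ((1 / 2 ^ j) *\<^sub>R rvec n)) * m p (rvec n)" for j
        using homj[OF p] by (simp add: F_def)
      then show ?thesis using that by (simp add: c_def sum_distrib_right)
    qed
    have cB: "cmod (c n) \<le> H" for n
    proof (cases "n = 0")
      case True
      then show ?thesis using bnd[OF p, of 0] H(3) c0 by simp
    next
      case False
      have "cmod (c n) = \<bar>\<Sum>j\<le>J. annular_bump (Suc s) ((1 / 2 ^ j) *\<^sub>R rvec n)\<bar> * cmod (m p (rvec n))"
        unfolding cn[OF False] norm_mult norm_of_real ..
      also have "\<dots> \<le> 1 * B"
        by (intro mult_mono abs_sum_annular_bump_le bnd[OF p]) auto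
      finally show ?thesis using H(3) by simp
    qed
    have cm: "c n = m p (rvec n)" if "norm (rvec n) \<le> 2 ^ J" for n
    proof (cases "n = 0")
      case True
      then show ?thesis by (simp add: c0 rvec0)
    next
      case False
      then show ?thesis unfolding cn[OF False]
        using sum_annular_bump[OF _ norm_rvec_ge_1[OF False] that, of "Suc s"] by simp
    qed
    have "conv M k (ch M n) x = m p (rvec n) * ch M n x" if n: "norm (rvec n) \<le> 2 ^ J" for n x
    proof -
      have "\<bar>n $ i\<bar> \<le> N" for i
      proof -
        have "\<bar>real_of_int (n $ i)\<bar> \<le> 2 ^ J"
          using component_le_norm_cart[of "rvec n" i] n by (simp add: rvec_def)
        then have "real_of_int \<bar>n $ i\<bar> \<le> real_of_int (2 ^ J)" by simp
        then have "\<bar>n $ i\<bar> \<le> 2 ^ J" by (simp only: of_int_le_iff)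
        also have "(2::int) ^ J \<le> 2 ^ (J + 1)" by (intro power_increasing) auto
        finally show ?thesis by (simp add: N_def)
      qed
      then have "n \<in> cube {-N..N}" by (auto simp: cube_def abs_le_iff minus_le_iff)
      from conv_kernel_ch[OF M sep this] show ?thesis by (simp add: k_def cm[OF n])
    qed
    moreover have "t * real (card {x \<in> torus M. t < cmod (conv M k f x)})
        \<le> (4 * 2 ^ CARD('d) + 16 ^ CARD('d) + 4) * H * (\<Sum>y\<in>torus M. cmod (f y))" if t: "t > 0" for f t
      unfolding M_def
    proof (rule calderon_zygmund[OF _ H(1) t])
      show "periodic (2 ^ q) k" unfolding k_def M_def by (rule periodic_kernel) simp
      show "(\<Sum>x\<in>torus (2 ^ q). (cmod (conv (2 ^ q) k g x))\<^sup>2) \<le> H\<^sup>2 * (\<Sum>x\<in>torus (2 ^ q). (cmod (g x))\<^sup>2)" for g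
        unfolding k_def M_def[symmetric] by (rule L2_bound_kernel[OF M sep cB])
      fix w :: "int ^ 'd" and \<rho> :: real
      assume \<rho>: "1 \<le> \<rho>" "\<forall>i. 0 \<le> w $ i \<and> real_of_int (w $ i) < \<rho>"
      have kz: "k z = (\<Sum>j\<le>J. dyadic_kernel M N j (F p) z) + m p 0 / of_nat M ^ CARD('d)" for z
      proof -
        have "(0::int) < 2 ^ (J + 1)" by simp
        then have "0 \<le> N" unfolding N_def by linarith
        then have z: "(0 :: int ^ 'd) \<in> cube {-N..N}" by (simp add: cube_def)
        have "(\<Sum>n\<in>cube {-N..N}. c n * ch M n z)
          = (\<Sum>n\<in>cube {-N..N}. (\<Sum>j\<le>J. F p ((1 / 2 ^ j) *\<^sub>R rvec n) * ch M n z) + (if n = 0 then m p 0 * ch M 0 z else 0))"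
          by (intro sum.cong refl) (auto simp: c_def ring_distribs sum_distrib_right)
        also have "\<dots> = (\<Sum>j\<le>J. \<Sum>n\<in>cube {-N..N}. F p ((1 / 2 ^ j) *\<^sub>R rvec n) * ch M n z) + m p 0 * ch M 0 z"
          unfolding sum.distrib using z by (subst sum.swap) simp
        also have "ch M 0 z = 1" by (simp add: ch_def)
        finally show ?thesis
          by (simp add: k_def kernel_def add_divide_distrib sum_divide_distrib)
      qed
      have "(\<Sum>x\<in>{x \<in> torus M. far M (4 * \<rho>) x}. cmod (k (x - w) - k x))
        \<le> (\<Sum>x\<in>{x \<in> torus M. far M (4 * \<rho>) x}. \<Sum>j\<le>J. cmod (dyadic_kernel M N j (F p) (x - w) - dyadic_kernel M N j (F p) x))"
        unfolding kz by (intro sum_mono) (simp add: sum_subtractf[symmetric] norm_sum)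
      also have "\<dots> = (\<Sum>j\<le>J. \<Sum>x\<in>{x \<in> torus M. far M (4 * \<rho>) x}. cmod (dyadic_kernel M N j (F p) (x - w) - dyadic_kernel M N j (F p) x))"
        by (rule sum.swap)
      also have "\<dots> \<le> C" by (rule C(2)[OF p N \<rho>])
      finally show "(\<Sum>x\<in>{x \<in> torus (2 ^ q). far (2 ^ q) (4 * \<rho>) x}. cmod (k (x - w) - k x)) \<le> H"
        using H(2) by (simp add: M_def)
    qed
    ultimately show ?thesis unfolding M_def by blast
  qed
  have "0 < (4 * 2 ^ CARD('d) + 16 ^ CARD('d) + 4) * H"
    using H(1) by (intro mult_pos_pos add_pos_pos) auto
  with main show ?thesis by blast
qed

section \<open>Integrals of partial derivatives\<close>

lemma integrable_compact_support:
  fixes f :: "'a::euclidean_space \<Rightarrow> 'b::{banach, second_countable_topology}"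
  assumes "compact S" "continuous_on UNIV f" "\<And>x. x \<notin> S \<Longrightarrow> f x = 0"
  shows "integrable lborel f"
proof -
  have "integrable lborel (\<lambda>x. indicator S x *\<^sub>R f x)"
    by (rule borel_integrable_compact[OF assms(1) continuous_on_subset[OF assms(2)]]) simp
  moreover have "(\<lambda>x. indicator S x *\<^sub>R f x) = f"
    using assms(3) by (auto simp: indicator_def fun_eq_iff)
  ultimately show ?thesis by simp
qed

lemma integral_translate:
  fixes f :: "'a::euclidean_space \<Rightarrow> 'b::{banach, second_countable_topology}"
  assumes "f \<in> borel_measurable borel"
  shows "(\<integral>x. f (x + c) \<partial>lborel) = (\<integral>x. f x \<partial>lborel)"
proof -
  have "(\<integral>x. f x \<partial>lborel) = (\<integral>x. f x \<partial>distr lborel borel ((+) c))"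
    by (simp add: lborel_distr_plus)
  also have "\<dots> = (\<integral>x. f (c + x) \<partial>lborel)" using assms by (intro integral_distr) auto
  finally show ?thesis by (simp add: add.commute)
qed

lemma integral_reflect:
  fixes f :: "'a::euclidean_space \<Rightarrow> 'b::{banach, second_countable_topology}"
  assumes "f \<in> borel_measurable borel"
  shows "(\<integral>y. f (c - y) \<partial>lborel) = (\<integral>x. f x \<partial>lborel)"
proof -
  have "distr lborel borel (\<lambda>y. c - y) = (lborel :: 'a measure)"
    using lborel_affine[of "-1" c] by (simp add: density_1 one_ennreal_def[symmetric])
  then have "(\<integral>x. f x \<partial>lborel) = (\<integral>x. f x \<partial>distr lborel borel (\<lambda>y. c - y))" by simp
  also have "\<dots> = (\<integral>y. f (c - y) \<partial>lborel)" using assms by (intro integral_distr) auto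
  finally show ?thesis ..
qed

text \<open>
  The integral of a difference quotient vanishes by translation invariance; the quotients converge boundedly on a
  fixed ball.
\<close>

lemma integral_pder_eq_0:
  fixes f g :: "real ^ 'd::finite \<Rightarrow> 'v::euclidean_space"
  assumes S: "compact S" and f: "continuous_on UNIV f" "\<And>x. x \<notin> S \<Longrightarrow> f x = 0"
    and g: "continuous_on UNIV g" "\<And>x. x \<notin> S \<Longrightarrow> g x = 0" and p: "\<And>x. pder i f x (g x)"
  shows "(\<integral>x. g x \<partial>lborel) = 0"
proof -
  obtain R where R: "\<And>x. x \<in> S \<Longrightarrow> norm x \<le> R" using compact_imp_bounded[OF S] unfolding bounded_iff by blast
  have "bounded (g ` S)" by (intro compact_imp_bounded compact_continuous_image continuous_on_subset[OF g(1)] S) simp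
  then obtain B where B: "B > 0" "\<And>x. x \<in> S \<Longrightarrow> norm (g x) \<le> B" unfolding bounded_pos by auto
  have gB: "norm (g x) \<le> B" for x using B g(2)[of x] by (cases "x \<in> S") auto
  define h where "h n = 1 / real (Suc n)" for n
  have h: "0 < h n" "h n \<le> 1" for n by (auto simp: h_def)
  have h0: "h \<longlonglongrightarrow> 0" unfolding h_def using LIMSEQ_inverse_real_of_nat by (simp add: inverse_eq_divide)
  define q where "q n x = (1 / h n) *\<^sub>R (f (x + h n *\<^sub>R axis i 1) - f x)" for n x
  have fi: "integrable lborel f" by (rule integrable_compact_support[OF S f])
  have fm: "f \<in> borel_measurable borel" by (rule borel_measurable_continuous_onI[OF f(1)])
  have gm: "g \<in> borel_measurable borel" by (rule borel_measurable_continuous_onI[OF g(1)])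
  have qm: "q n \<in> borel_measurable borel" for n unfolding q_def using fm by measurable
  have q0: "(\<integral>x. q n x \<partial>lborel) = 0" for n
  proof -
    have "integrable lborel (\<lambda>x. f (x + h n *\<^sub>R axis i 1))"
    proof (rule integrable_compact_support)
      show "compact ((\<lambda>x. x - h n *\<^sub>R axis i 1) ` S)"
        by (intro compact_continuous_image S continuous_intros)
      show "continuous_on UNIV (\<lambda>x. f (x + h n *\<^sub>R axis i 1))"
        by (intro continuous_on_compose2[OF f(1)] continuous_intros) auto
      show "f (x + h n *\<^sub>R axis i 1) = 0" if "x \<notin> (\<lambda>x. x - h n *\<^sub>R axis i 1) ` S" for x
        using that by (intro f(2)) (metis add_diff_cancel image_eqI)
    qed
    then show ?thesis unfolding q_def using fi integral_translate[OF fm] by simp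
  qed
  have "(\<lambda>n. \<integral>x. q n x \<partial>lborel) \<longlonglongrightarrow> (\<integral>x. g x \<partial>lborel)"
  proof (rule integral_dominated_convergence[where w = "\<lambda>x. indicator (cball 0 (R + 1)) x *\<^sub>R B"])
    show "integrable lborel (\<lambda>x::real ^ 'd. indicator (cball 0 (R + 1)) x *\<^sub>R B)"
      by (rule borel_integrable_compact[OF compact_cball continuous_on_const])
    have "(\<lambda>n. q n x) \<longlonglongrightarrow> g x" for x
    proof -
      have "filterlim h (at 0) sequentially"
        by (rule filterlim_atI[OF h0]) (use h(1) in \<open>simp add: less_imp_neq[symmetric]\<close>)
      from filterlim_compose[OF pder_iff_tendsto[THEN iffD1, OF p[of x]] this] show ?thesis by (simp only: q_def)
    qed
    then show "AE x in lborel. (\<lambda>n. q n x) \<longlonglongrightarrow> g x" by simp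
    have "norm (q n x) \<le> indicator (cball 0 (R + 1)) x *\<^sub>R B" for n x
    proof (cases "x \<in> cball 0 (R + 1)")
      case True
      have "norm (f (x + h n *\<^sub>R axis i 1) - f x) \<le> B * \<bar>h n\<bar>" by (rule norm_fdiff_le[OF p gB, unfolded fdiff_def])
      then show ?thesis using True h(1)[of n] unfolding q_def norm_scaleR by (simp add: field_simps)
    next
      case False
      then have nx: "norm x > R + 1" by simp
      have "norm x \<le> norm (x + h n *\<^sub>R axis i 1) + norm (h n *\<^sub>R (axis i 1 :: real ^ 'd))"
        by (metis add_diff_cancel norm_triangle_ineq4)
      then have "R < norm (x + h n *\<^sub>R axis i 1)" using nx h[of n] by (simp add: norm_axis_1)
      then have "x + h n *\<^sub>R axis i 1 \<notin> S" "x \<notin> S" using R[of "x + h n *\<^sub>R axis i 1"] R[of x] nx by auto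
      then show ?thesis using False by (simp add: q_def f(2))
    qed
    then show "\<And>n. AE x in lborel. norm (q n x) \<le> indicator (cball 0 (R + 1)) x *\<^sub>R B" by simp
  qed (use qm gm in auto)
  then show ?thesis unfolding q0 using LIMSEQ_unique tendsto_const by blast
qed

section \<open>Fourier transform of test functions\<close>

text \<open>
  The Fourier transform is \<open>cos_transform w - \<i> * sin_transform w\<close>. Keeping the two parts separate
  keeps them in the real space that the symbol acts on.
\<close>

definition cos_transform :: "(real ^ 'd::finite \<Rightarrow> 'v::euclidean_space) \<Rightarrow> real ^ 'd \<Rightarrow> 'v" where
  "cos_transform w \<xi> = (\<integral>x. cos (\<xi> \<bullet> x) *\<^sub>R w x \<partial>lborel)"

definition sin_transform :: "(real ^ 'd::finite \<Rightarrow> 'v::euclidean_space) \<Rightarrow> real ^ 'd \<Rightarrow> 'v" where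
  "sin_transform w \<xi> = (\<integral>x. sin (\<xi> \<bullet> x) *\<^sub>R w x \<partial>lborel)"

lemma pder_frechet:
  assumes "w differentiable (at x)" shows "pder i w x (pderiv_dir i w x)"
proof -
  have "(w has_derivative frechet_derivative w (at x)) (at x)"
    using assms frechet_derivative_works by blast
  then have 1: "(w has_derivative frechet_derivative w (at x)) (at (x + 0 *\<^sub>R axis i 1))" by simp
  have 2: "((\<lambda>t. x + t *\<^sub>R axis i 1) has_derivative (\<lambda>t. t *\<^sub>R axis i 1)) (at (0::real))"
    by (auto intro!: derivative_eq_intros)
  have l: "linear (frechet_derivative w (at x))" by (rule linear_frechet_derivative[OF assms])
  from has_derivative_compose[OF 2 1] show ?thesis
    unfolding pder_def has_vector_derivative_def pderiv_dir_def by (simp add: linear_cmul[OF l])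
qed

lemma pder_cos_inner: "pder i (\<lambda>x. cos (\<xi> \<bullet> x)) x (- \<xi> $ i * sin (\<xi> \<bullet> x))"
  and pder_sin_inner: "pder i (\<lambda>x. sin (\<xi> \<bullet> x)) x (\<xi> $ i * cos (\<xi> \<bullet> x))"
  unfolding pder_def has_real_derivative_iff_has_vector_derivative[symmetric]
  by (auto intro!: derivative_eq_intros simp: inner_axis inner_add_right)

lemma pder_scaleR:
  assumes "pder i a x a'" "pder i w x w'"
  shows "pder i (\<lambda>x. a x *\<^sub>R w x) x (a x *\<^sub>R w' + a' *\<^sub>R w x)"
  using bounded_bilinear.has_vector_derivative[OF bounded_bilinear_scaleR assms[unfolded pder_def]]
  by (simp add: pder_def)

lemma transform_pder:
  fixes w w' :: "real ^ 'd::finite \<Rightarrow> 'v::euclidean_space"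
  assumes S: "compact S" and w: "continuous_on UNIV w" "\<And>x. x \<notin> S \<Longrightarrow> w x = 0"
    and w': "continuous_on UNIV w'" "\<And>x. x \<notin> S \<Longrightarrow> w' x = 0" and p: "\<And>x. pder i w x (w' x)"
  shows "cos_transform w' \<xi> = \<xi> $ i *\<^sub>R sin_transform w \<xi>"
    and "sin_transform w' \<xi> = - (\<xi> $ i *\<^sub>R cos_transform w \<xi>)"
proof -
  have int: "integrable lborel (\<lambda>x. cos (\<xi> \<bullet> x) *\<^sub>R v x)" "integrable lborel (\<lambda>x. sin (\<xi> \<bullet> x) *\<^sub>R v x)"
    if "continuous_on UNIV v" "\<And>x. x \<notin> S \<Longrightarrow> v x = 0" for v :: "real ^ 'd \<Rightarrow> 'v"
    using that by (auto intro!: integrable_compact_support[OF S] continuous_intros)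
  have "(\<integral>x. cos (\<xi> \<bullet> x) *\<^sub>R w' x + (- \<xi> $ i * sin (\<xi> \<bullet> x)) *\<^sub>R w x \<partial>lborel) = 0"
    by (rule integral_pder_eq_0[OF S _ _ _ _ pder_scaleR[OF pder_cos_inner p]])
       (use w w' in \<open>auto intro!: continuous_intros\<close>)
  then have "0 = (\<integral>x. cos (\<xi> \<bullet> x) *\<^sub>R w' x - \<xi> $ i *\<^sub>R sin (\<xi> \<bullet> x) *\<^sub>R w x \<partial>lborel)" by simp
  also have "\<dots> = cos_transform w' \<xi> - \<xi> $ i *\<^sub>R sin_transform w \<xi>"
    unfolding cos_transform_def sin_transform_def
    using int[OF w] int[OF w'] by (subst Bochner_Integration.integral_diff) (auto simp del: scaleR_scaleR)
  finally show "cos_transform w' \<xi> = \<xi> $ i *\<^sub>R sin_transform w \<xi>" by simp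
  have "(\<integral>x. sin (\<xi> \<bullet> x) *\<^sub>R w' x + (\<xi> $ i * cos (\<xi> \<bullet> x)) *\<^sub>R w x \<partial>lborel) = 0"
    by (rule integral_pder_eq_0[OF S _ _ _ _ pder_scaleR[OF pder_sin_inner p]])
       (use w w' in \<open>auto intro!: continuous_intros\<close>)
  then have "0 = (\<integral>x. sin (\<xi> \<bullet> x) *\<^sub>R w' x + \<xi> $ i *\<^sub>R cos (\<xi> \<bullet> x) *\<^sub>R w x \<partial>lborel)" by simp
  also have "\<dots> = sin_transform w' \<xi> + \<xi> $ i *\<^sub>R cos_transform w \<xi>"
    unfolding cos_transform_def sin_transform_def
    using int[OF w] int[OF w'] by (subst Bochner_Integration.integral_add) (auto simp del: scaleR_scaleR)
  finally show "sin_transform w' \<xi> = - (\<xi> $ i *\<^sub>R cos_transform w \<xi>)" by (simp add: eq_neg_iff_add_eq_0)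
qed

text \<open>
  Multiplication by \<open>\<i>\<close> in terms of the pair of the two parts of the Fourier transform.
\<close>

definition rot :: "'v \<times> 'v \<Rightarrow> 'v::euclidean_space \<times> 'v" where
  "rot p = (snd p, - fst p)"

context
  fixes u :: "real ^ 'd::finite \<Rightarrow> 'v::euclidean_space"
  assumes u: "u \<in> test_functions"
begin

definition supp :: "(real ^ 'd) set" where "supp = closure {x. u x \<noteq> 0}"

lemma compact_supp: "compact supp"
  using u by (simp add: test_functions_def supp_def)

lemma differentiable_pderivs: "pderivs is u differentiable (at x)"
  using u by (simp add: test_functions_def smooth_def)

lemma continuous_pderivs: "continuous_on UNIV (pderivs is u)"
  by (rule differentiable_imp_continuous_on) (simp add: differentiable_on_def differentiable_pderivs)

lemma pder_pderivs: "pder i (pderivs is u) x (pderivs (i # is) u x)"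
  using pder_frechet[OF differentiable_pderivs] by simp

lemma pderivs_outside: "x \<notin> supp \<Longrightarrow> pderivs is u x = 0"
proof (induction "is" arbitrary: x)
  case Nil
  then show ?case using closure_subset[of "{x. u x \<noteq> 0}"] by (auto simp: supp_def)
next
  case (Cons i "is")
  have "open (- supp)" using compact_imp_closed[OF compact_supp] by auto
  then have "pder i (pderivs is u) x 0" by (rule pder_zero) (use Cons in auto)
  with pder_pderivs show ?case by (rule pder_unique)
qed

lemma transform_pderivs:
  "(cos_transform (pderivs is u) \<xi>, sin_transform (pderivs is u) \<xi>)
    = prod_list (map (($) \<xi>) is) *\<^sub>R (rot ^^ length is) (cos_transform u \<xi>, sin_transform u \<xi>)"
proof (induction "is")
  case (Cons i "is")
  have "cos_transform (pderivs (i # is) u) \<xi> = \<xi> $ i *\<^sub>R sin_transform (pderivs is u) \<xi>"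
    "sin_transform (pderivs (i # is) u) \<xi> = - (\<xi> $ i *\<^sub>R cos_transform (pderivs is u) \<xi>)"
    using transform_pder[OF compact_supp continuous_pderivs pderivs_outside continuous_pderivs pderivs_outside pder_pderivs]
    by auto
  then have "(cos_transform (pderivs (i # is) u) \<xi>, sin_transform (pderivs (i # is) u) \<xi>)
      = \<xi> $ i *\<^sub>R rot (cos_transform (pderivs is u) \<xi>, sin_transform (pderivs is u) \<xi>)"
    by (simp add: rot_def)
  also have "\<dots> = \<xi> $ i *\<^sub>R prod_list (map (($) \<xi>) is) *\<^sub>R rot ((rot ^^ length is) (cos_transform u \<xi>, sin_transform u \<xi>))"
    unfolding Cons.IH by (simp add: rot_def)
  finally show ?case by simp
qed simp

end

lemma prod_list_count: "prod_list (map f xs) = (\<Prod>i\<in>UNIV. f i ^ count_list xs i)"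
  for f :: "'d::finite \<Rightarrow> real"
proof (induction xs)
  case (Cons x xs)
  have "f i ^ count_list (x # xs) i = (if i = x then f i else 1) * f i ^ count_list xs i" for i by simp
  then show ?case using Cons by (simp add: prod.distrib)
qed simp

lemma length_count: "length xs = (\<Sum>i\<in>UNIV. count_list xs i)" for xs :: "'d::finite list"
proof (induction xs)
  case (Cons x xs)
  have "count_list (x # xs) i = (if i = x then 1 else 0) + count_list xs i" for i by simp
  then show ?case using Cons by (simp add: sum.distrib)
qed simp

text \<open>
  The Fourier transform of the equation is \<open>\<i> ^ k\<close> times the symbol applied to the transform. As the symbol is
  real, it may be applied to both parts separately, and rotating the pair does not affect its vanishing.
\<close>

lemma transform_in_symbol_kernel:
  fixes A :: "('d::finite \<Rightarrow> nat) \<Rightarrow> 'v::euclidean_space \<Rightarrow>\<^sub>L 'w::euclidean_space"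
  assumes u: "u \<in> test_functions" and Au: "\<And>x. diff_op A k u x = 0"
  shows "symbol A k \<xi> (cos_transform u \<xi>) = 0" "symbol A k \<xi> (sin_transform u \<xi>) = 0"
proof -
  define P where "P = (rot ^^ k) (cos_transform u \<xi>, sin_transform u \<xi>)"
  have m: "cos_transform (mderiv \<gamma> u) \<xi> = (\<Prod>i\<in>UNIV. (\<xi> $ i) ^ \<gamma> i) *\<^sub>R fst P"
    "sin_transform (mderiv \<gamma> u) \<xi> = (\<Prod>i\<in>UNIV. (\<xi> $ i) ^ \<gamma> i) *\<^sub>R snd P"
    "\<exists>is. mderiv \<gamma> u = pderivs is u"
    if "\<gamma> \<in> multi_indices k" for \<gamma>
  proof -
    define ds where "ds = (SOME is. \<forall>i. count_list is i = \<gamma> i)"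
    have ds: "\<forall>i. count_list ds i = \<gamma> i" unfolding ds_def using someI_ex[OF ex_directions] by blast
    have e: "mderiv \<gamma> u = pderivs ds u" by (simp add: mderiv_def ds_def)
    have "length ds = k" using that ds by (simp add: length_count multi_indices_def)
    moreover have "prod_list (map (($) \<xi>) ds) = (\<Prod>i\<in>UNIV. (\<xi> $ i) ^ \<gamma> i)" using ds by (simp add: prod_list_count)
    ultimately have "(cos_transform (mderiv \<gamma> u) \<xi>, sin_transform (mderiv \<gamma> u) \<xi>) = (\<Prod>i\<in>UNIV. (\<xi> $ i) ^ \<gamma> i) *\<^sub>R P"
      using transform_pderivs[OF u, of ds \<xi>] by (simp add: P_def e)
    then show "cos_transform (mderiv \<gamma> u) \<xi> = (\<Prod>i\<in>UNIV. (\<xi> $ i) ^ \<gamma> i) *\<^sub>R fst P"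
      "sin_transform (mderiv \<gamma> u) \<xi> = (\<Prod>i\<in>UNIV. (\<xi> $ i) ^ \<gamma> i) *\<^sub>R snd P" by (auto simp: prod_eq_iff)
    show "\<exists>is. mderiv \<gamma> u = pderivs is u" using e by blast
  qed
  have main: "(\<Sum>\<gamma>\<in>multi_indices k. A \<gamma> (\<integral>x. a x *\<^sub>R mderiv \<gamma> u x \<partial>lborel)) = 0"
    if a: "continuous_on UNIV a" for a :: "real ^ 'd \<Rightarrow> real"
  proof -
    have int: "integrable lborel (\<lambda>x. a x *\<^sub>R mderiv \<gamma> u x)" if "\<gamma> \<in> multi_indices k" for \<gamma>
    proof -
      from m(3)[OF that] obtain "is" where e: "mderiv \<gamma> u = pderivs is u" by blast
      show ?thesis unfolding e
        using pderivs_outside[OF u] by (intro integrable_compact_support[OF compact_supp[OF u]] continuous_intros a continuous_pderivs[OF u]) auto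
    qed
    have "(\<Sum>\<gamma>\<in>multi_indices k. A \<gamma> (\<integral>x. a x *\<^sub>R mderiv \<gamma> u x \<partial>lborel))
        = (\<Sum>\<gamma>\<in>multi_indices k. (\<integral>x. A \<gamma> (a x *\<^sub>R mderiv \<gamma> u x) \<partial>lborel))"
      using int by (intro sum.cong refl integral_bounded_linear[symmetric] blinfun.bounded_linear_right)
    also have "\<dots> = (\<integral>x. (\<Sum>\<gamma>\<in>multi_indices k. A \<gamma> (a x *\<^sub>R mderiv \<gamma> u x)) \<partial>lborel)"
      using int by (intro Bochner_Integration.integral_sum[symmetric] integrable_bounded_linear[OF blinfun.bounded_linear_right])
    also have "(\<lambda>x. \<Sum>\<gamma>\<in>multi_indices k. A \<gamma> (a x *\<^sub>R mderiv \<gamma> u x)) = (\<lambda>x. a x *\<^sub>R diff_op A k u x)"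
      by (simp add: diff_op_def scaleR_sum_right blinfun.scaleR_right fun_eq_iff)
    finally show ?thesis by (simp add: Au)
  qed
  have "(\<Sum>\<gamma>\<in>multi_indices k. A \<gamma> (cos_transform (mderiv \<gamma> u) \<xi>)) = 0"
    unfolding cos_transform_def by (rule main) (intro continuous_intros)
  then have 1: "symbol A k \<xi> (fst P) = 0"
    by (simp add: m symbol_def blinfun.sum_left blinfun.scaleR_left blinfun.scaleR_right cong: sum.cong)
  have "(\<Sum>\<gamma>\<in>multi_indices k. A \<gamma> (sin_transform (mderiv \<gamma> u) \<xi>)) = 0"
    unfolding sin_transform_def by (rule main) (intro continuous_intros)
  then have 2: "symbol A k \<xi> (snd P) = 0"
    by (simp add: m symbol_def blinfun.sum_left blinfun.scaleR_left blinfun.scaleR_right cong: sum.cong)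
  have "symbol A k \<xi> (fst ((rot ^^ n) p)) = 0 \<and> symbol A k \<xi> (snd ((rot ^^ n) p)) = 0
    \<Longrightarrow> symbol A k \<xi> (fst p) = 0 \<and> symbol A k \<xi> (snd p) = 0" for n p
    by (induction n) (auto simp: rot_def blinfun.minus_right)
  from this[of k "(cos_transform u \<xi>, sin_transform u \<xi>)"] 1 2
  show "symbol A k \<xi> (cos_transform u \<xi>) = 0" "symbol A k \<xi> (sin_transform u \<xi>) = 0"
    by (auto simp: P_def)
qed

lemma sin_transform_0: "sin_transform u 0 = 0"
  by (simp add: sin_transform_def)

text \<open>
  Along the ray through \<open>\<xi>\<close> the symbol only changes by a scalar factor, so its kernel contains the transform
  at \<open>h \<xi>\<close> for all \<open>h > 0\<close>; let \<open>h\<close> tend to \<open>0\<close>.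
\<close>

lemma mean_in_symbol_kernel:
  fixes A :: "('d::finite \<Rightarrow> nat) \<Rightarrow> 'v::euclidean_space \<Rightarrow>\<^sub>L 'w::euclidean_space"
  assumes u: "u \<in> test_functions" and Au: "\<And>x. diff_op A k u x = 0"
  shows "symbol A k \<xi> (cos_transform u 0) = 0"
proof -
  define h where "h n = 1 / real (Suc n)" for n
  have h0: "h \<longlonglongrightarrow> 0" unfolding h_def using LIMSEQ_inverse_real_of_nat by (simp add: inverse_eq_divide)
  have uc: "continuous_on UNIV u" using continuous_pderivs[OF u, of "[]"] by simp
  have um: "u \<in> borel_measurable borel" by (rule borel_measurable_continuous_onI[OF uc])
  have ui: "integrable lborel u"
    using pderivs_outside[OF u, of _ "[]"] by (intro integrable_compact_support[OF compact_supp[OF u] uc]) simp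
  have "(\<lambda>n. cos_transform u (h n *\<^sub>R \<xi>)) \<longlonglongrightarrow> cos_transform u 0"
    unfolding cos_transform_def
  proof (rule integral_dominated_convergence[where w = "\<lambda>x. norm (u x)"])
    have "(\<lambda>n. cos (h n *\<^sub>R \<xi> \<bullet> x) *\<^sub>R u x) \<longlonglongrightarrow> cos (0 *\<^sub>R \<xi> \<bullet> x) *\<^sub>R u x" for x
      by (intro tendsto_intros h0)
    then show "AE x in lborel. (\<lambda>n. cos (h n *\<^sub>R \<xi> \<bullet> x) *\<^sub>R u x) \<longlonglongrightarrow> cos (0 \<bullet> x) *\<^sub>R u x" by simp
    show "AE x in lborel. norm (cos (h n *\<^sub>R \<xi> \<bullet> x) *\<^sub>R u x) \<le> norm (u x)" for n
      by (intro AE_I2) (simp add: mult_left_le_one_le)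
  qed (use ui um in auto)
  then have "(\<lambda>n. symbol A k \<xi> (cos_transform u (h n *\<^sub>R \<xi>))) \<longlonglongrightarrow> symbol A k \<xi> (cos_transform u 0)"
    by (intro tendsto_intros)
  moreover have "symbol A k \<xi> (cos_transform u (h n *\<^sub>R \<xi>)) = 0" for n
  proof -
    have "h n ^ k *\<^sub>R symbol A k \<xi> (cos_transform u (h n *\<^sub>R \<xi>)) = 0"
      using transform_in_symbol_kernel(1)[OF u Au, of "h n *\<^sub>R \<xi>"] by (simp add: symbol_scaleR blinfun.scaleR_left)
    then show ?thesis by (simp add: h_def)
  qed
  ultimately show ?thesis by (simp add: LIMSEQ_const_iff)
qed

section \<open>Approximate identities\<close>

lemma uniform_continuity_compact_support:
  fixes u :: "'a::euclidean_space \<Rightarrow> 'b::real_normed_vector"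
  assumes T: "compact T" and u: "continuous_on UNIV u" "\<And>x. x \<notin> T \<Longrightarrow> u x = 0" and "e > 0"
  shows "\<exists>d>0. \<forall>x y. dist x y < d \<longrightarrow> dist (u x) (u y) < e"
proof -
  obtain R where R: "\<And>x. x \<in> T \<Longrightarrow> norm x \<le> R" using compact_imp_bounded[OF T] unfolding bounded_iff by blast
  have "uniformly_continuous_on (cball 0 (R + 1)) u"
    by (rule compact_uniformly_continuous[OF continuous_on_subset[OF u(1)]]) auto
  then obtain d where d: "d > 0" "\<And>x y. x \<in> cball 0 (R + 1) \<Longrightarrow> y \<in> cball 0 (R + 1) \<Longrightarrow> dist y x < d \<Longrightarrow> dist (u y) (u x) < e"
    using \<open>e > 0\<close> unfolding uniformly_continuous_on_def by metis
  have "dist (u x) (u y) < e" if "dist x y < min d 1" for x y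
  proof (cases "x \<in> T \<or> y \<in> T")
    case True
    have "norm x \<le> norm y + dist x y" "norm y \<le> norm x + dist x y"
      using norm_triangle_ineq2[of x y] norm_triangle_ineq2[of y x] by (auto simp: dist_norm norm_minus_commute)
    then have "x \<in> cball 0 (R + 1)" "y \<in> cball 0 (R + 1)" using True R[of x] R[of y] that by auto
    then show ?thesis using d(2)[of y x] that by (simp add: dist_commute)
  next
    case False
    then show ?thesis using u(2) \<open>e > 0\<close> by simp
  qed
  then show ?thesis using d(1) by (intro exI[of _ "min d 1"]) auto
qed

text \<open>
  Powers of a function with a strict maximum at \<open>0\<close> concentrate there. The constant \<open>c\<close> normalises the mass of
  the kernel on a small ball of radius \<open>\<delta>\<close>, where \<open>u\<close> hardly varies; outside this ball \<open>\<Phi> \<le> q\<close>, while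
  \<open>\<Phi> \<ge> p > q\<close> on a smaller ball already makes \<open>1/c\<close> at least of order \<open>p ^ N\<close>.
\<close>

lemma approximate_identity:
  fixes \<Phi> :: "'a::euclidean_space \<Rightarrow> real" and u :: "'a \<Rightarrow> 'b::euclidean_space"
  assumes \<Phi>: "continuous_on UNIV \<Phi>" "\<And>z. 0 \<le> \<Phi> z" "\<Phi> 0 = 1"
    and S: "compact S" "\<And>z. z \<in> S \<Longrightarrow> z \<noteq> 0 \<Longrightarrow> \<Phi> z < 1"
    and T: "compact T" and u: "continuous_on UNIV u" "\<And>x. x \<notin> T \<Longrightarrow> u x = 0"
    and X: "\<And>x y. x \<in> X \<Longrightarrow> y \<in> T \<Longrightarrow> x - y \<in> S" and e: "e > 0"
  shows "\<exists>N c. c > 0 \<and> (\<forall>x\<in>X. norm ((\<integral>y. (c * \<Phi> (x - y) ^ N) *\<^sub>R u y \<partial>lborel) - u x) \<le> e)"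
proof -
  obtain d where d: "d > 0" "\<And>x y. dist x y < d \<Longrightarrow> dist (u x) (u y) < e / 2"
    using uniform_continuity_compact_support[OF T u, of "e / 2"] e by auto
  define \<delta> where "\<delta> = d / 2"
  have \<delta>: "\<delta> > 0" "\<And>x y. dist x y \<le> \<delta> \<Longrightarrow> norm (u y - u x) \<le> e / 2"
  proof -
    show "\<delta> > 0" using d by (simp add: \<delta>_def)
    fix x y :: 'a assume "dist x y \<le> \<delta>"
    then have "dist y x < d" using d(1) by (simp add: \<delta>_def dist_commute)
    then show "norm (u y - u x) \<le> e / 2" using d(2)[of y x] by (simp add: dist_norm)
  qed
  have "bounded (u ` T)" by (intro compact_imp_bounded compact_continuous_image continuous_on_subset[OF u(1)] T) simp
  then obtain B where B: "B > 0" "\<And>x. x \<in> T \<Longrightarrow> norm (u x) \<le> B" unfolding bounded_pos by auto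
  have uB: "norm (u x) \<le> B" for x using B u(2)[of x] by (cases "x \<in> T") auto
  obtain q where q: "0 \<le> q" "q < 1" "\<And>z. z \<in> S \<Longrightarrow> \<delta> < norm z \<Longrightarrow> \<Phi> z \<le> q"
  proof (cases "S \<inter> {z. \<delta> \<le> norm z} = {}")
    case True
    then show ?thesis using that[of 0] by force
  next
    case False
    have "closed {z :: 'a. \<delta> \<le> norm z}" by (intro closed_Collect_le continuous_intros)
    then have c: "compact (S \<inter> {z. \<delta> \<le> norm z})" by (rule compact_Int_closed[OF S(1)])
    obtain z0 where z0: "z0 \<in> S \<inter> {z. \<delta> \<le> norm z}" "\<And>z. z \<in> S \<inter> {z. \<delta> \<le> norm z} \<Longrightarrow> \<Phi> z \<le> \<Phi> z0"
      using continuous_attains_sup[OF c False continuous_on_subset[OF \<Phi>(1)]] by auto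
    have "z0 \<noteq> 0" using z0(1) \<delta>(1) by auto
    then have "\<Phi> z0 < 1" using S(2) z0(1) by auto
    then show ?thesis using that[of "\<Phi> z0"] \<Phi>(2) z0(2) by force
  qed
  define p where "p = (1 + q) / 2"
  have p: "0 < p" "q < p" "p < 1" using q by (auto simp: p_def)
  have "isCont \<Phi> 0" using \<Phi>(1) by (simp add: continuous_on_eq_continuous_at)
  then obtain \<rho>' where \<rho>': "\<rho>' > 0" "\<And>z. norm z < \<rho>' \<Longrightarrow> \<bar>\<Phi> z - 1\<bar> < 1 - p"
    using p(3) unfolding continuous_at_eps_delta by (metis \<Phi>(3) diff_gt_0_iff_gt diff_zero dist_norm real_norm_def)
  define \<rho> where "\<rho> = min \<delta> (\<rho>' / 2)"
  have \<rho>: "\<rho> > 0" "\<rho> \<le> \<delta>" using \<delta> \<rho>' by (auto simp: \<rho>_def)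
  have \<rho>p: "p \<le> \<Phi> z" if "norm z \<le> \<rho>" for z
    using \<rho>'(2)[of z] that \<rho>'(1) by (auto simp: \<rho>_def)
  define vr where "vr = measure lborel (cball (0::'a) \<rho>)"
  define VS where "VS = measure lborel S"
  have vr: "vr > 0" unfolding vr_def by (rule content_cball_pos[OF \<rho>(1)])
  have VS: "VS \<ge> 0" by (simp add: VS_def)
  have "q / p < 1" "0 \<le> q / p" using p q by auto
  moreover have "0 < e / 2 * vr / (B * VS + 1)" using e vr B VS by (intro divide_pos_pos mult_pos_pos) (auto intro: add_nonneg_pos)
  ultimately obtain N where N: "(q / p) ^ N < e / 2 * vr / (B * VS + 1)"
    using real_arch_pow_inv[of "e / 2 * vr / (B * VS + 1)" "q / p"] by auto
  define a where "a = (\<integral>z. indicator (cball 0 \<delta>) z *\<^sub>R \<Phi> z ^ N \<partial>lborel)"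
  have \<Phi>N: "continuous_on UNIV (\<lambda>z. \<Phi> z ^ N)" by (intro continuous_intros \<Phi>(1))
  have "p ^ N * vr = (\<integral>z. indicator (cball 0 \<rho>) z *\<^sub>R p ^ N \<partial>(lborel :: 'a measure))"
    unfolding vr_def by simp
  also have "\<dots> \<le> a" unfolding a_def
  proof (rule integral_mono)
    show "integrable lborel (\<lambda>z::'a. indicator (cball 0 \<rho>) z *\<^sub>R p ^ N)"
      by (rule borel_integrable_compact[OF compact_cball continuous_on_const])
    show "integrable lborel (\<lambda>z::'a. indicator (cball 0 \<delta>) z *\<^sub>R \<Phi> z ^ N)"
      by (rule borel_integrable_compact[OF compact_cball continuous_on_subset[OF \<Phi>N]]) simp
    show "indicator (cball 0 \<rho>) z *\<^sub>R p ^ N \<le> indicator (cball 0 \<delta>) z *\<^sub>R \<Phi> z ^ N" for z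
      using \<rho>(2) \<rho>p[of z] p(1) \<Phi>(2)[of z] by (auto simp: indicator_def intro: power_mono)
  qed
  finally have a: "p ^ N * vr \<le> a" .
  then have a0: "a > 0" using p(1) vr by (metis less_le_trans mult_pos_pos zero_less_power)
  define c where "c = 1 / a"
  have c: "c > 0" "c * a = 1" using a0 by (auto simp: c_def)
  have small: "c * q ^ N * B * VS \<le> e / 2"
  proof -
    have "c * q ^ N * B * VS \<le> (1 / (p ^ N * vr)) * q ^ N * B * VS"
      unfolding c_def using a p vr q B VS a0 by (intro mult_right_mono divide_left_mono) auto
    also have "\<dots> = (q / p) ^ N * (B * VS) / vr" by (simp add: power_divide)
    also have "\<dots> \<le> (q / p) ^ N * (B * VS + 1) / vr"
      using q p vr by (intro divide_right_mono mult_left_mono) auto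
    also have "\<dots> \<le> (e / 2 * vr / (B * VS + 1)) * (B * VS + 1) / vr"
      using N vr B VS by (intro divide_right_mono mult_right_mono) auto
    also have "\<dots> = e / 2"
    proof -
      have "z * v / G * G / v = z" if "v > 0" "G > 0" for z v G :: real using that by simp
      moreover have "B * VS + 1 > 0" using B VS by (simp add: add_nonneg_pos)
      ultimately show ?thesis using vr by blast
    qed
    finally show ?thesis .
  qed
  have "norm ((\<integral>y. (c * \<Phi> (x - y) ^ N) *\<^sub>R u y \<partial>lborel) - u x) \<le> e" if x: "x \<in> X" for x
  proof -
    define w where "w y = indicator (cball x \<delta>) y *\<^sub>R (c * \<Phi> (x - y) ^ N)" for y
    define F where "F y = (c * \<Phi> (x - y) ^ N) *\<^sub>R u y" for y
    have cont: "continuous_on UNIV (\<lambda>y. c * \<Phi> (x - y) ^ N)"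
      by (intro continuous_intros continuous_on_compose2[OF \<Phi>(1)]) auto
    have wi: "integrable lborel w" unfolding w_def
      by (rule borel_integrable_compact[OF compact_cball continuous_on_subset[OF cont]]) simp
    have Fi: "integrable lborel F" unfolding F_def
      by (rule integrable_compact_support[OF T]) (use u in \<open>auto intro!: continuous_on_scaleR cont\<close>)
    have w1: "(\<integral>y. w y \<partial>lborel) = 1"
    proof -
      have "(\<integral>y. w y \<partial>lborel) = (\<integral>y. c * (indicator (cball 0 \<delta>) (x - y) *\<^sub>R \<Phi> (x - y) ^ N) \<partial>lborel)"
        unfolding w_def by (intro Bochner_Integration.integral_cong refl) (auto simp: indicator_def dist_norm norm_minus_commute)
      also have "\<dots> = (\<integral>y. c * (indicator (cball 0 \<delta>) y *\<^sub>R \<Phi> y ^ N) \<partial>lborel)"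
      proof (rule integral_reflect)
        have "\<Phi> \<in> borel_measurable borel" by (rule borel_measurable_continuous_onI[OF \<Phi>(1)])
        then show "(\<lambda>y. c * (indicator (cball 0 \<delta>) y *\<^sub>R \<Phi> y ^ N)) \<in> borel_measurable borel"
          by (intro borel_measurable_times borel_measurable_const borel_measurable_scaleR borel_measurable_indicator borel_measurable_power) auto
      qed
      also have "\<dots> = c * a" unfolding a_def by (rule integral_mult_right_zero)
      finally show ?thesis using c by simp
    qed
    define r where "r y = w y * (e / 2) + indicator S (x - y) * (c * q ^ N * B)" for y
    have Si: "integrable lborel (\<lambda>y. indicator S (x - y) * (c * q ^ N * B))"
    proof -
      have "integrable lborel (\<lambda>y. indicator ((\<lambda>z. x - z) ` S) y *\<^sub>R (c * q ^ N * B))"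
        by (rule borel_integrable_compact[OF compact_continuous_image[OF _ S(1)] continuous_on_const]) (intro continuous_intros)
      moreover have "indicator ((\<lambda>z. x - z) ` S) y = (indicator S (x - y) :: real)" for y
        by (auto simp: indicator_def image_iff intro!: bexI[of _ "x - y"])
      ultimately show ?thesis by simp
    qed
    have Sm: "S \<in> sets borel" using compact_imp_closed[OF S(1)] by auto
    have "(\<integral>y. indicator S (x - y) * (c * q ^ N * B) \<partial>lborel) = (\<integral>y. indicator S y * (c * q ^ N * B) \<partial>lborel)"
      using Sm by (intro integral_reflect borel_measurable_times borel_measurable_const borel_measurable_indicator)
    also have "\<dots> = VS * (c * q ^ N * B)" using Sm by (simp add: VS_def)
    finally have Sint: "(\<integral>y. indicator S (x - y) * (c * q ^ N * B) \<partial>lborel) = VS * (c * q ^ N * B)" .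
    have "(\<integral>y. F y \<partial>lborel) - u x = (\<integral>y. F y - w y *\<^sub>R u x \<partial>lborel)"
      using Fi wi w1 by simp
    also have "norm \<dots> \<le> (\<integral>y. r y \<partial>lborel)"
    proof (rule order.trans[OF integral_norm_bound Bochner_Integration.integral_mono])
      show "integrable lborel (\<lambda>y. norm (F y - w y *\<^sub>R u x))" using Fi wi by simp
      show "integrable lborel r" unfolding r_def using wi Si by simp
      fix y
      show "norm (F y - w y *\<^sub>R u x) \<le> r y"
      proof (cases "y \<in> cball x \<delta>")
        case True
        have "F y - w y *\<^sub>R u x = w y *\<^sub>R (u y - u x)" using True by (simp add: F_def w_def scaleR_diff_right)
        moreover have "0 \<le> w y" using c \<Phi>(2)[of "x - y"] by (simp add: w_def indicator_def)
        moreover have "norm (u y - u x) \<le> e / 2" using \<delta>(2)[of x y] True by simp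
        ultimately have "norm (F y - w y *\<^sub>R u x) \<le> w y * (e / 2)"
          by (simp only: norm_scaleR abs_of_nonneg) (rule mult_left_mono)
        moreover have "0 \<le> indicator S (x - y) * (c * q ^ N * B)" using c q B by simp
        ultimately show ?thesis by (simp add: r_def)
      next
        case False
        have w0: "w y = 0" using False by (simp add: w_def)
        show ?thesis
        proof (cases "y \<in> T")
          case T: True
          then have S': "x - y \<in> S" using X x by blast
          have "\<delta> < norm (x - y)" using False by (simp add: dist_norm)
          then have "\<Phi> (x - y) \<le> q" using q(3) S' by blast
          then have "\<Phi> (x - y) ^ N \<le> q ^ N" using \<Phi>(2) by (intro power_mono)
          then have "norm (F y) \<le> c * q ^ N * B"
            unfolding F_def norm_scaleR using c \<Phi>(2)[of "x - y"] uB[of y] B(1) q(1) by (intro mult_mono) (auto intro: mult_nonneg_nonneg)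
          then show ?thesis using S' by (simp add: r_def w0)
        next
          case False
          then show ?thesis using c q B by (simp add: F_def u(2) r_def w0)
        qed
      qed
    qed
    also have "\<dots> = e / 2 + c * q ^ N * B * VS"
      unfolding r_def using wi Si w1 Sint by (simp add: mult_ac)
    also have "\<dots> \<le> e" using small by simp
    finally show ?thesis by (simp add: F_def)
  qed
  then show ?thesis using c(1) by blast
qed

section \<open>The estimate on the torus\<close>

text \<open>
  The hypotheses on \<open>ys\<close> say that \<open>w\<close> is a trigonometric polynomial on the torus whose coefficient at
  frequency \<open>n\<close> is a combination of vectors \<open>g (a - \<i> b)\<close> with \<open>a\<close> and \<open>b\<close> in the kernel of the symbol at \<open>n\<close>, and in
  all kernels if \<open>n = 0\<close>. Testing with real functionals \<open>l\<close> avoids complexifying the space. The vector-valued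
  multiplier is handled entry by entry with respect to the standard basis; its entries, divided by the power of the weight
  that bounds \<open>s\<close> derivatives, form one family with bounds independent of \<open>V\<close>.
\<close>

lemma discrete_korn:
  fixes A :: "('d::finite \<Rightarrow> nat) \<Rightarrow> 'v::euclidean_space \<Rightarrow>\<^sub>L 'w::euclidean_space"
  assumes rank: "constant_rank A k"
  defines "s \<equiv> CARD('d) div 2 + 1"
  shows "\<exists>C>0. \<forall>V J q (w :: int ^ 'd \<Rightarrow> 'v) ys t. subspace V \<longrightarrow> V \<inter> wave_cone A k = {0} \<longrightarrow>
    2 * (2 ^ (J + 1) + int s) < 2 ^ q \<longrightarrow> 0 < t \<longrightarrow>
    (\<forall>(g, n, a, b) \<in> set ys. norm (rvec n) \<le> 2 ^ J \<and>
       (\<forall>\<xi>. rvec n = 0 \<or> \<xi> = rvec n \<longrightarrow> symbol A k \<xi> a = 0 \<and> symbol A k \<xi> b = 0)) \<longrightarrow>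
    (\<forall>l x. bounded_linear l \<longrightarrow> complex_of_real (l (w x))
       = (\<Sum>(g, n, a, b) \<leftarrow> ys. g * (of_real (l a) - \<i> * of_real (l b)) * ch (2 ^ q) n x)) \<longrightarrow>
    t * real (card {x \<in> torus (2 ^ q). t < norm (w x)})
      \<le> C * (1 / cone_dist V (wave_cone A k)) ^ (s + 1) * (\<Sum>x\<in>torus (2 ^ q). norm (perp V (w x)))"
proof -
  define \<V> where "\<V> = {V. subspace V \<and> V \<inter> wave_cone A k = {0}}"
  define K where "K V = 1 / cone_dist V (wave_cone A k)" for V
  \<comment> \<open>At frequency \<open>0\<close> the multiplier may be taken from any nonzero frequency, since there the coefficients lie in all
      kernels.\<close>
  define e0 where "e0 = (axis undefined 1 :: real ^ 'd)"
  have e0: "e0 \<noteq> 0" by (simp add: e0_def)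
  define Q where "Q V \<xi> = oblique A k V (if \<xi> = 0 then e0 else \<xi>)" for V \<xi>
  define I where "I = \<V> \<times> (Basis \<times> Basis :: ('v \<times> 'v) set)"
  define m where "m p \<xi> = complex_of_real (Q (fst p) \<xi> (snd (snd p)) \<bullet> fst (snd p) / K (fst p) ^ (s + 1))"
    for p :: "'v set \<times> 'v \<times> 'v" and \<xi>
  define U where "U = {\<xi> :: real ^ 'd. 1 / 4 < norm \<xi> \<and> norm \<xi> < 4}"
  have oU: "open U" unfolding U_def
    by (intro open_Collect_conj open_Collect_less continuous_intros)
  have K: "1 \<le> K V" if "V \<in> \<V>" for V
    using cone_dist_pos[of V A k] cone_dist_le(1)[of V "wave_cone A k"] that by (simp add: \<V>_def K_def)
  have "n + 1 \<le> 2 * (n div 2 + 1)" for n :: nat by presburger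
  then have s: "CARD('d) + 1 \<le> 2 * s" unfolding s_def .
  have "wsym \<V> (\<lambda>_. 1) U s 0 (\<lambda>V \<xi>. oblique A k V \<xi> /\<^sub>R K V ^ (s + 1))"
    using wsym_oblique[OF rank, of s] K unfolding \<V>_def[symmetric] U_def[symmetric] K_def[symmetric]
    by (intro wsym_normalize) auto
  then have 1: "wsym I (\<lambda>_. 1) U s 0 (\<lambda>p \<xi>. oblique A k (fst p) \<xi> /\<^sub>R K (fst p) ^ (s + 1))"
    by (rule wsym_reindex) (auto simp: I_def)
  have 2: "wsym I (\<lambda>_. 1) U s 0 (\<lambda>p _. snd (snd p))"
    by (rule wsym_const[where C = 1]) (auto simp: I_def)
  have 3: "wsym I (\<lambda>_. 1) U s 0 (\<lambda>p _. fst (snd p))"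
    by (rule wsym_const[where C = 1]) (auto simp: I_def)
  have 4: "wsym I (\<lambda>_. 1) U s (0 + 0) (\<lambda>p \<xi>. blinfun_apply (oblique A k (fst p) \<xi> /\<^sub>R K (fst p) ^ (s + 1)) (snd (snd p)))"
    by (rule wsym_bilinear[OF bounded_bilinear_blinfun_apply 1 2]) simp
  have 5: "wsym I (\<lambda>_. 1) U s (0 + 0 + 0) (\<lambda>p \<xi>. blinfun_apply (oblique A k (fst p) \<xi> /\<^sub>R K (fst p) ^ (s + 1)) (snd (snd p)) \<bullet> fst (snd p))"
    by (rule wsym_bilinear[OF bounded_bilinear_inner 4 3]) simp
  have "wsym I (\<lambda>_. 1) U s (0 + 0 + 0) (\<lambda>p \<xi>. complex_of_real (blinfun_apply (oblique A k (fst p) \<xi> /\<^sub>R K (fst p) ^ (s + 1)) (snd (snd p)) \<bullet> fst (snd p)))"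
    by (rule wsym_linear[OF bounded_linear_of_real 5]) simp
  then have wm: "wsym I (\<lambda>_. 1) U s 0 m"
    unfolding add_0_right
  proof (rule wsym_cong[OF oU])
    fix p \<xi> assume "\<xi> \<in> U"
    then have "\<xi> \<noteq> 0" by (auto simp: U_def)
    then show "complex_of_real (blinfun_apply (oblique A k (fst p) \<xi> /\<^sub>R K (fst p) ^ (s + 1)) (snd (snd p)) \<bullet> fst (snd p)) = m p \<xi>"
      unfolding m_def Q_def by (simp add: blinfun.scaleR_left divide_inverse mult.commute del: power_Suc)
  qed
  have hom: "m p ((1 / 2) *\<^sub>R \<xi>) = m p \<xi>" if "\<xi> \<noteq> 0" for p \<xi>
    using that oblique_scaleR[of "1 / 2" A k "fst p" \<xi>] by (simp add: m_def Q_def)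
  have bnd: "cmod (m p \<xi>) \<le> 2" if "p \<in> I" for p \<xi>
  proof -
    obtain V a b where p: "p = (V, a, b)" by (cases p) auto
    have V: "V \<in> \<V>" and ab: "a \<in> Basis" "b \<in> Basis" using that by (auto simp: p I_def)
    have "\<bar>Q V \<xi> b \<bullet> a\<bar> \<le> norm (Q V \<xi> b) * norm a" by (rule Cauchy_Schwarz_ineq2)
    also have "\<dots> \<le> norm (Q V \<xi>)" using norm_blinfun[of "Q V \<xi>" b] ab by simp
    also have "\<dots> \<le> 2 * K V"
      unfolding Q_def K_def using V e0 by (intro norm_oblique_le) (auto simp: \<V>_def)
    also have "\<dots> \<le> 2 * K V ^ (s + 1)" using self_le_power[OF K[OF V], of "s + 1"] by simp
    finally have h: "\<bar>Q V \<xi> b \<bullet> a\<bar> \<le> 2 * K V ^ (s + 1)" .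
    have "0 < K V ^ (s + 1)" using K[OF V] by (intro zero_less_power) linarith
    then have "\<bar>Q V \<xi> b \<bullet> a\<bar> / K V ^ (s + 1) \<le> 2" using h by (simp add: divide_le_eq)
    moreover have "0 \<le> K V" using K[OF V] by linarith
    ultimately show ?thesis by (simp add: m_def p norm_divide norm_mult norm_power)
  qed
  from multiplier_weak_type[OF wm[unfolded U_def] s hom bnd] obtain C where C: "C > 0"
    "\<And>p J q. p \<in> I \<Longrightarrow> 2 * (2 ^ (J + 1) + int s) < 2 ^ q \<Longrightarrow>
    \<exists>k. (\<forall>n x. norm (rvec n) \<le> 2 ^ J \<longrightarrow> conv (2 ^ q) k (ch (2 ^ q) n) x = m p (rvec n) * ch (2 ^ q) n x) \<and>
      (\<forall>f t. 0 < t \<longrightarrow> t * real (card {x \<in> torus (2 ^ q). t < cmod (conv (2 ^ q) k f x)})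
        \<le> C * (\<Sum>y\<in>torus (2 ^ q). cmod (f y)))"
    by blast
  define D where "D = real DIM('v)"
  have D: "D > 0" by (simp add: D_def)
  have "t * real (card {x \<in> torus (2 ^ q). t < norm (w x)})
      \<le> (D ^ 4 * C) * (1 / cone_dist V (wave_cone A k)) ^ (s + 1) * (\<Sum>x\<in>torus (2 ^ q). norm (perp V (w x)))"
    if V: "subspace V" "V \<inter> wave_cone A k = {0}" and q: "2 * (2 ^ (J + 1) + int s) < 2 ^ q" and t: "0 < t"
      and ys: "\<forall>(g, n, a, b) \<in> set ys. norm (rvec n) \<le> 2 ^ J \<and>
       (\<forall>\<xi>. rvec n = 0 \<or> \<xi> = rvec n \<longrightarrow> symbol A k \<xi> a = 0 \<and> symbol A k \<xi> b = 0)"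
      and w: "\<forall>l x. bounded_linear l \<longrightarrow> complex_of_real (l (w x))
       = (\<Sum>(g, n, a, b) \<leftarrow> ys. g * (of_real (l a) - \<i> * of_real (l b)) * ch (2 ^ q) n x)"
    for V J q ys t and w :: "int ^ 'd \<Rightarrow> 'v"
  proof -
    have V': "V \<in> \<V>" using V by (simp add: \<V>_def)
    define E where "E = K V ^ (s + 1)"
    have E: "E > 0" unfolding E_def using K[OF V'] by (intro zero_less_power) linarith
    define f where "f b x = complex_of_real (perp V (w x) \<bullet> b)" for b x
    define good where "good a b k \<longleftrightarrow> (\<forall>n x. norm (rvec n) \<le> 2 ^ J \<longrightarrow> conv (2 ^ q) k (ch (2 ^ q) n) x = m (V, a, b) (rvec n) * ch (2 ^ q) n x) \<and>
      (\<forall>f t. 0 < t \<longrightarrow> t * real (card {x \<in> torus (2 ^ q). t < cmod (conv (2 ^ q) k f x)})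
        \<le> C * (\<Sum>y\<in>torus (2 ^ q). cmod (f y)))" for a b k
    define kk where "kk a b = (SOME k. good a b k)" for a b
    have good: "good a b (kk a b)" if "a \<in> Basis" "b \<in> Basis" for a b
    proof -
      have "\<exists>k. good a b k"
        unfolding good_def by (rule C(2)[OF _ q]) (use that V' in \<open>simp add: I_def\<close>)
      then show ?thesis unfolding kk_def by (rule someI_ex)
    qed
    have kk: "conv (2 ^ q) (kk a b) (ch (2 ^ q) n) x = m (V, a, b) (rvec n) * ch (2 ^ q) n x"
      if "a \<in> Basis" "b \<in> Basis" "norm (rvec n) \<le> 2 ^ J" for a b n x
      using good[OF that(1,2)] that(3) unfolding good_def by blast
    have kk2: "t * real (card {x \<in> torus (2 ^ q). t < cmod (conv (2 ^ q) (kk a b) f x)})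
        \<le> C * (\<Sum>y\<in>torus (2 ^ q). cmod (f y))" if "a \<in> Basis" "b \<in> Basis" "0 < t" for a b f t
      using good[OF that(1,2)] that(3) unfolding good_def by blast
    have conv_sum: "conv M k (\<lambda>x. \<Sum>z\<leftarrow>zs. h z x) x = (\<Sum>z\<leftarrow>zs. conv M k (h z) x)"
      for M k zs x and h :: "'z \<Rightarrow> int ^ 'd \<Rightarrow> complex"
      by (induction zs) (auto simp: conv_def ring_distribs sum.distrib)
    have conv_cmult: "conv M k (\<lambda>x. c * h x) x = c * conv M k h x"
      for M k c x and h :: "int ^ 'd \<Rightarrow> complex"
      by (simp add: conv_def sum_distrib_left mult_ac)
    have key: "complex_of_real (w x \<bullet> a) = of_real E * (\<Sum>b\<in>Basis. conv (2 ^ q) (kk a b) (f b) x)"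
      if a: "a \<in> Basis" for a x
    proof -
      have Qr: "(\<Sum>b\<in>Basis. (perp V r \<bullet> b) * (Q V (rvec n) b \<bullet> a)) = r \<bullet> a"
        if r: "\<forall>\<xi>. rvec n = 0 \<or> \<xi> = rvec n \<longrightarrow> symbol A k \<xi> r = 0" for n r
      proof -
        have "Q V (rvec n) (perp V r) = r"
          unfolding Q_def using r e0 by (intro oblique_perp[OF V]) auto
        moreover have "Q V (rvec n) (perp V r) \<bullet> a = Q V (rvec n) (\<Sum>b\<in>Basis. (perp V r \<bullet> b) *\<^sub>R b) \<bullet> a"
          by (simp add: euclidean_representation)
        ultimately show ?thesis
          by (simp add: blinfun.sum_right blinfun.scaleR_right inner_sum_left)
      qed
      have fb: "f b = (\<lambda>x. \<Sum>(g, n, r, r') \<leftarrow> ys. (g * (of_real (perp V r \<bullet> b) - \<i> * of_real (perp V r' \<bullet> b))) * ch (2 ^ q) n x)" for b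
      proof
        fix x
        have "bounded_linear (\<lambda>v. perp V v \<bullet> b)"
          by (rule bounded_linear_compose[OF bounded_linear_inner_left blinfun.bounded_linear_right])
        then show "f b x = (\<Sum>(g, n, r, r') \<leftarrow> ys. (g * (of_real (perp V r \<bullet> b) - \<i> * of_real (perp V r' \<bullet> b))) * ch (2 ^ q) n x)"
          unfolding f_def by (rule w[rule_format])
      qed
      have "(\<Sum>b\<in>Basis. conv (2 ^ q) (kk a b) (f b) x)
        = (\<Sum>b\<in>Basis. \<Sum>(g, n, r, r') \<leftarrow> ys. (g * (of_real (perp V r \<bullet> b) - \<i> * of_real (perp V r' \<bullet> b))) * (m (V, a, b) (rvec n) * ch (2 ^ q) n x))"
      proof (rule sum.cong[OF refl])
        fix b :: 'v assume b: "b \<in> Basis"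
        show "conv (2 ^ q) (kk a b) (f b) x = (\<Sum>(g, n, r, r') \<leftarrow> ys. (g * (of_real (perp V r \<bullet> b) - \<i> * of_real (perp V r' \<bullet> b))) * (m (V, a, b) (rvec n) * ch (2 ^ q) n x))"
          unfolding fb case_prod_beta conv_sum conv_cmult
          by (intro arg_cong[of _ _ sum_list] map_cong refl arg_cong2[of _ _ _ _ "(*)"] kk[OF a b])
             (use ys in auto)
      qed
      also have "\<dots> = (\<Sum>(g, n, r, r') \<leftarrow> ys. \<Sum>b\<in>Basis. (g * (of_real (perp V r \<bullet> b) - \<i> * of_real (perp V r' \<bullet> b))) * (m (V, a, b) (rvec n) * ch (2 ^ q) n x))"
        by (induction ys) (auto simp: sum.distrib)
      also have "\<dots> = (\<Sum>(g, n, r, r') \<leftarrow> ys. g * (of_real (r \<bullet> a) - \<i> * of_real (r' \<bullet> a)) * ch (2 ^ q) n x / of_real E)"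
      proof (intro arg_cong[of _ _ sum_list] map_cong refl)
        fix y assume y: "y \<in> set ys"
        obtain g n r r' where yy: "y = (g, n, r, r')" by (cases y)
        have r: "\<forall>\<xi>. rvec n = 0 \<or> \<xi> = rvec n \<longrightarrow> symbol A k \<xi> r = 0"
          "\<forall>\<xi>. rvec n = 0 \<or> \<xi> = rvec n \<longrightarrow> symbol A k \<xi> r' = 0"
          using ys y unfolding yy by blast+
        have "(\<Sum>b\<in>Basis. (g * (of_real (perp V r \<bullet> b) - \<i> * of_real (perp V r' \<bullet> b))) * (m (V, a, b) (rvec n) * ch (2 ^ q) n x))
           = g * (of_real (\<Sum>b\<in>Basis. (perp V r \<bullet> b) * (Q V (rvec n) b \<bullet> a)) - \<i> * of_real (\<Sum>b\<in>Basis. (perp V r' \<bullet> b) * (Q V (rvec n) b \<bullet> a))) * ch (2 ^ q) n x / of_real E"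
          by (simp add: m_def E_def of_real_sum sum_distrib_left sum_distrib_right sum_subtractf[symmetric]
              sum_divide_distrib right_diff_distrib left_diff_distrib diff_divide_distrib mult_ac)
        then show "(case y of (g, n, r, r') \<Rightarrow> \<Sum>b\<in>Basis. (g * (of_real (perp V r \<bullet> b) - \<i> * of_real (perp V r' \<bullet> b))) * (m (V, a, b) (rvec n) * ch (2 ^ q) n x))
          = (case y of (g, n, r, r') \<Rightarrow> g * (of_real (r \<bullet> a) - \<i> * of_real (r' \<bullet> a)) * ch (2 ^ q) n x / of_real E)"
          unfolding yy prod.case Qr[OF r(1)] Qr[OF r(2)] .
      qed
      also have "\<dots> = (\<Sum>(g, n, r, r') \<leftarrow> ys. g * (of_real (r \<bullet> a) - \<i> * of_real (r' \<bullet> a)) * ch (2 ^ q) n x) / of_real E"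
        by (induction ys) (auto simp: add_divide_distrib)
      also have "(\<Sum>(g, n, r, r') \<leftarrow> ys. g * (of_real (r \<bullet> a) - \<i> * of_real (r' \<bullet> a)) * ch (2 ^ q) n x) = of_real (w x \<bullet> a)"
        using w[rule_format, OF bounded_linear_inner_left[of a], of x] by simp
      finally show ?thesis using E by simp
    qed
    \<comment> \<open>If none of the \<open>D\<^sup>2\<close> entries exceeds \<open>\<tau>\<close>, then \<open>w\<close> does not exceed \<open>t\<close>.\<close>
    define \<tau> where "\<tau> = t / (E * D\<^sup>2)"
    have \<tau>: "\<tau> > 0" using t E D by (simp add: \<tau>_def)
    define Y where "Y p = {x \<in> torus (2 ^ q) :: (int ^ 'd) set. \<tau> < cmod (conv (2 ^ q) (kk (fst p) (snd p)) (f (snd p)) x)}" for p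
    define BB where "BB = (Basis \<times> Basis :: ('v \<times> 'v) set)"
    have "{x \<in> torus (2 ^ q). t < norm (w x)} \<subseteq> (\<Union>p\<in>BB. Y p)"
    proof
      fix x assume "x \<in> {x \<in> torus (2 ^ q). t < norm (w x)}"
      then have x: "x \<in> torus (2 ^ q)" "t < norm (w x)" by auto
      show "x \<in> (\<Union>p\<in>BB. Y p)"
      proof (rule ccontr)
        assume n: "x \<notin> (\<Union>p\<in>BB. Y p)"
        have le: "cmod (conv (2 ^ q) (kk a b) (f b) x) \<le> \<tau>" if "a \<in> Basis" "b \<in> Basis" for a b
        proof -
          have "(a, b) \<in> BB" using that by (simp add: BB_def)
          then have "x \<notin> Y (a, b)" using n by blast
          then show ?thesis using x(1) by (simp add: Y_def not_less)
        qed
        have "norm (w x) \<le> (\<Sum>a\<in>Basis. \<bar>w x \<bullet> a\<bar>)" by (rule norm_le_l1)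
        also have "\<dots> \<le> (\<Sum>a\<in>(Basis :: 'v set). E * (D * \<tau>))"
        proof (rule sum_mono)
          fix a :: 'v assume a: "a \<in> Basis"
          have "\<bar>w x \<bullet> a\<bar> = cmod (of_real (w x \<bullet> a))" by simp
          also have "\<dots> = E * cmod (\<Sum>b\<in>Basis. conv (2 ^ q) (kk a b) (f b) x)"
            unfolding key[OF a] norm_mult using E by simp
          also have "\<dots> \<le> E * (\<Sum>b\<in>(Basis :: 'v set). \<tau>)"
            using E le[OF a] by (intro mult_left_mono order.trans[OF norm_sum] sum_mono) auto
          finally show "\<bar>w x \<bullet> a\<bar> \<le> E * (D * \<tau>)" by (simp add: D_def)
        qed
        also have "\<dots> = t" using E D by (simp add: \<tau>_def D_def power2_eq_square)
        finally show False using x(2) by simp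
      qed
    qed
    then have "card {x \<in> torus (2 ^ q). t < norm (w x)} \<le> card (\<Union>p\<in>BB. Y p)"
      by (intro card_mono finite_UN_I) (auto simp: BB_def Y_def)
    also have "\<dots> \<le> (\<Sum>p\<in>BB. card (Y p))" by (rule card_UN_le) (simp add: BB_def)
    finally have "real (card {x \<in> torus (2 ^ q). t < norm (w x)}) \<le> (\<Sum>p\<in>BB. real (card (Y p)))"
      by (simp only: of_nat_sum[symmetric] of_nat_le_iff)
    then have "\<tau> * real (card {x \<in> torus (2 ^ q). t < norm (w x)}) \<le> (\<Sum>p\<in>BB. \<tau> * real (card (Y p)))"
      unfolding sum_distrib_left[symmetric] using \<tau> by (intro mult_left_mono) auto
    also have "\<dots> \<le> (\<Sum>p\<in>BB. C * (\<Sum>x\<in>torus (2 ^ q). norm (perp V (w x))))"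
    proof (rule sum_mono)
      fix p assume "p \<in> BB"
      then have p: "fst p \<in> Basis" "snd p \<in> Basis" by (auto simp: BB_def)
      have "\<tau> * real (card (Y p)) \<le> C * (\<Sum>y\<in>torus (2 ^ q). cmod (f (snd p) y))"
        unfolding Y_def by (rule kk2[OF p \<tau>])
      also have "\<dots> \<le> C * (\<Sum>x\<in>torus (2 ^ q). norm (perp V (w x)))"
        using C(1) Basis_le_norm[OF p(2)] by (intro mult_left_mono sum_mono) (auto simp: f_def)
      finally show "\<tau> * real (card (Y p)) \<le> C * (\<Sum>x\<in>torus (2 ^ q). norm (perp V (w x)))" .
    qed
    also have "\<dots> = D\<^sup>2 * C * (\<Sum>x\<in>torus (2 ^ q). norm (perp V (w x)))"
      by (simp add: BB_def D_def power2_eq_square card_cartesian_product)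
    finally have "(E * D\<^sup>2) * (\<tau> * real (card {x \<in> torus (2 ^ q). t < norm (w x)}))
        \<le> (E * D\<^sup>2) * (D\<^sup>2 * C * (\<Sum>x\<in>torus (2 ^ q). norm (perp V (w x))))"
      by (rule mult_left_mono) (use E in simp)
    moreover have "(E * D\<^sup>2) * (\<tau> * real (card {x \<in> torus (2 ^ q). t < norm (w x)})) = t * real (card {x \<in> torus (2 ^ q). t < norm (w x)})"
      using E D by (simp add: \<tau>_def)
    moreover have "(E * D\<^sup>2) * (D\<^sup>2 * C * (\<Sum>x\<in>torus (2 ^ q). norm (perp V (w x)))) = (D ^ 4 * C) * E * (\<Sum>x\<in>torus (2 ^ q). norm (perp V (w x)))"
      by (simp add: power2_eq_square power4_eq_xxxx)
    ultimately have "t * real (card {x \<in> torus (2 ^ q). t < norm (w x)}) \<le> (D ^ 4 * C) * E * (\<Sum>x\<in>torus (2 ^ q). norm (perp V (w x)))"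
      by linarith
    then show ?thesis by (simp only: E_def K_def)
  qed
  then show ?thesis
    by (intro exI[of _ "D ^ 4 * C"] conjI allI impI) (use D C(1) in simp)
qed

section \<open>Approximation by trigonometric polynomials\<close>

definition trig_sum :: "real \<Rightarrow> (complex \<times> (int ^ 'd::finite)) list \<Rightarrow> real ^ 'd \<Rightarrow> complex" where
  "trig_sum L xs z = (\<Sum>(g, n) \<leftarrow> xs. g * cis (2 * pi / L * (rvec n \<bullet> z)))"

definition trig_poly :: "real \<Rightarrow> (real ^ 'd::finite \<Rightarrow> complex) \<Rightarrow> bool" where
  "trig_poly L f \<longleftrightarrow> (\<exists>xs. f = trig_sum L xs)"

lemma trig_sum_append: "trig_sum L (xs @ ys) z = trig_sum L xs z + trig_sum L ys z"
  by (simp add: trig_sum_def)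

lemma rvec_add: "rvec (n + m) = rvec n + rvec m"
  by (simp add: rvec_def vec_eq_iff)

lemma rvec_0: "rvec 0 = 0"
  by (simp add: rvec_def vec_eq_iff)

lemma trig_poly_add: "trig_poly L f \<Longrightarrow> trig_poly L g \<Longrightarrow> trig_poly L (\<lambda>z. f z + g z)"
proof -
  assume "trig_poly L f" "trig_poly L g"
  then obtain xs ys where "f = trig_sum L xs" "g = trig_sum L ys" by (auto simp: trig_poly_def)
  then have "(\<lambda>z. f z + g z) = trig_sum L (xs @ ys)" by (simp add: trig_sum_append fun_eq_iff)
  then show ?thesis unfolding trig_poly_def by blast
qed

lemma trig_sum_shift:
  "trig_sum L (map (\<lambda>(h, m). (g * h, n + m)) ys) z = g * cis (2 * pi / L * (rvec n \<bullet> z)) * trig_sum L ys z"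
  unfolding trig_sum_def
  by (induction ys) (auto simp: rvec_add inner_add_left cis_mult[symmetric] ring_distribs add_divide_distrib)

lemma trig_poly_mult: "trig_poly L f \<Longrightarrow> trig_poly L g \<Longrightarrow> trig_poly L (\<lambda>z. f z * g z)"
proof -
  assume "trig_poly L f" "trig_poly L g"
  then obtain xs ys where fg: "f = trig_sum L xs" "g = trig_sum L ys" by (auto simp: trig_poly_def)
  have "\<exists>zs. (\<lambda>z. trig_sum L xs z * trig_sum L ys z) = trig_sum L zs"
  proof (induction xs)
    case Nil
    show ?case by (rule exI[of _ "[]"]) (simp add: trig_sum_def)
  next
    case (Cons x xs)
    then obtain zs where zs: "(\<lambda>z. trig_sum L xs z * trig_sum L ys z) = trig_sum L zs" by blast
    obtain h n where x: "x = (h, n)" by (cases x)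
    have "trig_sum L (x # xs) z * trig_sum L ys z = trig_sum L (map (\<lambda>(g, m). (h * g, n + m)) ys @ zs) z" for z
      unfolding trig_sum_append trig_sum_shift zs[symmetric] by (simp add: trig_sum_def x ring_distribs)
    then show ?case by blast
  qed
  then show ?thesis by (simp add: trig_poly_def fg)
qed

lemma trig_poly_const: "trig_poly L (\<lambda>_. c)"
  unfolding trig_poly_def by (rule exI[of _ "[(c, 0)]"]) (simp add: trig_sum_def fun_eq_iff rvec_0)

lemma trig_poly_power: "trig_poly L f \<Longrightarrow> trig_poly L (\<lambda>z. f z ^ N)"
  by (induction N) (auto intro: trig_poly_mult trig_poly_const)

lemma trig_poly_sum: "finite A \<Longrightarrow> (\<And>i. i \<in> A \<Longrightarrow> trig_poly L (f i)) \<Longrightarrow> trig_poly L (\<lambda>z. \<Sum>i\<in>A. f i z)"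
  by (induction rule: finite_induct) (auto intro: trig_poly_add trig_poly_const)

lemma trig_poly_cos: "trig_poly L (\<lambda>z. complex_of_real (cos (2 * pi / L * z $ i)))"
proof -
  have "rvec (axis i 1) \<bullet> z = z $ i" "rvec (- axis i 1) \<bullet> z = - z $ i" for z
  proof -
    have "rvec (axis i 1) = axis i 1" "rvec (- axis i 1) = - axis i 1"
      by (auto simp: rvec_def vec_eq_iff axis_def)
    then show "rvec (axis i 1) \<bullet> z = z $ i" "rvec (- axis i 1) \<bullet> z = - z $ i"
      by (auto simp: inner_axis' inner_axis inner_commute)
  qed
  then have "complex_of_real (cos (2 * pi / L * z $ i)) = trig_sum L [(1 / 2, axis i 1), (1 / 2, - axis i 1)] z" for z
    by (simp add: trig_sum_def complex_eq_iff)
  then show ?thesis unfolding trig_poly_def by blast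
qed

text \<open>
  A trigonometric polynomial of period \<open>L\<close> that attains its maximum only at the lattice points; its powers are
  concentrated trigonometric polynomials (in one dimension, de la Vallee-Poussin kernels).
\<close>

definition trig_peak :: "real \<Rightarrow> real ^ 'd::finite \<Rightarrow> real" where
  "trig_peak L z = (\<Sum>i\<in>UNIV. (1 + cos (2 * pi / L * z $ i)) / 2) / real CARD('d)"

lemma trig_poly_peak: "trig_poly L (\<lambda>z :: real ^ 'd::finite. complex_of_real (trig_peak L z))"
proof -
  have "complex_of_real (trig_peak L z)
      = (\<Sum>i\<in>UNIV. (1 + complex_of_real (cos (2 * pi / L * z $ i))) * (1 / 2)) * (1 / of_nat CARD('d))" for z :: "real ^ 'd"
    by (simp add: trig_peak_def)
  moreover have "trig_poly L (\<lambda>z :: real ^ 'd. (\<Sum>i\<in>UNIV. (1 + complex_of_real (cos (2 * pi / L * z $ i))) * (1 / 2)) * (1 / of_nat CARD('d)))"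
    by (intro trig_poly_mult trig_poly_sum trig_poly_add trig_poly_const trig_poly_cos) auto
  ultimately show ?thesis by simp
qed

lemma trig_peak_props:
  fixes z :: "real ^ 'd::finite"
  shows "0 \<le> trig_peak L z" "trig_peak L (0 :: real ^ 'd) = 1"
    and "L > 0 \<Longrightarrow> (\<And>i. \<bar>z $ i\<bar> < L) \<Longrightarrow> z \<noteq> 0 \<Longrightarrow> trig_peak L z < 1"
    and "continuous_on UNIV (trig_peak L :: real ^ 'd \<Rightarrow> real)"
proof -
  have n: "0 \<le> 1 + cos t" for t :: real using cos_ge_minus_one[of t] by linarith
  show "0 \<le> trig_peak L z" unfolding trig_peak_def by (intro divide_nonneg_nonneg sum_nonneg n) auto
  show "trig_peak L (0 :: real ^ 'd) = 1" by (simp add: trig_peak_def)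
  show "continuous_on UNIV (trig_peak L :: real ^ 'd \<Rightarrow> real)"
    unfolding trig_peak_def by (intro continuous_intros) auto
  assume L: "L > 0" and z: "\<And>i. \<bar>z $ i\<bar> < L" "z \<noteq> 0"
  obtain i where i: "z $ i \<noteq> 0" using z(2) by (auto simp: vec_eq_iff)
  have "cos (2 * pi / L * z $ i) \<noteq> 1"
  proof
    assume "cos (2 * pi / L * z $ i) = 1"
    then obtain l where l: "2 * pi / L * z $ i = real_of_int l * 2 * pi" unfolding cos_one_2pi_int by blast
    then have zl: "z $ i = real_of_int l * L" using L by (simp add: field_simps)
    then have "\<bar>real_of_int l\<bar> * L < 1 * L" using z(1)[of i] L by (simp add: abs_mult)
    then have "\<bar>real_of_int l\<bar> < 1" using L by (simp only: mult_less_cancel_right_pos)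
    then have "l = 0" by linarith
    then show False using i zl by simp
  qed
  then have c: "cos (2 * pi / L * z $ i) < 1" using cos_le_one[of "2 * pi / L * z $ i"] by linarith
  have "(\<Sum>i\<in>UNIV. (1 + cos (2 * pi / L * z $ i)) / 2) < (\<Sum>i\<in>(UNIV::'d set). 1)"
  proof (rule sum_strict_mono_ex1)
    show "\<exists>i\<in>UNIV. (1 + cos (2 * pi / L * z $ i)) / 2 < 1" using c by (intro bexI[of _ i]) auto
  qed auto
  then show "trig_peak L z < 1" by (simp add: trig_peak_def divide_less_eq)
qed

text \<open>
  Convolving with a trigonometric polynomial multiplies its coefficients by the values of the Fourier transform
  of \<open>g\<close>, real and imaginary parts being written out.
\<close>

lemma integral_trig_conv:
  fixes g :: "real ^ 'd::finite \<Rightarrow> real"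
  assumes T: "compact T" and g: "continuous_on UNIV g" "\<And>x. x \<notin> T \<Longrightarrow> g x = 0"
  shows "integrable lborel (\<lambda>y. trig_sum L xs (x - y) * of_real (g y)) \<and>
    (\<integral>y. trig_sum L xs (x - y) * of_real (g y) \<partial>lborel) = (\<Sum>(c, n) \<leftarrow> xs. c * cis (2 * pi / L * (rvec n \<bullet> x)) *
      (of_real (\<integral>y. cos ((2 * pi / L) *\<^sub>R rvec n \<bullet> y) * g y \<partial>lborel) - \<i> * of_real (\<integral>y. sin ((2 * pi / L) *\<^sub>R rvec n \<bullet> y) * g y \<partial>lborel)))"
proof (induction xs)
  case Nil
  show ?case by (simp add: trig_sum_def)
next
  case (Cons p xs)
  obtain c n where p: "p = (c, n)" by (cases p)
  define k where "k = (2 * pi / L) *\<^sub>R rvec n"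
  define a where "a = c * cis (2 * pi / L * (rvec n \<bullet> x))"
  have i1: "integrable lborel (\<lambda>y. cos (k \<bullet> y) * g y)" and i2: "integrable lborel (\<lambda>y. sin (k \<bullet> y) * g y)"
    using g by (auto intro!: integrable_compact_support[OF T] continuous_intros)
  have e: "trig_sum L (p # xs) (x - y) * of_real (g y)
      = a * (of_real (cos (k \<bullet> y) * g y) - \<i> * of_real (sin (k \<bullet> y) * g y)) + trig_sum L xs (x - y) * of_real (g y)" for y
  proof -
    have "2 * pi / L * (rvec n \<bullet> (x - y)) = 2 * pi / L * (rvec n \<bullet> x) + - (k \<bullet> y)"
      by (simp add: k_def inner_diff_right right_diff_distrib)
    then have "cis (2 * pi / L * (rvec n \<bullet> (x - y))) = cis (2 * pi / L * (rvec n \<bullet> x)) * cis (- (k \<bullet> y))"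
      by (simp only: cis_mult)
    moreover have "cis (- (k \<bullet> y)) = of_real (cos (k \<bullet> y)) - \<i> * of_real (sin (k \<bullet> y))"
      by (simp add: complex_eq_iff)
    ultimately show ?thesis by (simp add: trig_sum_def p a_def ring_distribs mult_ac)
  qed
  have j: "integrable lborel (\<lambda>y. a * (of_real (cos (k \<bullet> y) * g y) - \<i> * of_real (sin (k \<bullet> y) * g y)))"
    by (intro integrable_mult_right Bochner_Integration.integrable_diff integrable_of_real i1 i2)
  have J: "(\<integral>y. a * (of_real (cos (k \<bullet> y) * g y) - \<i> * of_real (sin (k \<bullet> y) * g y)) \<partial>lborel)
      = a * (of_real (\<integral>y. cos (k \<bullet> y) * g y \<partial>lborel) - \<i> * of_real (\<integral>y. sin (k \<bullet> y) * g y \<partial>lborel))"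
  proof -
    have "(\<integral>y. complex_of_real (cos (k \<bullet> y) * g y) - \<i> * of_real (sin (k \<bullet> y) * g y) \<partial>lborel)
      = (\<integral>y. complex_of_real (cos (k \<bullet> y) * g y) \<partial>lborel) - (\<integral>y. \<i> * complex_of_real (sin (k \<bullet> y) * g y) \<partial>lborel)"
      by (intro Bochner_Integration.integral_diff integrable_of_real integrable_mult_right i1 i2)
    then show ?thesis by (simp only: integral_mult_right_zero integral_complex_of_real)
  qed
  have IH: "integrable lborel (\<lambda>y. trig_sum L xs (x - y) * of_real (g y))" using Cons by blast
  have "integrable lborel (\<lambda>y. trig_sum L (p # xs) (x - y) * of_real (g y))"
    unfolding e by (rule Bochner_Integration.integrable_add[OF j IH])
  moreover have "(\<integral>y. trig_sum L (p # xs) (x - y) * of_real (g y) \<partial>lborel)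
      = a * (of_real (\<integral>y. cos (k \<bullet> y) * g y \<partial>lborel) - \<i> * of_real (\<integral>y. sin (k \<bullet> y) * g y \<partial>lborel))
        + (\<integral>y. trig_sum L xs (x - y) * of_real (g y) \<partial>lborel)"
    unfolding e Bochner_Integration.integral_add[OF j IH] J ..
  ultimately show ?case using Cons unfolding p a_def k_def by (simp only: list.map sum_list.Cons prod.case)
qed

text \<open>
  Differences \<open>x - y\<close> with \<open>x\<close> in the cube of side \<open>L\<close> and \<open>y\<close> in the support have coordinates of modulus at most
  \<open>3 L / 4\<close>, so \<open>0\<close> is the only lattice point they meet and periodicity does no harm.
\<close>

lemma exists_trig_approximation:
  fixes u :: "real ^ 'd::finite \<Rightarrow> 'v::euclidean_space"
  assumes u: "u \<in> test_functions" and L: "L > 0" and e: "e > 0"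
    and supp: "\<And>x i. x \<in> supp u \<Longrightarrow> \<bar>x $ i\<bar> \<le> L / 4"
  shows "\<exists>v xs. (\<forall>x. (\<forall>i. \<bar>x $ i\<bar> \<le> L / 2) \<longrightarrow> norm (v x - u x) \<le> e) \<and>
    (\<forall>l x. bounded_linear l \<longrightarrow> complex_of_real (l (v x))
      = (\<Sum>(c, n) \<leftarrow> xs. c * cis (2 * pi / L * (rvec n \<bullet> x)) *
      (of_real (l (cos_transform u ((2 * pi / L) *\<^sub>R rvec n))) - \<i> * of_real (l (sin_transform u ((2 * pi / L) *\<^sub>R rvec n))))))"
proof -
  define S where "S = cbox (\<chi> i. - (3 * L / 4)) (\<chi> i. 3 * L / 4 :: real ^ 'd)"
  define X where "X = {x :: real ^ 'd. \<forall>i. \<bar>x $ i\<bar> \<le> L / 2}"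
  have uc: "continuous_on UNIV u" using continuous_pderivs[OF u, of "[]"] by simp
  have u0: "x \<notin> supp u \<Longrightarrow> u x = 0" for x using pderivs_outside[OF u, of x "[]"] by simp
  note T = compact_supp[OF u]
  have "\<exists>N c. c > 0 \<and> (\<forall>x\<in>X. norm ((\<integral>y. (c * trig_peak L (x - y) ^ N) *\<^sub>R u y \<partial>lborel) - u x) \<le> e)"
  proof (rule approximate_identity[OF trig_peak_props(4) trig_peak_props(1) trig_peak_props(2) _ _ T uc u0 _ e])
    show "compact S" by (simp add: S_def)
    show "trig_peak L z < 1" if "z \<in> S" "z \<noteq> 0" for z
    proof (rule trig_peak_props(3)[OF L _ that(2)])
      fix i
      have "- (3 * L / 4) \<le> z $ i" "z $ i \<le> 3 * L / 4" using that(1) by (auto simp: S_def mem_box_cart)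
      then show "\<bar>z $ i\<bar> < L" using L by (simp add: abs_less_iff)
    qed
    fix x y assume xy: "x \<in> X" "y \<in> supp u"
    have "- (3 * L / 4) \<le> (x - y) $ i \<and> (x - y) $ i \<le> 3 * L / 4" for i
    proof -
      have "\<bar>x $ i\<bar> \<le> L / 2" "\<bar>y $ i\<bar> \<le> L / 4" using xy supp by (auto simp: X_def)
      then show ?thesis unfolding vector_minus_component by linarith
    qed
    then show "x - y \<in> S" by (auto simp: S_def mem_box_cart)
  qed
  then obtain N c where c: "\<And>x. x \<in> X \<Longrightarrow> norm ((\<integral>y. (c * trig_peak L (x - y) ^ N) *\<^sub>R u y \<partial>lborel) - u x) \<le> e" by blast
  define v where "v x = (\<integral>y. (c * trig_peak L (x - y) ^ N) *\<^sub>R u y \<partial>lborel)" for x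
  have "trig_poly L (\<lambda>z :: real ^ 'd. complex_of_real c * complex_of_real (trig_peak L z) ^ N)"
    by (intro trig_poly_mult trig_poly_const trig_poly_power trig_poly_peak)
  then obtain xs where xs: "(\<lambda>z :: real ^ 'd. complex_of_real c * complex_of_real (trig_peak L z) ^ N) = trig_sum L xs"
    by (auto simp: trig_poly_def)
  have xs': "complex_of_real (c * trig_peak L z ^ N) = trig_sum L xs z" for z :: "real ^ 'd"
    using fun_cong[OF xs, of z] by simp
  have "complex_of_real (l (v x))
      = (\<Sum>(c, n) \<leftarrow> xs. c * cis (2 * pi / L * (rvec n \<bullet> x)) *
      (of_real (l (cos_transform u ((2 * pi / L) *\<^sub>R rvec n))) - \<i> * of_real (l (sin_transform u ((2 * pi / L) *\<^sub>R rvec n)))))"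
    if l: "bounded_linear l" for l x
  proof -
    define g where "g y = l (u y)" for y
    have gc: "continuous_on UNIV g"
      unfolding g_def using bounded_linear.continuous_on[OF l uc] .
    have g0: "y \<notin> supp u \<Longrightarrow> g y = 0" for y using u0[of y] linear_0[OF bounded_linear.linear[OF l]] by (simp add: g_def)
    have lint: "l (\<integral>y. a y *\<^sub>R u y \<partial>lborel) = (\<integral>y. a y * g y \<partial>lborel)"
      if a: "continuous_on UNIV a" for a :: "real ^ 'd \<Rightarrow> real"
    proof -
      have "integrable lborel (\<lambda>y. a y *\<^sub>R u y)"
        by (rule integrable_compact_support[OF T]) (use u0 in \<open>auto intro!: continuous_on_scaleR a uc\<close>)
      then have "l (\<integral>y. a y *\<^sub>R u y \<partial>lborel) = (\<integral>y. l (a y *\<^sub>R u y) \<partial>lborel)"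
        by (rule integral_bounded_linear[OF l, symmetric])
      also have "\<dots> = (\<integral>y. a y * g y \<partial>lborel)"
        by (simp add: g_def linear_cmul[OF bounded_linear.linear[OF l]])
      finally show ?thesis .
    qed
    have "l (v x) = (\<integral>y. (c * trig_peak L (x - y) ^ N) * g y \<partial>lborel)"
      unfolding v_def by (rule lint) (intro continuous_intros continuous_on_compose2[OF trig_peak_props(4)]; simp)
    then have "complex_of_real (l (v x)) = (\<integral>y. complex_of_real ((c * trig_peak L (x - y) ^ N) * g y) \<partial>lborel)"
      by (simp only: integral_complex_of_real)
    also have "\<dots> = (\<integral>y. trig_sum L xs (x - y) * complex_of_real (g y) \<partial>lborel)"
      by (simp only: of_real_mult[of "_ * _"] xs')
    also have "\<dots> = (\<Sum>(c, n) \<leftarrow> xs. c * cis (2 * pi / L * (rvec n \<bullet> x)) *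
      (of_real (\<integral>y. cos ((2 * pi / L) *\<^sub>R rvec n \<bullet> y) * g y \<partial>lborel) - \<i> * of_real (\<integral>y. sin ((2 * pi / L) *\<^sub>R rvec n \<bullet> y) * g y \<partial>lborel)))"
      using integral_trig_conv[OF T gc g0, of L xs x] by blast
    also have "\<dots> = (\<Sum>(c, n) \<leftarrow> xs. c * cis (2 * pi / L * (rvec n \<bullet> x)) *
      (of_real (l (cos_transform u ((2 * pi / L) *\<^sub>R rvec n))) - \<i> * of_real (l (sin_transform u ((2 * pi / L) *\<^sub>R rvec n)))))"
    proof -
      have "l (cos_transform u k) = (\<integral>y. cos (k \<bullet> y) * g y \<partial>lborel)" for k
        unfolding cos_transform_def by (rule lint) (intro continuous_intros)
      moreover have "l (sin_transform u k) = (\<integral>y. sin (k \<bullet> y) * g y \<partial>lborel)" for k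
        unfolding sin_transform_def by (rule lint) (intro continuous_intros)
      ultimately show ?thesis by (simp only:)
    qed
    finally show ?thesis .
  qed
  then show ?thesis using c unfolding v_def[symmetric] X_def by blast
qed

section \<open>Sampling on a grid\<close>

definition grid_point :: "real \<Rightarrow> real \<Rightarrow> int ^ 'd::finite \<Rightarrow> real ^ 'd" where
  "grid_point L h x = (\<chi> i. h * real_of_int (x $ i) - L / 2)"

text \<open>
  Half-open, so that distinct cells are disjoint.
\<close>

definition grid_cell :: "real \<Rightarrow> real \<Rightarrow> int ^ 'd::finite \<Rightarrow> (real ^ 'd) set" where
  "grid_cell L h x = {y. \<forall>i. grid_point L h x $ i \<le> y $ i \<and> y $ i < grid_point L h x $ i + h}"

lemma grid_cell_iff:
  assumes "h > 0"
  shows "y \<in> grid_cell L h x \<longleftrightarrow> (\<forall>i. x $ i = \<lfloor>(y $ i + L / 2) / h\<rfloor>)"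
proof -
  have "(grid_point L h x $ i \<le> y $ i \<and> y $ i < grid_point L h x $ i + h) \<longleftrightarrow> x $ i = \<lfloor>(y $ i + L / 2) / h\<rfloor>" for i
  proof -
    have "(grid_point L h x $ i \<le> y $ i \<and> y $ i < grid_point L h x $ i + h)
        \<longleftrightarrow> real_of_int (x $ i) \<le> (y $ i + L / 2) / h \<and> (y $ i + L / 2) / h < real_of_int (x $ i) + 1"
      using assms by (auto simp: grid_point_def field_simps)
    also have "\<dots> \<longleftrightarrow> \<lfloor>(y $ i + L / 2) / h\<rfloor> = x $ i" by (simp add: floor_eq_iff)
    finally show ?thesis by auto
  qed
  then show ?thesis unfolding grid_cell_def by blast
qed

lemma grid_cell_disjoint:
  assumes "h > 0" "y \<in> grid_cell L h x" "y \<in> grid_cell L h x'"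
  shows "x = x'"
  using assms by (auto simp: grid_cell_iff vec_eq_iff)

lemma grid_cell_box: "box (grid_point L h x) (\<chi> i. grid_point L h x $ i + h) \<subseteq> grid_cell L h x"
  "grid_cell L h x \<subseteq> cbox (grid_point L h x) (\<chi> i. grid_point L h x $ i + h)"
  by (simp_all add: subset_iff grid_cell_def mem_box_cart less_imp_le)

lemma grid_cell_sets: "grid_cell L h x \<in> sets borel" for x :: "int ^ 'd::finite"
proof -
  have "grid_cell L h x = (\<Inter>i\<in>UNIV. {y. grid_point L h x $ i \<le> y $ i} \<inter> {y. y $ i < grid_point L h x $ i + h})"
    by (auto simp: grid_cell_def)
  also have "\<dots> \<in> sets borel"
    by (intro sets.finite_INT sets.Int borel_closed borel_open closed_Collect_le open_Collect_less continuous_intros) auto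
  finally show ?thesis .
qed

lemma emeasure_grid_cell:
  fixes x :: "int ^ 'd::finite"
  assumes "h > 0"
  shows "emeasure lborel (grid_cell L h x) = ennreal (h ^ CARD('d))"
proof (rule antisym)
  define a b where "a = grid_point L h x" "b = (\<chi> i. grid_point L h x $ i + h)"
  have le: "a $ i \<le> b $ i" for i using assms by (simp add: a_b_def)
  have ne: "cbox a b \<noteq> {}" using le by (simp add: interval_ne_empty_cart)
  have "measure lborel (cbox a b) = (\<Prod>i\<in>UNIV. b $ i - a $ i)" by (rule content_cbox_cart[OF ne])
  also have "\<dots> = h ^ CARD('d)" by (simp add: a_b_def)
  finally have "emeasure lborel (cbox a b) = ennreal (h ^ CARD('d))"
    by (subst emeasure_eq_ennreal_measure) (auto simp: emeasure_lborel_cbox_eq)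
  moreover have "emeasure lborel (box a b) = emeasure lborel (cbox a b)"
    by (simp add: emeasure_lborel_box_eq emeasure_lborel_cbox_eq)
  ultimately show "emeasure lborel (grid_cell L h x) \<le> ennreal (h ^ CARD('d))" "ennreal (h ^ CARD('d)) \<le> emeasure lborel (grid_cell L h x)"
    using emeasure_mono[OF grid_cell_box(2)[of L h x], of lborel] emeasure_mono[OF grid_cell_box(1)[of L h x], of lborel]
      grid_cell_sets[of L h x] by (simp_all add: a_b_def)
qed

lemma dist_grid_cell_le:
  fixes x :: "int ^ 'd::finite" and h :: real
  assumes "y \<in> grid_cell L h x"
  shows "dist y (grid_point L h x) \<le> CARD('d) * h"
proof -
  have "dist y (grid_point L h x) \<le> (\<Sum>i\<in>UNIV. \<bar>(y - grid_point L h x) $ i\<bar>)"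
    unfolding dist_norm by (rule norm_le_l1_cart)
  also have "\<dots> \<le> (\<Sum>i\<in>(UNIV::'d set). h)"
    using assms by (intro sum_mono) (auto simp: grid_cell_def abs_le_iff less_imp_le algebra_simps)
  finally show ?thesis by simp
qed

lemma grid_cell_covers:
  fixes y :: "real ^ 'd::finite"
  assumes "L > 0" "M > 0" "\<And>i. \<bar>y $ i\<bar> < L / 2"
  shows "\<exists>x\<in>torus M. y \<in> grid_cell L (L / real M) x"
proof -
  define x where "x = (\<chi> i. \<lfloor>(y $ i + L / 2) / (L / real M)\<rfloor> :: int ^ 'd)"
  have h: "L / real M > 0" using assms by simp
  have "0 \<le> x $ i \<and> x $ i < int M" for i
  proof -
    have y: "- (L / 2) < y $ i" "y $ i < L / 2" using assms(3)[of i] by auto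
    then have "0 \<le> (y $ i + L / 2) / (L / real M)" using h by (intro divide_nonneg_pos) auto
    moreover have "(y $ i + L / 2) / (L / real M) < real_of_int (int M)"
      using y h assms(1,2) by (simp add: divide_less_eq field_simps)
    ultimately show ?thesis by (simp add: x_def floor_less_iff)
  qed
  then have "x \<in> torus M" by (auto simp: cube_def)
  moreover have "y \<in> grid_cell L (L / real M) x" using h by (simp add: grid_cell_iff x_def)
  ultimately show ?thesis by blast
qed

lemma grid_cell_fmeasurable: "h > 0 \<Longrightarrow> grid_cell L h x \<in> fmeasurable lborel"
  by (intro fmeasurableI) (simp_all add: grid_cell_sets emeasure_grid_cell)

lemma measure_grid_cell: "h > 0 \<Longrightarrow> measure lborel (grid_cell L h (x :: int ^ 'd::finite)) = h ^ CARD('d)"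
  by (simp add: measure_def emeasure_grid_cell)

text \<open>
  The value at a grid point is compared with the average over its cell, and the cells are disjoint.
\<close>

lemma riemann_sum_le:
  fixes \<phi> :: "real ^ 'd::finite \<Rightarrow> real"
  assumes L: "L > 0" and M: "M > 0" and int: "integrable lborel \<phi>" and pos: "\<And>y. 0 \<le> \<phi> y"
    and osc: "\<And>x y. y \<in> grid_cell L (L / real M) x \<Longrightarrow> \<phi> (grid_point L (L / real M) x) \<le> \<phi> y + e"
  shows "(L / real M) ^ CARD('d) * (\<Sum>x\<in>torus M. \<phi> (grid_point L (L / real M) x)) \<le> (\<integral>y. \<phi> y \<partial>lborel) + e * L ^ CARD('d)"
proof -
  define h where "h = L / real M"
  have h: "h > 0" using L M by (simp add: h_def)
  define ind where "ind x y = (indicator (grid_cell L h x) y :: real)" for x :: "int ^ 'd" and y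
  have i1: "integrable lborel (ind x)" for x
    unfolding ind_def using grid_cell_fmeasurable[OF h, of L x]
    by (intro integrable_real_indicator) (auto simp: fmeasurable_def)
  have i2: "integrable lborel (\<lambda>y. ind x y * \<phi> y)" for x
    unfolding ind_def using integrable_mult_indicator[of "grid_cell L h x" lborel \<phi>] int grid_cell_sets[of L h x] by simp
  have v: "(\<integral>y. ind x y \<partial>lborel) = h ^ CARD('d)" for x :: "int ^ 'd"
    unfolding ind_def using measure_grid_cell[OF h, of L x] grid_cell_sets[of L h x] by simp
  have "h ^ CARD('d) * (\<Sum>x\<in>torus M. \<phi> (grid_point L h x)) = (\<Sum>x\<in>torus M. (\<integral>y. ind x y * \<phi> (grid_point L h x) \<partial>lborel))"
    by (simp add: sum_distrib_left v)
  also have "\<dots> \<le> (\<Sum>x\<in>torus M. (\<integral>y. ind x y * \<phi> y + ind x y * e \<partial>lborel))"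
  proof (intro sum_mono integral_mono)
    fix x y
    show "ind x y * \<phi> (grid_point L h x) \<le> ind x y * \<phi> y + ind x y * e"
      using osc[of y x] by (auto simp: ind_def h_def indicator_def)
  qed (intro Bochner_Integration.integrable_add integrable_mult_left i1 i2)+
  also have "\<dots> = (\<Sum>x\<in>torus M. (\<integral>y. ind x y * \<phi> y \<partial>lborel)) + (\<Sum>x\<in>(torus M :: (int ^ 'd) set). h ^ CARD('d) * e)"
    unfolding sum.distrib[symmetric]
    by (intro sum.cong refl) (simp add: Bochner_Integration.integral_add[OF i2 integrable_mult_left[OF i1]] v)
  also have "(\<Sum>x\<in>(torus M :: (int ^ 'd) set). h ^ CARD('d) * e) = e * L ^ CARD('d)"
    using M by (simp add: card_cube h_def power_divide)
  also have "(\<Sum>x\<in>torus M. (\<integral>y. ind x y * \<phi> y \<partial>lborel)) = (\<integral>y. (\<Sum>x\<in>torus M. ind x y * \<phi> y) \<partial>lborel)"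
    by (rule Bochner_Integration.integral_sum[symmetric]) (rule i2)
  also have "\<dots> \<le> (\<integral>y. \<phi> y \<partial>lborel)"
  proof (rule integral_mono)
    show "integrable lborel (\<lambda>y. \<Sum>x\<in>torus M. ind x y * \<phi> y)" by (intro Bochner_Integration.integrable_sum i2)
    fix y
    have "(\<Sum>x\<in>torus M. ind x y) \<le> 1"
    proof (cases "\<exists>x\<in>torus M. y \<in> grid_cell L h x")
      case True
      then obtain x0 where x0: "x0 \<in> torus M" "y \<in> grid_cell L h x0" by blast
      have "ind x y = (if x = x0 then 1 else 0)" for x
        using grid_cell_disjoint[OF h] x0(2) by (auto simp: ind_def indicator_def)
      then show ?thesis by simp
    next
      case False
      then have "ind x y = 0" if "x \<in> torus M" for x using that by (auto simp: ind_def)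
      then show ?thesis by simp
    qed
    then have "(\<Sum>x\<in>torus M. ind x y) * \<phi> y \<le> 1 * \<phi> y" using pos by (intro mult_right_mono) auto
    then show "(\<Sum>x\<in>torus M. ind x y * \<phi> y) \<le> \<phi> y" by (simp add: sum_distrib_right)
  qed (rule int)
  finally show ?thesis by (simp add: h_def)
qed

text \<open>
  The grid starts at the corner \<open>-L/2\<close> of the cube, which multiplies the character by a phase that depends on the
  frequency only and can be moved into the coefficient.
\<close>

lemma ch_grid_point:
  assumes "L > 0" "M > 0"
  shows "cis (2 * pi / L * (rvec n \<bullet> grid_point L (L / real M) x)) = cis (- (pi * (\<Sum>i\<in>UNIV. real_of_int (n $ i)))) * ch M n x"
proof -
  have "rvec n \<bullet> grid_point L (L / real M) x
      = L / real M * (\<Sum>i\<in>UNIV. real_of_int (n $ i) * real_of_int (x $ i)) - L / 2 * (\<Sum>i\<in>UNIV. real_of_int (n $ i))"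
    by (simp add: inner_vec_def rvec_def grid_point_def sum_distrib_left sum_subtractf[symmetric] algebra_simps)
  then have "2 * pi / L * (rvec n \<bullet> grid_point L (L / real M) x)
      = - (pi * (\<Sum>i\<in>UNIV. real_of_int (n $ i))) + 2 * pi / real M * (\<Sum>i\<in>UNIV. real_of_int (n $ i) * real_of_int (x $ i))"
    using assms by (simp add: right_diff_distrib)
  then show ?thesis by (simp only: ch_def cis_mult)
qed

text \<open>
  There are two errors of size \<open>e\<close>: between \<open>u\<close> and its trigonometric approximation, and between the values of
  \<open>u\<close> at a grid point and on the cell of that point. Together they change the level \<open>t\<close> by at most \<open>2 e\<close> and the integral by
  at most \<open>2 e\<close> times the volume of the cube, which is fixed while \<open>e\<close> tends to \<open>0\<close>.
\<close>

theorem korn_weak_type: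
  fixes A :: "('d::finite \<Rightarrow> nat) \<Rightarrow> 'v::euclidean_space \<Rightarrow>\<^sub>L 'w::euclidean_space"
  assumes rank: "constant_rank A k"
  shows "\<exists>C>0. \<forall>V u t. subspace V \<longrightarrow> V \<inter> wave_cone A k = {0} \<longrightarrow> u \<in> test_functions \<longrightarrow>
    (\<forall>x. diff_op A k u x = 0) \<longrightarrow> 0 < t \<longrightarrow>
    t * measure lborel {x. t < norm (u x)}
      \<le> C * (1 / cone_dist V (wave_cone A k)) ^ (CARD('d) div 2 + 2) * (\<integral>x. norm (perp V (u x)) \<partial>lborel)"
proof -
  define s where "s = CARD('d) div 2 + 1"
  obtain C where C: "C > 0" and dk: "\<And>V J q (w :: int ^ 'd \<Rightarrow> 'v) ys t. subspace V \<Longrightarrow> V \<inter> wave_cone A k = {0} \<Longrightarrow>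
    2 * (2 ^ (J + 1) + int s) < 2 ^ q \<Longrightarrow> 0 < t \<Longrightarrow>
    (\<forall>(g, n, a, b) \<in> set ys. norm (rvec n) \<le> 2 ^ J \<and>
       (\<forall>\<xi>. rvec n = 0 \<or> \<xi> = rvec n \<longrightarrow> symbol A k \<xi> a = 0 \<and> symbol A k \<xi> b = 0)) \<Longrightarrow>
    (\<forall>l x. bounded_linear l \<longrightarrow> complex_of_real (l (w x))
       = (\<Sum>(g, n, a, b) \<leftarrow> ys. g * (of_real (l a) - \<i> * of_real (l b)) * ch (2 ^ q) n x)) \<Longrightarrow>
    t * real (card {x \<in> torus (2 ^ q). t < norm (w x)})
      \<le> C * (1 / cone_dist V (wave_cone A k)) ^ (s + 1) * (\<Sum>x\<in>torus (2 ^ q). norm (perp V (w x)))"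
    using discrete_korn[OF rank] unfolding s_def[symmetric] by blast
  have "t * measure lborel {x. t < norm (u x)}
      \<le> C * (1 / cone_dist V (wave_cone A k)) ^ (s + 1) * (\<integral>x. norm (perp V (u x)) \<partial>lborel)"
    if V: "subspace V" "V \<inter> wave_cone A k = {0}" and u: "u \<in> test_functions"
      and Au: "\<And>x. diff_op A k u x = 0" and t: "0 < t" for V u t
  proof -
    define E where "E = C * (1 / cone_dist V (wave_cone A k)) ^ (s + 1)"
    have E: "E > 0" unfolding E_def using C cone_dist_pos[OF V] by simp
    define S where "S = {x. t < norm (u x)}"
    define m where "m = measure lborel S"
    have m: "m \<ge> 0" by (simp add: m_def)
    define \<phi> where "\<phi> y = norm (perp V (u y))" for y
    define \<nu> where "\<nu> = (\<integral>y. \<phi> y \<partial>lborel)"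
    have uc: "continuous_on UNIV u" using continuous_pderivs[OF u, of "[]"] by simp
    have u0: "x \<notin> supp u \<Longrightarrow> u x = 0" for x using pderivs_outside[OF u, of x "[]"] by simp
    note T = compact_supp[OF u]
    have \<phi>i: "integrable lborel \<phi>"
      unfolding \<phi>_def by (rule integrable_compact_support[OF T])
        (use u0 in \<open>auto intro!: continuous_intros uc simp: blinfun.zero_right\<close>)
    obtain R where R: "\<And>x. x \<in> supp u \<Longrightarrow> norm x \<le> R" "R > 0"
      using compact_imp_bounded[OF T] unfolding bounded_pos by blast
    \<comment> \<open>The support of \<open>u\<close> then has coordinates of modulus at most \<open>L/4\<close>, as periodisation requires.\<close>
    define L where "L = 4 * R"
    have L: "L > 0" using R by (simp add: L_def)
    have supp: "\<bar>x $ i\<bar> \<le> L / 4" if "x \<in> supp u" for x i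
      using component_le_norm_cart[of x i] R(1)[OF that] by (simp add: L_def)
    have Sm: "S \<in> sets borel"
      unfolding S_def by (intro borel_open open_Collect_less continuous_intros uc)
    have main: "(t - 2 * e) * m \<le> E * (\<nu> + 2 * e * L ^ CARD('d))" if e: "0 < e" "4 * e \<le> t" for e
    proof -
      obtain \<delta> where \<delta>: "\<delta> > 0" "\<And>x y. dist x y < \<delta> \<Longrightarrow> dist (u x) (u y) < e"
        using uniform_continuity_compact_support[OF T uc u0 e(1)] by blast
      obtain v xs where v: "\<And>x. (\<forall>i. \<bar>x $ i\<bar> \<le> L / 2) \<Longrightarrow> norm (v x - u x) \<le> e"
        "\<And>l x. bounded_linear l \<Longrightarrow> complex_of_real (l (v x))
          = (\<Sum>(c, n) \<leftarrow> xs. c * cis (2 * pi / L * (rvec n \<bullet> x)) *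
          (of_real (l (cos_transform u ((2 * pi / L) *\<^sub>R rvec n))) - \<i> * of_real (l (sin_transform u ((2 * pi / L) *\<^sub>R rvec n)))))"
        using exists_trig_approximation[OF u L e(1) supp] by blast
      have "\<exists>J. \<forall>p\<in>set xs. norm (rvec (snd p)) \<le> 2 ^ J"
      proof -
        obtain J where J: "(\<Sum>p\<in>set xs. norm (rvec (snd p))) < 2 ^ J"
          using real_arch_pow[of 2 "\<Sum>p\<in>set xs. norm (rvec (snd p))"] by auto
        have "norm (rvec (snd p)) \<le> 2 ^ J" if "p \<in> set xs" for p
          using member_le_sum[OF that, of "\<lambda>p. norm (rvec (snd p))"] J by simp
        then show ?thesis by blast
      qed
      then obtain J where J: "\<And>p. p \<in> set xs \<Longrightarrow> norm (rvec (snd p)) \<le> 2 ^ J" by blast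
      obtain q where q: "max (real_of_int (2 * (2 ^ (J + 1) + int s))) (CARD('d) * L / \<delta>) < 2 ^ q"
        using real_arch_pow[of 2 "max (real_of_int (2 * (2 ^ (J + 1) + int s))) (CARD('d) * L / \<delta>)"] by auto
      have "real_of_int (2 * (2 ^ (J + 1) + int s)) < real_of_int (2 ^ q)" using q by simp
      then have q1: "2 * (2 ^ (J + 1) + int s) < 2 ^ q" by (simp only: of_int_less_iff)
      define M where "M = (2::nat) ^ q"
      have M: "M > 0" by (simp add: M_def)
      define h where "h = L / real M"
      have h: "h > 0" using L M by (simp add: h_def)
      have dh: "CARD('d) * h < \<delta>"
      proof -
        have "CARD('d) * L / \<delta> < real M" using q by (simp add: M_def)
        then show ?thesis using \<delta>(1) M by (simp add: h_def field_simps)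
      qed
      have osc: "norm (u y - u (grid_point L h x)) \<le> e" if "y \<in> grid_cell L h x" for x y
      proof -
        have "dist y (grid_point L h x) < \<delta>" using dist_grid_cell_le[OF that] dh by linarith
        then show ?thesis using \<delta>(2)[of y "grid_point L h x"] by (simp add: dist_norm)
      qed
      define w where "w x = v (grid_point L h x)" for x
      have wu: "norm (w x - u (grid_point L h x)) \<le> e" if x: "x \<in> torus M" for x
        unfolding w_def
      proof (rule v(1), rule allI)
        fix i
        have "0 \<le> x $ i" "x $ i < int M" using x by (auto simp: cube_def)
        then have xi: "0 \<le> real_of_int (x $ i)" "real_of_int (x $ i) \<le> real M" by linarith+
        have "0 \<le> h * real_of_int (x $ i)" using h xi by simp
        moreover have "h * real_of_int (x $ i) \<le> h * real M" using h xi by (intro mult_left_mono) auto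
        moreover have "h * real M = L" using M by (simp add: h_def)
        ultimately show "\<bar>grid_point L h x $ i\<bar> \<le> L / 2" unfolding abs_le_iff grid_point_def by (simp add: field_simps)
      qed
      define ys where "ys = map (\<lambda>(c, n). (c * cis (- (pi * (\<Sum>i\<in>UNIV. real_of_int (n $ i)))), n,
          cos_transform u ((2 * pi / L) *\<^sub>R rvec n), sin_transform u ((2 * pi / L) *\<^sub>R rvec n))) xs"
      define t' where "t' = t - 2 * e"
      have t': "t' > 0" using e t by (simp add: t'_def)
      have "t' * real (card {x \<in> torus (2 ^ q). t' < norm (w x)}) \<le> E * (\<Sum>x\<in>torus (2 ^ q). norm (perp V (w x)))"
        unfolding E_def
      proof (rule dk[OF V q1 t'])
        show "\<forall>(g, n, a, b) \<in> set ys. norm (rvec n) \<le> 2 ^ J \<and>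
           (\<forall>\<xi>. rvec n = 0 \<or> \<xi> = rvec n \<longrightarrow> symbol A k \<xi> a = 0 \<and> symbol A k \<xi> b = 0)"
        proof -
          have ker: "symbol A k \<xi> (cos_transform u ((2 * pi / L) *\<^sub>R rvec n)) = 0 \<and> symbol A k \<xi> (sin_transform u ((2 * pi / L) *\<^sub>R rvec n)) = 0"
            if \<xi>: "rvec n = 0 \<or> \<xi> = rvec n" for \<xi> n
          proof (cases "rvec n = (0 :: real ^ 'd)")
            case True
            then show ?thesis by (simp add: mean_in_symbol_kernel[OF u Au] sin_transform_0 blinfun.zero_right)
          next
            case False
            have "(2 * pi / L) ^ k *\<^sub>R symbol A k (rvec n) (cos_transform u ((2 * pi / L) *\<^sub>R rvec n)) = 0"
              "(2 * pi / L) ^ k *\<^sub>R symbol A k (rvec n) (sin_transform u ((2 * pi / L) *\<^sub>R rvec n)) = 0"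
              using transform_in_symbol_kernel[OF u Au, of "(2 * pi / L) *\<^sub>R rvec n"]
              by (simp_all only: symbol_scaleR blinfun.scaleR_left)
            moreover have "(2 * pi / L) ^ k \<noteq> 0" using L by simp
            ultimately show ?thesis using \<xi> False by (metis scaleR_eq_0_iff)
          qed
          then show ?thesis using J by (force simp: ys_def)
        qed
        show "\<forall>l x. bounded_linear l \<longrightarrow> complex_of_real (l (w x))
          = (\<Sum>(g, n, a, b) \<leftarrow> ys. g * (of_real (l a) - \<i> * of_real (l b)) * ch (2 ^ q) n x)"
        proof (intro allI impI)
          fix l :: "'v \<Rightarrow> real" and x :: "int ^ 'd" assume l: "bounded_linear l"
          have "complex_of_real (l (w x)) = (\<Sum>(c, n) \<leftarrow> xs. c * (cis (- (pi * (\<Sum>i\<in>UNIV. real_of_int (n $ i)))) * ch M n x) *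
            (of_real (l (cos_transform u ((2 * pi / L) *\<^sub>R rvec n))) - \<i> * of_real (l (sin_transform u ((2 * pi / L) *\<^sub>R rvec n)))))"
            unfolding w_def v(2)[OF l] h_def ch_grid_point[OF L M] ..
          also have "\<dots> = (\<Sum>(g, n, a, b) \<leftarrow> ys. g * (of_real (l a) - \<i> * of_real (l b)) * ch M n x)"
            unfolding ys_def map_map by (intro arg_cong[of _ _ sum_list] map_cong refl) (simp add: case_prod_beta mult_ac)
          finally show "complex_of_real (l (w x)) = (\<Sum>(g, n, a, b) \<leftarrow> ys. g * (of_real (l a) - \<i> * of_real (l b)) * ch (2 ^ q) n x)"
            by (simp only: M_def)
        qed
      qed
      then have dw: "t' * real (card {x \<in> torus M. t' < norm (w x)}) \<le> E * (\<Sum>x\<in>torus M. norm (perp V (w x)))"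
        by (simp only: M_def)
      define B where "B = {x \<in> torus M. t' < norm (w x)}"
      have "S \<subseteq> (\<Union>x\<in>B. grid_cell L h x)"
      proof
        fix y assume "y \<in> S"
        then have y: "t < norm (u y)" by (simp add: S_def)
        then have "y \<in> supp u" using u0[of y] t by fastforce
        then have "\<bar>y $ i\<bar> < L / 2" for i using supp[of y i] L by linarith
        then obtain x where x: "x \<in> torus M" "y \<in> grid_cell L h x"
          using grid_cell_covers[OF L M] unfolding h_def by blast
        have "norm (u y) \<le> norm (w x) + norm (u y - u (grid_point L h x)) + norm (w x - u (grid_point L h x))"
          by (smt (verit) norm_triangle_ineq2 norm_minus_commute)
        then have "t' < norm (w x)" using y osc[OF x(2)] wu[OF x(1)] by (simp add: t'_def)
        then show "y \<in> (\<Union>x\<in>B. grid_cell L h x)" using x by (auto simp: B_def)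
      qed
      then have "m \<le> measure lborel (\<Union>x\<in>B. grid_cell L h x)"
        unfolding m_def using Sm h
        by (intro measure_mono_fmeasurable fmeasurable.finite_UN grid_cell_fmeasurable) (auto simp: B_def)
      also have "\<dots> \<le> (\<Sum>x\<in>B. measure lborel (grid_cell L h x))"
        by (rule measure_UNION_le) (auto simp: B_def grid_cell_sets)
      also have "\<dots> = real (card B) * h ^ CARD('d)" by (simp add: measure_grid_cell[OF h])
      finally have "t' * m \<le> t' * (real (card B) * h ^ CARD('d))" using t' by (intro mult_left_mono) auto
      also have "\<dots> = h ^ CARD('d) * (t' * real (card B))" by simp
      also have "\<dots> \<le> h ^ CARD('d) * (E * (\<Sum>x\<in>torus M. norm (perp V (w x))))"
        using dw h unfolding B_def by (intro mult_left_mono) auto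
      also have "\<dots> \<le> h ^ CARD('d) * (E * (\<Sum>x\<in>torus M. \<phi> (grid_point L h x) + e))"
      proof (intro mult_left_mono sum_mono)
        fix x :: "int ^ 'd" assume x: "x \<in> torus M"
        have "norm (perp V (w x)) \<le> norm (perp V (u (grid_point L h x))) + norm (perp V (w x - u (grid_point L h x)))"
          unfolding blinfun.diff_right by (rule norm_triangle_sub)
        also have "norm (perp V (w x - u (grid_point L h x))) \<le> norm (perp V) * norm (w x - u (grid_point L h x))"
          by (rule norm_blinfun)
        also have "\<dots> \<le> 1 * e" by (intro mult_mono norm_perp_le V wu x) auto
        finally show "norm (perp V (w x)) \<le> \<phi> (grid_point L h x) + e" by (simp add: \<phi>_def)
      qed (use h E in auto)
      also have "\<dots> = E * (h ^ CARD('d) * (\<Sum>x\<in>torus M. \<phi> (grid_point L h x))) + E * (e * L ^ CARD('d))"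
      proof -
        have "h ^ CARD('d) * (real M ^ CARD('d)) = L ^ CARD('d)" using M by (simp add: h_def power_divide)
        then have "h ^ CARD('d) * (real M ^ CARD('d) * e) = e * L ^ CARD('d)" by (metis mult.assoc mult.commute)
        then show ?thesis by (simp add: sum.distrib card_cube ring_distribs)
      qed
      also have "h ^ CARD('d) * (\<Sum>x\<in>torus M. \<phi> (grid_point L h x)) \<le> \<nu> + e * L ^ CARD('d)"
        unfolding h_def \<nu>_def
      proof (rule riemann_sum_le[OF L M \<phi>i])
        fix x :: "int ^ 'd" and y assume y: "y \<in> grid_cell L (L / real M) x"
        have "\<phi> (grid_point L h x) \<le> norm (perp V (u y)) + norm (perp V (u y - u (grid_point L h x)))"
          unfolding \<phi>_def blinfun.diff_right by (metis norm_minus_commute norm_triangle_sub)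
        also have "norm (perp V (u y - u (grid_point L h x))) \<le> norm (perp V) * norm (u y - u (grid_point L h x))"
          by (rule norm_blinfun)
        also have "\<dots> \<le> 1 * e" using y by (intro mult_mono norm_perp_le V osc) (auto simp: h_def)
        finally show "\<phi> (grid_point L (L / real M) x) \<le> \<phi> y + e" by (simp add: \<phi>_def h_def)
      qed (simp add: \<phi>_def)
      finally have "t' * m \<le> E * (\<nu> + e * L ^ CARD('d)) + E * (e * L ^ CARD('d))"
        using E by (simp add: mult_left_mono)
      then show ?thesis by (simp add: t'_def algebra_simps)
    qed
    have "t * m \<le> E * \<nu>"
    proof (rule field_le_epsilon)
      fix r :: real assume r: "0 < r"
      define Z where "Z = 2 * m + 2 * E * L ^ CARD('d)"
      have Z: "Z \<ge> 0" using m E L by (simp add: Z_def)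
      define e where "e = min (t / 4) (r / (Z + 1))"
      have e: "0 < e" "4 * e \<le> t" "e \<le> r / (Z + 1)" using t r Z by (auto simp: e_def)
      have "e * Z \<le> e * (Z + 1)" using e by simp
      also have "\<dots> \<le> r" using e(3) Z by (simp add: pos_le_divide_eq)
      finally have "e * Z \<le> r" .
      moreover have "t * m \<le> E * \<nu> + e * Z" using main[OF e(1,2)] by (simp add: Z_def algebra_simps)
      ultimately show "t * m \<le> E * \<nu> + r" by linarith
    qed
    then show ?thesis by (simp only: m_def S_def E_def \<nu>_def \<phi>_def)
  qed
  then show ?thesis using C by (auto simp: s_def intro!: exI[of _ C])
qed

theorem lemma2p1:
  fixes A :: "('d::finite \<Rightarrow> nat) \<Rightarrow> 'v::euclidean_space \<Rightarrow>\<^sub>L 'w::euclidean_space"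
    and k :: nat
  assumes "k \<ge> 1" and "constant_rank A k"
  shows "\<exists>C::real. C \<ge> 1 \<and>
    (\<forall>V. subspace V \<and> V \<inter> wave_cone A k = {0} \<longrightarrow>
      korn_const A k V < \<infinity> \<and>
      korn_const A k V \<le>
        ennreal (C * cone_dist V (wave_cone A k) powi (- int (CARD('d) div 2 + 2))))"
proof -
  obtain C where C: "C > 0" "\<And>V u t. subspace V \<Longrightarrow> V \<inter> wave_cone A k = {0} \<Longrightarrow> u \<in> test_functions \<Longrightarrow>
    (\<forall>x. diff_op A k u x = 0) \<Longrightarrow> 0 < t \<Longrightarrow>
    t * measure lborel {x. t < norm (u x)}
      \<le> C * (1 / cone_dist V (wave_cone A k)) ^ (CARD('d) div 2 + 2) * (\<integral>x. norm (perp V (u x)) \<partial>lborel)"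
    using korn_weak_type[OF assms(2)] by blast
  have "korn_const A k V \<le> ennreal (max 1 C * cone_dist V (wave_cone A k) powi (- int (CARD('d) div 2 + 2)))"
    if V: "subspace V" "V \<inter> wave_cone A k = {0}" for V
  proof -
    define E where "E = C * (1 / cone_dist V (wave_cone A k)) ^ (CARD('d) div 2 + 2)"
    have E: "E > 0" unfolding E_def using C(1) cone_dist_pos[OF V] by simp
    have "E \<le> max 1 C * (1 / cone_dist V (wave_cone A k)) ^ (CARD('d) div 2 + 2)"
      unfolding E_def using cone_dist_pos[OF V] by (intro mult_right_mono) auto
    also have "\<dots> = max 1 C * cone_dist V (wave_cone A k) powi (- int (CARD('d) div 2 + 2))"
      unfolding power_int_minus power_int_of_nat power_one_over inverse_eq_divide ..
    finally have EE: "E \<le> max 1 C * cone_dist V (wave_cone A k) powi (- int (CARD('d) div 2 + 2))" .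
    have "weak_L1 u / L1_dist u V \<le> ennreal E"
      if u: "u \<in> test_functions" "\<forall>x. diff_op A k u x = 0" for u
    proof -
      define \<nu> where "\<nu> = (\<integral>x. norm (perp V (u x)) \<partial>lborel)"
      have \<nu>: "\<nu> \<ge> 0" unfolding \<nu>_def by (rule Bochner_Integration.integral_nonneg) simp
      have uc: "continuous_on UNIV u" using continuous_pderivs[OF u(1), of "[]"] by simp
      have u0: "x \<notin> supp u \<Longrightarrow> u x = 0" for x using pderivs_outside[OF u(1), of x "[]"] by simp
      note T = compact_supp[OF u(1)]
      have pc: "continuous_on UNIV (\<lambda>x. norm (perp V (u x)))" by (intro continuous_intros uc)
      have pi: "integrable lborel (\<lambda>x. norm (perp V (u x)))"
        by (rule integrable_compact_support[OF T pc]) (simp add: u0 blinfun.zero_right)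
      have "L1_dist u V = (\<integral>\<^sup>+ x. ennreal (norm (perp V (u x))) \<partial>lebesgue)"
        by (simp add: L1_dist_def infdist_eq_norm_perp[OF V(1)])
      also have "\<dots> = (\<integral>\<^sup>+ x. ennreal (norm (perp V (u x))) \<partial>lborel)"
        using borel_measurable_continuous_onI[OF pc] by (intro nn_integral_completion)
      also have "\<dots> = ennreal \<nu>"
        unfolding \<nu>_def by (rule nn_integral_eq_integral[OF pi]) simp
      finally have L1: "L1_dist u V = ennreal \<nu>" .
      have "weak_L1 u \<le> ennreal (E * \<nu>)"
        unfolding weak_L1_def
      proof (rule SUP_least)
        fix t :: real assume "t \<in> {0<..}"
        then have t: "t > 0" by simp
        define S where "S = {x. t < norm (u x)}"
        have Sm: "S \<in> sets borel"
          unfolding S_def by (intro borel_open open_Collect_less continuous_intros uc)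
        have "S \<subseteq> supp u" using u0 t by (force simp: S_def)
        then have "bounded S" using compact_imp_bounded[OF T] bounded_subset by blast
        then have "emeasure lborel S < \<infinity>" using emeasure_bounded_finite by blast
        then have "emeasure lebesgue S = ennreal (measure lborel S)"
          using Sm by (simp add: emeasure_eq_ennreal_measure)
        then have "ennreal t * emeasure lebesgue S = ennreal (t * measure lborel S)"
          using t by (simp add: ennreal_mult)
        also have "\<dots> \<le> ennreal (E * \<nu>)"
          unfolding E_def \<nu>_def S_def by (intro ennreal_leI C(2) V u t)
        finally show "ennreal t * emeasure lebesgue {x. t < norm (u x)} \<le> ennreal (E * \<nu>)" by (simp add: S_def)
      qed
      then have w: "weak_L1 u \<le> ennreal E * ennreal \<nu>" using E \<nu> by (simp add: ennreal_mult)
      show ?thesis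
      proof (cases "\<nu> = 0")
        case True
        then have "weak_L1 u = 0" using w by simp
        then show ?thesis by simp
      next
        case False
        then have "0 < ennreal \<nu>" using \<nu> by simp
        have "weak_L1 u / L1_dist u V \<le> ennreal E * ennreal \<nu> / ennreal \<nu>"
          unfolding L1 by (rule divide_right_mono_ennreal[OF w])
        also have "\<dots> = ennreal E" using False \<nu> by (simp add: ennreal_mult_divide_eq)
        finally show ?thesis .
      qed
    qed
    then have "korn_const A k V \<le> ennreal E" unfolding korn_const_def by (intro Sup_least) auto
    also have "\<dots> \<le> ennreal (max 1 C * cone_dist V (wave_cone A k) powi (- int (CARD('d) div 2 + 2)))"
      by (rule ennreal_leI[OF EE])
    finally show ?thesis .
  qed
  then show ?thesis
    by (intro exI[of _ "max 1 C"]) (auto intro: le_less_trans[OF _ ennreal_less_top])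
qed

end
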